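(* Let $X=\mathbf{P}(L\oplus\mathcal{O})$ be the ruled surface over a genus $2$ curve described in the context, with zero and infinity sections $S_0,S_\infty$, and let $k_2\cong5.0275$ be the only positive real root of $m^3-3m^2-9m-6$. (i) For $0<m\le k_2$ there exists a complete extremal metric on $X\setminus S_\infty$ with momentum profile on $[0,m]$ and scalar curvature $$\frac{12(m^2-2m-3)}{m^2(m^2+6m+6)}\,\tau-\frac{6(2m^2-m-4)}{m(m^2+6m+6)}.$$ When $m<k_2$ the resulting metric is asymptotically hyperbolic (near $S_\infty$). (ii) For any positive $c$ and $m>c$ such that $\frac{m-c}{c+1}\le k_2$ there exists a complete extremal metric on $X\setminus S_0$ with momentum profile on $[c,m]$ and scalar curvature $$\frac1{c+1}\left[\frac{12(2\tilde m^2+4\tilde m+3)}{\tilde m^2(\tilde m^2+6\tilde m+6)}\cdot\frac{\tau-c}{c+1}-\frac{6(3\tilde m^2+5\tilde m+2)}{\tilde m(\tilde m^2+6\tilde m+6)}\right],\qquad\tilde m=\frac{m-c}{c+1}.$$ If the inequality is strict, the resulting metric is asymptotically hyperbolic (near $S_0$).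
   Context: Ruled surface. $M$ is a genus $2$ curve with a metric $\omega_M$ of constant scalar curvature and area $2\pi$; $L\to M$ is a holomorphic line bundle of degree $-1$ with a Hermitian metric $h$ whose curvature $\gamma=-\sqrt{-1}\,\partial\bar\partial\log h$ equals $-\omega_M$. So $\omega_M(\tau)=\omega_M-\tau\gamma=(1+\tau)\omega_M$. Momentum profiles. Let $t$ be the logarithm of the fibrewise norm on $L$. A function $\phi$ on $[a,b]$, $\phi(a)=\phi(b)=0$, positive on $(a,b)$, determines a circle-invariant metric $\omega_\phi=p^*\omega_M+2\sqrt{-1}\,\partial\bar\partial f(t)$ ($p$ the projection to $M$), where $f$ is the Legendre transform of $F$ with $F''=1/\phi$; $\tau=f'(t)\in[a,b]$ is the moment map for the fibrewise $S^1$-rotation ($\tau=a$ corresponding to $S_0$ and $\tau=b$ to $S_\infty$). $\phi$ is called the momentum profile of the metric. The scalar curvature (complex convention, half the Riemannian one) is $S(\omega_\phi)=\frac1{2(1+\tau)}\left(-4-[(1+\tau)\phi]''\right)$. Extremal: the gradient of the scalar curvature is a holomorphic vector field. Asymptotically hyperbolic near a smooth divisor $D\subset X$: the complete Kähler metric $g$ on $X\setminus D$ is, near $D$, asymptotic to a metric $g_0=K\frac{|dz|^2}{(|z|\log|z|)^2}+\eta$, where $K$ is a smooth positive function on $X$, the symmetric 2-tensor $\eta$ is a smooth extension of a metric on $D$, $z$ is a local defining holomorphic function for $D$, and asymptotic means $\lim_{z\to0}\Vert\nabla^i_{(g_0)}(g-g_0)\Vert_{(g_0)}=0$ for all $i\in\mathbf{N}$.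 *)

theory Defs
  imports "HOL-Analysis.Analysis" "HOL-Homology.Homology"
begin

section \<open>Calculus on open subsets of complex coordinate space\<close>

text \<open>For open \<open>U\<close>: existence of continuous iterated directional derivatives up to order \<open>k\<close>.\<close>

primrec Ck_on ::
  "nat \<Rightarrow> ('a::real_normed_vector \<Rightarrow> 'b::real_normed_vector) \<Rightarrow> 'a set \<Rightarrow> bool"
where
  "Ck_on 0 f U \<longleftrightarrow> continuous_on U f"
| "Ck_on (Suc k) f U \<longleftrightarrow>
     (\<exists>f'. (\<forall>x\<in>U. (f has_derivative f' x) (at x)) \<and> (\<forall>v. Ck_on k (\<lambda>x. f' x v) U))"

definition smooth_on :: "'a set \<Rightarrow> ('a::real_normed_vector \<Rightarrow> 'b::real_normed_vector) \<Rightarrow> bool"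
  where "smooth_on U f \<longleftrightarrow> (\<forall>k. Ck_on k f U)"

definition hol_fun_on :: "(complex^'n::finite \<Rightarrow> complex) \<Rightarrow> (complex^'n) set \<Rightarrow> bool"
  where "hol_fun_on f U \<longleftrightarrow>
    (\<forall>z\<in>U. \<exists>f'. (f has_derivative f') (at z) \<and> (\<forall>c v. f' (c *s v) = c * f' v))"

definition hol_map_on :: "(complex^'n::finite \<Rightarrow> complex^'m::finite) \<Rightarrow> (complex^'n) set \<Rightarrow> bool"
  where "hol_map_on f U \<longleftrightarrow> (\<forall>i. hol_fun_on (\<lambda>z. f z $ i) U)"

text \<open>The Wirtinger derivatives with respect to \<open>z\<^sub>j\<close> and to the conjugate of \<open>z\<^sub>j\<close>, and the
  coefficients of \<open>\<partial>\<close> \<open>\<partial>\<close>-bar of a real function.\<close>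

definition d_z :: "'n::finite \<Rightarrow> (complex^'n \<Rightarrow> complex) \<Rightarrow> complex^'n \<Rightarrow> complex"
  where "d_z j f z =
    (frechet_derivative f (at z) (axis j 1) - \<i> * frechet_derivative f (at z) (axis j \<i>)) / 2"

definition d_zbar :: "'n::finite \<Rightarrow> (complex^'n \<Rightarrow> complex) \<Rightarrow> complex^'n \<Rightarrow> complex"
  where "d_zbar j f z =
    (frechet_derivative f (at z) (axis j 1) + \<i> * frechet_derivative f (at z) (axis j \<i>)) / 2"

definition ddbar :: "'n::finite \<Rightarrow> 'n \<Rightarrow> (complex^'n \<Rightarrow> real) \<Rightarrow> complex^'n \<Rightarrow> complex"
  where "ddbar j k f z = d_z j (d_zbar k (\<lambda>y. complex_of_real (f y))) z"


section \<open>Complex manifolds given by atlases\<close>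

text \<open>A chart is a domain together with a coordinate map, whose values off the domain are
  irrelevant. The topology of the manifold is the one induced by the atlas.\<close>

type_synonym ('x, 'n) chart = "'x set \<times> ('x \<Rightarrow> complex^'n)"

definition atlas_space :: "('x, 'n::finite) chart set \<Rightarrow> 'x set"
  where "atlas_space A = \<Union> (fst ` A)"

definition atlas_topology :: "('x, 'n::finite) chart set \<Rightarrow> 'x topology"
  where "atlas_topology A =
    topology (\<lambda>W. W \<subseteq> atlas_space A \<and> (\<forall>(U, \<psi>)\<in>A. open (\<psi> ` (W \<inter> U))))"

definition complex_atlas :: "('x, 'n::finite) chart set \<Rightarrow> bool"
  where "complex_atlas A \<longleftrightarrow>
    (\<forall>(U, \<psi>)\<in>A. inj_on \<psi> U \<and> open (\<psi> ` U)) \<and>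
    (\<forall>(U, \<psi>)\<in>A. \<forall>(V, \<xi>)\<in>A.
       open (\<psi> ` (U \<inter> V)) \<and> hol_map_on (\<xi> \<circ> inv_into U \<psi>) (\<psi> ` (U \<inter> V)))"

definition compact_riemann_surface :: "('m, 1) chart set \<Rightarrow> bool"
  where "compact_riemann_surface A \<longleftrightarrow>
    complex_atlas A \<and> atlas_space A \<noteq> {} \<and> Hausdorff_space (atlas_topology A) \<and>
    compact_space (atlas_topology A) \<and> connected_space (atlas_topology A)"

text \<open>The genus is half the rank of the first integral homology group.\<close>

definition has_genus :: "('m, 1) chart set \<Rightarrow> nat \<Rightarrow> bool"
  where "has_genus A g \<longleftrightarrow>
    homology_group 1 (atlas_topology A) \<cong> free_Abelian_group {..<2 * g}"

definition mfd_holomorphic_on :: "('x, 'n::finite) chart set \<Rightarrow> 'x set \<Rightarrow> ('x \<Rightarrow> complex) \<Rightarrow> bool"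
  where "mfd_holomorphic_on A W g \<longleftrightarrow>
    (\<forall>(U, \<psi>)\<in>A. hol_fun_on (g \<circ> inv_into U \<psi>) (\<psi> ` (U \<inter> W)))"

definition mfd_smooth_on :: "('x, 'n::finite) chart set \<Rightarrow> 'x set \<Rightarrow> ('x \<Rightarrow> real) \<Rightarrow> bool"
  where "mfd_smooth_on A W g \<longleftrightarrow>
    (\<forall>(U, \<psi>)\<in>A. smooth_on (\<psi> ` (U \<inter> W)) (g \<circ> inv_into U \<psi>))"

definition transition_deriv ::
  "('x, 'n::finite) chart \<Rightarrow> ('x, 'n) chart \<Rightarrow> 'x \<Rightarrow> complex^'n \<Rightarrow> complex^'n"
  where "transition_deriv c d x =
    frechet_derivative (snd d \<circ> inv_into (fst c) (snd c)) (at (snd c x))"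


section \<open>Kaehler metrics\<close>

text \<open>A matrix field \<open>H\<close> in each chart stands for the real (1,1)-form
  \<open>\<i> \<Sum> H\<^sub>j\<^sub>k dz\<^sub>j \<and> d(cnj z\<^sub>k)\<close>. When positive definite this is the Kaehler form of the Riemannian
  metric \<open>2 Re (\<Sum> H\<^sub>j\<^sub>k dz\<^sub>j d(cnj z\<^sub>k))\<close>.\<close>

type_synonym ('x, 'n) form11 = "('x, 'n) chart \<Rightarrow> complex^'n \<Rightarrow> complex^'n^'n"

definition herm :: "complex^'n::finite^'n \<Rightarrow> complex^'n \<Rightarrow> complex^'n \<Rightarrow> complex"
  where "herm P u v = (\<Sum>j\<in>UNIV. \<Sum>k\<in>UNIV. P $ j $ k * u $ j * cnj (v $ k))"

definition riem :: "(complex^'n::finite \<Rightarrow> complex^'n^'n) \<Rightarrow> complex^'n \<Rightarrow> complex^'n \<Rightarrow> complex^'n \<Rightarrow> real"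
  where "riem P z u v = 2 * Re (herm (P z) u v)"

text \<open>The last clause says that the Kaehler form is closed.\<close>

definition kaehler_metric :: "('x, 'n::finite) chart set \<Rightarrow> 'x set \<Rightarrow> ('x, 'n) form11 \<Rightarrow> bool"
  where "kaehler_metric A Y H \<longleftrightarrow>
    (\<forall>(U, \<psi>)\<in>A. \<forall>j k. smooth_on (\<psi> ` (U \<inter> Y)) (\<lambda>z. H (U, \<psi>) z $ j $ k)) \<and>
    (\<forall>(U, \<psi>)\<in>A. \<forall>z\<in>\<psi> ` (U \<inter> Y).
       (\<forall>j k. H (U, \<psi>) z $ j $ k = cnj (H (U, \<psi>) z $ k $ j)) \<and>
       (\<forall>u. u \<noteq> 0 \<longrightarrow> 0 < Re (herm (H (U, \<psi>) z) u u))) \<and>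
    (\<forall>c\<in>A. \<forall>d\<in>A. \<forall>x\<in>fst c \<inter> fst d \<inter> Y. \<forall>u v.
       herm (H c (snd c x)) u v =
       herm (H d (snd d x)) (transition_deriv c d x u) (transition_deriv c d x v)) \<and>
    (\<forall>(U, \<psi>)\<in>A. \<forall>z\<in>\<psi> ` (U \<inter> Y). \<forall>j k l.
       d_z l (\<lambda>y. H (U, \<psi>) y $ j $ k) z = d_z j (\<lambda>y. H (U, \<psi>) y $ l $ k) z)"

text \<open>Scalar curvature in the complex convention, half the Riemannian one: the trace, with respect
  to the metric, of the Ricci form \<open>- \<i>\<close> \<open>\<partial>\<close> \<open>\<partial>\<close>-bar \<open>log det H\<close>.\<close>

definition scalar_curvature :: "(complex^'n::finite \<Rightarrow> complex^'n^'n) \<Rightarrow> complex^'n \<Rightarrow> real"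
  where "scalar_curvature P z =
    - Re (\<Sum>j\<in>UNIV. \<Sum>k\<in>UNIV. matrix_inv (P z) $ k $ j * ddbar j k (\<lambda>y. ln (Re (det (P y)))) z)"

definition mfd_scalar_curvature ::
  "('x, 'n::finite) chart set \<Rightarrow> 'x set \<Rightarrow> ('x, 'n) form11 \<Rightarrow> ('x \<Rightarrow> real) \<Rightarrow> bool"
  where "mfd_scalar_curvature A Y H s \<longleftrightarrow>
    (\<forall>(U, \<psi>)\<in>A. \<forall>x\<in>U \<inter> Y. scalar_curvature (H (U, \<psi>)) (\<psi> x) = s x)"

definition gradient ::
  "(complex^'n::finite \<Rightarrow> complex^'n^'n) \<Rightarrow> (complex^'n \<Rightarrow> real) \<Rightarrow> complex^'n \<Rightarrow> complex^'n"
  where "gradient P f z = (THE w. \<forall>v. riem P z w v = frechet_derivative f (at z) v)"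

definition extremal_metric :: "('x, 'n::finite) chart set \<Rightarrow> 'x set \<Rightarrow> ('x, 'n) form11 \<Rightarrow> bool"
  where "extremal_metric A Y H \<longleftrightarrow>
    (\<forall>(U, \<psi>)\<in>A. hol_map_on (gradient (H (U, \<psi>)) (scalar_curvature (H (U, \<psi>)))) (\<psi> ` (U \<inter> Y)))"

text \<open>\<open>curve_of_length A Y H x y l\<close>: some piecewise \<open>C\<^sup>1\<close> curve in \<open>Y\<close> from \<open>x\<close> to \<open>y\<close> has length \<open>l\<close>;
  the curve is subdivided into finitely many \<open>C\<^sup>1\<close> pieces that each lie in one chart.\<close>

inductive curve_of_length ::
  "('x, 'n::finite) chart set \<Rightarrow> 'x set \<Rightarrow> ('x, 'n) form11 \<Rightarrow> 'x \<Rightarrow> 'x \<Rightarrow> real \<Rightarrow> bool"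
  for A Y H
where
  const: "x \<in> Y \<Longrightarrow> curve_of_length A Y H x x 0"
| join: "\<lbrakk>curve_of_length A Y H x y l; (U, \<psi>) \<in> A; y \<in> U \<inter> Y; z \<in> U \<inter> Y;
    c C1_differentiable_on {0..1}; c ` {0..1} \<subseteq> \<psi> ` (U \<inter> Y); c 0 = \<psi> y; c 1 = \<psi> z\<rbrakk> \<Longrightarrow>
    curve_of_length A Y H x z
      (l + integral {0..1} (\<lambda>s. sqrt (riem (H (U, \<psi>)) (c s)
             (vector_derivative c (at s)) (vector_derivative c (at s)))))"

text \<open>Completeness of the geodesic distance (the infimum of the lengths).\<close>

definition complete_metric ::
  "('x, 'n::finite) chart set \<Rightarrow> 'x set \<Rightarrow> ('x, 'n) form11 \<Rightarrow> bool"
  where "complete_metric A Y H \<longleftrightarrow>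
    (\<forall>s::nat \<Rightarrow> 'x. range s \<subseteq> Y \<longrightarrow>
      (\<forall>e>0. \<exists>N. \<forall>i\<ge>N. \<forall>j\<ge>N. \<exists>l<e. curve_of_length A Y H (s i) (s j) l) \<longrightarrow>
      (\<exists>x\<in>Y. \<forall>e>0. \<exists>N. \<forall>i\<ge>N. \<exists>l<e. curve_of_length A Y H (s i) x l))"

text \<open>Integral of a (1,1)-form over a compact Riemann surface, computed by cutting the surface into
  Borel pieces, each relatively compact in a chart. Here \<open>\<i> a dz \<and> d(cnj z) = 2 a dx \<and> dy\<close>. The
  value is independent of the partition by the change of variables formula.\<close>

definition has_surface_integral :: "('m, 1) chart set \<Rightarrow> ('m, 1) form11 \<Rightarrow> real \<Rightarrow> bool"
  where "has_surface_integral A \<alpha> I \<longleftrightarrow>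
    (\<exists>P. finite P \<and> disjoint_family_on snd P \<and> \<Union> (snd ` P) = atlas_space A \<and>
      (\<forall>(c, B)\<in>P. c \<in> A \<and> B \<subseteq> fst c \<and> snd c ` B \<in> sets borel \<and>
         (\<exists>K. compact K \<and> snd c ` B \<subseteq> K \<and> K \<subseteq> snd c ` fst c)) \<and>
      (\<Sum>(c, B)\<in>P. LINT z:snd c ` B|lborel. 2 * Re (\<alpha> c z $ 1 $ 1)) = I)"


section \<open>Hermitian holomorphic line bundles\<close>

text \<open>A line bundle is given by its projection \<open>p\<close> and a set \<open>T\<close> of local trivialisations
  \<open>(W, \<theta>)\<close>, where \<open>\<theta>\<close> is the linear fibre coordinate over \<open>W\<close>.\<close>

type_synonym ('l, 'm) triv = "'m set \<times> ('l \<Rightarrow> complex)"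

definition holomorphic_line_bundle ::
  "('m, 'n::finite) chart set \<Rightarrow> ('l \<Rightarrow> 'm) \<Rightarrow> ('l, 'm) triv set \<Rightarrow> bool"
  where "holomorphic_line_bundle A p T \<longleftrightarrow>
    \<Union> (fst ` T) = atlas_space A \<and>
    (\<forall>(W, \<theta>)\<in>T. openin (atlas_topology A) W \<and>
       bij_betw (\<lambda>v. (p v, \<theta> v)) (p -` W) (W \<times> UNIV)) \<and>
    (\<forall>(W, \<theta>)\<in>T. \<forall>(W', \<theta>')\<in>T. \<exists>g. mfd_holomorphic_on A (W \<inter> W') g \<and>
       (\<forall>x\<in>W \<inter> W'. g x \<noteq> 0) \<and> (\<forall>v. p v \<in> W \<inter> W' \<longrightarrow> \<theta>' v = g (p v) * \<theta> v))"

text \<open>A Hermitian metric is given by its fibrewise norm on the total space.\<close>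

definition hermitian_norm ::
  "('m, 'n::finite) chart set \<Rightarrow> ('l \<Rightarrow> 'm) \<Rightarrow> ('l, 'm) triv set \<Rightarrow> ('l \<Rightarrow> real) \<Rightarrow> bool"
  where "hermitian_norm A p T nrm \<longleftrightarrow>
    (\<forall>(W, \<theta>)\<in>T. \<exists>h. mfd_smooth_on A W h \<and> (\<forall>x\<in>W. 0 < h x) \<and>
       (\<forall>v. p v \<in> W \<longrightarrow> nrm v = sqrt (h (p v)) * cmod (\<theta> v)))"

text \<open>The squared norm of the local frame dual to \<open>\<theta>\<close>.\<close>

definition local_weight :: "('l \<Rightarrow> 'm) \<Rightarrow> ('l \<Rightarrow> real) \<Rightarrow> ('l \<Rightarrow> complex) \<Rightarrow> 'm \<Rightarrow> real"
  where "local_weight p nrm \<theta> x = (nrm (THE v. p v = x \<and> \<theta> v = 1))\<^sup>2"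

definition is_curvature_form ::
  "('m, 'n::finite) chart set \<Rightarrow> ('l \<Rightarrow> 'm) \<Rightarrow> ('l, 'm) triv set \<Rightarrow> ('l \<Rightarrow> real) \<Rightarrow> ('m, 'n) form11 \<Rightarrow> bool"
  where "is_curvature_form A p T nrm \<gamma> \<longleftrightarrow>
    (\<forall>(U, \<psi>)\<in>A. \<forall>(W, \<theta>)\<in>T. \<forall>x\<in>U \<inter> W. \<forall>j k.
       \<gamma> (U, \<psi>) (\<psi> x) $ j $ k =
       - ddbar j k (\<lambda>z. ln (local_weight p nrm \<theta> (inv_into U \<psi> z))) (\<psi> x))"

text \<open>The degree is the integral of the first Chern form \<open>\<gamma> / 2\<pi>\<close> of any Hermitian metric.\<close>

definition has_degree ::
  "('m, 1) chart set \<Rightarrow> ('l \<Rightarrow> 'm) \<Rightarrow> ('l, 'm) triv set \<Rightarrow> int \<Rightarrow> bool"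
  where "has_degree A p T d \<longleftrightarrow>
    (\<forall>nrm \<gamma>. hermitian_norm A p T nrm \<longrightarrow> is_curvature_form A p T nrm \<gamma> \<longrightarrow>
       has_surface_integral A \<gamma> (2 * pi * of_int d))"


section \<open>The ruled surface\<close>

text \<open>Points of the projective bundle of the sum of \<open>L\<close> with the trivial bundle are the lines
  \<open>[v : s]\<close>, represented by their sets of nonzero vectors.\<close>

type_synonym 'l line = "('l \<times> complex) set"

definition line :: "('l \<Rightarrow> 'm) \<Rightarrow> ('l, 'm) triv set \<Rightarrow> 'l \<Rightarrow> complex \<Rightarrow> 'l line"
  where "line p T v s = {(u, r). p u = p v \<and>
    (\<exists>c. c \<noteq> 0 \<and> r = c * s \<and> (\<forall>(W, \<theta>)\<in>T. p v \<in> W \<longrightarrow> \<theta> u = c * \<theta> v))}"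

definition zero_vector :: "('l \<Rightarrow> 'm) \<Rightarrow> ('l, 'm) triv set \<Rightarrow> 'l \<Rightarrow> bool"
  where "zero_vector p T v \<longleftrightarrow> (\<forall>(W, \<theta>)\<in>T. p v \<in> W \<longrightarrow> \<theta> v = 0)"

definition proj_bundle :: "('l \<Rightarrow> 'm) \<Rightarrow> ('l, 'm) triv set \<Rightarrow> 'l line set"
  where "proj_bundle p T =
    {line p T v s | v s. p v \<in> \<Union> (fst ` T) \<and> (\<not> zero_vector p T v \<or> s \<noteq> 0)}"

definition zero_section :: "('l \<Rightarrow> 'm) \<Rightarrow> ('l, 'm) triv set \<Rightarrow> 'l line set"
  where "zero_section p T = {line p T v 1 | v. p v \<in> \<Union> (fst ` T) \<and> zero_vector p T v}"

definition infinity_section :: "('l \<Rightarrow> 'm) \<Rightarrow> ('l, 'm) triv set \<Rightarrow> 'l line set"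
  where "infinity_section p T = {line p T v 0 | v. p v \<in> \<Union> (fst ` T) \<and> \<not> zero_vector p T v}"

text \<open>Over a base chart and a trivialisation there are two charts, with coordinates
  \<open>(z, \<theta> v / s)\<close> off the infinity section and \<open>(z, s / \<theta> v)\<close> off the zero section.\<close>

definition chart_off_infinity ::
  "('l \<Rightarrow> 'm) \<Rightarrow> ('l, 'm) triv set \<Rightarrow> ('m, 1) chart \<Rightarrow> ('l, 'm) triv \<Rightarrow> ('l line, 2) chart"
  where "chart_off_infinity p T c w =
    ({line p T v s | v s. p v \<in> fst c \<inter> fst w \<and> s \<noteq> 0},
     \<lambda>x. THE z. \<exists>v s. x = line p T v s \<and> s \<noteq> 0 \<and> z = vector [snd c (p v) $ 1, snd w v / s])"

definition chart_off_zero ::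
  "('l \<Rightarrow> 'm) \<Rightarrow> ('l, 'm) triv set \<Rightarrow> ('m, 1) chart \<Rightarrow> ('l, 'm) triv \<Rightarrow> ('l line, 2) chart"
  where "chart_off_zero p T c w =
    ({line p T v s | v s. p v \<in> fst c \<inter> fst w \<and> snd w v \<noteq> 0},
     \<lambda>x. THE z. \<exists>v s. x = line p T v s \<and> snd w v \<noteq> 0 \<and> z = vector [snd c (p v) $ 1, s / snd w v])"

definition ruled_atlas ::
  "('m, 1) chart set \<Rightarrow> ('l \<Rightarrow> 'm) \<Rightarrow> ('l, 'm) triv set \<Rightarrow> ('l line, 2) chart set"
  where "ruled_atlas A p T =
    {chart_off_infinity p T c w | c w. c \<in> A \<and> w \<in> T} \<union>
    {chart_off_zero p T c w | c w. c \<in> A \<and> w \<in> T}"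


section \<open>Momentum profiles\<close>

text \<open>The logarithm of the fibrewise norm; off the infinity section, \<open>[v : s]\<close> is the vector \<open>v / s\<close>
  of \<open>L\<close>.\<close>

definition log_norm :: "('l \<Rightarrow> 'm) \<Rightarrow> ('l, 'm) triv set \<Rightarrow> ('l \<Rightarrow> real) \<Rightarrow> 'l line \<Rightarrow> real"
  where "log_norm p T nrm x =
    (THE t. \<exists>v s. x = line p T v s \<and> s \<noteq> 0 \<and> t = ln (nrm v / cmod s))"

text \<open>\<open>F\<close> is only determined up to an affine function, that is, \<open>f\<close> up to a translation of \<open>t\<close> and an
  additive constant. Surjectivity of \<open>F'\<close> says that \<open>f\<close> is defined for all \<open>t\<close>, hence on the whole
  complement of the two sections.\<close>

definition profile_potential ::
  "real \<Rightarrow> real \<Rightarrow> (real \<Rightarrow> real) \<Rightarrow> (real \<Rightarrow> real) \<Rightarrow> bool"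
  where "profile_potential a b \<phi> f \<longleftrightarrow>
    a < b \<and> continuous_on {a..b} \<phi> \<and> \<phi> a = 0 \<and> \<phi> b = 0 \<and> (\<forall>x\<in>{a<..<b}. 0 < \<phi> x) \<and>
    (\<exists>F F'. (\<forall>x\<in>{a<..<b}. (F has_real_derivative F' x) (at x) \<and>
                           (F' has_real_derivative 1 / \<phi> x) (at x)) \<and>
       F' ` {a<..<b} = UNIV \<and> (\<forall>t. f t = (SUP x\<in>{a<..<b}. x * t - F x)))"

definition moment_map ::
  "('l \<Rightarrow> 'm) \<Rightarrow> ('l, 'm) triv set \<Rightarrow> ('l \<Rightarrow> real) \<Rightarrow> real \<Rightarrow> real \<Rightarrow> (real \<Rightarrow> real) \<Rightarrow> 'l line \<Rightarrow> real"
  where "moment_map p T nrm a b f x =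
    (if x \<in> zero_section p T then a
     else if x \<in> infinity_section p T then b
     else deriv f (log_norm p T nrm x))"

text \<open>Off the two sections, \<open>H\<close> is the form \<open>p\<^sup>* \<omega>\<^sub>M + 2 \<i>\<close> \<open>\<partial>\<close> \<open>\<partial>\<close>-bar \<open>f(t)\<close>. In the charts of the ruled
  surface the projection to the base is the first coordinate.\<close>

definition momentum_form ::
  "('m, 1) chart set \<Rightarrow> ('l \<Rightarrow> 'm) \<Rightarrow> ('l, 'm) triv set \<Rightarrow> ('l \<Rightarrow> real) \<Rightarrow> ('m, 1) form11 \<Rightarrow>
   (real \<Rightarrow> real) \<Rightarrow> ('l line, 2) form11 \<Rightarrow> bool"
  where "momentum_form A p T nrm \<omega>M f H \<longleftrightarrow>
    (\<forall>c\<in>A. \<forall>w\<in>T. \<forall>d\<in>{chart_off_infinity p T c w, chart_off_zero p T c w}.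
      \<forall>x\<in>fst d - zero_section p T - infinity_section p T. \<forall>j k.
        H d (snd d x) $ j $ k =
          (if j = 1 \<and> k = 1 then \<omega>M c (vec (snd d x $ 1)) $ 1 $ 1 else 0) +
          2 * ddbar j k (\<lambda>z. f (log_norm p T nrm (inv_into (fst d) (snd d) z))) (snd d x))"


section \<open>Asymptotically hyperbolic metrics\<close>

text \<open>Covariant tensors of order \<open>k\<close> on an open set of \<open>'e\<close> are functions of a point and a list of \<open>k\<close>
  vectors. The Levi-Civita connection on constant vector fields comes from the Koszul formula.\<close>

definition christoffel ::
  "('e::euclidean_space \<Rightarrow> 'e \<Rightarrow> 'e \<Rightarrow> real) \<Rightarrow> 'e \<Rightarrow> 'e \<Rightarrow> 'e \<Rightarrow> 'e"
  where "christoffel g x u v = (THE y. \<forall>w. g x y w =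
    (frechet_derivative (\<lambda>y. g y v w) (at x) u + frechet_derivative (\<lambda>y. g y u w) (at x) v
      - frechet_derivative (\<lambda>y. g y u v) (at x) w) / 2)"

definition nabla ::
  "('e::euclidean_space \<Rightarrow> 'e \<Rightarrow> 'e \<Rightarrow> real) \<Rightarrow> ('e \<Rightarrow> 'e list \<Rightarrow> real) \<Rightarrow> 'e \<Rightarrow> 'e list \<Rightarrow> real"
  where "nabla g S x us = (case us of [] \<Rightarrow> 0 | u # vs \<Rightarrow>
    frechet_derivative (\<lambda>y. S y vs) (at x) u
      - (\<Sum>i<length vs. S x (vs[i := christoffel g x u (vs ! i)])))"

definition orthonormal_basis :: "('e::euclidean_space \<Rightarrow> 'e \<Rightarrow> real) \<Rightarrow> 'e set \<Rightarrow> bool"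
  where "orthonormal_basis q B \<longleftrightarrow>
    finite B \<and> span B = UNIV \<and> (\<forall>u\<in>B. \<forall>v\<in>B. q u v = (if u = v then 1 else 0))"

definition tensor_norm ::
  "('e::euclidean_space \<Rightarrow> 'e \<Rightarrow> 'e \<Rightarrow> real) \<Rightarrow> nat \<Rightarrow> ('e \<Rightarrow> 'e list \<Rightarrow> real) \<Rightarrow> 'e \<Rightarrow> real"
  where "tensor_norm g k S x =
    (let B = (SOME B. orthonormal_basis (g x) B)
     in sqrt (\<Sum>vs | set vs \<subseteq> B \<and> length vs = k. (S x vs)\<^sup>2))"

definition smooth_symmetric_tensor ::
  "('x, 'n::finite) chart set \<Rightarrow>
   (('x, 'n) chart \<Rightarrow> complex^'n \<Rightarrow> complex^'n \<Rightarrow> complex^'n \<Rightarrow> real) \<Rightarrow> bool"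
  where "smooth_symmetric_tensor A \<eta> \<longleftrightarrow>
    (\<forall>(U, \<psi>)\<in>A. \<forall>u v. smooth_on (\<psi> ` U) (\<lambda>z. \<eta> (U, \<psi>) z u v)) \<and>
    (\<forall>(U, \<psi>)\<in>A. \<forall>z\<in>\<psi> ` U. bilinear (\<eta> (U, \<psi>) z) \<and>
       (\<forall>u v. \<eta> (U, \<psi>) z u v = \<eta> (U, \<psi>) z v u)) \<and>
    (\<forall>c\<in>A. \<forall>d\<in>A. \<forall>x\<in>fst c \<inter> fst d. \<forall>u v.
       \<eta> c (snd c x) u v = \<eta> d (snd d x) (transition_deriv c d x u) (transition_deriv c d x v))"

text \<open>\<open>\<zeta>\<close> is holomorphic on the coordinate neighbourhood \<open>N\<close> and defines \<open>D\<close> with multiplicity one.\<close>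

definition local_defining_function ::
  "('x, 'n::finite) chart \<Rightarrow> 'x set \<Rightarrow> (complex^'n) set \<Rightarrow> (complex^'n \<Rightarrow> complex) \<Rightarrow> bool"
  where "local_defining_function c D N \<zeta> \<longleftrightarrow>
    open N \<and> N \<subseteq> snd c ` fst c \<and> hol_fun_on \<zeta> N \<and>
    (\<forall>z\<in>N. \<zeta> z = 0 \<longleftrightarrow> inv_into (fst c) (snd c) z \<in> D) \<and>
    (\<forall>z\<in>N. \<zeta> z = 0 \<longrightarrow> (\<exists>u. frechet_derivative \<zeta> (at z) u \<noteq> 0))"

definition hyperbolic_model ::
  "(complex^'n \<Rightarrow> real) \<Rightarrow> (complex^'n \<Rightarrow> complex^'n \<Rightarrow> complex^'n \<Rightarrow> real) \<Rightarrow>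
   (complex^'n::finite \<Rightarrow> complex) \<Rightarrow> complex^'n \<Rightarrow> complex^'n \<Rightarrow> complex^'n \<Rightarrow> real"
  where "hyperbolic_model K \<eta> \<zeta> z u v =
    K z * Re (frechet_derivative \<zeta> (at z) u * cnj (frechet_derivative \<zeta> (at z) v))
      / (cmod (\<zeta> z) * ln (cmod (\<zeta> z)))\<^sup>2 + \<eta> z u v"

text \<open>\<open>H\<close> is a Kaehler metric on the complement of the divisor \<open>D\<close>. The filter in the last clause is
  \<open>\<zeta> \<longrightarrow> 0\<close> with \<open>\<zeta> \<noteq> 0\<close>, uniformly over \<open>N\<close>; \<open>\<eta>\<close> is positive definite on the tangent spaces of \<open>D\<close>.\<close>

definition asymptotically_hyperbolic ::
  "('x, 'n::finite) chart set \<Rightarrow> 'x set \<Rightarrow> ('x, 'n) form11 \<Rightarrow> bool"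
  where "asymptotically_hyperbolic A D H \<longleftrightarrow>
    (\<exists>K \<eta>. mfd_smooth_on A (atlas_space A) K \<and> (\<forall>x\<in>atlas_space A. 0 < K x) \<and>
      smooth_symmetric_tensor A \<eta> \<and>
      (\<forall>x\<in>D. \<exists>c\<in>A. \<exists>N \<zeta>. x \<in> fst c \<and> snd c x \<in> N \<and> local_defining_function c D N \<zeta> \<and>
        (\<forall>z\<in>N. \<zeta> z = 0 \<longrightarrow>
           (\<forall>u. u \<noteq> 0 \<longrightarrow> frechet_derivative \<zeta> (at z) u = 0 \<longrightarrow> 0 < \<eta> c z u u)) \<and>
        (let g = riem (H c);
             g0 = hyperbolic_model (K \<circ> inv_into (fst c) (snd c)) (\<eta> c) \<zeta>;
             S = (\<lambda>z vs. g z (vs ! 0) (vs ! 1) - g0 z (vs ! 0) (vs ! 1))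
         in \<forall>i. ((\<lambda>z. tensor_norm g0 (i + 2) ((nabla g0 ^^ i) S) z) \<longlongrightarrow> 0)
                  (inf (filtercomap \<zeta> (at 0)) (principal N)))))"


definition k2 :: real
  where "k2 = (THE m. 0 < m \<and> m ^ 3 - 3 * m\<^sup>2 - 9 * m - 6 = 0)"

end

theory Submission
  imports Defs
begin

text \<open>In a bundle chart \<open>(z, w)\<close> the metrics have the form
  \<open>\<lambda>(r) \<omega>\<^sub>M + \<mu>(r) e\<^sup>k \<bar>dw + w \<partial>k\<bar>\<^sup>2\<close> with \<open>r = e\<^sup>k \<bar>w\<bar>\<^sup>2\<close>, and everything reduces to one function \<open>X\<close> of
  \<open>r\<close>, the moment coordinate, which solves \<open>2 r X' D(X) = Q(X)\<close> for a quartic \<open>Q\<close> and a linear \<open>D\<close>. The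
  scalar curvature is affine in \<open>X\<close> exactly because of the linear equation satisfied by \<open>Q''\<close>, and its
  gradient is then a constant multiple of \<open>w \<partial>/\<partial>w\<close>. A simple zero of \<open>Q\<close> at \<open>X = 0\<close> makes the metric
  close up along one section; the double zero at \<open>X = M\<close> puts the other section at infinite distance,
  since \<open>- ln (M - X)\<close> is Lipschitz along curves and its sublevel sets are compact. The remaining factor
  of \<open>Q\<close> is positive up to \<open>X = M\<close> iff \<open>M < k2\<close>. In that case \<open>M - X\<close> is asymptotic to a multiple of
  \<open>1 / \<bar>ln \<bar>w\<bar>\<bar>\<close>; the hyperbolic coframe \<open>dz, dw / (w ln \<bar>w\<bar>)\<close> has bounded connection coefficients, and the
  coefficients of the difference to the model in that frame lie in a class of functions that vanish
  at the divisor and is closed under differentiation along the frame.\<close>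

section \<open>Calculus of smooth functions\<close>

text \<open>In the coordinate \<open>x\<close> the curvature formula reads
  \<open>Q'' = - 4 - 2 * D * kap * S\<close>, so an affine \<open>S\<close> means a quartic
  \<open>Q\<close>, and every constant comes from linear algebra. Zeros at \<open>x = 0\<close>
  (simple) and \<open>x = M\<close> (double) leave two coefficients, \<open>p0\<close> and
  \<open>p1\<close>. The condition \<open>M\<^sup>2 * p0 = 2 * d0\<close> says that the profile has
  slope 2 or -2 at the closing end, so that there is no cone angle; comparing the three coefficients
  of \<open>Q''\<close> then fixes \<open>p1\<close>, \<open>A0\<close> and \<open>A1\<close>. The
  cubic defining \<open>k2\<close> is a negative multiple of \<open>p0 + p1 * M\<close>, the value
  of the linear factor at the complete end. Both parts of the theorem are one problem:
  \<open>eps\<close> tells whether the moment map rises or falls away from the closing section, and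
  \<open>kap = c + 1\<close> rescales \<open>[c, m]\<close> to length \<open>mt\<close>. A potential
  \<open>f(t)\<close> is singular on the sections. The metric is therefore built from its
  coefficients, which make sense up to the closing section, and compared with the potential only off
  the sections. Passing from \<open>w\<close> to \<open>1 / w\<close> inverts \<open>r\<close> and
  changes one sign, so both kinds of charts share the computations.\<close>

lemma Ck_on_cong:
  assumes "open U" "\<And>x. x \<in> U \<Longrightarrow> f x = g x" "Ck_on k f U"
  shows "Ck_on k g U"
proof (cases k)
  case 0
  with assms show ?thesis by (simp cong: continuous_on_cong)
next
  case (Suc j)
  with assms(3) obtain f' where f': "\<forall>x\<in>U. (f has_derivative f' x) (at x)"
    "\<forall>v. Ck_on j (\<lambda>x. f' x v) U" by auto
  have "\<forall>x\<in>U. (g has_derivative f' x) (at x)"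
    using f'(1) assms(1,2) has_derivative_transform_within_open by blast
  with f'(2) Suc show ?thesis by auto
qed

lemma Ck_on_subset: "Ck_on k f U \<Longrightarrow> V \<subseteq> U \<Longrightarrow> Ck_on k f V"
proof (induction k arbitrary: f)
  case 0 then show ?case by (simp add: continuous_on_subset)
next
  case (Suc k)
  then obtain f' where "\<forall>x\<in>U. (f has_derivative f' x) (at x)" "\<forall>v. Ck_on k (\<lambda>x. f' x v) U" by auto
  with Suc show ?case unfolding Ck_on.simps by blast
qed

text \<open>\<open>Ck_on\<close> at a successor speaks only of derivatives. The base case is
  continuity of differentiable functions; the step applies the induction hypothesis to the
  directional derivatives.\<close>

lemma Ck_on_SucD: "Ck_on (Suc k) f U \<Longrightarrow> Ck_on k f U"
proof (induction k arbitrary: f)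
  case 0
  then obtain f' where "\<forall>x\<in>U. (f has_derivative f' x) (at x)" by auto
  then show ?case
    using continuous_at_imp_continuous_on has_derivative_continuous by fastforce
next
  case (Suc k)
  from Suc.prems obtain f' where f': "\<forall>x\<in>U. (f has_derivative f' x) (at x)"
    "\<forall>v. Ck_on (Suc k) (\<lambda>x. f' x v) U" unfolding Ck_on.simps(2)[of "Suc k"] by blast
  have "Ck_on k (\<lambda>x. f' x v) U" for v using Suc.IH f'(2) by blast
  with f'(1) show ?case unfolding Ck_on.simps(2)[of k] by blast
qed

lemma Ck_on_const [simp]: "Ck_on k (\<lambda>x. c) U"
proof (induction k arbitrary: c)
  case (Suc k)
  have "\<forall>x\<in>U. ((\<lambda>x. c) has_derivative (\<lambda>v. 0)) (at x)" by simp
  with Suc show ?case unfolding Ck_on.simps by (intro exI[of _ "\<lambda>_ _. 0"]) simp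
qed simp

lemma Ck_on_bounded_linear:
  assumes "bounded_linear L" shows "Ck_on k L U"
proof (cases k)
  case 0 then show ?thesis using assms by (simp add: linear_continuous_on)
next
  case (Suc j)
  have "\<forall>x\<in>U. (L has_derivative L) (at x)" using assms by (simp add: bounded_linear_imp_has_derivative)
  with Suc show ?thesis by (simp, intro exI[of _ "\<lambda>_. L"], simp)
qed

lemma Ck_on_add: "Ck_on k f U \<Longrightarrow> Ck_on k g U \<Longrightarrow> Ck_on k (\<lambda>x. f x + g x) U"
proof (induction k arbitrary: f g)
  case 0 then show ?case by (simp add: continuous_on_add)
next
  case (Suc k)
  from Suc.prems obtain f' g' where *: "\<forall>x\<in>U. (f has_derivative f' x) (at x)" "\<forall>v. Ck_on k (\<lambda>x. f' x v) U"
    "\<forall>x\<in>U. (g has_derivative g' x) (at x)" "\<forall>v. Ck_on k (\<lambda>x. g' x v) U" by auto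
  show ?case unfolding Ck_on.simps
    using * Suc.IH by (intro exI[of _ "\<lambda>x v. f' x v + g' x v"] conjI ballI allI has_derivative_add) simp_all
qed

lemma Ck_on_bounded_linear_comp:
  assumes "bounded_linear L"
  shows "Ck_on k f U \<Longrightarrow> Ck_on k (\<lambda>x. L (f x)) U"
proof (induction k arbitrary: f)
  case 0 then show ?case using assms
    by (auto intro: bounded_linear.continuous_on)
next
  case (Suc k)
  from Suc.prems obtain f' where *: "\<forall>x\<in>U. (f has_derivative f' x) (at x)" "\<forall>v. Ck_on k (\<lambda>x. f' x v) U"
    by auto
  show ?case unfolding Ck_on.simps
    using * Suc.IH by (intro exI[of _ "\<lambda>x v. L (f' x v)"] conjI ballI allI
      bounded_linear.has_derivative[OF assms]) simp_all
qed

lemma Ck_on_bilinear: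
  assumes "bounded_bilinear bop"
  shows "Ck_on k f U \<Longrightarrow> Ck_on k g U \<Longrightarrow> Ck_on k (\<lambda>x. bop (f x) (g x)) U"
proof (induction k arbitrary: f g)
  case 0 then show ?case using assms by (simp add: bounded_bilinear.continuous_on)
next
  case (Suc k)
  from Suc.prems obtain f' g' where *: "\<forall>x\<in>U. (f has_derivative f' x) (at x)" "\<forall>v. Ck_on k (\<lambda>x. f' x v) U"
    "\<forall>x\<in>U. (g has_derivative g' x) (at x)" "\<forall>v. Ck_on k (\<lambda>x. g' x v) U" by auto
  have **: "Ck_on k f U" "Ck_on k g U" using Suc.prems Ck_on_SucD by blast+
  show ?case unfolding Ck_on.simps
    using * ** Suc.IH
    by (intro exI[of _ "\<lambda>x v. bop (f x) (g' x v) + bop (f' x v) (g x)"] conjI ballI allI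
      bounded_bilinear.FDERIV[OF assms] Ck_on_add) simp_all
qed

text \<open>Compositions occur in two shapes only: with an inner bounded linear map (the projection
  to the base) and with an outer function of one real variable (functions of \<open>rad\<close>).
  These two chain rules replace a general one.\<close>

lemma Ck_on_comp_linear:
  assumes "bounded_linear L" "L ` U \<subseteq> V"
  shows "Ck_on k f V \<Longrightarrow> Ck_on k (\<lambda>x. f (L x)) U"
proof (induction k arbitrary: f)
  case 0
  then show ?case
    using continuous_on_compose2[OF _ linear_continuous_on[OF assms(1)] assms(2), of f] by simp
next
  case (Suc k)
  from Suc.prems obtain f' where *: "\<forall>x\<in>V. (f has_derivative f' x) (at x)" "\<forall>v. Ck_on k (\<lambda>x. f' x v) V"
    by auto
  have "((\<lambda>x. f (L x)) has_derivative (\<lambda>v. f' (L x) (L v))) (at x)" if "x \<in> U" for x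
    by (rule has_derivative_compose[OF bounded_linear_imp_has_derivative[OF assms(1)]])
      (use * that assms in auto)
  with * Suc.IH show ?case unfolding Ck_on.simps
    by (intro exI[of _ "\<lambda>x v. f' (L x) (L v)"]) auto
qed

lemma Ck_on_comp_real:
  fixes F :: "real \<Rightarrow> 'b::real_normed_vector"
  assumes "g ` U \<subseteq> J"
  shows "Ck_on k F J \<Longrightarrow> Ck_on k g U \<Longrightarrow> Ck_on k (\<lambda>x. F (g x)) U"
proof (induction k arbitrary: F)
  case 0 then show ?case using continuous_on_compose2[OF _ _ assms, of F] by simp
next
  case (Suc k)
  from Suc.prems obtain F' g' where *: "\<forall>x\<in>J. (F has_derivative F' x) (at x)" "\<forall>v. Ck_on k (\<lambda>x. F' x v) J"
    "\<forall>x\<in>U. (g has_derivative g' x) (at x)" "\<forall>v. Ck_on k (\<lambda>x. g' x v) U" by auto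
  have "Ck_on k g U" using Suc.prems Ck_on_SucD by blast
  \<comment> \<open>Only derivatives in fixed directions are controlled, so the varying increment
    \<open>g' x v\<close> is pulled out of the linear map \<open>F' (g x)\<close>, leaving the fixed
    direction \<open>1\<close>.\<close>
  then have "Ck_on k (\<lambda>x. g' x v *\<^sub>R F' (g x) 1) U" for v
    using * Suc.IH[of "\<lambda>x. F' x 1"] by (intro Ck_on_bilinear[OF bounded_bilinear_scaleR]) auto
  moreover have "((\<lambda>x. F (g x)) has_derivative (\<lambda>v. g' x v *\<^sub>R F' (g x) 1)) (at x)" if "x \<in> U" for x
  proof -
    have F: "(F has_derivative F' (g x)) (at (g x))" using * assms that by blast
    have "F' (g x) c = c *\<^sub>R F' (g x) 1" for c
      using linear_scale[OF has_derivative_linear[OF F], of c 1] by simp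
    moreover have "((\<lambda>x. F (g x)) has_derivative (\<lambda>v. F' (g x) (g' x v))) (at x)"
      by (rule has_derivative_compose[where g = F, OF bspec[OF *(3) that] F])
    ultimately show ?thesis by (subst (asm) \<open>\<And>c. F' (g x) c = c *\<^sub>R F' (g x) 1\<close>)
  qed
  ultimately show ?case unfolding Ck_on.simps
    by (intro exI[of _ "\<lambda>x v. g' x v *\<^sub>R F' (g x) 1"]) blast
qed

lemma Ck_on_Suc_realI:
  fixes F :: "real \<Rightarrow> real"
  assumes "\<And>x. x \<in> J \<Longrightarrow> (F has_real_derivative F' x) (at x)" "Ck_on k F' J"
  shows "Ck_on (Suc k) F J"
proof -
  have "Ck_on k (\<lambda>x. F' x * v) J" for v
    by (intro Ck_on_bilinear[OF bounded_bilinear_mult] assms) simp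
  with assms(1) show ?thesis unfolding Ck_on.simps
    by (intro exI[of _ "\<lambda>x v. F' x * v"]) (auto simp: has_field_derivative_def)
qed

lemma smooth_on_cong: "open U \<Longrightarrow> (\<And>x. x \<in> U \<Longrightarrow> f x = g x) \<Longrightarrow> smooth_on U f \<Longrightarrow> smooth_on U g"
  unfolding smooth_on_def using Ck_on_cong by blast

lemma smooth_on_subset: "smooth_on U f \<Longrightarrow> V \<subseteq> U \<Longrightarrow> smooth_on V f"
  unfolding smooth_on_def using Ck_on_subset by blast

lemma smooth_on_const [simp]: "smooth_on U (\<lambda>x. c)"
  unfolding smooth_on_def by simp

lemma smooth_on_bounded_linear: "bounded_linear L \<Longrightarrow> smooth_on U L"
  unfolding smooth_on_def using Ck_on_bounded_linear by blast

lemma smooth_on_add: "smooth_on U f \<Longrightarrow> smooth_on U g \<Longrightarrow> smooth_on U (\<lambda>x. f x + g x)"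
  unfolding smooth_on_def using Ck_on_add by blast

lemma smooth_on_bounded_linear_comp: "bounded_linear L \<Longrightarrow> smooth_on U f \<Longrightarrow> smooth_on U (\<lambda>x. L (f x))"
  unfolding smooth_on_def using Ck_on_bounded_linear_comp by blast

lemma smooth_on_mult:
  fixes f g :: "_ \<Rightarrow> 'b::real_normed_algebra"
  shows "smooth_on U f \<Longrightarrow> smooth_on U g \<Longrightarrow> smooth_on U (\<lambda>x. f x * g x)"
  unfolding smooth_on_def using Ck_on_bilinear[OF bounded_bilinear_mult] by blast

lemma smooth_on_minus: "smooth_on U f \<Longrightarrow> smooth_on U (\<lambda>x. - f x)"
  by (rule smooth_on_bounded_linear_comp[OF bounded_linear_minus[OF bounded_linear_ident]])

lemma smooth_on_diff: "smooth_on U f \<Longrightarrow> smooth_on U g \<Longrightarrow> smooth_on U (\<lambda>x. f x - g x)"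
  using smooth_on_add[OF _ smooth_on_minus, of U f g] by simp

lemma smooth_on_power:
  fixes f :: "_ \<Rightarrow> 'b::real_normed_algebra_1"
  shows "smooth_on U f \<Longrightarrow> smooth_on U (\<lambda>x. f x ^ n)"
  by (induction n) (auto intro: smooth_on_mult)

lemma smooth_on_comp_linear:
  "bounded_linear L \<Longrightarrow> L ` U \<subseteq> V \<Longrightarrow> smooth_on V f \<Longrightarrow> smooth_on U (\<lambda>x. f (L x))"
  unfolding smooth_on_def using Ck_on_comp_linear by blast

lemma smooth_on_comp_real:
  fixes F :: "real \<Rightarrow> 'b::real_normed_vector"
  shows "g ` U \<subseteq> J \<Longrightarrow> smooth_on J F \<Longrightarrow> smooth_on U g \<Longrightarrow> smooth_on U (\<lambda>x. F (g x))"
  unfolding smooth_on_def using Ck_on_comp_real by blast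

section \<open>Smoothness of elementary functions and of solutions of equations in one real
  variable\<close>

lemma smooth_on_inverse_real: "(0::real) \<notin> J \<Longrightarrow> smooth_on J inverse"
  unfolding smooth_on_def
proof
  fix k assume J: "(0::real) \<notin> J"
  show "Ck_on k inverse J"
  proof (induction k)
    case 0 from J show ?case by (auto intro!: continuous_intros)
  next
    case (Suc k)
    show ?case
    proof (rule Ck_on_Suc_realI)
      \<comment> \<open>Written as a product of inverses, the derivative is covered by the induction
        hypothesis.\<close>
      show "(inverse has_real_derivative - (inverse x * inverse x)) (at x)" if "x \<in> J" for x
        using DERIV_inverse[of x UNIV] that J by (auto simp: power2_eq_square)
      show "Ck_on k (\<lambda>x::real. - (inverse x * inverse x)) J"
        by (intro Ck_on_bounded_linear_comp[OF bounded_linear_minus[OF bounded_linear_ident]]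
            Ck_on_bilinear[OF bounded_bilinear_mult] Suc)
    qed
  qed
qed

lemma smooth_on_ln: 
  assumes "J \<subseteq> {0::real<..}" shows "smooth_on J ln"
  unfolding smooth_on_def
proof
  fix k 
  show "Ck_on k ln J"
  proof (cases k)
    case 0 show ?thesis unfolding 0 Ck_on.simps by (rule continuous_on_ln[OF continuous_on_id]) (use assms in auto)
  next
    case (Suc j)
    show ?thesis unfolding Suc
    proof (rule Ck_on_Suc_realI)
      show "(ln has_real_derivative inverse x) (at x)" if "x \<in> J" for x
        using that assms by (auto intro: DERIV_ln)
      show "Ck_on j inverse J"
        using smooth_on_inverse_real[of J] assms unfolding smooth_on_def by auto
    qed
  qed
qed

lemma smooth_on_exp: "smooth_on J (exp :: real \<Rightarrow> real)"
  unfolding smooth_on_def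
proof
  fix k show "Ck_on k exp J"
  proof (induction k)
    case 0 show ?case by (auto intro!: continuous_intros)
  next
    case (Suc k) then show ?case by (intro Ck_on_Suc_realI[where F' = exp]) auto
  qed
qed

lemma smooth_on_inverse:
  fixes g :: "_ \<Rightarrow> real"
  shows "(\<And>x. x \<in> U \<Longrightarrow> g x \<noteq> 0) \<Longrightarrow> smooth_on U g \<Longrightarrow> smooth_on U (\<lambda>x. inverse (g x))"
  by (rule smooth_on_comp_real[where J = "- {0}"]) (auto intro: smooth_on_inverse_real)

lemma smooth_on_divide:
  fixes f g :: "_ \<Rightarrow> real"
  shows "(\<And>x. x \<in> U \<Longrightarrow> g x \<noteq> 0) \<Longrightarrow> smooth_on U f \<Longrightarrow> smooth_on U g \<Longrightarrow> smooth_on U (\<lambda>x. f x / g x)"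
  unfolding divide_inverse by (intro smooth_on_mult smooth_on_inverse)

lemma smooth_on_imp_continuous_on: "smooth_on U f \<Longrightarrow> continuous_on U f"
  unfolding smooth_on_def using Ck_on.simps(1)[of f U] by blast

lemma smooth_on_imp_differentiable: "smooth_on U f \<Longrightarrow> x \<in> U \<Longrightarrow> f differentiable (at x)"
  unfolding smooth_on_def differentiable_def using Ck_on.simps(2)[of 0 f U] by blast

lemma smooth_on_imp_has_derivative:
  "smooth_on U f \<Longrightarrow> x \<in> U \<Longrightarrow> (f has_derivative frechet_derivative f (at x)) (at x)"
  using frechet_derivative_works[THEN iffD1] smooth_on_imp_differentiable by blast

lemma smooth_on_frechet_derivative:
  assumes "open U" "smooth_on U f"
  shows "smooth_on U (\<lambda>x. frechet_derivative f (at x) v)"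
  unfolding smooth_on_def
proof
  fix k
  from assms(2) have "Ck_on (Suc k) f U" unfolding smooth_on_def by blast
  then obtain f' where f': "\<forall>x\<in>U. (f has_derivative f' x) (at x)" "\<forall>v. Ck_on k (\<lambda>x. f' x v) U"
    by auto
  have "f' x v = frechet_derivative f (at x) v" if "x \<in> U" for x
    using frechet_derivative_at[OF bspec[OF f'(1) that]] by simp
  then show "Ck_on k (\<lambda>x. frechet_derivative f (at x) v) U"
    by (rule Ck_on_cong[OF assms(1) _ spec[OF f'(2)]])
qed

lemma smooth_on_real_derivative:
  fixes F :: "real \<Rightarrow> real"
  assumes "smooth_on J F" "x \<in> J"
  shows "(F has_real_derivative deriv F x) (at x)"
proof -
  obtain D where "(F has_real_derivative D) (at x)"
    using smooth_on_imp_differentiable[OF assms] real_differentiable_def by blast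
  then show ?thesis using DERIV_imp_deriv by blast
qed

lemma smooth_on_deriv:
  fixes F :: "real \<Rightarrow> real"
  assumes "open J" "smooth_on J F"
  shows "smooth_on J (deriv F)"
proof (rule smooth_on_cong[OF assms(1) _ smooth_on_frechet_derivative[OF assms, of 1]])
  fix x assume "x \<in> J"
  from smooth_on_real_derivative[OF assms(2) this]
  have "(F has_derivative (*) (deriv F x)) (at x)"
    by (simp add: has_field_derivative_def)
  from fun_cong[OF frechet_derivative_at[OF this], of 1]
  show "frechet_derivative F (at x) 1 = deriv F x" by simp
qed

lemma smooth_on_antiderivative:
  fixes F :: "real \<Rightarrow> real"
  assumes "\<And>x. x \<in> J \<Longrightarrow> (F has_real_derivative F' x) (at x)" "smooth_on J F'"
  shows "smooth_on J F"
  unfolding smooth_on_def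
proof
  fix k
  have "Ck_on k F' J" using assms(2) unfolding smooth_on_def by blast
  from Ck_on_SucD[OF Ck_on_Suc_realI[OF assms(1) this]] show "Ck_on k F J" .
qed

text \<open>Bootstrapping: if \<open>X\<close> is \<open>C\<^sup>k\<close>, so is its derivative \<open>W (X x)\<close>.\<close>

lemma smooth_on_autonomous:
  fixes X :: "real \<Rightarrow> real"
  assumes "\<And>x. x \<in> J \<Longrightarrow> (X has_real_derivative W (X x)) (at x)" "X ` J \<subseteq> I" "smooth_on I W"
  shows "smooth_on J X"
  unfolding smooth_on_def
proof
  fix k show "Ck_on k X J"
  proof (induction k)
    case 0
    show ?case using assms(1) by (auto intro!: continuous_at_imp_continuous_on intro: DERIV_isCont)
  next
    case (Suc k)
    show ?case
      by (rule Ck_on_Suc_realI[OF assms(1)])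
        (use assms(3) Suc assms(2) in \<open>auto simp: smooth_on_def intro: Ck_on_comp_real\<close>)
  qed
qed

lemma smooth_on_of_real: "smooth_on U f \<Longrightarrow> smooth_on U (\<lambda>x. complex_of_real (f x))"
  by (rule smooth_on_bounded_linear_comp[OF bounded_linear_of_real])

lemma smooth_on_Re: "smooth_on U f \<Longrightarrow> smooth_on U (\<lambda>x. Re (f x))"
  by (rule smooth_on_bounded_linear_comp[OF bounded_linear_Re])

lemma smooth_on_Im: "smooth_on U f \<Longrightarrow> smooth_on U (\<lambda>x. Im (f x))"
  by (rule smooth_on_bounded_linear_comp[OF bounded_linear_Im])

lemma smooth_on_cnj: "smooth_on U f \<Longrightarrow> smooth_on U (\<lambda>x. cnj (f x))"
  by (rule smooth_on_bounded_linear_comp[OF bounded_linear_cnj])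

lemma smooth_on_component: "smooth_on U (\<lambda>y::complex^'n. y $ i)"
  by (rule smooth_on_bounded_linear[OF bounded_linear_vec_nth])

lemma smooth_on_d_z: "open U \<Longrightarrow> smooth_on U f \<Longrightarrow> smooth_on U (d_z j f)"
  unfolding d_z_def[abs_def] divide_inverse
  by (intro smooth_on_mult smooth_on_diff smooth_on_const smooth_on_frechet_derivative)

lemma smooth_on_d_zbar: "open U \<Longrightarrow> smooth_on U f \<Longrightarrow> smooth_on U (d_zbar j f)"
  unfolding d_zbar_def[abs_def] divide_inverse
  by (intro smooth_on_mult smooth_on_add smooth_on_const smooth_on_frechet_derivative)

section \<open>Wirtinger derivatives\<close>

lemma frechet_derivative_cong_open:
  assumes "open U" "z \<in> U" "\<And>x. x \<in> U \<Longrightarrow> f x = g x"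
  shows "frechet_derivative f (at z) = frechet_derivative g (at z)"
proof -
  have "(f has_derivative D) (at z) \<longleftrightarrow> (g has_derivative D) (at z)" for D
    by (rule iffI; erule has_derivative_transform_within_open[OF _ assms(1,2)]) (simp_all add: assms(3))
  then show ?thesis unfolding frechet_derivative_def by simp
qed

lemma d_z_cong_open:
  assumes "open U" "z \<in> U" "\<And>x. x \<in> U \<Longrightarrow> f x = g x"
  shows "d_z j f z = d_z j g z" "d_zbar j f z = d_zbar j g z"
  by (simp_all add: d_z_def d_zbar_def frechet_derivative_cong_open[OF assms])

lemma ddbar_cong_open:
  assumes "open U" "z \<in> U" "\<And>x. x \<in> U \<Longrightarrow> f x = g x"
  shows "ddbar i j f z = ddbar i j g z"
  unfolding ddbar_def
  by (rule d_z_cong_open(1)[OF assms(1,2)], rule d_z_cong_open(2)[OF assms(1)]) (simp_all add: assms(3))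

lemma
  assumes "(f has_derivative f') (at z)"
  shows d_z_eqI: "d_z j f z = (f' (axis j 1) - \<i> * f' (axis j \<i>)) / 2"
    and d_zbar_eqI: "d_zbar j f z = (f' (axis j 1) + \<i> * f' (axis j \<i>)) / 2"
  unfolding d_z_def d_zbar_def frechet_derivative_at[OF assms, symmetric] by simp_all

lemma d_z_const [simp]: "d_z j (\<lambda>_. c) z = 0" "d_zbar j (\<lambda>_. c) z = 0"
  by (simp_all add: d_z_def d_zbar_def)

lemma
  assumes "f differentiable (at z)" "g differentiable (at z)"
  shows d_z_add: "d_z j (\<lambda>y. f y + g y) z = d_z j f z + d_z j g z"
    and d_zbar_add: "d_zbar j (\<lambda>y. f y + g y) z = d_zbar j f z + d_zbar j g z"
    and d_z_mult: "d_z j (\<lambda>y. f y * g y) z = d_z j f z * g z + f z * d_z j g z"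
    and d_zbar_mult: "d_zbar j (\<lambda>y. f y * g y) z = d_zbar j f z * g z + f z * d_zbar j g z"
proof -
  note d = frechet_derivative_works[THEN iffD1, OF assms(1)] frechet_derivative_works[THEN iffD1, OF assms(2)]
  note s = has_derivative_add[OF d] and p = has_derivative_mult[OF d]
  show "d_z j (\<lambda>y. f y + g y) z = d_z j f z + d_z j g z"
    "d_zbar j (\<lambda>y. f y + g y) z = d_zbar j f z + d_zbar j g z"
    "d_z j (\<lambda>y. f y * g y) z = d_z j f z * g z + f z * d_z j g z"
    "d_zbar j (\<lambda>y. f y * g y) z = d_zbar j f z * g z + f z * d_zbar j g z"
    unfolding d_z_eqI[OF s] d_zbar_eqI[OF s] d_z_eqI[OF p] d_zbar_eqI[OF p]
    by (simp_all add: d_z_def d_zbar_def field_simps)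
qed

lemma has_derivative_of_real_comp:
  "(g has_derivative g') (at z) \<Longrightarrow> ((\<lambda>y. complex_of_real (g y)) has_derivative (\<lambda>v. complex_of_real (g' v))) (at z)"
  by (rule bounded_linear.has_derivative[OF bounded_linear_of_real])

lemma
  assumes g: "g differentiable (at z)" and F: "(F has_real_derivative D) (at (g z))"
  shows d_z_real_comp: "d_z j (\<lambda>y. complex_of_real (F (g y))) z = of_real D * d_z j (\<lambda>y. complex_of_real (g y)) z"
    and d_zbar_real_comp: "d_zbar j (\<lambda>y. complex_of_real (F (g y))) z = of_real D * d_zbar j (\<lambda>y. complex_of_real (g y)) z"
    and differentiable_real_comp: "(\<lambda>y. F (g y)) differentiable (at z)"
proof -
  from g have d: "(g has_derivative frechet_derivative g (at z)) (at z)"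
    by (rule frechet_derivative_works[THEN iffD1])
  from F have "(F has_derivative (*) D) (at (g z))" by (simp add: has_field_derivative_def)
  from has_derivative_compose[where g = F, OF d this]
  have c: "((\<lambda>y. F (g y)) has_derivative (\<lambda>v. D * frechet_derivative g (at z) v)) (at z)" .
  then show "(\<lambda>y. F (g y)) differentiable (at z)" by (rule differentiableI)
  show "d_z j (\<lambda>y. complex_of_real (F (g y))) z = of_real D * d_z j (\<lambda>y. complex_of_real (g y)) z"
    "d_zbar j (\<lambda>y. complex_of_real (F (g y))) z = of_real D * d_zbar j (\<lambda>y. complex_of_real (g y)) z"
    unfolding d_z_eqI[OF has_derivative_of_real_comp[OF c]] d_z_eqI[OF has_derivative_of_real_comp[OF d]]
      d_zbar_eqI[OF has_derivative_of_real_comp[OF c]] d_zbar_eqI[OF has_derivative_of_real_comp[OF d]]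
    by (simp_all add: field_simps)
qed

lemma d_zbar_of_real:
  assumes "g differentiable (at z)"
  shows "d_zbar j (\<lambda>y. complex_of_real (g y)) z = cnj (d_z j (\<lambda>y. complex_of_real (g y)) z)"
proof -
  note d = has_derivative_of_real_comp[OF frechet_derivative_works[THEN iffD1, OF assms]]
  show ?thesis unfolding d_z_eqI[OF d] d_zbar_eqI[OF d] by simp
qed

lemma d_z_cnj:
  assumes "f differentiable (at z)"
  shows "d_z j (\<lambda>y. cnj (f y)) z = cnj (d_zbar j f z)" "d_zbar j (\<lambda>y. cnj (f y)) z = cnj (d_z j f z)"
proof -
  note d = frechet_derivative_works[THEN iffD1, OF assms]
  note c = bounded_linear.has_derivative[OF bounded_linear_cnj d]
  show "d_z j (\<lambda>y. cnj (f y)) z = cnj (d_zbar j f z)" "d_zbar j (\<lambda>y. cnj (f y)) z = cnj (d_z j f z)"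
    unfolding d_z_eqI[OF c] d_zbar_eqI[OF c] d_z_eqI[OF d] d_zbar_eqI[OF d] by simp_all
qed

lemma d_z_component:
  "d_z j (\<lambda>y. y $ i) z = (if i = j then 1 else 0)" "d_zbar j (\<lambda>y. y $ i) z = 0"
proof -
  have d: "((\<lambda>y::complex^'a. y $ i) has_derivative (\<lambda>v. v $ i)) (at z)"
    by (rule bounded_linear_imp_has_derivative[OF bounded_linear_vec_nth])
  show "d_z j (\<lambda>y. y $ i) z = (if i = j then 1 else 0)" "d_zbar j (\<lambda>y. y $ i) z = 0"
    unfolding d_z_eqI[OF d] d_zbar_eqI[OF d] by (auto simp: axis_def)
qed

lemma axis_expansion: "v = (\<Sum>j\<in>UNIV. Re (v $ j) *\<^sub>R axis j 1 + Im (v $ j) *\<^sub>R axis j (\<i>::complex))"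
proof (subst vec_eq_iff, intro allI)
  fix i
  have "(\<Sum>j\<in>UNIV. Re (v $ j) *\<^sub>R axis j 1 + Im (v $ j) *\<^sub>R axis j \<i>) $ i
      = (\<Sum>j\<in>UNIV. if j = i then v $ i else 0)"
    unfolding sum_component by (rule sum.cong) (auto simp: axis_def complex_eq_iff)
  then show "v $ i = (\<Sum>j\<in>UNIV. Re (v $ j) *\<^sub>R axis j 1 + Im (v $ j) *\<^sub>R axis j \<i>) $ i" by simp
qed

text \<open>For a real function the derivatives along \<open>z_j\<close> and its conjugate are
  conjugate to each other, so the full differential is twice the real part of the holomorphic one.
  This turns the complex computations below into real derivatives.\<close>

lemma real_derivative_d_z:
  fixes g :: "complex^'n::finite \<Rightarrow> real"
  assumes "(g has_derivative g') (at z)"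
  shows "g' v = 2 * Re (\<Sum>j\<in>UNIV. d_z j (\<lambda>y. complex_of_real (g y)) z * v $ j)"
proof -
  note l = has_derivative_linear[OF assms]
  have "g' v = (\<Sum>j\<in>UNIV. Re (v $ j) * g' (axis j 1) + Im (v $ j) * g' (axis j \<i>))"
    by (subst axis_expansion) (simp add: linear_sum[OF l] linear_add[OF l] linear_scale[OF l])
  also have "\<dots> = 2 * Re (\<Sum>j\<in>UNIV. d_z j (\<lambda>y. complex_of_real (g y)) z * v $ j)"
    unfolding d_z_eqI[OF has_derivative_of_real_comp[OF assms]] Re_sum sum_distrib_left
    by (rule sum.cong) (simp_all add: field_simps)
  finally show ?thesis .
qed

section \<open>Functions pulled back from the base curve\<close>

definition bp :: "complex^2 \<Rightarrow> complex^1"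
  where "bp y = vec (y $ 1)"

lemma bounded_linear_bp: "bounded_linear bp"
proof -
  have "linear bp"
    by (rule linearI) (simp_all add: bp_def vec_eq_iff)
  then show ?thesis by (simp add: linear_conv_bounded_linear)
qed

lemma continuous_on_bp: "continuous_on U bp"
  by (rule linear_continuous_on[OF bounded_linear_bp])

lemma bp_nth [simp]: "bp y $ i = y $ 1"
  by (simp add: bp_def)

lemma bp_axis [simp]: "bp (axis 1 c) = axis 1 c" "bp (axis 2 c) = 0"
  by (simp_all add: bp_def vec_eq_iff axis_def forall_1)

lemma has_derivative_bp:
  "(b has_derivative b') (at (bp z)) \<Longrightarrow> ((\<lambda>y. b (bp y)) has_derivative (\<lambda>v. b' (bp v))) (at z)"
  by (rule has_derivative_compose[OF bounded_linear_imp_has_derivative[OF bounded_linear_bp]])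

lemma differentiable_bp: "b differentiable (at (bp z)) \<Longrightarrow> (\<lambda>y. b (bp y)) differentiable (at z)"
  using has_derivative_bp unfolding differentiable_def by fastforce

lemma
  assumes "b differentiable (at (bp z))"
  shows d_z_bp: "d_z 1 (\<lambda>y. b (bp y)) z = d_z 1 b (bp z)" "d_z 2 (\<lambda>y. b (bp y)) z = 0"
    and d_zbar_bp: "d_zbar 1 (\<lambda>y. b (bp y)) z = d_zbar 1 b (bp z)" "d_zbar 2 (\<lambda>y. b (bp y)) z = 0"
proof -
  note d = frechet_derivative_works[THEN iffD1, OF assms]
  note l = linear_0[OF has_derivative_linear[OF d]]
  show "d_z 1 (\<lambda>y. b (bp y)) z = d_z 1 b (bp z)" "d_z 2 (\<lambda>y. b (bp y)) z = 0"
    "d_zbar 1 (\<lambda>y. b (bp y)) z = d_zbar 1 b (bp z)" "d_zbar 2 (\<lambda>y. b (bp y)) z = 0"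
    unfolding d_z_eqI[OF has_derivative_bp[OF d]] d_zbar_eqI[OF has_derivative_bp[OF d]]
      d_z_eqI[OF d] d_zbar_eqI[OF d] by (simp_all add: l)
qed

section \<open>Circle-invariant metrics in bundle coordinates\<close>

text \<open>In a trivialisation with coordinates \<open>(z, w)\<close>, the squared fibre norm is \<open>exp (k z) * \<bar>w\<bar>\<^sup>2\<close>, where
  \<open>k\<close> is the logarithm of the Hermitian weight or its negative.\<close>

definition rad :: "(complex^1 \<Rightarrow> real) \<Rightarrow> complex^2 \<Rightarrow> real"
  where "rad k y = exp (k (bp y)) * (cmod (y $ 2))\<^sup>2"

definition kz :: "(complex^1 \<Rightarrow> real) \<Rightarrow> complex^1 \<Rightarrow> complex"
  where "kz k = d_z 1 (\<lambda>x. complex_of_real (k x))"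

text \<open>The covector \<open>dw + w \<partial>k\<close>, the vertical projection of the Chern
  connection of the weight. The forms of \<open>lform\<close> are diagonal in the coframe
  \<open>dz\<close>, \<open>vcov\<close>.\<close>

definition vcov :: "(complex^1 \<Rightarrow> real) \<Rightarrow> complex^2 \<Rightarrow> complex^2 \<Rightarrow> complex"
  where "vcov k y u = u $ 2 + y $ 2 * kz k (bp y) * u $ 1"

text \<open>The form \<open>\<i>(\<lambda> a dz \<and> d(cnj z) + \<mu> exp k (dw + w \<partial>k) \<and> cnj (dw + w \<partial>k))\<close>.\<close>

definition lform ::
  "(real \<Rightarrow> real) \<Rightarrow> (real \<Rightarrow> real) \<Rightarrow> (complex^1 \<Rightarrow> real) \<Rightarrow> (complex^1 \<Rightarrow> real) \<Rightarrow> complex^2 \<Rightarrow> complex^2^2"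
  where "lform lam mu a k y =
    (\<chi> i j. (if i = 1 \<and> j = 1 then complex_of_real (lam (rad k y) * a (bp y)) else 0) +
       complex_of_real (mu (rad k y) * exp (k (bp y))) * vcov k y (axis i 1) * cnj (vcov k y (axis j 1)))"

lemma vcov_axis [simp]: "vcov k y (axis 1 c) = y $ 2 * kz k (bp y) * c" "vcov k y (axis 2 c) = c"
  by (simp_all add: vcov_def axis_def)

lemma herm_lform:
  "herm (lform lam mu a k y) u v =
    complex_of_real (lam (rad k y) * a (bp y)) * u $ 1 * cnj (v $ 1) +
    complex_of_real (mu (rad k y) * exp (k (bp y))) * vcov k y u * cnj (vcov k y v)"
  unfolding herm_def lform_def by (simp add: sum_2 vcov_def axis_def algebra_simps)

text \<open>The passage from \<open>dw\<close> to \<open>dw + w \<partial>k\<close> is unipotent, so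
  only the two diagonal coefficients survive.\<close>

lemma det_lform: "det (lform lam mu a k y) =
   complex_of_real (lam (rad k y) * a (bp y) * (mu (rad k y) * exp (k (bp y))))"
  unfolding det_2 lform_def by (simp add: algebra_simps)

lemma rad_ge_0: "0 \<le> rad k y" by (simp add: rad_def)

lemma rad_pos: "y $ 2 \<noteq> 0 \<Longrightarrow> 0 < rad k y" by (simp add: rad_def)

lemma of_real_rad: "complex_of_real (rad k y) = of_real (exp (k (bp y))) * (y $ 2 * cnj (y $ 2))"
  unfolding rad_def by (simp only: of_real_mult complex_norm_square)

locale weight =
  fixes O1 :: "(complex^1) set" and k :: "complex^1 \<Rightarrow> real"
  assumes open_O1: "open O1" and smooth_k: "smooth_on O1 k"
begin

definition Ov where "Ov = bp -` O1"

lemma open_Ov: "open Ov"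
  unfolding Ov_def using continuous_on_bp[of UNIV] open_O1 open_vimage by blast

lemma smooth_bp: "smooth_on O1 b \<Longrightarrow> smooth_on Ov (\<lambda>y. b (bp y))"
  by (rule smooth_on_comp_linear[OF bounded_linear_bp]) (auto simp: Ov_def)

lemma smooth_kz: "smooth_on O1 (kz k)"
  unfolding kz_def by (intro smooth_on_d_z open_O1 smooth_on_of_real smooth_k)

lemma smooth_exp_k: "smooth_on Ov (\<lambda>y. exp (k (bp y)))"
  by (rule smooth_on_comp_real[where J = UNIV]) (auto intro: smooth_on_exp smooth_bp smooth_k)

lemma smooth_cmod_sq: "smooth_on U (\<lambda>y::complex^'n. (cmod (y $ i))\<^sup>2)"
  unfolding cmod_power2
  by (intro smooth_on_add smooth_on_power smooth_on_Re smooth_on_Im smooth_on_component)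

lemma smooth_rad: "smooth_on Ov (rad k)"
  unfolding rad_def[abs_def] by (intro smooth_on_mult smooth_exp_k smooth_cmod_sq)

lemma diff_of_real: "g differentiable (at y) \<Longrightarrow> (\<lambda>y. complex_of_real (g y)) differentiable (at y)"
  using has_derivative_of_real_comp unfolding differentiable_def by fastforce

lemma k_diff: "x \<in> O1 \<Longrightarrow> k differentiable (at x)"
  using smooth_on_imp_differentiable[OF smooth_k] .

lemma kz_diff: "x \<in> O1 \<Longrightarrow> kz k differentiable (at x)"
  using smooth_on_imp_differentiable[OF smooth_kz] .

lemma w_diff: "(\<lambda>y::complex^2. y $ 2) differentiable (at y)" "(\<lambda>y::complex^2. cnj (y $ 2)) differentiable (at y)"
  by (rule smooth_on_imp_differentiable[of UNIV], auto intro: smooth_on_cnj smooth_on_component)+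

lemma expk_diff: "y \<in> Ov \<Longrightarrow> (\<lambda>y. complex_of_real (exp (k (bp y)))) differentiable (at y)"
  using smooth_on_imp_differentiable[OF smooth_on_of_real[OF smooth_exp_k]] .

lemma rad_diff: "y \<in> Ov \<Longrightarrow> rad k differentiable (at y)"
  using smooth_on_imp_differentiable[OF smooth_rad] .

lemma d_expk:
  assumes "y \<in> Ov"
  shows "d_z 1 (\<lambda>y. complex_of_real (exp (k (bp y)))) y = of_real (exp (k (bp y))) * kz k (bp y)"
    "d_z 2 (\<lambda>y. complex_of_real (exp (k (bp y)))) y = 0"
    "d_zbar 1 (\<lambda>y. complex_of_real (exp (k (bp y)))) y = of_real (exp (k (bp y))) * cnj (kz k (bp y))"
    "d_zbar 2 (\<lambda>y. complex_of_real (exp (k (bp y)))) y = 0"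
proof -
  from assms have 1: "bp y \<in> O1" by (simp add: Ov_def)
  note kd = k_diff[OF 1] and kd' = diff_of_real[OF k_diff[OF 1]]
  note e = d_z_real_comp[OF differentiable_bp[OF kd] DERIV_exp] d_zbar_real_comp[OF differentiable_bp[OF kd] DERIV_exp]
  show "d_z 1 (\<lambda>y. complex_of_real (exp (k (bp y)))) y = of_real (exp (k (bp y))) * kz k (bp y)"
    "d_z 2 (\<lambda>y. complex_of_real (exp (k (bp y)))) y = 0"
    "d_zbar 1 (\<lambda>y. complex_of_real (exp (k (bp y)))) y = of_real (exp (k (bp y))) * cnj (kz k (bp y))"
    "d_zbar 2 (\<lambda>y. complex_of_real (exp (k (bp y)))) y = 0"
    unfolding e d_z_bp[OF kd'] d_zbar_bp[OF kd'] d_zbar_of_real[OF kd] by (simp_all add: kz_def)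
qed

lemma d_rad:
  assumes "y \<in> Ov"
  shows "d_z 1 (\<lambda>y. complex_of_real (rad k y)) y = kz k (bp y) * of_real (rad k y)"
    "d_z 2 (\<lambda>y. complex_of_real (rad k y)) y = of_real (exp (k (bp y))) * cnj (y $ 2)"
    "d_zbar 1 (\<lambda>y. complex_of_real (rad k y)) y = cnj (kz k (bp y)) * of_real (rad k y)"
    "d_zbar 2 (\<lambda>y. complex_of_real (rad k y)) y = of_real (exp (k (bp y))) * y $ 2"
  unfolding of_real_rad
  by (simp_all add: d_z_mult d_zbar_mult expk_diff[OF assms] w_diff differentiable_mult d_expk[OF assms]
      d_z_component d_z_cnj[OF w_diff(1)])

text \<open>Horizontal directions preserve the fibre norm, hence only \<open>vcov\<close> enters.
  This is why gradients of functions of \<open>rad\<close> are vertical and why distances across the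
  levels of \<open>rad\<close> are governed by the vertical part of the metric.\<close>

lemma derivative_rad:
  assumes "y \<in> Ov"
  shows "(rad k has_derivative (\<lambda>u. 2 * exp (k (bp y)) * Re (cnj (y $ 2) * vcov k y u))) (at y)"
proof -
  have d: "(rad k has_derivative frechet_derivative (rad k) (at y)) (at y)"
    using frechet_derivative_works rad_diff[OF assms] by blast
  have "frechet_derivative (rad k) (at y) = (\<lambda>u. 2 * exp (k (bp y)) * Re (cnj (y $ 2) * vcov k y u))"
    unfolding real_derivative_d_z[OF d] sum_2 d_rad[OF assms] unfolding of_real_rad vcov_def
    by (rule ext) (simp add: algebra_simps)
  with d show ?thesis by simp
qed

text \<open>Off \<open>w = 0\<close> this is the chain rule in the variable \<open>ln r\<close>,
  because \<open>ln r - k\<close> is the logarithm of \<open>\<bar>w\<bar>\<^sup>2\<close> and hence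
  pluriharmonic. Expressed with \<open>P1\<close> and \<open>P2\<close> the formula has no pole and
  also holds at \<open>w = 0\<close>.\<close>

lemma ddbar_rad:
  assumes y: "y \<in> Ov" "open J" "rad k y \<in> J"
    and P: "\<And>r. r \<in> J \<Longrightarrow> (P has_real_derivative P1 r) (at r)"
    and P1: "(P1 has_real_derivative P2) (at (rad k y))"
  shows "ddbar i j (\<lambda>y. P (rad k y)) y =
     (if i = 1 \<and> j = 1 then of_real (rad k y * P1 (rad k y)) * ddbar 1 1 k (bp y) else 0) +
     of_real ((P1 (rad k y) + rad k y * P2) * exp (k (bp y))) * vcov k y (axis i 1) * cnj (vcov k y (axis j 1))"
proof -
  define U where "U = Ov \<inter> rad k -` J"
  have oU: "open U" unfolding U_def
    by (rule continuous_open_preimage[OF smooth_on_imp_continuous_on[OF smooth_rad] open_Ov y(2)])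
  have yU: "y \<in> U" using y by (auto simp: U_def)
  have U: "y' \<in> Ov" "rad k y' \<in> J" "bp y' \<in> O1" if "y' \<in> U" for y' using that by (auto simp: U_def Ov_def)
  have b: "bp y \<in> O1" using y by (simp add: Ov_def)
  have P1d: "(\<lambda>y. complex_of_real (P1 (rad k y))) differentiable (at y)"
    by (intro diff_of_real differentiable_real_comp[OF rad_diff[OF y(1)] P1])
  note dP1 = d_z_real_comp[OF rad_diff[OF y(1)] P1]
  note rd = diff_of_real[OF rad_diff[OF y(1)]]
  note kzd = kz_diff[OF b]
  have ckzd: "(\<lambda>x. cnj (kz k x)) differentiable (at (bp y))"
    using bounded_linear.has_derivative[OF bounded_linear_cnj] kzd unfolding differentiable_def by blast
  note dck = d_z_bp[OF ckzd]
  have dk1: "d_z 1 (\<lambda>x. cnj (kz k x)) (bp y) = ddbar 1 1 k (bp y)"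
    unfolding ddbar_def
    by (rule d_z_cong_open(1)[OF open_O1 b]) (simp add: kz_def d_zbar_of_real k_diff)
  have 1: "ddbar i 1 (\<lambda>y. P (rad k y)) y =
     d_z i (\<lambda>y. of_real (P1 (rad k y)) * (cnj (kz k (bp y)) * of_real (rad k y))) y"
    unfolding ddbar_def
    by (rule d_z_cong_open(1)[OF oU yU]) (simp add: d_zbar_real_comp[OF rad_diff P] U d_rad)
  have 2: "ddbar i 2 (\<lambda>y. P (rad k y)) y =
     d_z i (\<lambda>y. of_real (P1 (rad k y)) * (of_real (exp (k (bp y))) * y $ 2)) y"
    unfolding ddbar_def
    by (rule d_z_cong_open(1)[OF oU yU]) (simp add: d_zbar_real_comp[OF rad_diff P] U d_rad)
  note rules = d_z_mult differentiable_mult P1d dP1 rd differentiable_bp[OF ckzd]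
        dck dk1 d_rad[OF y(1)] d_expk[OF y(1)] d_z_component expk_diff[OF y(1)] w_diff
  have "ddbar 1 1 (\<lambda>y. P (rad k y)) y = of_real (rad k y * P1 (rad k y)) * ddbar 1 1 k (bp y) +
     of_real ((P1 (rad k y) + rad k y * P2) * exp (k (bp y))) * vcov k y (axis 1 1) * cnj (vcov k y (axis 1 1))"
    if "i = 1" unfolding 1[unfolded that]
    by (simp only: rules) (simp add: of_real_rad algebra_simps)
  moreover have "ddbar 2 1 (\<lambda>y. P (rad k y)) y =
     of_real ((P1 (rad k y) + rad k y * P2) * exp (k (bp y))) * vcov k y (axis 2 1) * cnj (vcov k y (axis 1 1))"
    if "i = 2" unfolding 1[unfolded that]
    by (simp only: rules) (simp add: of_real_rad algebra_simps)
  moreover have "ddbar 1 2 (\<lambda>y. P (rad k y)) y = 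
     of_real ((P1 (rad k y) + rad k y * P2) * exp (k (bp y))) * vcov k y (axis 1 1) * cnj (vcov k y (axis 2 1))"
    if "i = 1" unfolding 2[unfolded that]
    by (simp only: rules) (simp add: of_real_rad algebra_simps)
  moreover have "ddbar 2 2 (\<lambda>y. P (rad k y)) y =
     of_real ((P1 (rad k y) + rad k y * P2) * exp (k (bp y))) * vcov k y (axis 2 1) * cnj (vcov k y (axis 2 1))"
    if "i = 2" unfolding 2[unfolded that]
    by (simp only: rules) (simp add: of_real_rad algebra_simps)
  ultimately show ?thesis using exhaust_2[of i] exhaust_2[of j] by (elim disjE) (simp_all only: simp_thms if_True if_False zero_neq_one, simp_all)
qed

end

section \<open>The trace of the Ricci form as a two by two computation\<close>

lemma matrix_inv_eqI:
  fixes P :: "'a::semiring_1^'n^'n"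
  assumes "P ** B = mat 1" "B ** P = mat 1"
  shows "matrix_inv P = B"
proof -
  have "P ** matrix_inv P = mat 1 \<and> matrix_inv P ** P = mat 1"
    unfolding matrix_inv_def by (rule someI[of _ B]) (use assms in simp)
  then have "matrix_inv P = (B ** P) ** matrix_inv P" using assms by simp
  also have "\<dots> = B"
    using \<open>P ** matrix_inv P = mat 1 \<and> _\<close> by (simp flip: matrix_mul_assoc)
  finally show ?thesis .
qed

text \<open>Both matrices are diagonal in the same coframe \<open>dz\<close>,
  \<open>dw + t dz\<close>, so the trace is the sum of the ratios of the diagonal entries. In the
  application \<open>s\<close> is the conjugate of \<open>t\<close>.\<close>

lemma trace_inv_2x2:
  fixes t A m \<alpha> \<beta> :: complex and N P :: "complex^2^2"
  assumes "A \<noteq> 0" "m \<noteq> 0"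
    and P: "P = (\<chi> i j. (if i = 1 \<and> j = 1 then A else 0) + m * (if i = 1 then t else 1) * (if j = 1 then s else 1))"
    and N: "\<And>i j. N $ i $ j = (if i = 1 \<and> j = 1 then \<alpha> else 0) + \<beta> * (if i = 1 then t else 1) * (if j = 1 then s else 1)"
  shows "(\<Sum>j\<in>UNIV. \<Sum>k\<in>UNIV. matrix_inv P $ k $ j * N $ j $ k) = \<alpha> / A + \<beta> / m"
proof -
  define B :: "complex^2^2" where
    "B = (\<chi> i j. if i = 1 then (if j = 1 then 1 / A else - t / A)
                 else if j = 1 then - s / A else 1 / m + t * s / A)"
  have "matrix_inv P = B"
    by (rule matrix_inv_eqI)
      (use assms(1,2) in \<open>simp_all add: vec_eq_iff matrix_matrix_mult_def mat_def forall_2 sum_2 P B_def field_simps\<close>)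
  then show ?thesis
    using assms(1,2) by (simp add: sum_2 N B_def field_simps)
qed

lemma ddbar_add:
  assumes "open U" "smooth_on U f" "smooth_on U g" "y \<in> U"
  shows "ddbar i j (\<lambda>y. f y + g y) y = ddbar i j f y + ddbar i j g y"
proof -
  note fd = smooth_on_imp_differentiable[OF smooth_on_of_real[OF assms(2)]]
  note gd = smooth_on_imp_differentiable[OF smooth_on_of_real[OF assms(3)]]
  note fd' = smooth_on_imp_differentiable[OF smooth_on_d_zbar[OF assms(1) smooth_on_of_real[OF assms(2)]]]
  note gd' = smooth_on_imp_differentiable[OF smooth_on_d_zbar[OF assms(1) smooth_on_of_real[OF assms(3)]]]
  have "ddbar i j (\<lambda>y. f y + g y) y =
    d_z i (\<lambda>y. d_zbar j (\<lambda>y. complex_of_real (f y)) y + d_zbar j (\<lambda>y. complex_of_real (g y)) y) y"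
    unfolding ddbar_def
    by (rule d_z_cong_open(1)[OF assms(1,4)]) (simp add: d_zbar_add fd gd)
  also have "\<dots> = ddbar i j f y + ddbar i j g y"
    unfolding ddbar_def by (rule d_z_add[OF fd'[OF assms(4)] gd'[OF assms(4)]])
  finally show ?thesis .
qed

context weight
begin

lemma ddbar_bp:
  assumes "smooth_on O1 b" "y \<in> Ov"
  shows "ddbar i j (\<lambda>y. b (bp y)) y = (if i = 1 \<and> j = 1 then ddbar 1 1 b (bp y) else 0)"
proof -
  note bd = smooth_on_imp_differentiable[OF smooth_on_of_real[OF assms(1)]]
  note bd' = smooth_on_imp_differentiable[OF smooth_on_d_zbar[OF open_O1 smooth_on_of_real[OF assms(1)]]]
  have b: "bp y \<in> O1" using assms by (simp add: Ov_def)
  have 1: "ddbar i 1 (\<lambda>y. b (bp y)) y = d_z i (\<lambda>y. d_zbar 1 (\<lambda>x. complex_of_real (b x)) (bp y)) y" for i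
    unfolding ddbar_def
    by (rule d_z_cong_open(1)[OF open_Ov assms(2)], rule d_zbar_bp(1)[OF bd]) (simp add: Ov_def)
  have 2: "ddbar i 2 (\<lambda>y. b (bp y)) y = d_z i (\<lambda>y. 0) y" for i
    unfolding ddbar_def
    by (rule d_z_cong_open(1)[OF open_Ov assms(2)], rule d_zbar_bp(2)[OF bd]) (simp add: Ov_def)
  have "ddbar 1 1 (\<lambda>y. b (bp y)) y = ddbar 1 1 b (bp y)" "ddbar 2 1 (\<lambda>y. b (bp y)) y = 0"
    unfolding 1 d_z_bp[OF bd'[OF b]] by (simp_all add: ddbar_def)
  moreover have "ddbar i 2 (\<lambda>y. b (bp y)) y = 0" unfolding 2 by simp
  ultimately show ?thesis using exhaust_2[of i] exhaust_2[of j] by auto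
qed

end

text \<open>The sign \<open>e\<close> is 1 where \<open>w\<close> is a fibre coordinate of
  \<open>L\<close> and -1 where it is the inverse of one. \<open>ddbar_k\<close> is the curvature
  condition on \<open>h\<close>, \<open>ddbar_ln_a\<close> says that the base has scalar curvature
  -2, and \<open>lam_deriv\<close> is closedness of the form. The set \<open>J\<close> of values of
  \<open>rad\<close> contains 0 or not according to whether the section \<open>w = 0\<close> belongs
  to the domain.\<close>

locale radial = weight +
  fixes a :: "complex^1 \<Rightarrow> real" and J :: "real set" and lam mu :: "real \<Rightarrow> real" and e :: real
  assumes smooth_a: "smooth_on O1 a" and a_pos: "\<And>x. x \<in> O1 \<Longrightarrow> 0 < a x"
    and ddbar_k: "\<And>x. x \<in> O1 \<Longrightarrow> ddbar 1 1 k x = of_real (e * a x)"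
    and ddbar_ln_a: "\<And>x. x \<in> O1 \<Longrightarrow> Re (ddbar 1 1 (\<lambda>x. ln (a x)) x) = 2 * a x"
    and open_J: "open J" and smooth_lam: "smooth_on J lam" and smooth_mu: "smooth_on J mu"
    and lam_pos: "\<And>r. r \<in> J \<Longrightarrow> 0 < lam r" and mu_pos: "\<And>r. r \<in> J \<Longrightarrow> 0 < mu r"
    and lam_deriv: "\<And>r. r \<in> J \<Longrightarrow> (lam has_real_derivative e * mu r) (at r)"
begin

definition Om where "Om = Ov \<inter> rad k -` J"

abbreviation H where "H \<equiv> lform lam mu a k"

lemma open_Om: "open Om"
  unfolding Om_def
  by (rule continuous_open_preimage[OF smooth_on_imp_continuous_on[OF smooth_rad] open_Ov open_J])

lemma Om_D: "y \<in> Om \<Longrightarrow> y \<in> Ov" "y \<in> Om \<Longrightarrow> bp y \<in> O1" "y \<in> Om \<Longrightarrow> rad k y \<in> J"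
  by (auto simp: Om_def Ov_def)

lemma smooth_Om: "smooth_on Ov f \<Longrightarrow> smooth_on Om f"
  by (rule smooth_on_subset) (auto simp: Om_def)

lemma smooth_comp_rad: "smooth_on J F \<Longrightarrow> smooth_on Om (\<lambda>y. F (rad k y))"
  by (rule smooth_on_comp_real[OF _ _ smooth_Om[OF smooth_rad]]) (auto simp: Om_def)

lemma smooth_vcov: "smooth_on Om (\<lambda>y. vcov k y u)"
  unfolding vcov_def
  by (intro smooth_on_add smooth_on_mult smooth_on_const smooth_on_component smooth_Om smooth_bp smooth_kz)

lemma smooth_H: "smooth_on Om (\<lambda>y. H y $ i $ j)"
proof -
  have "smooth_on Om (\<lambda>y. (if i = 1 \<and> j = 1 then complex_of_real (lam (rad k y) * a (bp y)) else 0))"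
    by (cases "i = 1 \<and> j = 1") (auto simp del: of_real_mult intro!: smooth_on_of_real smooth_on_mult smooth_comp_rad smooth_lam
        smooth_Om[OF smooth_bp[OF smooth_a]])
  then show ?thesis unfolding lform_def vec_lambda_beta
    by (intro smooth_on_add smooth_on_mult smooth_on_cnj smooth_vcov smooth_on_of_real smooth_comp_rad smooth_mu
        smooth_Om[OF smooth_exp_k])
qed

lemma hermitian_H: "H y $ i $ j = cnj (H y $ j $ i)"
  by (simp add: lform_def ac_simps)

lemma riem_H: "riem H y u v = 2 * (lam (rad k y) * a (bp y) * Re (u $ 1 * cnj (v $ 1)) +
   mu (rad k y) * exp (k (bp y)) * Re (vcov k y u * cnj (vcov k y v)))"
  unfolding riem_def herm_lform by (simp add: algebra_simps)

lemma riem_self: "riem H y u u = 2 * (lam (rad k y) * a (bp y) * (cmod (u $ 1))\<^sup>2 +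
   mu (rad k y) * exp (k (bp y)) * (cmod (vcov k y u))\<^sup>2)"
  unfolding riem_H by (simp add: complex_mult_cnj cmod_power2)

lemma positive_H:
  assumes "y \<in> Om" "u \<noteq> 0"
  shows "0 < riem H y u u"
proof -
  have p: "0 < lam (rad k y) * a (bp y)" "0 < mu (rad k y) * exp (k (bp y))"
    using Om_D[OF assms(1)] lam_pos a_pos mu_pos by simp_all
  have "u $ 1 \<noteq> 0 \<or> vcov k y u \<noteq> 0"
    using assms(2) by (auto simp: vcov_def vec_eq_iff forall_2)
  moreover have "0 \<le> lam (rad k y) * a (bp y) * (cmod (u $ 1))\<^sup>2"
    "0 \<le> mu (rad k y) * exp (k (bp y)) * (cmod (vcov k y u))\<^sup>2"
    by (rule mult_nonneg_nonneg[OF less_imp_le[OF p(1)]], simp)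
      (rule mult_nonneg_nonneg[OF less_imp_le[OF p(2)]], simp)
  moreover have "0 < lam (rad k y) * a (bp y) * (cmod (u $ 1))\<^sup>2" if "u $ 1 \<noteq> 0"
    by (rule mult_pos_pos[OF p(1)]) (use that in simp)
  moreover have "0 < mu (rad k y) * exp (k (bp y)) * (cmod (vcov k y u))\<^sup>2" if "vcov k y u \<noteq> 0"
    by (rule mult_pos_pos[OF p(2)]) (use that in simp)
  ultimately show ?thesis unfolding riem_self by (elim disjE) (simp_all add: add_pos_nonneg add_nonneg_pos)
qed

lemma mu_deriv: "r \<in> J \<Longrightarrow> (mu has_real_derivative deriv mu r) (at r)"
  by (rule smooth_on_real_derivative[OF smooth_mu])

text \<open>The vertical part fails to be closed only through the differential of
  \<open>dw + w \<partial>k\<close>, which is \<open>w\<close> times the curvature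
  \<open>e * a\<close>. The derivative of \<open>lam\<close> compensates for it, which is the
  content of \<open>lam_deriv\<close>.\<close>

lemma closed_H:
  assumes y: "y \<in> Om"
  shows "d_z l (\<lambda>y. H y $ i $ j) y = d_z i (\<lambda>y. H y $ l $ j) y"
proof -
  note D = Om_D[OF y]
  note rd = diff_of_real[OF rad_diff[OF D(1)]]
  note dlam = d_z_real_comp[OF rad_diff[OF D(1)] lam_deriv[OF D(3)]]
  note dmu = d_z_real_comp[OF rad_diff[OF D(1)] mu_deriv[OF D(3)]]
  note lamd = diff_of_real[OF differentiable_real_comp[OF rad_diff[OF D(1)] lam_deriv[OF D(3)]]]
  note mud = diff_of_real[OF differentiable_real_comp[OF rad_diff[OF D(1)] mu_deriv[OF D(3)]]]
  note ad = smooth_on_imp_differentiable[OF smooth_on_of_real[OF smooth_a] D(2)]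
  note kzd = kz_diff[OF D(2)]
  have ckzd: "(\<lambda>x. cnj (kz k x)) differentiable (at (bp y))"
    by (rule smooth_on_imp_differentiable[OF smooth_on_cnj[OF smooth_kz] D(2)])
  have dk1: "d_z 1 (\<lambda>x. cnj (kz k x)) (bp y) = of_real (e * a (bp y))"
    unfolding ddbar_k[OF D(2), symmetric] ddbar_def
    by (rule d_z_cong_open(1)[OF open_O1 D(2)]) (simp add: kz_def d_zbar_of_real k_diff)
  note rules = d_z_add differentiable_add d_z_mult differentiable_mult lamd dlam mud dmu rd
    differentiable_bp[OF ad] differentiable_bp[OF kzd] differentiable_bp[OF ckzd]
    d_z_bp[OF ad] d_z_bp[OF ckzd] d_z_bp[OF kzd] dk1 d_rad[OF D(1)] d_expk[OF D(1)] d_z_component expk_diff[OF D(1)] w_diff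
    d_z_cnj(1)[OF w_diff(1)] d_z_component(2)
  have H11: "(\<lambda>y. H y $ 1 $ 1) = (\<lambda>y. of_real (lam (rad k y)) * of_real (a (bp y)) +
      of_real (mu (rad k y)) * of_real (exp (k (bp y))) * (y $ 2) * kz k (bp y) * cnj (y $ 2) * cnj (kz k (bp y)))"
    by (rule ext) (simp add: lform_def)
  have H12: "(\<lambda>y. H y $ 1 $ 2) = (\<lambda>y. of_real (mu (rad k y)) * of_real (exp (k (bp y))) * (y $ 2) * kz k (bp y))"
    by (rule ext) (simp add: lform_def)
  have H21: "(\<lambda>y. H y $ 2 $ 1) = (\<lambda>y. of_real (mu (rad k y)) * of_real (exp (k (bp y))) * cnj (y $ 2) * cnj (kz k (bp y)))"
    by (rule ext) (simp add: lform_def)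
  have H22: "(\<lambda>y. H y $ 2 $ 2) = (\<lambda>y. of_real (mu (rad k y)) * of_real (exp (k (bp y))))"
    by (rule ext) (simp add: lform_def)
  have 1: "d_z 1 (\<lambda>y. H y $ 2 $ 1) y = d_z 2 (\<lambda>y. H y $ 1 $ 1) y"
    unfolding H21 H11 by (simp only: rules) (simp add: of_real_rad algebra_simps)
  have 2: "d_z 1 (\<lambda>y. H y $ 2 $ 2) y = d_z 2 (\<lambda>y. H y $ 1 $ 2) y"
    unfolding H12 H22 by (simp only: rules) (simp add: of_real_rad algebra_simps)
  \<comment> \<open>For \<open>l = i\<close> both sides coincide, so the two identities for
    \<open>l \<noteq> i\<close>, one for each \<open>j\<close>, are all that is needed.\<close>
  show ?thesis
    using exhaust_2[of i] exhaust_2[of j] exhaust_2[of l] by (elim disjE) (simp_all only: 1 2)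
qed

text \<open>By \<open>derivative_rad\<close> the differential is a multiple of the real part of
  \<open>cnj w * vcov\<close>, which is dual to a vertical vector; the factor \<open>exp k\<close>
  of the metric cancels. If the derivative of \<open>S\<close> is a constant multiple of
  \<open>mu\<close>, the gradient is that multiple of the holomorphic field
  \<open>w \<partial>/\<partial>w\<close>.\<close>

lemma gradient_H:
  assumes y: "y \<in> Om" and S: "(S has_real_derivative D) (at (rad k y))"
    and f: "open U" "y \<in> U" "\<And>x. x \<in> U \<Longrightarrow> f x = S (rad k x)"
  shows "gradient H f y = vector [0, of_real (D / mu (rad k y)) * y $ 2]"
proof -
  note O = Om_D[OF y]
  from S have "(S has_derivative (*) D) (at (rad k y))" by (simp add: has_field_derivative_def)
  from has_derivative_compose[where g = S, OF derivative_rad[OF O(1)] this]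
  have "((\<lambda>y. S (rad k y)) has_derivative (\<lambda>u. D * (2 * exp (k (bp y)) * Re (cnj (y $ 2) * vcov k y u)))) (at y)" .
  from frechet_derivative_at[OF this, symmetric]
  have fd: "frechet_derivative f (at y) = (\<lambda>u. D * (2 * exp (k (bp y)) * Re (cnj (y $ 2) * vcov k y u)))"
    by (rule trans[OF frechet_derivative_cong_open[OF f(1,2)], rotated]) (rule f(3))
  let ?w = "vector [0, of_real (D / mu (rad k y)) * y $ 2] :: complex^2"
  have w: "riem H y ?w v = frechet_derivative f (at y) v" for v
    unfolding riem_H fd using mu_pos[OF O(3)] by (simp add: vcov_def algebra_simps field_simps)
  show ?thesis
    unfolding gradient_def
  proof (rule the_equality)
    show "\<forall>v. riem H y ?w v = frechet_derivative f (at y) v" using w by blast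
  next
    fix w' assume "\<forall>v. riem H y w' v = frechet_derivative f (at y) v"
    then have *: "riem H y w' v = riem H y ?w v" for v using w by simp
    have "riem H y (w' - ?w) (w' - ?w) = riem H y w' (w' - ?w) - riem H y ?w (w' - ?w)"
      unfolding riem_H by (simp add: vcov_def algebra_simps)
    with * have "riem H y (w' - ?w) (w' - ?w) = 0" by simp
    with positive_H[OF y, of "w' - ?w"] show "w' = ?w" by auto
  qed
qed

text \<open>The logarithm of the determinant splits into \<open>ln (lam * mu)\<close>, a function of
  \<open>rad\<close>, and \<open>ln a + k\<close>, a function on the base; \<open>V\<close> is the
  derivative of the former with respect to \<open>ln r\<close>. The horizontal trace collects 2 from
  the base curvature, \<open>e\<close> from \<open>k\<close> and \<open>e * V\<close> from the
  radial part; the vertical trace is \<open>V' / mu\<close>.\<close>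

lemma scalar_curvature_H:
  assumes y: "y \<in> Om"
    and V: "\<And>r. r \<in> J \<Longrightarrow> r * (e * mu r / lam r + deriv mu r / mu r) = V r"
    and V': "(V has_real_derivative V') (at (rad k y))"
  shows "scalar_curvature H y =
    - (2 + e + e * V (rad k y)) / lam (rad k y) - V' / mu (rad k y)"
proof -
  note O = Om_D[OF y]
  define P where "P r = ln (lam r * mu r)" for r
  define P1 where "P1 r = e * mu r / lam r + deriv mu r / mu r" for r
  have P: "(P has_real_derivative P1 r) (at r)" if "r \<in> J" for r
    unfolding P_def P1_def using lam_pos[OF that] mu_pos[OF that]
    by (intro DERIV_cong[OF DERIV_chain2[OF DERIV_ln_divide DERIV_mult[OF lam_deriv[OF that] mu_deriv[OF that]]]])
      (simp_all add: field_simps)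
  have sm: "smooth_on J P1"
    unfolding P1_def
    by (intro smooth_on_add smooth_on_divide smooth_on_mult smooth_on_const smooth_mu smooth_lam
        smooth_on_deriv open_J) (simp_all add: lam_pos mu_pos less_imp_neq[symmetric])
  have smP: "smooth_on J P"
    by (rule smooth_on_antiderivative[OF P sm])
  note P1 = smooth_on_real_derivative[OF sm O(3)]
  let ?r = "rad k y"
  have "((\<lambda>r. r * P1 r) has_real_derivative P1 ?r + ?r * deriv P1 ?r) (at ?r)"
    by (rule DERIV_cong[OF DERIV_mult[OF DERIV_ident P1]]) simp
  moreover have "((\<lambda>r. r * P1 r) has_real_derivative V') (at ?r)"
    by (rule has_field_derivative_transform_within_open[OF V' open_J O(3)]) (use V in \<open>simp add: P1_def\<close>)
  ultimately have V'_eq: "P1 ?r + ?r * deriv P1 ?r = V'"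
    by (rule DERIV_unique)
  have VP: "?r * P1 ?r = V ?r" using V[OF O(3)] by (simp add: P1_def)
  define b where "b x = ln (a x) + k x" for x
  have sln: "smooth_on O1 (\<lambda>x. ln (a x))"
    by (rule smooth_on_comp_real[OF _ smooth_on_ln[OF order.refl] smooth_a]) (use a_pos in auto)
  have smb: "smooth_on O1 b"
    unfolding b_def by (intro smooth_on_add sln smooth_k)
  have ddb: "ddbar 1 1 b (bp y) = ddbar 1 1 (\<lambda>x. ln (a x)) (bp y) + of_real (e * a (bp y))"
    unfolding b_def ddbar_add[OF open_O1 sln smooth_k O(2)] ddbar_k[OF O(2)] ..
  have split: "ln (Re (det (H x))) = P (rad k x) + b (bp x)" if "x \<in> Om" for x
    unfolding det_lform P_def b_def
    using lam_pos[OF Om_D(3)[OF that]] mu_pos[OF Om_D(3)[OF that]] a_pos[OF Om_D(2)[OF that]]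
    by (simp add: ln_mult)
  let ?b = "ddbar 1 1 b (bp y)"
  have dd: "ddbar i j (\<lambda>y. ln (Re (det (H y)))) y =
      (if i = 1 \<and> j = 1 then of_real (e * a (bp y) * V ?r) + ?b else 0) +
      of_real (V' * exp (k (bp y))) * vcov k y (axis i 1) * cnj (vcov k y (axis j 1))" for i j
  proof -
    have "ddbar i j (\<lambda>y. ln (Re (det (H y)))) y = ddbar i j (\<lambda>x. P (rad k x) + b (bp x)) y"
      by (rule ddbar_cong_open[OF open_Om y split])
    also have "\<dots> = ddbar i j (\<lambda>x. P (rad k x)) y + ddbar i j (\<lambda>x. b (bp x)) y"
      by (rule ddbar_add[OF open_Om smooth_comp_rad[OF smP] smooth_Om[OF smooth_bp[OF smb]] y])
    also have "\<dots> = (if i = 1 \<and> j = 1 then of_real (e * a (bp y) * V ?r) + ?b else 0) +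
      of_real (V' * exp (k (bp y))) * vcov k y (axis i 1) * cnj (vcov k y (axis j 1))"
      by (subst ddbar_rad[OF O(1) open_J O(3) P P1], assumption)
        (simp only: ddbar_bp[OF smb O(1)] V'_eq VP ddbar_k[OF O(2)], simp add: algebra_simps)
    finally show ?thesis .
  qed
  define N :: "complex^2^2" where "N = (\<chi> i j. ddbar i j (\<lambda>y. ln (Re (det (H y)))) y)"
  let ?A = "complex_of_real (lam ?r * a (bp y))" and ?m = "complex_of_real (mu ?r * exp (k (bp y)))"
  let ?al = "of_real (e * a (bp y) * V ?r) + ?b" and ?be = "complex_of_real (V' * exp (k (bp y)))"
  let ?t = "y $ 2 * kz k (bp y)"
  have ax: "vcov k y (axis i 1) = (if i = 1 then ?t else 1)" for i
    using exhaust_2[of i] by auto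
  have "(\<Sum>i\<in>UNIV. \<Sum>j\<in>UNIV. matrix_inv (H y) $ j $ i * N $ i $ j) = ?al / ?A + ?be / ?m"
  proof (rule trace_inv_2x2)
    show "?A \<noteq> 0" "?m \<noteq> 0" using lam_pos a_pos mu_pos O by (simp_all add: less_imp_neq[symmetric])
    show "H y = (\<chi> i j. (if i = 1 \<and> j = 1 then ?A else 0) + ?m * (if i = 1 then ?t else 1) * (if j = 1 then cnj ?t else 1))"
      unfolding lform_def ax by (simp add: vec_eq_iff)
    show "N $ i $ j = (if i = 1 \<and> j = 1 then ?al else 0) + ?be * (if i = 1 then ?t else 1) * (if j = 1 then cnj ?t else 1)" for i j
      unfolding N_def dd ax by simp
  qed
  then have "scalar_curvature H y = - Re (?al / ?A + ?be / ?m)"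
    unfolding scalar_curvature_def N_def by simp
  also have "Re (?al / ?A + ?be / ?m) = Re ?al / (lam ?r * a (bp y)) + V' * exp (k (bp y)) / (mu ?r * exp (k (bp y)))"
    by (simp only: plus_complex.simps Re_divide_of_real Re_complex_of_real)
  also have "Re ?al = a (bp y) * (e * V ?r + 2 + e)"
    unfolding ddb by (simp add: ddbar_ln_a[OF O(2)] algebra_simps)
  also have "a (bp y) * (e * V ?r + 2 + e) / (lam ?r * a (bp y)) = (e * V ?r + 2 + e) / lam ?r"
    using a_pos[OF O(2)] by simp
  also have "V' * exp (k (bp y)) / (mu ?r * exp (k (bp y))) = V' / mu ?r" by simp
  finally have "scalar_curvature H y = - ((e * V ?r + 2 + e) / lam ?r + V' / mu ?r)" .
  also have "\<dots> = - (2 + e + e * V (rad k y)) / lam (rad k y) - V' / mu (rad k y)"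
    unfolding minus_divide_left[symmetric] by (simp only: minus_add_distrib add.commute) simp
  finally show ?thesis .
qed

text \<open>The form \<open>\<omega>\<^sub>M\<close> already contributes 1 to the horizontal
  coefficient, so the potential has to supply \<open>lam - 1\<close>, which by
  \<open>ddbar_rad\<close> prescribes its first derivative. The vertical coefficient then follows
  from \<open>lam_deriv\<close>.\<close>

lemma potential_H:
  assumes y: "y \<in> Om" "y $ 2 \<noteq> 0" and e: "e * e = 1"
    and P: "\<And>r. r \<in> J \<Longrightarrow> 0 < r \<Longrightarrow> (P has_real_derivative e * (lam r - 1) / (2 * r)) (at r)"
  shows "H y $ i $ j = (if i = 1 \<and> j = 1 then of_real (a (bp y)) else 0) + 2 * ddbar i j (\<lambda>x. P (rad k x)) y"
proof -
  note O = Om_D[OF y(1)]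
  let ?r = "rad k y" and ?P1 = "\<lambda>r. e * (lam r - 1) / (2 * r)"
  have r: "0 < ?r" using rad_pos y by blast
  have J': "open (J \<inter> {0<..})" "?r \<in> J \<inter> {0<..}" using open_J O(3) r by auto
  have P': "(P has_real_derivative ?P1 r) (at r)" if "r \<in> J \<inter> {0<..}" for r using P that by auto
  have e1: "e * (e * x) = x" for x using e by (simp flip: mult.assoc)
  have P1: "(?P1 has_real_derivative (mu ?r / 2 - ?P1 ?r) / ?r) (at ?r)"
    by (rule DERIV_cong[OF DERIV_divide[OF DERIV_cmult[OF DERIV_diff[OF lam_deriv[OF O(3)] DERIV_const]] DERIV_cmult[OF DERIV_ident]]])
      (use r e1 in \<open>simp_all add: field_simps\<close>)
  have q1: "?P1 ?r + ?r * ((mu ?r / 2 - ?P1 ?r) / ?r) = mu ?r / 2" using r by simp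
  have q2: "?r * ?P1 ?r = e * (lam ?r - 1) / 2" using r by simp
  have dd: "ddbar i j (\<lambda>x. P (rad k x)) y =
     (if i = 1 \<and> j = 1 then of_real (e * (lam ?r - 1) / 2) * of_real (e * a (bp y)) else 0) +
     of_real (mu ?r / 2 * exp (k (bp y))) * vcov k y (axis i 1) * cnj (vcov k y (axis j 1))"
    by (subst ddbar_rad[OF O(1) J' P' P1], assumption) (simp only: q1 q2 ddbar_k[OF O(2)])
  have "e * (lam ?r - 1) * (e * a (bp y)) = (lam ?r - 1) * a (bp y)"
    using e1[of "(lam ?r - 1) * a (bp y)"] by (simp add: ac_simps)
  then have "complex_of_real (e * (lam ?r - 1) * (e * a (bp y))) = of_real ((lam ?r - 1) * a (bp y))"
    by (rule arg_cong)
  then have "2 * (complex_of_real (e * (lam ?r - 1) / 2) * of_real (e * a (bp y))) = of_real ((lam ?r - 1) * a (bp y))"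
    by simp
  then show ?thesis unfolding dd lform_def vec_lambda_beta distrib_left
    by (simp add: algebra_simps)
qed

end

section \<open>The Legendre transform and momentum profiles\<close>

lemma DERIV_antiderivative_open:
  fixes f :: "real \<Rightarrow> real"
  assumes "a < b" "\<And>x. a < x \<Longrightarrow> x < b \<Longrightarrow> isCont f x"
  obtains F where "\<And>x. a < x \<Longrightarrow> x < b \<Longrightarrow> (F has_real_derivative f x) (at x)"
  using einterval_antiderivative[of "ereal a" "ereal b" f] assms
  by (auto simp: has_real_derivative_iff_has_vector_derivative)

text \<open>Since \<open>F'\<close> increases, the supremum is attained exactly where
  \<open>F' = t\<close>, at \<open>tau t\<close>. The difference quotient is then squeezed between
  \<open>tau t\<close> and \<open>tau (t + h)\<close>, and continuity of \<open>tau\<close> finishes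
  the argument.\<close>

lemma legendre_derivative:
  fixes F F' G tau :: "real \<Rightarrow> real"
  assumes F: "\<And>x. a < x \<Longrightarrow> x < b \<Longrightarrow> (F has_real_derivative F' x) (at x)"
    and F': "\<And>x. a < x \<Longrightarrow> x < b \<Longrightarrow> (F' has_real_derivative G x) (at x)"
    and G: "\<And>x. a < x \<Longrightarrow> x < b \<Longrightarrow> 0 < G x"
    and tau: "\<And>t. a < tau t" "\<And>t. tau t < b" "\<And>t. F' (tau t) = t" "isCont tau t"
  shows "((\<lambda>t. SUP x\<in>{a<..<b}. x * t - F x) has_real_derivative tau t) (at t)"
proof -
  have mono: "F' x < F' y" if "a < x" "x < y" "y < b" for x y
  proof (rule DERIV_pos_imp_increasing[OF that(2)])
    fix z assume "x \<le> z" "z \<le> y"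
    then have "a < z" "z < b" using that by auto
    with F' G show "\<exists>y. (F' has_real_derivative y) (at z) \<and> 0 < y" by blast
  qed
  have max: "x * t - F x \<le> tau t * t - F (tau t)" if x: "a < x" "x < b" for x t
  proof (cases x "tau t" rule: linorder_cases)
    case less
    then obtain z where z: "x < z" "z < tau t" "F (tau t) - F x = (tau t - x) * F' z"
      using MVT2[OF less, of F F'] F x tau(2)[of t] by force
    then have "F' z \<le> t" using mono[of z "tau t"] x tau by (metis less_le less_trans)
    then have "(tau t - x) * F' z \<le> (tau t - x) * t" using less by (intro mult_left_mono) auto
    with z(3) show ?thesis by (simp add: algebra_simps)
  next
    case greater
    then obtain z where z: "tau t < z" "z < x" "F x - F (tau t) = (x - tau t) * F' z"
      using MVT2[OF greater, of F F'] F x tau(1)[of t] by force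
    then have "t \<le> F' z" using mono[of "tau t" z] x tau by (metis less_le less_trans)
    then have "(x - tau t) * t \<le> (x - tau t) * F' z" using greater by (intro mult_left_mono) auto
    with z(3) show ?thesis by (simp add: algebra_simps)
  qed simp
  define f where "f = (\<lambda>t. SUP x\<in>{a<..<b}. x * t - F x)"
  have f: "f t = tau t * t - F (tau t)" for t
    unfolding f_def
    by (rule cSup_eq_maximum) (use tau max in auto)
  \<comment> \<open>Each of the two suprema is estimated from below by the maximiser of the
    other.\<close>
  have bounds: "tau t * h \<le> f (t + h) - f t" "f (t + h) - f t \<le> tau (t + h) * h" for h
    using max[OF tau(1,2), of t "t + h"] max[OF tau(1,2), of "t + h" t] unfolding f
    by (simp_all add: algebra_simps)
  have "(\<lambda>h. (f (t + h) - f t) / h) \<midarrow>0\<rightarrow> tau t"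
  proof (rule LIM_equal2[where R = 1 and g = "\<lambda>h. tau t + ((f (t + h) - f t) / h - tau t)"])
    have "(\<lambda>h. (f (t + h) - f t) / h - tau t) \<midarrow>0\<rightarrow> 0"
    proof (rule Lim_null_comparison)
      have "norm ((f (t + h) - f t) / h - tau t) \<le> \<bar>tau (t + h) - tau t\<bar>" if "h \<noteq> 0" for h
      proof (cases "h > 0")
        case True
        then have "tau t \<le> (f (t + h) - f t) / h" "(f (t + h) - f t) / h \<le> tau (t + h)"
          using bounds[of h] by (simp_all add: pos_le_divide_eq pos_divide_le_eq)
        then show ?thesis by simp
      next
        case False
        then have "(f (t + h) - f t) / h \<le> tau t" "tau (t + h) \<le> (f (t + h) - f t) / h"
          using bounds[of h] that by (simp_all add: neg_le_divide_eq neg_divide_le_eq)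
        then show ?thesis by simp
      qed
      then show "\<forall>\<^sub>F h in at 0. norm ((f (t + h) - f t) / h - tau t) \<le> \<bar>tau (t + h) - tau t\<bar>"
        by (simp add: eventually_at_filter)
      have "(\<lambda>h. tau (t + h)) \<midarrow>0\<rightarrow> tau t" using tau(4) by (simp add: isCont_iff)
      then have "(\<lambda>h. tau (t + h) - tau t) \<midarrow>0\<rightarrow> 0" by (simp add: LIM_zero_iff)
      then show "(\<lambda>h. \<bar>tau (t + h) - tau t\<bar>) \<midarrow>0\<rightarrow> 0" by (rule tendsto_rabs_zero)
    qed
    from tendsto_add[OF tendsto_const this, of "tau t"]
    show "(\<lambda>h. tau t + ((f (t + h) - f t) / h - tau t)) \<midarrow>0\<rightarrow> tau t" by simp
  qed simp_all
  then show ?thesis unfolding f_def[symmetric] DERIV_def .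
qed

text \<open>After the substitution \<open>1 + \<tau> = kap * (d0 + eps * x)\<close>, with \<open>x\<close> measured from the end of the moment
  interval where the metric closes up, the profile is \<open>kap * Q x / D x\<close>, with a double zero of \<open>Q\<close> at the
  complete end \<open>x = M\<close>.\<close>

locale profile =
  fixes eps kap M d0 p0 p1 A0 A1 :: real
  assumes eps: "eps = 1 \<or> eps = -1" and kap: "0 < kap" and M: "0 < M"
    and D0: "0 < d0" and DM: "0 < d0 + eps * M"
    and p0: "0 < p0" and pM: "0 \<le> p0 + p1 * M"
    and p0_d0: "M\<^sup>2 * p0 = 2 * d0"
    and Q2: "\<And>x. p0 * (6 * x - 4 * M) + p1 * (12 * x\<^sup>2 - 12 * M * x + 2 * M\<^sup>2)
       = - 4 - 2 * (d0 + eps * x) * (kap * (A0 + A1 * x))"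
begin

definition D where "D x = d0 + eps * x"
definition P where "P x = (M - x)\<^sup>2 * (p0 + p1 * x)"
definition Q where "Q x = x * P x"
definition Q1 where "Q1 x = p0 * ((M - x)\<^sup>2 - 2 * x * (M - x)) + p1 * (2 * x * (M - x)\<^sup>2 - 2 * x\<^sup>2 * (M - x))"

lemma eps_sq [simp]: "eps * eps = 1" "eps * (eps * y) = y"
  using eps by auto

lemma D_deriv: "(D has_real_derivative eps) (at x)"
  unfolding D_def[abs_def] by (rule derivative_eq_intros refl | simp)+

lemma Q_deriv: "(Q has_real_derivative Q1 x) (at x)"
  unfolding Q_def[abs_def] P_def Q1_def
  by (rule derivative_eq_intros refl)+ (simp add: algebra_simps power2_eq_square)

text \<open>Here the curvature enters: \<open>(1 + \<tau>) * \<phi>\<close> is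
  \<open>kap\<^sup>2 * Q\<close>, and \<open>d/d\<tau>\<close> is \<open>eps / kap\<close> times
  \<open>d/dx\<close>, so its second derivative in \<open>\<tau>\<close> is exactly the second
  derivative of \<open>Q\<close>.\<close>

lemma Q1_deriv: "(Q1 has_real_derivative - 4 - 2 * D x * (kap * (A0 + A1 * x))) (at x)"
  unfolding Q1_def[abs_def] D_def Q2[symmetric]
  by (rule derivative_eq_intros refl)+ (simp add: algebra_simps power2_eq_square)

lemma D_pos: "0 \<le> x \<Longrightarrow> x \<le> M \<Longrightarrow> 0 < D x"
  using eps D0 DM unfolding D_def by auto

lemma lin_pos: "0 \<le> x \<Longrightarrow> x < M \<Longrightarrow> 0 < p0 + p1 * x"
proof -
  assume x: "0 \<le> x" "x < M"
  show ?thesis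
  proof (cases "p1 \<ge> 0")
    case True with p0 x show ?thesis by (simp add: add_pos_nonneg)
  next
    case False
    then have "p1 * M < p1 * x" using x by simp
    with pM show ?thesis by simp
  qed
qed

lemma P_pos: "0 \<le> x \<Longrightarrow> x < M \<Longrightarrow> 0 < P x"
  unfolding P_def using lin_pos by simp

lemma Q_pos: "0 < x \<Longrightarrow> x < M \<Longrightarrow> 0 < Q x"
  unfolding Q_def using P_pos by simp

text \<open>The value at \<open>x = M\<close> of \<open>Q / (D * (M - x)\<^sup>2)\<close>. It
  governs the decay of \<open>M - X\<close> at the complete end, and \<open>kap / C\<close> becomes
  the coefficient of the hyperbolic model.\<close>

definition C where "C = M * (p0 + p1 * M) / D M"

text \<open>\<open>rho\<close> is the squared fibre norm, up to scale, as a function of the moment coordinate: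
  \<open>d(ln rho) = 2 dx * D / Q\<close>, and \<open>2 D / Q - 1 / x\<close> extends across \<open>x = 0\<close>.\<close>

lemma exists_solution:
  obtains T :: "real \<Rightarrow> real" and rh :: "real \<Rightarrow> real" and J :: "real set"
  where "open J" "{0..} \<subseteq> J" "smooth_on J T" "T 0 = 0"
    "\<And>r. r \<in> J \<Longrightarrow> T r < M" "\<And>r. r \<in> J \<Longrightarrow> 0 < D (T r)" "\<And>r. r \<in> J \<Longrightarrow> 0 < deriv T r"
    "\<And>r. r \<in> J \<Longrightarrow> 2 * r * deriv T r * D (T r) = Q (T r)"
    "\<And>r. 0 < r \<Longrightarrow> 0 < T r" "\<And>x. 0 < x \<Longrightarrow> x < M \<Longrightarrow> 0 < rh x"
    "\<And>x. 0 < x \<Longrightarrow> x < M \<Longrightarrow> T (rh x) = x" "\<And>r. 0 < r \<Longrightarrow> rh (T r) = r"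
    "\<And>x. 0 < x \<Longrightarrow> x < M \<Longrightarrow> (rh has_real_derivative rh x * (2 * D x / Q x)) (at x)"
    "strict_mono_on J T"
proof -
  \<comment> \<open>A margin below \<open>x = 0\<close> on which \<open>D\<close> and the linear
    factor stay positive, so that the domain \<open>J\<close> is an open neighbourhood of
    \<open>{0..}\<close> including \<open>r = 0\<close>.\<close>
  define del where "del = min (d0 / 2) (p0 / (2 * (\<bar>p1\<bar> + 1)))"
  have del: "0 < del" "del < d0" unfolding del_def using D0 p0 by auto
  have "\<bar>p1\<bar> * del \<le> \<bar>p1\<bar> * (p0 / (2 * (\<bar>p1\<bar> + 1)))"
    by (intro mult_left_mono) (auto simp: del_def)
  also have "\<dots> < p0" using p0 by (simp add: field_simps) (smt (verit) mult_nonneg_nonneg)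
  finally have p1del: "\<bar>p1\<bar> * del < p0" .
  define I where "I = {-del<..<M}"
  have DI: "0 < D x" if "x \<in> I" for x
  proof (cases "x \<ge> 0")
    case True then show ?thesis using D_pos that by (auto simp: I_def)
  next
    case False then show ?thesis using eps del that by (auto simp: I_def D_def)
  qed
  have PI: "0 < P x" if "x \<in> I" for x
  proof (cases "x \<ge> 0")
    case True then show ?thesis using P_pos that by (auto simp: I_def)
  next
    case False
    have "\<bar>p1 * x\<bar> \<le> \<bar>p1\<bar> * del" unfolding abs_mult
      by (intro mult_left_mono) (use False that in \<open>auto simp: I_def\<close>)
    with p1del have "0 < p0 + p1 * x" by linarith
    then show ?thesis using that by (auto simp: I_def P_def)
  qed
  \<comment> \<open>The polynomial \<open>(2 * D - P) / x\<close>. The division is exact because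
    \<open>p0_d0\<close> says \<open>P 0 = 2 * D 0\<close>; consequently
    \<open>2 * D / Q - 1 / x = N / P\<close> is regular at 0.\<close>
  define N where "N x = 2 * eps + 2 * M * p0 - M\<^sup>2 * p1 + x * (2 * M * p1 - p0) - x\<^sup>2 * p1" for x
  have NP: "x * N x = 2 * D x - P x" for x
    using p0_d0 unfolding N_def D_def P_def by (simp add: algebra_simps power2_eq_square)
  have cN: "isCont (\<lambda>x. N x / P x) x" if "x \<in> I" for x
    using PI[OF that] unfolding N_def P_def by (intro continuous_intros) auto
  obtain g where g: "\<And>x. -del < x \<Longrightarrow> x < M \<Longrightarrow> (g has_real_derivative N x / P x) (at x)"
    using DERIV_antiderivative_open[of "-del" M "\<lambda>x. N x / P x"] cN del M unfolding I_def by auto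
  define rho where "rho x = x * exp (g x)" for x
  have rho': "(rho has_real_derivative exp (g x) * (2 * D x / P x)) (at x)" if "x \<in> I" for x
  proof -
    have gx: "(g has_real_derivative N x / P x) (at x)" using g that by (auto simp: I_def)
    have "exp (g x) + x * (exp (g x) * (N x / P x)) = exp (g x) * ((P x + x * N x) / P x)"
      using PI[OF that] by (simp add: field_simps)
    also have "\<dots> = exp (g x) * (2 * D x / P x)" unfolding NP by simp
    finally show ?thesis
      unfolding rho_def[abs_def]
      by (intro DERIV_cong[OF DERIV_mult[OF DERIV_ident DERIV_fun_exp[OF gx]]]) (simp add: mult_ac)
  qed
  have rho'_pos: "0 < exp (g x) * (2 * D x / P x)" if "x \<in> I" for x
    using DI[OF that] PI[OF that] by simp
  have mono: "rho x < rho y" if "x \<in> I" "y \<in> I" "x < y" for x y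
  proof (rule DERIV_pos_imp_increasing[OF that(3)])
    fix z assume "x \<le> z" "z \<le> y"
    then have "z \<in> I" using that by (auto simp: I_def)
    with rho' rho'_pos show "\<exists>y. (rho has_real_derivative y) (at z) \<and> 0 < y" by blast
  qed
  have inj: "inj_on rho I"
    by (rule inj_onI) (metis mono less_irrefl linorder_neqE)
  have oI: "open I" unfolding I_def by simp
  have crho: "continuous_on I rho"
    by (intro continuous_at_imp_continuous_on ballI DERIV_isCont[OF rho'])
  define J where "J = rho ` I"
  have oJ: "open J" unfolding J_def by (rule invariance_of_domain[OF crho oI inj])
  have z: "0 \<in> I" using del M by (auto simp: I_def)
  have rho0: "rho 0 = 0" by (simp add: rho_def)
  \<comment> \<open>Ensures that all of \<open>{0..}\<close> is reached. Because of the double zero,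
    \<open>2 * D / Q\<close> is at least \<open>c / (M - x)\<^sup>2\<close>, so
    \<open>ln rho\<close> exceeds \<open>c / (M - x)\<close> up to a constant.\<close>
  have unbounded: "\<exists>x. 0 < x \<and> x < M \<and> r < rho x" for r
  proof -
    define m where "m = min d0 (D M)"
    have m: "0 < m" unfolding m_def using D0 D_pos[of M] M by simp
    have mD: "m \<le> D x" if "0 \<le> x" "x \<le> M" for x
      using eps that unfolding m_def D_def by auto
    define c where "c = 2 * m / (M * (p0 + \<bar>p1\<bar> * M))"
    have c: "0 < c" unfolding c_def using m M p0 by (simp add: add_pos_nonneg)
    define h where "h x = ln x + g x - c / (M - x)" for x
    have h': "(h has_real_derivative 2 * D x / Q x - c / (M - x)\<^sup>2) (at x)" if x: "0 < x" "x < M" for x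
    proof -
      have xI: "x \<in> I" using x del by (auto simp: I_def)
      have e: "1 / x + N x / P x = 2 * D x / Q x"
        using NP[of x] PI[OF xI] x unfolding Q_def by (simp add: field_simps)
      have gx: "(g has_real_derivative N x / P x) (at x)" using g xI by (auto simp: I_def)
      have "((\<lambda>x. c / (M - x)) has_real_derivative c / (M - x)\<^sup>2) (at x)"
        by (rule derivative_eq_intros refl)+ (use x in \<open>auto simp: field_simps power2_eq_square\<close>)
      from DERIV_diff[OF DERIV_add[OF DERIV_ln_divide[OF x(1)] gx] this] show ?thesis
        unfolding h_def[abs_def] e .
    qed
    have pos: "0 \<le> 2 * D x / Q x - c / (M - x)\<^sup>2" if x: "0 < x" "x < M" for x
    proof -
      have l: "0 < p0 + p1 * x" using lin_pos x by simp
      have "p1 * x \<le> \<bar>p1\<bar> * M" using x by (intro mult_mono) auto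
      then have "x * (p0 + p1 * x) \<le> M * (p0 + \<bar>p1\<bar> * M)" using x l by (intro mult_mono) auto
      then have "c \<le> 2 * m / (x * (p0 + p1 * x))" unfolding c_def using m l x
        by (intro divide_left_mono) (auto intro!: mult_pos_pos add_pos_nonneg simp: p0 M)
      also have "\<dots> \<le> 2 * D x / (x * (p0 + p1 * x))" using mD[of x] x l
        by (intro divide_right_mono) auto
      finally have "c / (M - x)\<^sup>2 \<le> 2 * D x / (x * (p0 + p1 * x)) / (M - x)\<^sup>2"
        by (rule divide_right_mono) simp
      also have "\<dots> = 2 * D x / Q x" unfolding Q_def P_def by (simp add: mult_ac)
      finally show ?thesis by simp
    qed
    have hmono: "h (M / 2) \<le> h x" if x: "M / 2 \<le> x" "x < M" for x
    proof (rule DERIV_nonneg_imp_nondecreasing[OF x(1)])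
      fix z assume "M / 2 \<le> z" "z \<le> x"
      then have "0 < z" "z < M" using x M by auto
      with h' pos show "\<exists>y. (h has_real_derivative y) (at z) \<and> 0 \<le> y" by blast
    qed
    \<comment> \<open>The gap \<open>u\<close> is chosen below with \<open>c / u > y\<close>, so
      that \<open>h (M / 2) + c / u\<close> passes the target \<open>ln (\<bar>r\<bar> + 1)\<close>;
      the term \<open>\<bar>r\<bar> + 1\<close> keeps the logarithm defined for every
      \<open>r\<close>.\<close>
    define y where "y = ln (\<bar>r\<bar> + 1) - h (M / 2)"
    define u where "u = min (M / 2) (c / (\<bar>y\<bar> + 1))"
    have u: "0 < u" unfolding u_def using c M by simp
    have u: "0 < u" "u \<le> M / 2" "u \<le> c / (\<bar>y\<bar> + 1)"
      using u unfolding u_def by (auto simp only: min.cobounded1 min.cobounded2)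
    have "\<bar>y\<bar> + 1 \<le> c / u" using u c by (simp add: field_simps)
    then have "ln (\<bar>r\<bar> + 1) < h (M / 2) + c / u" unfolding y_def by linarith
    also have "\<dots> \<le> h (M - u) + c / u" using hmono[of "M - u"] u by simp
    also have "\<dots> = ln (M - u) + g (M - u)" by (simp add: h_def)
    finally have "exp (ln (\<bar>r\<bar> + 1)) < exp (ln (M - u) + g (M - u))" by (rule exp_less_mono)
    also have "\<dots> = rho (M - u)" unfolding rho_def exp_add using u M by simp
    finally have "r < rho (M - u)" by simp
    with u M show ?thesis by (intro exI[of _ "M - u"]) auto
  qed
  have J0: "{0..} \<subseteq> J"
  proof
    fix r :: real assume "r \<in> {0..}"
    obtain x where x: "0 < x" "x < M" "r < rho x" using unbounded by blast
    have "continuous_on {0..x} rho" by (rule continuous_on_subset[OF crho]) (use x del in \<open>auto simp: I_def\<close>)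
    then obtain y where "0 \<le> y" "y \<le> x" "rho y = r"
      using IVT'[of rho 0 r x] x rho0 \<open>r \<in> {0..}\<close> by auto
    then show "r \<in> J" unfolding J_def I_def using x del by (intro image_eqI[of _ _ y]) auto
  qed
  define T where "T = inv_into I rho"
  have Trho: "T (rho x) = x" if "x \<in> I" for x
    unfolding T_def by (rule inv_into_f_f[OF inj that])
  have rhoT: "rho (T r) = r" "T r \<in> I" if "r \<in> J" for r
    using that unfolding J_def T_def by (auto intro: f_inv_into_f inv_into_into)
  \<comment> \<open>The reciprocal of \<open>rho'\<close>. The inverse function thus solves the
    autonomous equation \<open>T' = W (T r)\<close> with smooth \<open>W\<close>, the situation of
    \<open>smooth_on_autonomous\<close>.\<close>
  define W where "W x = P x / (2 * D x) * exp (- g x)" for x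
  have T': "(T has_real_derivative W (T r)) (at r)" if "r \<in> J" for r
  proof -
    let ?d = "exp (g (T r)) * (2 * D (T r) / P (T r))"
    note I = rhoT(2)[OF that]
    have "(rho has_derivative (*) ?d) (at (T r))"
      using rho'[OF I] by (simp add: has_field_derivative_def)
    moreover have "(*) d \<circ> (*) (inverse d) = id" if "0 < d" for d :: real using that by (auto simp: fun_eq_iff)
    ultimately have "(T has_derivative (*) (inverse ?d)) (at (rho (T r)))"
      using has_derivative_inverse_strong[OF oI I crho Trho] rho'_pos[OF I] by blast
    moreover have "inverse ?d = W (T r)" unfolding W_def exp_minus
      by (simp add: divide_simps)
    ultimately show ?thesis unfolding rhoT(1)[OF that] has_field_derivative_def by simp
  qed
  have smN: "smooth_on I (\<lambda>x. N x / P x)"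
    unfolding N_def P_def
    by (intro smooth_on_divide smooth_on_add smooth_on_diff smooth_on_mult smooth_on_power smooth_on_const
      smooth_on_bounded_linear[OF bounded_linear_ident]) (use PI in \<open>force simp: P_def\<close>)
  have smg: "smooth_on I g"
    by (rule smooth_on_antiderivative[OF _ smN]) (use g in \<open>auto simp: I_def\<close>)
  have smW: "smooth_on I W"
  proof -
    have "smooth_on I (\<lambda>x. exp (- g x))"
      by (rule smooth_on_comp_real[OF subset_UNIV smooth_on_exp smooth_on_minus[OF smg]])
    moreover have "smooth_on I (\<lambda>x. P x / (2 * D x))"
      unfolding P_def D_def
      by (intro smooth_on_divide smooth_on_add smooth_on_diff smooth_on_mult smooth_on_power smooth_on_const
        smooth_on_bounded_linear[OF bounded_linear_ident]) (use DI in \<open>force simp: D_def\<close>)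
    ultimately show ?thesis unfolding W_def[abs_def] by (rule smooth_on_mult[rotated])
  qed
  have smT: "smooth_on J T"
    by (rule smooth_on_autonomous[OF T' _ smW]) (use rhoT in auto)
  have dT: "deriv T r = W (T r)" if "r \<in> J" for r using T'[OF that] by (rule DERIV_imp_deriv)
  have pos: "0 \<le> T r \<and> (0 < r \<longrightarrow> 0 < T r)" if "0 \<le> r" for r
  proof -
    have rJ: "r \<in> J" using J0 that by auto
    show ?thesis using mono[OF rhoT(2)[OF rJ] z] rhoT(1)[OF rJ] rho0 that
      by (metis le_less_linear less_eq_real_def not_less)
  qed
  have rhpos: "0 < rho x" if "0 < x" for x using that by (simp add: rho_def)
  have xI: "x \<in> I" if "0 < x" "x < M" for x using that del by (auto simp: I_def)
  show thesis
  proof (rule that[of J T rho])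
    show "T 0 = 0" using Trho[OF z] rho0 by simp
    show "T r < M" if "r \<in> J" for r using rhoT(2)[OF that] by (auto simp: I_def)
    show "0 < D (T r)" if "r \<in> J" for r using rhoT(2)[OF that] DI by blast
    show "0 < deriv T r" if "r \<in> J" for r
      unfolding dT[OF that] W_def using DI PI rhoT(2)[OF that] by simp
    show "2 * r * deriv T r * D (T r) = Q (T r)" if "r \<in> J" for r
    proof -
      have "2 * rho (T r) * W (T r) * D (T r) = Q (T r)"
        using DI[OF rhoT(2)[OF that]] unfolding rho_def W_def Q_def
        by (simp add: field_simps flip: exp_add)
      then show ?thesis by (simp only: rhoT(1)[OF that] dT[OF that])
    qed
    show "0 < T r" if "0 < r" for r using pos[of r] that by auto
    show "rho (T r) = r" if "0 < r" for r
      by (rule rhoT(1)) (use J0 that in auto)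
    show "(rho has_real_derivative rho x * (2 * D x / Q x)) (at x)" if "0 < x" "x < M" for x
      using rho'[OF xI[OF that]] that unfolding rho_def[of x] Q_def by (simp add: mult_ac)
    show "strict_mono_on J T"
    proof (rule strict_mono_onI)
      fix r s assume "r \<in> J" "s \<in> J" "r < s"
      then show "T r < T s" using mono[of "T s" "T r"] rhoT by (metis less_asym linorder_neqE)
    qed
  qed (use oJ J0 smT rhpos Trho xI in auto)
qed

end

locale profile_solution = profile +
  fixes T rh :: "real \<Rightarrow> real" and J :: "real set"
  assumes sol: "open J" "{0..} \<subseteq> J" "smooth_on J T" "T 0 = 0"
    "\<And>r. r \<in> J \<Longrightarrow> T r < M" "\<And>r. r \<in> J \<Longrightarrow> 0 < D (T r)" "\<And>r. r \<in> J \<Longrightarrow> 0 < deriv T r"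
    "\<And>r. r \<in> J \<Longrightarrow> 2 * r * deriv T r * D (T r) = Q (T r)"
    "\<And>r. 0 < r \<Longrightarrow> 0 < T r" "\<And>x. 0 < x \<Longrightarrow> x < M \<Longrightarrow> 0 < rh x"
    "\<And>x. 0 < x \<Longrightarrow> x < M \<Longrightarrow> T (rh x) = x" "\<And>r. 0 < r \<Longrightarrow> rh (T r) = r"
    "\<And>x. 0 < x \<Longrightarrow> x < M \<Longrightarrow> (rh has_real_derivative rh x * (2 * D x / Q x)) (at x)"
    "strict_mono_on J T"
begin

lemma T_nonneg: "0 \<le> r \<Longrightarrow> 0 \<le> T r"
  using sol(4) sol(9)[of r] by (cases "r = 0") auto

text \<open>The alternatives in \<open>ab\<close> decide whether the closing end is the lower or the
  upper end of the moment interval. Along the solution the moment map, as a function of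
  \<open>t\<close>, inverts \<open>F'\<close>, so \<open>legendre_derivative\<close> identifies it
  with the derivative of \<open>f\<close>.\<close>

lemma profile_potential_exists:
  assumes ab: "eps = 1 \<and> a = kap * d0 - 1 \<and> b = kap * D M - 1 \<or>
    eps = -1 \<and> a = kap * D M - 1 \<and> b = kap * d0 - 1"
  obtains \<phi> f where "profile_potential a b \<phi> f"
    "\<And>t. (f has_real_derivative kap * D (T (exp (2 * eps * t))) - 1) (at t)"
proof -
  define xi where "xi t = ((t + 1) / kap - d0) * eps" for t
  have tau_xi: "kap * D (xi t) - 1 = t" for t using kap by (simp add: xi_def D_def field_simps)
  have xi_tau: "xi (kap * D x - 1) = x" for x using kap by (simp add: xi_def D_def field_simps)
  have ends: "xi a = 0 \<and> xi b = M \<or> xi a = M \<and> xi b = 0"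
    using ab kap by (auto simp: xi_def D_def field_simps)
  have "a < b" using ab mult_pos_pos[OF kap M] by (auto simp: D_def algebra_simps)
  have xi_in: "0 < xi t" "xi t < M" if "a < t" "t < b" for t
    using ab kap that unfolding xi_def D_def by (auto simp: field_simps)
  have xi_cl: "0 \<le> xi t" "xi t \<le> M" if "a \<le> t" "t \<le> b" for t
    using ab kap that unfolding xi_def D_def by (auto simp: field_simps)
  have tau_in: "a < kap * D x - 1" "kap * D x - 1 < b" if "0 < x" "x < M" for x
    using ab mult_pos_pos[OF kap that(1)] mult_strict_left_mono[OF that(2) kap] unfolding D_def
    by (auto simp: algebra_simps)
  define \<phi> where "\<phi> t = kap * Q (xi t) / D (xi t)" for t
  have xi': "(xi has_real_derivative eps / kap) (at t)" for t
    unfolding xi_def[abs_def] using kap by (auto intro!: derivative_eq_intros)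
  \<comment> \<open>Here \<open>t\<close> is a moment value and \<open>F' t\<close> the logarithm of
    the corresponding fibre norm: \<open>rh\<close> gives the squared norm, inverted when
    \<open>eps = -1\<close>, hence the factor \<open>eps / 2\<close>.\<close>
  define F' where "F' t = eps / 2 * ln (rh (xi t))" for t
  have F': "(F' has_real_derivative 1 / \<phi> t) (at t)" if t: "a < t" "t < b" for t
  proof -
    note x = xi_in[OF t]
    have "(F' has_real_derivative eps / 2 * (1 / rh (xi t) * (rh (xi t) * (2 * D (xi t) / Q (xi t)) * (eps / kap)))) (at t)"
      unfolding F'_def[abs_def]
      by (intro DERIV_cmult DERIV_chain2[OF DERIV_ln_divide] DERIV_chain2[OF sol(13)] xi' x sol(10))
    moreover have "eps / 2 * (1 / rh (xi t) * (rh (xi t) * (2 * D (xi t) / Q (xi t)) * (eps / kap))) = 1 / \<phi> t"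
      using sol(10)[OF x] D_pos[of "xi t"] x Q_pos[OF x] kap unfolding \<phi>_def by (simp add: field_simps)
    ultimately show ?thesis by simp
  qed
  obtain F where F: "\<And>t. a < t \<Longrightarrow> t < b \<Longrightarrow> (F has_real_derivative F' t) (at t)"
    using DERIV_antiderivative_open[OF \<open>a < b\<close>, of F'] F' DERIV_isCont by blast
  define tau where "tau t = kap * D (T (exp (2 * eps * t))) - 1" for t
  have TT: "0 < T (exp (2 * eps * t))" "T (exp (2 * eps * t)) < M" for t
    using sol(2,5,9) by (auto simp: subset_iff)
  have tau: "a < tau t" "tau t < b" "F' (tau t) = t" for t
    using tau_in[OF TT, of t] unfolding tau_def F'_def xi_tau by (simp_all add: sol(12))
  have Tc: "isCont T r" if "0 < r" for r
    using smooth_on_imp_continuous_on[OF sol(3)] sol(1,2) that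
    by (auto simp: continuous_on_eq_continuous_at subset_iff)
  have tauc: "isCont tau t" for t
  proof -
    have "isCont (\<lambda>t. T (exp (2 * eps * t))) t"
      by (rule isCont_o2[of t "\<lambda>t. exp (2 * eps * t)" T]) (auto intro!: continuous_intros Tc)
    then show ?thesis unfolding tau_def[abs_def] D_def by (intro continuous_intros)
  qed
  have phipos: "0 < \<phi> t" if "a < t" "t < b" for t
    unfolding \<phi>_def using kap Q_pos[OF xi_in[OF that]] D_pos[of "xi t"] xi_in[OF that] by simp
  define f where "f = (\<lambda>t. SUP x\<in>{a<..<b}. x * t - F x)"
  show thesis
  proof (rule that[of \<phi> f])
    show "(f has_real_derivative kap * D (T (exp (2 * eps * t))) - 1) (at t)" for t
      unfolding f_def tau_def[symmetric]
      by (rule legendre_derivative[OF F F' _ tau tauc]) (use phipos in auto)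
    have "isCont \<phi> t" if "a \<le> t" "t \<le> b" for t
    proof -
      have "isCont (\<lambda>x. kap * Q x / D x) (xi t)"
        using D_pos[OF xi_cl[OF that]] DERIV_isCont[OF Q_deriv] DERIV_isCont[OF D_deriv]
        by (intro continuous_intros) auto
      from isCont_o2[OF DERIV_isCont[OF xi'] this] show ?thesis unfolding \<phi>_def[abs_def] .
    qed
    then have "continuous_on {a..b} \<phi>" by (intro continuous_at_imp_continuous_on) auto
    moreover have "\<phi> a = 0" "\<phi> b = 0" using ends by (auto simp: \<phi>_def Q_def P_def)
    moreover have "F' ` {a<..<b} = UNIV" using tau by (metis UNIV_eq_I greaterThanLessThan_iff image_eqI)
    ultimately show "profile_potential a b \<phi> f"
      unfolding profile_potential_def using \<open>a < b\<close> phipos F F' f_def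
      by (intro conjI exI[of _ F] exI[of _ F']) auto
  qed
qed

text \<open>L'Hospital's rule for \<open>ln rh\<close> against \<open>1 / (M - x)\<close>: the
  quotient of the derivatives is \<open>2 * D * (M - x)\<^sup>2 / Q\<close>, with limit
  \<open>2 / C\<close> because the linear factor does not vanish at \<open>M\<close>. Substituting
  \<open>x = T r\<close> replaces \<open>rh x\<close> by \<open>r\<close>.\<close>

lemma asymptotics:
  assumes "0 < p0 + p1 * M"
  shows "((\<lambda>r. (M - T r) * ln r) \<longlongrightarrow> 2 / C) at_top"
    and "filterlim T (at_left M) at_top"
proof -
  have ev: "eventually (\<lambda>x. 0 < x \<and> x < M) (at_left M)"
    using M eventually_at_left_real[of 0 M] by (auto elim: eventually_mono)
  have "((\<lambda>x. ln (rh x) / (1 / (M - x))) \<longlongrightarrow> 2 / C) (at_left M)"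
  proof (rule lhopital_left_at_top[where f' = "\<lambda>x. 2 * D x / Q x" and g' = "\<lambda>x. 1 / (M - x)\<^sup>2"])
    show "LIM x at_left M. 1 / (M - x) :> at_top"
    proof -
      have "((\<lambda>x. M - x) \<longlongrightarrow> 0) (at_left M)" by (rule tendsto_eq_intros refl | simp)+
      then have "filterlim (\<lambda>x. M - x) (at_right 0) (at_left M)"
        by (rule filterlim_atI[unfolded at_within_def, THEN _] | auto intro!: filterlim_at_right_to_0 simp: filterlim_at eventually_at_filter)
      from filterlim_compose[OF filterlim_inverse_at_top_right this] show ?thesis
        by (simp add: divide_inverse)
    qed
    show "\<forall>\<^sub>F x in at_left M. 1 / (M - x)\<^sup>2 \<noteq> 0" using ev by eventually_elim auto
    show "\<forall>\<^sub>F x in at_left M. ((\<lambda>x. ln (rh x)) has_real_derivative 2 * D x / Q x) (at x)"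
      using ev
    proof eventually_elim
      case (elim x)
      from DERIV_chain2[OF DERIV_ln_divide[OF sol(10)] sol(13), of x] elim sol(10)[of x]
      show ?case by simp
    qed
    show "\<forall>\<^sub>F x in at_left M. ((\<lambda>x. 1 / (M - x)) has_real_derivative 1 / (M - x)\<^sup>2) (at x)"
      using ev
    proof eventually_elim
      case (elim x)
      show ?case by (rule derivative_eq_intros refl)+ (use elim in \<open>auto simp: field_simps power2_eq_square\<close>)
    qed
    have "((\<lambda>x. 2 * D x / (x * (p0 + p1 * x))) \<longlongrightarrow> 2 * D M / (M * (p0 + p1 * M))) (at_left M)"
      unfolding D_def by (intro tendsto_intros) (use assms M in auto)
    then have "((\<lambda>x. 2 * D x / (x * (p0 + p1 * x))) \<longlongrightarrow> 2 / C) (at_left M)" by (simp add: C_def)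
    then show "((\<lambda>x. 2 * D x / Q x / (1 / (M - x)\<^sup>2)) \<longlongrightarrow> 2 / C) (at_left M)"
      by (rule Lim_transform_eventually) (use ev in eventually_elim, auto simp: Q_def P_def)
  qed
  then have lim: "((\<lambda>x. (M - x) * ln (rh x)) \<longlongrightarrow> 2 / C) (at_left M)" by (simp add: mult.commute)
  have TM: "T r < M" if "0 < r" for r using sol(2,5) that by (auto simp: subset_iff)
  show *: "filterlim T (at_left M) at_top"
    unfolding filterlim_at
  proof (intro conjI)
    show "\<forall>\<^sub>F r in at_top. T r \<in> {..<M} \<and> T r \<noteq> M"
      using eventually_gt_at_top[of 0] by eventually_elim (use TM in force)
    show "(T \<longlongrightarrow> M) at_top"
    proof (rule increasing_tendsto)
      show "\<forall>\<^sub>F r in at_top. T r \<le> M"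
        using eventually_gt_at_top[of 0] by eventually_elim (use TM in force)
      fix x assume "x < M"
      define y where "y = max (M / 2) x"
      have y: "0 < y" "y < M" "x \<le> y" unfolding y_def using M \<open>x < M\<close> by auto
      show "\<forall>\<^sub>F r in at_top. x < T r"
        using eventually_gt_at_top[of "rh y"]
      proof eventually_elim
        case (elim r)
        from sol(10)[OF y(1,2)] sol(2) elim have "T (rh y) < T r"
          by (intro strict_mono_onD[OF sol(14)]) auto
        with sol(11)[OF y(1,2)] y show ?case by simp
      qed
    qed
  qed
  from filterlim_compose[OF lim *] show "((\<lambda>r. (M - T r) * ln r) \<longlongrightarrow> 2 / C) at_top"
    by (rule Lim_transform_eventually) (use eventually_gt_at_top[of 0] in eventually_elim, simp add: sol(12))
qed

end

text \<open>A common setting for the charts around the closing section (\<open>sg = 1\<close>,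
  \<open>X = T\<close>) and those at the complete end (\<open>sg = -1\<close>,
  \<open>X r = T (inverse r)\<close>); the equation differs only by the sign.\<close>

locale radial_profile = profile +
  fixes X :: "real \<Rightarrow> real" and J :: "real set" and sg :: real
  assumes sg: "sg = 1 \<or> sg = -1" and oJ: "open J" and smX: "smooth_on J X"
    and DX: "\<And>r. r \<in> J \<Longrightarrow> 0 < D (X r)" and X': "\<And>r. r \<in> J \<Longrightarrow> 0 < sg * deriv X r"
    and ode: "\<And>r. r \<in> J \<Longrightarrow> 2 * r * deriv X r * D (X r) = sg * Q (X r)"
begin

definition lam where "lam r = kap * D (X r)"
definition mu where "mu r = sg * kap * deriv X r"
definition V where "V r = sg * Q1 (X r) / (2 * D (X r)) - 1"

lemma sg_sq [simp]: "sg * sg = 1" "sg * (sg * y) = y"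
  using sg by auto

lemmas dX = smooth_on_real_derivative[OF smX]

lemma smooth_DX: "smooth_on J (\<lambda>r. D (X r))"
  unfolding D_def by (intro smooth_on_add smooth_on_mult smooth_on_const smX)

lemma lam_smooth: "smooth_on J lam" and mu_smooth: "smooth_on J mu"
  unfolding lam_def[abs_def] mu_def[abs_def]
  by (intro smooth_on_mult smooth_on_const smooth_DX smooth_on_deriv oJ smX)+

lemma lam_gt_0: "r \<in> J \<Longrightarrow> 0 < lam r" and mu_gt_0: "r \<in> J \<Longrightarrow> 0 < mu r"
  using mult_pos_pos[OF kap DX] mult_pos_pos[OF kap X'] by (simp_all add: lam_def mu_def mult_ac)

lemma lam_has_derivative: "r \<in> J \<Longrightarrow> (lam has_real_derivative sg * eps * mu r) (at r)"
  unfolding lam_def[abs_def] mu_def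
  by (rule DERIV_cong[OF DERIV_cmult[OF DERIV_chain2[OF D_deriv dX]]]) (simp_all add: mult_ac)

lemma DX_deriv: "r \<in> J \<Longrightarrow> ((\<lambda>r. D (X r)) has_real_derivative eps * deriv X r) (at r)"
  by (rule DERIV_chain2[OF D_deriv dX])

text \<open>By the equation \<open>lam * mu\<close> equals
  \<open>kap\<^sup>2 * Q (X r) / (2 * r)\<close>, and \<open>V\<close> is \<open>r\<close> times its
  logarithmic derivative. Differentiating the equation itself, and then dividing by
  \<open>X'\<close> and \<open>D\<close> only, avoids a division by \<open>r\<close> or
  \<open>Q\<close> and so includes \<open>r = 0\<close>.\<close>

lemma V_eq:
  assumes "r \<in> J"
  shows "r * (sg * eps * mu r / lam r + deriv mu r / mu r) = V r"
proof -
  have d2: "(deriv X has_real_derivative deriv (deriv X) r) (at r)"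
    by (rule smooth_on_real_derivative[OF smooth_on_deriv[OF oJ smX] assms])
  let ?X1 = "deriv X r" and ?X2 = "deriv (deriv X) r" and ?D = "D (X r)"
  have nz: "?X1 \<noteq> 0" using X'[OF assms] by auto
  have "deriv mu r = sg * kap * ?X2"
    unfolding mu_def[abs_def] by (rule DERIV_imp_deriv[OF DERIV_cmult[OF d2]])
  then have l: "sg * eps * mu r / lam r + deriv mu r / mu r = eps * ?X1 / ?D + ?X2 / ?X1"
    using kap sg nz DX[OF assms] unfolding lam_def mu_def by (auto simp: field_simps)
  have "((\<lambda>r. r * (deriv X r * D (X r))) has_real_derivative
     ?X1 * ?D + r * (?X2 * ?D + ?X1 * (eps * ?X1))) (at r)"
    by (rule DERIV_cong[OF DERIV_mult[OF DERIV_ident DERIV_mult[OF d2 DX_deriv[OF assms]]]])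
      (simp add: algebra_simps)
  moreover have "((\<lambda>r. r * (deriv X r * D (X r))) has_real_derivative sg / 2 * (Q1 (X r) * ?X1)) (at r)"
    by (rule has_field_derivative_transform_within_open[OF DERIV_cmult[OF DERIV_chain2[OF Q_deriv dX[OF assms]]] oJ assms])
      (use ode in \<open>simp add: field_simps\<close>)
  ultimately have "?X1 * ?D + r * (?X2 * ?D + ?X1 * (eps * ?X1)) = sg / 2 * (Q1 (X r) * ?X1)"
    by (rule DERIV_unique)
  then have E: "r * (?X2 * ?D + ?X1 * (eps * ?X1)) = sg / 2 * (Q1 (X r) * ?X1) - ?X1 * ?D"
    by simp
  have "r * (eps * ?X1 / ?D + ?X2 / ?X1) = r * (?X2 * ?D + ?X1 * (eps * ?X1)) / (?X1 * ?D)"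
    using nz DX[OF assms] by (simp add: field_simps)
  also have "\<dots> = sg * Q1 (X r) / (2 * ?D) - 1"
    unfolding E using nz DX[OF assms] by (simp add: field_simps)
  finally have "r * (eps * ?X1 / ?D + ?X2 / ?X1) = sg * Q1 (X r) / (2 * ?D) - 1" .
  then show ?thesis unfolding l V_def .
qed

lemma V_deriv:
  assumes "r \<in> J"
  shows "(V has_real_derivative sg * deriv X r * ((- 4 - 2 * D (X r) * (kap * (A0 + A1 * X r))) / (2 * D (X r)) -
    eps * Q1 (X r) / (2 * (D (X r))\<^sup>2))) (at r)"
proof -
  note d = DERIV_divide[OF DERIV_cmult[OF DERIV_chain2[OF Q1_deriv dX[OF assms]], of sg]
      DERIV_cmult[OF DX_deriv[OF assms], of 2]]
  show ?thesis unfolding V_def[abs_def]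
    by (rule DERIV_cong[OF DERIV_diff[OF d DERIV_const]])
      (use DX[OF assms] in \<open>simp_all add: field_simps power2_eq_square\<close>)
qed

text \<open>The \<open>Q1\<close> terms of the horizontal and vertical traces cancel, the base
  contribution \<open>- 2 / lam\<close> cancels against the constant \<open>-4\<close> of
  \<open>Q2\<close>, and the prescribed affine function remains.\<close>

lemma scalar_eq:
  assumes "r \<in> J"
  shows "- (2 + sg * eps + sg * eps * V r) / lam r - 
     sg * deriv X r * ((- 4 - 2 * D (X r) * (kap * (A0 + A1 * X r))) / (2 * D (X r)) -
    eps * Q1 (X r) / (2 * (D (X r))\<^sup>2)) / mu r = A0 + A1 * X r"
proof -
  let ?D = "D (X r)" and ?S = "A0 + A1 * X r"
  have nz: "sg * deriv X r \<noteq> 0" and D: "0 < ?D" using X'[OF assms] DX[OF assms] by auto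
  have 1: "2 + sg * eps + sg * eps * V r = 2 + eps * Q1 (X r) / (2 * ?D)"
    unfolding V_def by (simp add: algebra_simps)
  have 2: "sg * deriv X r * y / mu r = y / kap" for y
    unfolding mu_def using nz by (simp add: mult_ac)
  show ?thesis unfolding 1 2 lam_def using D kap by (simp add: field_simps power2_eq_square)
qed

end

context profile_solution
begin

sublocale closing: radial_profile eps kap M d0 p0 p1 A0 A1 T J 1
  by unfold_locales (use sol in auto)

lemma inverse_deriv:
  assumes "0 < r"
  shows "((\<lambda>r. T (inverse r)) has_real_derivative - (deriv T (inverse r) / r\<^sup>2)) (at r)"
proof -
  have "inverse r \<in> J" using sol(2) assms by (auto simp: subset_iff)
  from DERIV_chain2[OF smooth_on_real_derivative[OF sol(3) this] DERIV_inverse[of r]] assms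
  show ?thesis by (simp add: power2_eq_square divide_inverse)
qed

sublocale cusp: radial_profile eps kap M d0 p0 p1 A0 A1 "\<lambda>r. T (inverse r)" "{0<..}" "-1"
proof unfold_locales
  show "smooth_on {0<..} (\<lambda>r. T (inverse r))"
    by (rule smooth_on_comp_real[OF _ sol(3) smooth_on_inverse_real]) (use sol(2) in \<open>auto simp: subset_iff\<close>)
  fix r :: real assume r: "r \<in> {0<..}"
  then have J: "inverse r \<in> J" using sol(2) by (auto simp: subset_iff)
  have d: "deriv (\<lambda>r. T (inverse r)) r = - (deriv T (inverse r) / r\<^sup>2)"
    using inverse_deriv r by (intro DERIV_imp_deriv) auto
  show "0 < D (T (inverse r))" by (rule sol(6)[OF J])
  show "0 < - 1 * deriv (\<lambda>r. T (inverse r)) r" unfolding d using sol(7)[OF J] r by simp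
  show "2 * r * deriv (\<lambda>r. T (inverse r)) r * D (T (inverse r)) = - 1 * Q (T (inverse r))"
    unfolding d using sol(8)[OF J] r by (simp add: field_simps power2_eq_square)
qed auto

end

section \<open>Asymptotics at the cusp\<close>

locale cusp_chart = profile_solution + weight O1 k
  for O1 :: "(complex^1) set" and k :: "complex^1 \<Rightarrow> real" +
  fixes a :: "complex^1 \<Rightarrow> real" and x0 :: "complex^1" and rd :: real
  assumes sma: "smooth_on O1 a" and apos: "\<And>x. x \<in> O1 \<Longrightarrow> 0 < a x"
    and strict: "0 < p0 + p1 * M" and rd: "0 < rd" and cball_O1: "cball x0 rd \<subseteq> O1"
begin

text \<open>The closed ball inside \<open>O1\<close> bounds all functions of the base point, and the
  radius \<open>1 / 2\<close> keeps \<open>ln \<bar>w\<bar>\<close> negative and away from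
  0.\<close>

definition N where "N = {y::complex^2. bp y \<in> ball x0 rd \<and> cmod (y $ 2) < 1 / 2}"
definition Ns where "Ns = {y \<in> N. y $ 2 \<noteq> 0}"
definition L where "L y = ln (cmod ((y::complex^2) $ 2))"
definition Fl where "Fl = inf (filtercomap (\<lambda>y::complex^2. y $ 2) (at 0)) (principal N)"
definition q where "q y = M - T (inverse (rad k y))"
text \<open>The error in the asymptotic relation \<open>q * L = - 1 / C\<close>. Together
  \<open>q\<close> and \<open>dl\<close> have frame derivatives that are polynomial in themselves
  and bounded functions, so no other decaying quantity is needed.\<close>

definition dl where "dl y = L y * q y + 1 / C"
text \<open>The limit at the divisor of the horizontal coefficient \<open>2 * lam * a\<close> of the
  Riemannian metric.\<close>

definition En where "En x = 2 * kap * D M * a x"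
definition g0 :: "complex^2 \<Rightarrow> complex^2 \<Rightarrow> complex^2 \<Rightarrow> real"
  where "g0 y u v = kap / C * Re (u $ 2 * cnj (v $ 2)) / (cmod (y $ 2) * ln (cmod (y $ 2)))\<^sup>2 +
    En (bp y) * Re (u $ 1 * cnj (v $ 1))"

text \<open>The real and imaginary parts of \<open>dz\<close> and of \<open>dw / (w ln \<bar>w\<bar>)\<close>; the covariant derivatives of the
  latter have constant coefficients, as in the hyperbolic plane.\<close>

definition cz :: "complex^2 \<Rightarrow> complex^2 \<Rightarrow> complex"
  where "cz y v = v $ 2 / (y $ 2 * of_real (L y))"
definition fr :: "complex^2 \<Rightarrow> nat \<Rightarrow> complex^2 \<Rightarrow> real"
  where "fr y b v = (if b = 0 then Re (v $ 1) else if b = 1 then Im (v $ 1)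
    else if b = 2 then Re (cz y v) else Im (cz y v))"
definition fd :: "(complex^2 \<Rightarrow> real) \<Rightarrow> (nat \<Rightarrow> complex^2 \<Rightarrow> real) \<Rightarrow> bool"
  where "fd c d \<longleftrightarrow> (\<forall>y\<in>Ns. (c has_derivative (\<lambda>u. \<Sum>b<4. d b y * fr y b u)) (at y))"

lemma sum4: "(\<Sum>b<4. f b) = f 0 + f 1 + f 2 + (f (3::nat) :: 'x::comm_monoid_add)"
  by (simp add: eval_nat_numeral add.assoc)

lemma C_pos: "0 < C"
  unfolding C_def using M strict D_pos[of M] by simp

lemma open_N: "open N"
proof -
  have "open (bp -` ball x0 rd)" using continuous_on_bp[of UNIV] open_ball open_vimage by blast
  moreover have "open {y::complex^2. cmod (y $ 2) < 1 / 2}"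
    by (intro open_Collect_less continuous_intros)
  ultimately have "open (bp -` ball x0 rd \<inter> {y. cmod (y $ 2) < 1 / 2})" by (rule open_Int)
  moreover have "bp -` ball x0 rd \<inter> {y. cmod (y $ 2) < 1 / 2} = N" by (auto simp: N_def)
  ultimately show ?thesis by simp
qed

lemma open_Ns: "open Ns"
proof -
  have "open {y::complex^2. y $ 2 \<noteq> 0}" by (intro open_Collect_neq continuous_intros)
  from open_Int[OF open_N this] have "open (N \<inter> {y. y $ 2 \<noteq> 0})" .
  moreover have "N \<inter> {y. y $ 2 \<noteq> 0} = Ns" by (auto simp: Ns_def)
  ultimately show ?thesis by simp
qed

lemma Ns_D:
  assumes "y \<in> Ns"
  shows "y $ 2 \<noteq> 0" "bp y \<in> O1" "y \<in> Ov" "L y < 0" "0 < rad k y"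
proof -
  show "y $ 2 \<noteq> 0" using assms by (simp add: Ns_def)
  then show "0 < rad k y" by (rule rad_pos)
  show "bp y \<in> O1" using assms cball_O1 by (auto simp: Ns_def N_def subset_iff)
  then show "y \<in> Ov" by (simp add: Ov_def)
  show "L y < 0" using assms unfolding L_def Ns_def N_def by auto
qed

lemma eventually_Ns: "\<forall>\<^sub>F y in Fl. y \<in> Ns"
  unfolding Fl_def eventually_inf_principal eventually_filtercomap Ns_def
  by (rule exI[of _ "\<lambda>z. z \<noteq> 0"]) (auto simp: eventually_at_filter)

lemma filterlim_w: "filterlim (\<lambda>y. y $ 2) (at 0) Fl"
  unfolding Fl_def by (rule filterlim_mono[OF filterlim_filtercomap order.refl]) simp

lemma cmod_lim: "filterlim (\<lambda>y. cmod (y $ 2)) (at_right 0) Fl"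
proof -
  have "((\<lambda>y. y $ 2) \<longlongrightarrow> 0) Fl"
    using filterlim_w by (simp add: filterlim_at)
  then have "((\<lambda>y. cmod (y $ 2)) \<longlongrightarrow> 0) Fl" by (rule tendsto_norm_zero)
  moreover have "\<forall>\<^sub>F y in Fl. cmod (y $ 2) \<in> {0<..} \<and> cmod (y $ 2) \<noteq> 0"
    using eventually_Ns by eventually_elim (simp add: Ns_def)
  ultimately show ?thesis unfolding filterlim_at by simp
qed

lemma base_bounded:
  assumes "smooth_on O1 b"
  obtains B where "\<And>y. y \<in> Ns \<Longrightarrow> \<bar>b (bp y) :: real\<bar> \<le> B"
proof -
  have "continuous_on (cball x0 rd) b"
    by (rule continuous_on_subset[OF smooth_on_imp_continuous_on[OF assms] cball_O1])
  then have "bounded (b ` cball x0 rd)"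
    by (intro compact_imp_bounded compact_continuous_image compact_cball)
  then obtain B where B: "\<forall>x\<in>b ` cball x0 rd. \<bar>x\<bar> \<le> B" by (auto simp: bounded_real)
  show thesis
  proof (rule that)
    fix y assume "y \<in> Ns"
    then have "bp y \<in> cball x0 rd" by (auto simp: Ns_def N_def)
    with B show "\<bar>b (bp y)\<bar> \<le> B" by auto
  qed
qed

lemma rad_lim: "filterlim (\<lambda>y. inverse (rad k y)) at_top Fl"
proof -
  obtain B where B: "\<And>y. y \<in> Ns \<Longrightarrow> \<bar>k (bp y)\<bar> \<le> B" using base_bounded[OF smooth_k] by blast
  have "((\<lambda>y. cmod (y $ 2)) \<longlongrightarrow> 0) Fl" using cmod_lim by (simp add: filterlim_at)
  from tendsto_mult[OF tendsto_const tendsto_power[OF this, of 2], of "exp B"]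
  have "((\<lambda>y. exp B * (cmod (y $ 2))\<^sup>2) \<longlongrightarrow> 0) Fl" by simp
  then have "(rad k \<longlongrightarrow> 0) Fl"
  proof (rule Lim_null_comparison[rotated])
    show "\<forall>\<^sub>F y in Fl. norm (rad k y) \<le> exp B * (cmod (y $ 2))\<^sup>2"
      using eventually_Ns
    proof eventually_elim
      case (elim y)
      have "k (bp y) \<le> B" using B[OF elim] by linarith
      then show ?case unfolding rad_def by (simp add: mult_right_mono)
    qed
  qed
  moreover have "\<forall>\<^sub>F y in Fl. rad k y \<in> {0<..} \<and> rad k y \<noteq> 0"
    using eventually_Ns by eventually_elim (use Ns_D(5) in force)
  ultimately have "filterlim (rad k) (at_right 0) Fl" unfolding filterlim_at by simp
  from filterlim_compose[OF filterlim_inverse_at_top_right this] show ?thesis .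
qed

lemma T_range: "y \<in> Ns \<Longrightarrow> 0 < T (inverse (rad k y))" "y \<in> Ns \<Longrightarrow> T (inverse (rad k y)) < M"
  "y \<in> Ns \<Longrightarrow> inverse (rad k y) \<in> J"
  using sol(2,5,9) Ns_D(5)[of y] by (auto simp: subset_iff)

lemma q_lim: "(q \<longlongrightarrow> 0) Fl"
proof -
  from filterlim_compose[OF asymptotics(2)[OF strict] rad_lim]
  have "((\<lambda>y. T (inverse (rad k y))) \<longlongrightarrow> M) Fl" by (simp add: filterlim_at)
  from tendsto_diff[OF tendsto_const this, of M] show ?thesis by (simp add: q_def[abs_def])
qed

lemma L_eq: "y \<in> Ns \<Longrightarrow> L y = - (ln (inverse (rad k y)) + k (bp y)) / 2"
  using Ns_D(1)[of y] unfolding rad_def L_def by (simp add: ln_mult ln_inverse ln_realpow)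

text \<open>Apply \<open>asymptotics\<close> with \<open>r = inverse (rad k y)\<close>. By
  \<open>L_eq\<close> the logarithm of this \<open>r\<close> differs from \<open>- 2 * L\<close> by
  \<open>k\<close>, which is bounded and is multiplied by \<open>q\<close>.\<close>

lemma dl_lim: "(dl \<longlongrightarrow> 0) Fl"
proof -
  obtain B where B: "\<And>y. y \<in> Ns \<Longrightarrow> \<bar>k (bp y)\<bar> \<le> B" using base_bounded[OF smooth_k] by blast
  from filterlim_compose[OF asymptotics(1)[OF strict] rad_lim]
  have 1: "((\<lambda>y. q y * ln (inverse (rad k y))) \<longlongrightarrow> 2 / C) Fl" by (simp add: q_def)
  have 2: "((\<lambda>y. q y * k (bp y)) \<longlongrightarrow> 0) Fl"
  proof (rule Lim_null_comparison)
    show "\<forall>\<^sub>F y in Fl. norm (q y * k (bp y)) \<le> B * \<bar>q y\<bar>"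
      using eventually_Ns by eventually_elim (use B in \<open>simp add: abs_mult mult.commute mult_right_mono\<close>)
    show "((\<lambda>y. B * \<bar>q y\<bar>) \<longlongrightarrow> 0) Fl"
      using tendsto_mult_right_zero[OF tendsto_rabs_zero[OF q_lim]] .
  qed
  have "((\<lambda>y. - (q y * ln (inverse (rad k y)) + q y * k (bp y)) / 2 + 1 / C) \<longlongrightarrow> - (2 / C + 0) / 2 + 1 / C) Fl"
    by (intro tendsto_intros 1 2) simp
  then have "((\<lambda>y. - (q y * ln (inverse (rad k y)) + q y * k (bp y)) / 2 + 1 / C) \<longlongrightarrow> 0) Fl" by simp
  then show ?thesis
    by (rule Lim_transform_eventually)
      (use eventually_Ns in eventually_elim, simp add: dl_def L_eq algebra_simps add_divide_distrib)
qed

text \<open>Two classes of coefficient functions, bounded and vanishing at the divisor, both closed under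
  differentiation along the frame.\<close>

inductive bnd :: "(complex^2 \<Rightarrow> real) \<Rightarrow> bool" and van :: "(complex^2 \<Rightarrow> real) \<Rightarrow> bool"
where
  bnd_base: "smooth_on O1 b \<Longrightarrow> bnd (\<lambda>y. b (bp y))"
| bnd_inv: "bnd (\<lambda>y. 1 / D (T (inverse (rad k y))))"
| bnd_add: "bnd f \<Longrightarrow> bnd g \<Longrightarrow> bnd (\<lambda>y. f y + g y)"
| bnd_mult: "bnd f \<Longrightarrow> bnd g \<Longrightarrow> bnd (\<lambda>y. f y * g y)"
| bnd_van: "van f \<Longrightarrow> bnd f"
| van_q: "van q"
| van_dl: "van dl"
| van_add: "van f \<Longrightarrow> van g \<Longrightarrow> van (\<lambda>y. f y + g y)"
| van_mult: "bnd f \<Longrightarrow> van g \<Longrightarrow> van (\<lambda>y. f y * g y)"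
| van_cong: "van f \<Longrightarrow> (\<And>y. y \<in> Ns \<Longrightarrow> g y = f y) \<Longrightarrow> van g"

lemma bnd_const: "bnd (\<lambda>y. c)"
  using bnd_base[of "\<lambda>_. c"] by simp

lemma bnd_limits:
  "bnd f \<Longrightarrow> \<exists>B. \<forall>\<^sub>F y in Fl. \<bar>f y\<bar> \<le> B"
  "van g \<Longrightarrow> (g \<longlongrightarrow> 0) Fl"
proof (induction rule: bnd_van.inducts)
  case (bnd_base b)
  then obtain B where B: "\<And>y. y \<in> Ns \<Longrightarrow> \<bar>b (bp y)\<bar> \<le> B" using base_bounded by blast
  have "\<forall>\<^sub>F y in Fl. \<bar>b (bp y)\<bar> \<le> B" using eventually_Ns by eventually_elim (rule B)
  then show ?case by blast
next
  case bnd_inv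
  define m where "m = min d0 (D M)"
  have m: "0 < m" unfolding m_def using D0 D_pos[of M] M by simp
  have *: "\<bar>1 / D (T (inverse (rad k y)))\<bar> \<le> 1 / m" if "y \<in> Ns" for y
  proof -
    have "m \<le> D (T (inverse (rad k y)))"
      using eps T_range[OF that] unfolding m_def D_def by auto
    then show ?thesis using m by (simp add: frac_le)
  qed
  have "\<forall>\<^sub>F y in Fl. \<bar>1 / D (T (inverse (rad k y)))\<bar> \<le> 1 / m" using eventually_Ns by eventually_elim (rule *)
  then show ?case by blast
next
  case (bnd_add f g)
  then obtain B B' where "\<forall>\<^sub>F y in Fl. \<bar>f y\<bar> \<le> B" "\<forall>\<^sub>F y in Fl. \<bar>g y\<bar> \<le> B'" by blast
  then have "\<forall>\<^sub>F y in Fl. \<bar>f y + g y\<bar> \<le> B + B'" by eventually_elim linarith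
  then show ?case by blast
next
  case (bnd_mult f g)
  then obtain B B' where "\<forall>\<^sub>F y in Fl. \<bar>f y\<bar> \<le> B" "\<forall>\<^sub>F y in Fl. \<bar>g y\<bar> \<le> B'" by blast
  then have "\<forall>\<^sub>F y in Fl. \<bar>f y * g y\<bar> \<le> B * B'"
  proof eventually_elim
    case (elim y)
    have "0 \<le> B" using elim(1) by (rule order_trans[OF abs_ge_zero])
    then show ?case unfolding abs_mult by (intro mult_mono elim abs_ge_zero)
  qed
  then show ?case by blast
next
  case (bnd_van f)
  from tendstoD[OF bnd_van(2) zero_less_one] have "\<forall>\<^sub>F y in Fl. \<bar>f y\<bar> \<le> 1"
    by eventually_elim (simp add: dist_real_def)
  then show ?case by blast
next
  case (van_add f g)
  from tendsto_add[OF van_add(2,4)] show ?case by simp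
next
  case (van_mult f g)
  then obtain B where B: "\<forall>\<^sub>F y in Fl. \<bar>f y\<bar> \<le> B" by blast
  show ?case
  proof (rule Lim_null_comparison)
    show "\<forall>\<^sub>F y in Fl. norm (f y * g y) \<le> B * \<bar>g y\<bar>"
      using B by eventually_elim (simp add: abs_mult mult_right_mono)
    show "((\<lambda>y. B * \<bar>g y\<bar>) \<longlongrightarrow> 0) Fl"
      by (rule tendsto_mult_right_zero[OF tendsto_rabs_zero[OF van_mult(4)]])
  qed
next
  case (van_cong f g)
  then show ?case
    by (intro Lim_transform_eventually[OF van_cong(2)]) (use eventually_Ns in eventually_elim, simp)
qed (use q_lim dl_lim in auto)

lemma fr_simps [simp]:
  "fr y 0 v = Re (v $ 1)" "fr y (Suc 0) v = Im (v $ 1)" "fr y 2 v = Re (cz y v)" "fr y 3 v = Im (cz y v)"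
  by (simp_all add: fr_def)

lemma w_cz: "y \<in> Ns \<Longrightarrow> u $ 2 / y $ 2 = of_real (L y) * cz y u"
  using Ns_D(1,4)[of y] by (auto simp: cz_def)

lemma fd_base:
  assumes "smooth_on O1 b"
  shows "fd (\<lambda>y. b (bp y)) (\<lambda>i y. if i = 0 then frechet_derivative b (at (bp y)) (axis 1 1)
     else if i = 1 then frechet_derivative b (at (bp y)) (axis 1 \<i>) else 0)"
  unfolding fd_def
proof
  fix y assume y: "y \<in> Ns"
  note d = smooth_on_imp_has_derivative[OF assms Ns_D(2)[OF y]]
  note l = has_derivative_linear[OF d]
  have "frechet_derivative b (at (bp y)) (bp u) = frechet_derivative b (at (bp y)) (axis 1 1) * Re (u $ 1) +
     frechet_derivative b (at (bp y)) (axis 1 \<i>) * Im (u $ 1)" for u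
  proof -
    have "bp u = Re (u $ 1) *\<^sub>R axis 1 1 + Im (u $ 1) *\<^sub>R axis 1 \<i>"
      by (subst axis_expansion) (simp add: UNIV_1)
    then show ?thesis by (simp add: linear_add[OF l] linear_scale[OF l])
  qed
  with has_derivative_bp[OF d]
  show "((\<lambda>y. b (bp y)) has_derivative (\<lambda>u. \<Sum>i<4. (if i = 0 then frechet_derivative b (at (bp y)) (axis 1 1)
     else if i = 1 then frechet_derivative b (at (bp y)) (axis 1 \<i>) else 0) * fr y i u)) (at y)"
    by (simp add: sum4)
qed

lemma fd_add:
  assumes "fd f d" "fd g d'"
  shows "fd (\<lambda>y. f y + g y) (\<lambda>b y. d b y + d' b y)"
  unfolding fd_def
proof
  fix y assume "y \<in> Ns"
  with assms have d: "(f has_derivative (\<lambda>u. \<Sum>b<4. d b y * fr y b u)) (at y)"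
    "(g has_derivative (\<lambda>u. \<Sum>b<4. d' b y * fr y b u)) (at y)" unfolding fd_def by simp_all
  show "((\<lambda>y. f y + g y) has_derivative (\<lambda>u. \<Sum>b<4. (d b y + d' b y) * fr y b u)) (at y)"
    by (rule has_derivative_eq_rhs[OF has_derivative_add[OF d]]) (simp add: sum.distrib distrib_right)
qed

lemma fd_mult:
  assumes "fd f d" "fd g d'"
  shows "fd (\<lambda>y. f y * g y) (\<lambda>b y. f y * d' b y + d b y * g y)"
  unfolding fd_def
proof
  fix y assume "y \<in> Ns"
  with assms have d: "(f has_derivative (\<lambda>u. \<Sum>b<4. d b y * fr y b u)) (at y)"
    "(g has_derivative (\<lambda>u. \<Sum>b<4. d' b y * fr y b u)) (at y)" unfolding fd_def by simp_all
  show "((\<lambda>y. f y * g y) has_derivative (\<lambda>u. \<Sum>b<4. (f y * d' b y + d b y * g y) * fr y b u)) (at y)"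
    by (rule has_derivative_eq_rhs[OF has_derivative_mult[OF d]], rule ext) (simp add: sum4 algebra_simps)
qed

lemma fd_cong: 
  assumes "fd f d" "\<And>y. y \<in> Ns \<Longrightarrow> g y = f y" 
  shows "fd g d"
  unfolding fd_def
proof
  fix y assume y: "y \<in> Ns"
  with assms(1) have "(f has_derivative (\<lambda>u. \<Sum>b<4. d b y * fr y b u)) (at y)" by (simp add: fd_def)
  then show "(g has_derivative (\<lambda>u. \<Sum>b<4. d b y * fr y b u)) (at y)"
    by (rule has_derivative_transform_within_open[OF _ open_Ns y]) (simp add: assms(2))
qed

definition Re_k where "Re_k y = Re (kz k (bp y))"
definition Im_k where "Im_k y = Im (kz k (bp y))"

lemma bnd_k: "bnd Re_k" "bnd Im_k"
  unfolding Re_k_def[abs_def] Im_k_def[abs_def]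
  by (rule bnd_base[OF smooth_on_Re[OF smooth_kz]], rule bnd_base[OF smooth_on_Im[OF smooth_kz]])

lemma L_derivative: "y \<in> Ns \<Longrightarrow> (L has_derivative (\<lambda>u. L y * Re (cz y u))) (at y)"
proof -
  assume y: "y \<in> Ns"
  note w = Ns_D(1)[OF y]
  have "((\<lambda>y::complex^2. y $ 2) has_derivative (\<lambda>u. u $ 2)) (at y)"
    by (rule bounded_linear_imp_has_derivative[OF bounded_linear_vec_nth])
  from has_derivative_compose[OF this has_derivative_norm[OF w]]
  have "((\<lambda>y::complex^2. cmod (y $ 2)) has_derivative (\<lambda>u. u $ 2 \<bullet> sgn (y $ 2))) (at y)" .
  from has_derivative_ln[OF _ this] w
  have d: "(L has_derivative (\<lambda>u. (u $ 2 \<bullet> sgn (y $ 2)) * inverse (cmod (y $ 2)))) (at y)"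
    unfolding L_def[abs_def] by simp
  have "(u $ 2 \<bullet> sgn (y $ 2)) * inverse (cmod (y $ 2)) = Re (u $ 2 / y $ 2)" for u :: "complex^2"
  proof -
    have "(u $ 2 \<bullet> sgn (y $ 2)) * inverse (cmod (y $ 2)) =
       (Re (u $ 2) * Re (y $ 2) + Im (u $ 2) * Im (y $ 2)) * (inverse (cmod (y $ 2)) * inverse (cmod (y $ 2)))"
      by (simp add: sgn_div_norm inner_complex_def algebra_simps)
    also have "inverse (cmod (y $ 2)) * inverse (cmod (y $ 2)) = inverse ((Re (y $ 2))\<^sup>2 + (Im (y $ 2))\<^sup>2)"
      unfolding cmod_power2[symmetric] by (simp add: power2_eq_square)
    finally show ?thesis by (simp add: Re_divide divide_inverse algebra_simps)
  qed
  then show ?thesis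
    by (intro has_derivative_eq_rhs[OF d] ext) (simp add: w_cz[OF y])
qed

text \<open>The bounded factor in \<open>Q / D = q\<^sup>2 * ell\<close>.\<close>

definition ell where "ell y = T (inverse (rad k y)) * (p0 + p1 * T (inverse (rad k y))) * (1 / D (T (inverse (rad k y))))"

lemma bnd_T: "bnd (\<lambda>y. T (inverse (rad k y)))"
proof -
  have "bnd (\<lambda>y. M + -1 * q y)" by (intro bnd_add bnd_mult bnd_const bnd_van van_q)
  then show ?thesis by (simp add: q_def)
qed

lemma bnd_ell: "bnd ell"
  unfolding ell_def[abs_def] by (intro bnd_mult bnd_add bnd_T bnd_const bnd_inv)

text \<open>The equation turns \<open>2 * r * X'\<close> into \<open>- q\<^sup>2 * ell\<close>, and
  the bracket is the real part of \<open>vcov / w\<close>, rewritten with \<open>kz\<close> and the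
  frame covector \<open>cz\<close>.\<close>

lemma q_derivative:
  assumes y: "y \<in> Ns"
  shows "(q has_derivative (\<lambda>u. (q y)\<^sup>2 * ell y * (Re_k y * Re (u $ 1) - Im_k y * Im (u $ 1) + L y * Re (cz y u)))) (at y)"
proof -
  let ?r = "rad k y" and ?X = "\<lambda>r. T (inverse r)"
  have r: "?r \<in> {0<..}" using Ns_D(5)[OF y] by simp
  have "(?X has_derivative (*) (deriv ?X ?r)) (at ?r)"
    using cusp.dX[OF r] by (simp add: has_field_derivative_def)
  from has_derivative_compose[where g = ?X, OF derivative_rad[OF Ns_D(3)[OF y]] this]
  have "((\<lambda>y. M - T (inverse (rad k y))) has_derivative
     (\<lambda>u. 0 - deriv ?X ?r * (2 * exp (k (bp y)) * Re (cnj (y $ 2) * vcov k y u)))) (at y)"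
    by (intro has_derivative_diff has_derivative_const)
  moreover have "0 - deriv ?X ?r * (2 * exp (k (bp y)) * Re (cnj (y $ 2) * vcov k y u)) =
     (q y)\<^sup>2 * ell y * (Re_k y * Re (u $ 1) - Im_k y * Im (u $ 1) + L y * Re (cz y u))" for u
  proof -
    have 1: "vcov k y u = y $ 2 * (kz k (bp y) * u $ 1 + of_real (L y) * cz y u)"
      unfolding vcov_def w_cz[OF y, symmetric] using Ns_D(1)[OF y] by (simp add: field_simps)
    have 2: "cnj (y $ 2) * vcov k y u = of_real ((cmod (y $ 2))\<^sup>2) * (kz k (bp y) * u $ 1 + of_real (L y) * cz y u)"
      unfolding 1 complex_norm_square by (simp add: mult_ac)
    have "- deriv ?X ?r * (2 * exp (k (bp y)) * Re (cnj (y $ 2) * vcov k y u)) =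
      - (2 * ?r * deriv ?X ?r) * Re (kz k (bp y) * u $ 1 + of_real (L y) * cz y u)"
      unfolding 2 Re_complex_of_real times_complex.simps by (simp add: rad_def)
    also have "- (2 * ?r * deriv ?X ?r) = (q y)\<^sup>2 * ell y"
      using cusp.ode[OF r] cusp.DX[OF r] unfolding q_def ell_def Q_def P_def by (simp add: field_simps)
    finally show ?thesis by (simp add: Re_k_def Im_k_def)
  qed
  ultimately show ?thesis by (simp add: q_def[abs_def])
qed

text \<open>The only unbounded coefficient in the frame derivatives is \<open>L\<close>, and it
  always comes multiplied by \<open>q\<close>. This identity makes it disappear.\<close>

lemma qL: "q y * L y = dl y - 1 / C"
  by (simp add: dl_def mult.commute)

lemma fd_q: "fd q (\<lambda>b y. if b = 0 then q y * q y * ell y * Re_k y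
    else if b = 1 then - (q y * q y * ell y * Im_k y)
    else if b = 2 then q y * ell y * (dl y - 1 / C) else 0)"
  unfolding fd_def
proof
  fix y assume "y \<in> Ns"
  note d = q_derivative[OF this]
  show "(q has_derivative (\<lambda>u. \<Sum>b<4. (if b = 0 then q y * q y * ell y * Re_k y
    else if b = 1 then - (q y * q y * ell y * Im_k y)
    else if b = 2 then q y * ell y * (dl y - 1 / C) else 0) * fr y b u)) (at y)"
    by (rule has_derivative_eq_rhs[OF d]) (simp add: sum4 power2_eq_square algebra_simps flip: qL)
qed

text \<open>The derivative of \<open>q * L\<close> along the real part of \<open>cz\<close> is
  \<open>q * L * (1 + q * L * ell)\<close>. It vanishes in the limit because \<open>q * L\<close>
  tends to \<open>- 1 / C\<close> and \<open>ell\<close> to \<open>C\<close>.\<close>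

lemma fd_dl: "fd dl (\<lambda>b y. if b = 0 then q y * (dl y - 1 / C) * ell y * Re_k y
    else if b = 1 then - (q y * (dl y - 1 / C) * ell y * Im_k y)
    else if b = 2 then (dl y - 1 / C) * ((dl y - 1 / C) * ell y + 1) else 0)"
  unfolding fd_def
proof
  fix y assume y: "y \<in> Ns"
  note d = has_derivative_add[OF has_derivative_mult[OF L_derivative[OF y] q_derivative[OF y]] has_derivative_const]
  show "(dl has_derivative (\<lambda>u. \<Sum>b<4. (if b = 0 then q y * (dl y - 1 / C) * ell y * Re_k y
    else if b = 1 then - (q y * (dl y - 1 / C) * ell y * Im_k y)
    else if b = 2 then (dl y - 1 / C) * ((dl y - 1 / C) * ell y + 1) else 0) * fr y b u)) (at y)"
    unfolding dl_def[abs_def]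
    by (rule has_derivative_eq_rhs[OF d[of "1 / C"]], rule ext)
      (simp add: sum4 power2_eq_square algebra_simps)
qed

lemma van_neg: "van f \<Longrightarrow> van (\<lambda>y. - f y)"
  using van_mult[OF bnd_const[of "-1"], of f] by simp

lemma van_zero: "van (\<lambda>y. 0)"
  using van_mult[OF bnd_const[of 0] van_q] by simp

lemma van_mult2: "van f \<Longrightarrow> bnd g \<Longrightarrow> van (\<lambda>y. f y * g y)"
  using van_mult[of g f] by (simp add: mult.commute)

lemma bnd_minus: "bnd f \<Longrightarrow> bnd g \<Longrightarrow> bnd (\<lambda>y. f y - g y)"
  using bnd_add[OF _ bnd_mult[OF bnd_const[of "-1"]], of f g] by simp

text \<open>The constant \<open>C\<close> is the value of \<open>ell\<close> at \<open>q = 0\<close>.\<close>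

lemma van_ell: "van (\<lambda>y. 1 - ell y / C)"
proof (rule van_cong)
  let ?X = "\<lambda>y. T (inverse (rad k y))"
  \<comment> \<open>Over a common denominator the numerator of \<open>1 - ell / C\<close> is
    \<open>M * (p0 + p1 * M) * D X - D M * X * (p0 + p1 * X)\<close>, which is zero at
    \<open>X = M\<close>. The long factor is the quotient by \<open>M - X\<close>.\<close>
  show "van (\<lambda>y. q y * ((1 / D (?X y)) * ((p0 * d0 + p1 * d0 * (M + ?X y) + eps * p1 * M * ?X y) * (1 / (M * (p0 + p1 * M))))))"
    by (intro van_mult2 van_q bnd_mult bnd_add bnd_T bnd_const bnd_inv)
  fix y assume y: "y \<in> Ns"
  have "D (?X y) \<noteq> 0" using sol(6)[OF T_range(3)[OF y]] by simp
  moreover have "M * (p0 + p1 * M) \<noteq> 0" "D M \<noteq> 0" using M strict D_pos[of M] by auto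
  ultimately show "1 - ell y / C = q y * ((1 / D (?X y)) * ((p0 * d0 + p1 * d0 * (M + ?X y) + eps * p1 * M * ?X y) * (1 / (M * (p0 + p1 * M)))))"
    unfolding ell_def C_def q_def
    by (simp add: divide_simps) (simp add: D_def algebra_simps)
qed

lemma van_dl2: "van (\<lambda>y. (dl y - 1 / C) * ell y + 1)"
proof -
  have "van (\<lambda>y. dl y * ell y + (1 - ell y / C))" by (intro van_add van_mult2 van_dl bnd_ell van_ell)
  then show ?thesis by (simp add: algebra_simps)
qed

lemma frame_derivatives:
  "bnd f \<Longrightarrow> \<exists>d. fd f d \<and> (\<forall>b<4. bnd (d b))"
  "van g \<Longrightarrow> \<exists>d. fd g d \<and> (\<forall>b<4. van (d b))"
proof (induction rule: bnd_van.inducts)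
  case (bnd_base b)
  let ?d = "\<lambda>i y. if i = (0::nat) then frechet_derivative b (at (bp y)) (axis 1 1)
     else if i = 1 then frechet_derivative b (at (bp y)) (axis 1 \<i>) else 0"
  have "bnd (?d i)" for i
  proof -
    have "bnd (\<lambda>y. frechet_derivative b (at (bp y)) v)" for v
      by (rule bnd_van.bnd_base[OF smooth_on_frechet_derivative[OF open_O1 bnd_base]])
    then show ?thesis using bnd_const[of 0] by (cases "i = 0"; cases "i = 1"; simp)
  qed
  with fd_base[OF bnd_base] show ?case by blast
next
  case bnd_inv
  let ?R = "\<lambda>y. 1 / D (T (inverse (rad k y)))"
  let ?d = "\<lambda>b y. if b = (0::nat) then q y * q y * ell y * Re_k y
    else if b = 1 then - (q y * q y * ell y * Im_k y)
    else if b = 2 then q y * ell y * (dl y - 1 / C) else 0"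
  have "fd ?R (\<lambda>b y. eps * (?R y * ?R y) * ?d b y)"
    unfolding fd_def
  proof
    fix y assume y: "y \<in> Ns"
    have D: "D (T (inverse (rad k y))) \<noteq> 0" using sol(6)[OF T_range(3)[OF y]] by simp
    have q: "(q has_derivative (\<lambda>u. \<Sum>b<4. ?d b y * fr y b u)) (at y)" using fd_q y unfolding fd_def by blast
    \<comment> \<open>As a function of \<open>q\<close> alone, the reciprocal of \<open>D\<close>
      inherits its frame derivatives from \<open>fd_q\<close>.\<close>
    have R: "?R = (\<lambda>y. inverse (D (M - q y)))" by (rule ext) (simp add: q_def divide_inverse)
    have "((\<lambda>z. inverse (D (M - z))) has_real_derivative eps * (?R y * ?R y)) (at (q y))"
      unfolding D_def by (rule derivative_eq_intros refl)+
        (use D in \<open>simp_all add: q_def D_def divide_inverse power2_eq_square\<close>)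
    then have "((\<lambda>z. inverse (D (M - z))) has_derivative (*) (eps * (?R y * ?R y))) (at (q y))"
      by (simp add: has_field_derivative_def)
    from has_derivative_compose[where g = "\<lambda>z. inverse (D (M - z))", OF q this]
    show "(?R has_derivative (\<lambda>u. \<Sum>b<4. eps * (?R y * ?R y) * ?d b y * fr y b u)) (at y)"
      unfolding R by (simp only: sum_distrib_left mult.assoc)
  qed
  moreover have "bnd (\<lambda>y. eps * (?R y * ?R y) * ?d b y)" for b
  proof -
    have "bnd (?d b)"
      using bnd_const[of 0] bnd_van[OF van_neg[OF van_mult2[OF van_mult2[OF van_mult[OF bnd_van[OF van_q] van_q] bnd_ell] bnd_k(2)]]]
        bnd_van[OF van_mult2[OF van_mult2[OF van_mult[OF bnd_van[OF van_q] van_q] bnd_ell] bnd_k(1)]]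
        bnd_van[OF van_mult2[OF van_mult2[OF van_q bnd_ell] bnd_minus[OF bnd_van[OF van_dl] bnd_const]], of "1 / C"]
      by (cases "b = 0"; cases "b = 1"; cases "b = 2"; simp)
    then show ?thesis by (intro bnd_mult bnd_const bnd_van.bnd_inv)
  qed
  ultimately show ?case by blast
next
  case (bnd_add f g)
  then obtain d d' where "fd f d" "\<forall>b<4. bnd (d b)" "fd g d'" "\<forall>b<4. bnd (d' b)" by blast
  then show ?case
    by (intro exI[of _ "\<lambda>b y. d b y + d' b y"] conjI fd_add allI impI bnd_van.bnd_add) auto
next
  case (bnd_mult f g)
  then obtain d d' where "fd f d" "\<forall>b<4. bnd (d b)" "fd g d'" "\<forall>b<4. bnd (d' b)" by blast
  with bnd_mult(1,3) show ?case
    by (intro exI[of _ "\<lambda>b y. f y * d' b y + d b y * g y"] conjI fd_mult allI impI bnd_van.bnd_add bnd_van.bnd_mult) auto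
next
  case (bnd_van f)
  then show ?case using bnd_van.bnd_van by blast
next
  case van_q
  have "van (\<lambda>y. if b = (0::nat) then q y * q y * ell y * Re_k y
    else if b = 1 then - (q y * q y * ell y * Im_k y)
    else if b = 2 then q y * ell y * (dl y - 1 / C) else 0)" for b
    using van_zero van_neg[OF van_mult2[OF van_mult2[OF van_mult[OF bnd_van[OF bnd_van.van_q] bnd_van.van_q] bnd_ell] bnd_k(2)]]
        van_mult2[OF van_mult2[OF van_mult[OF bnd_van[OF bnd_van.van_q] bnd_van.van_q] bnd_ell] bnd_k(1)]
        van_mult2[OF van_mult2[OF bnd_van.van_q bnd_ell] bnd_minus[OF bnd_van[OF van_dl] bnd_const], of "1 / C"]
      by (cases "b = 0"; cases "b = 1"; cases "b = 2"; simp)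
  with fd_q show ?case by blast
next
  case van_dl
  have b: "bnd (\<lambda>y. dl y - 1 / C)" by (rule bnd_minus[OF bnd_van[OF bnd_van.van_dl] bnd_const])
  have "van (\<lambda>y. if b = (0::nat) then q y * (dl y - 1 / C) * ell y * Re_k y
    else if b = 1 then - (q y * (dl y - 1 / C) * ell y * Im_k y)
    else if b = 2 then (dl y - 1 / C) * ((dl y - 1 / C) * ell y + 1) else 0)" for b
    using van_zero van_neg[OF van_mult2[OF van_mult2[OF van_mult2[OF van_q b] bnd_ell] bnd_k(2)]]
        van_mult2[OF van_mult2[OF van_mult2[OF van_q b] bnd_ell] bnd_k(1)]
        van_mult[OF b van_dl2]
      by (cases "b = 0"; cases "b = 1"; cases "b = 2"; simp)
  with fd_dl show ?case by blast
next
  case (van_add f g)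
  then obtain d d' where "fd f d" "\<forall>b<4. van (d b)" "fd g d'" "\<forall>b<4. van (d' b)" by blast
  then show ?case
    by (intro exI[of _ "\<lambda>b y. d b y + d' b y"] conjI fd_add allI impI bnd_van.van_add) auto
next
  case (van_mult f g)
  then obtain d d' where "fd f d" "\<forall>b<4. bnd (d b)" "fd g d'" "\<forall>b<4. van (d' b)" by blast
  with van_mult(1,3) show ?case
    by (intro exI[of _ "\<lambda>b y. f y * d' b y + d b y * g y"] conjI fd_mult allI impI bnd_van.van_add
      bnd_van.van_mult van_mult2) auto
next
  case (van_cong f g)
  then obtain d where "fd f d" "\<forall>b<4. van (d b)" by blast
  moreover have "fd g d" by (rule fd_cong[OF \<open>fd f d\<close>]) (rule van_cong(3))
  ultimately show ?case by blast
qed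

end

text \<open>The Koszul expression of a metric \<open>E * \<bar>dz\<bar>\<^sup>2\<close> in one
  complex variable, with \<open>m = \<partial> ln E\<close>: the three terms combine into the
  complex product \<open>m * u * v\<close>, so the Christoffel map is complex bilinear.\<close>

lemma conformal_koszul:
  "Re (m * u) * Re (v * cnj w) + Re (m * v) * Re (u * cnj w) - Re (m * w) * Re (u * cnj v) = Re (m * u * v * cnj w)"
  by (simp add: algebra_simps)

lemma Re_mult_cnj_self: "Re (z * cnj z) = (cmod z)\<^sup>2"
  using cmod_power2[of z] by (simp add: power2_eq_square)

lemma Re_of_real_mult: "Re (of_real c * z) = c * Re z"
  by simp

text \<open>\<open>tensor_norm\<close> sums over an unspecified orthonormal basis; a bound on the
  number of its elements makes the estimates independent of the choice.\<close>

lemma orthonormal_card: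
  fixes g :: "'e::euclidean_space \<Rightarrow> 'e \<Rightarrow> real"
  assumes B: "orthonormal_basis g B" and lin: "\<And>v. linear (\<lambda>u. g u v)"
  shows "finite B" "card B \<le> DIM('e)"
proof -
  show fin: "finite B" using B by (simp add: orthonormal_basis_def)
  have "independent B"
  proof (rule independent_if_scalars_zero[OF fin])
    fix f and v assume 0: "(\<Sum>x\<in>B. f x *\<^sub>R x) = 0" and v: "v \<in> B"
    have "0 = g (\<Sum>x\<in>B. f x *\<^sub>R x) v" unfolding 0 using linear_0[OF lin] by simp
    also have "\<dots> = (\<Sum>x\<in>B. f x * g x v)"
      by (simp add: linear_sum[OF lin] linear_scale[OF lin])
    also have "\<dots> = (\<Sum>x\<in>B. if x = v then f v else 0)"
      using B v by (intro sum.cong) (auto simp: orthonormal_basis_def)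
    also have "\<dots> = f v" using fin v by simp
    finally show "f v = 0" by simp
  qed
  then show "card B \<le> DIM('e)" using independent_bound by blast
qed

section \<open>The Levi-Civita connection of the model and decay of all covariant
  derivatives\<close>

context cusp_chart
begin

definition lE where "lE x = ln (En x)"
definition cE where "cE y = kz lE (bp y)"
text \<open>This is \<open>\<partial> ln G\<close>, the Christoffel coefficient of the hyperbolic
  factor, as \<open>cE\<close> is that of the base factor.\<close>

definition cG where "cG y = - (1 + 1 / of_real (L y)) / y $ 2"
definition G where "G y = kap / C / (cmod (y $ 2) * ln (cmod (y $ 2)))\<^sup>2"
definition Gam :: "complex^2 \<Rightarrow> complex^2 \<Rightarrow> complex^2 \<Rightarrow> complex^2"
  where "Gam y u v = vector [cE y * u $ 1 * v $ 1, cG y * u $ 2 * v $ 2]"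

lemma En_pos: "x \<in> O1 \<Longrightarrow> 0 < En x"
  unfolding En_def using kap D_pos[of M] M apos by simp

lemma smooth_En: "smooth_on O1 En"
  unfolding En_def[abs_def] by (intro smooth_on_mult smooth_on_const sma)

lemma smooth_lE: "smooth_on O1 lE"
  unfolding lE_def[abs_def] by (rule smooth_on_comp_real[OF _ smooth_on_ln[OF order.refl] smooth_En]) (use En_pos in auto)

lemma G_pos: "y \<in> Ns \<Longrightarrow> 0 < G y"
  unfolding G_def using kap C_pos Ns_D(1,4)[of y] by (simp add: L_def)

lemma En_derivative:
  assumes y: "y \<in> Ns"
  shows "((\<lambda>y. En (bp y)) has_derivative (\<lambda>u. 2 * En (bp y) * Re (cE y * u $ 1))) (at y)"
proof -
  note x = Ns_D(2)[OF y]
  note d = smooth_on_imp_has_derivative[OF smooth_lE x]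
  have "((\<lambda>x. exp (lE x)) has_derivative (\<lambda>v. frechet_derivative lE (at (bp y)) v * exp (lE (bp y)))) (at (bp y))"
    using has_derivative_exp[OF d] by simp
  then have "(En has_derivative (\<lambda>v. frechet_derivative lE (at (bp y)) v * exp (lE (bp y)))) (at (bp y))"
    by (rule has_derivative_transform_within_open[OF _ open_O1 x]) (simp add: lE_def En_pos)
  from has_derivative_bp[OF this] show ?thesis
    by (rule has_derivative_eq_rhs)
      (use En_pos[OF x] in \<open>simp add: fun_eq_iff real_derivative_d_z[OF d] cE_def kz_def lE_def\<close>)
qed

lemma dL_w: "y \<in> Ns \<Longrightarrow> L y * Re (cz y u) = Re (u $ 2 / y $ 2)"
  by (simp add: w_cz)

lemma G_derivative:
  assumes y: "y \<in> Ns"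
  shows "(G has_derivative (\<lambda>u. 2 * G y * Re (cG y * u $ 2))) (at y)"
proof -
  let ?h = "\<lambda>y. exp (L y) * L y"
  have G: "G x = kap / C * inverse (?h x * ?h x)" if "x \<in> Ns" for x
    using Ns_D(1)[OF that] by (simp add: G_def L_def power2_eq_square divide_inverse)
  have hnz: "?h y \<noteq> 0" using Ns_D(4)[OF y] by simp
  note dL = L_derivative[OF y]
  note dh = has_derivative_mult[OF has_derivative_exp[OF dL] dL]
  have nz: "?h y * ?h y \<noteq> 0" using hnz by simp
  from has_derivative_mult[OF has_derivative_const Deriv.has_derivative_inverse[OF nz has_derivative_mult[OF dh dh]], of "kap / C"]
  have "((\<lambda>x. kap / C * inverse (?h x * ?h x)) has_derivative (\<lambda>u. 2 * G y * Re (cG y * u $ 2))) (at y)"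
  proof (rule has_derivative_eq_rhs, intro ext)
    fix u
    let ?r = "L y * Re (cz y u)"
    have r: "Re (cG y * u $ 2) = - (1 + 1 / L y) * ?r"
    proof -
      have "cG y * u $ 2 = of_real (- (1 + 1 / L y)) * (u $ 2 / y $ 2)" by (simp add: cG_def)
      then show ?thesis unfolding dL_w[OF y] by (simp only: Re_of_real_mult)
    qed
    show "kap / C * - (inverse (?h y * ?h y) * (?h y * (exp (L y) * ?r + ?r * exp (L y) * L y) +
       (exp (L y) * ?r + ?r * exp (L y) * L y) * ?h y) * inverse (?h y * ?h y)) + 0 * inverse (?h y * ?h y) = 2 * G y * Re (cG y * u $ 2)"
      unfolding r G[OF y] using less_imp_neq[OF Ns_D(4)[OF y]] less_imp_neq[OF C_pos] by (simp add: field_simps)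
  qed
  then show ?thesis
    by (rule has_derivative_transform_within_open[OF _ open_Ns y]) (simp add: G)
qed

lemma g0_eq: "g0 y u v = G y * Re (u $ 2 * cnj (v $ 2)) + En (bp y) * Re (u $ 1 * cnj (v $ 1))"
  by (simp add: g0_def G_def)

lemma g0_derivative:
  assumes y: "y \<in> Ns"
  shows "frechet_derivative (\<lambda>y. g0 y v w) (at y) u = 2 * G y * Re (cG y * u $ 2) * Re (v $ 2 * cnj (w $ 2)) +
    2 * En (bp y) * Re (cE y * u $ 1) * Re (v $ 1 * cnj (w $ 1))"
proof -
  have "((\<lambda>y. g0 y v w) has_derivative (\<lambda>u. 2 * G y * Re (cG y * u $ 2) * Re (v $ 2 * cnj (w $ 2)) +
    2 * En (bp y) * Re (cE y * u $ 1) * Re (v $ 1 * cnj (w $ 1)))) (at y)"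
    unfolding g0_eq
    by (intro has_derivative_add has_derivative_mult_left G_derivative[OF y] En_derivative[OF y])
  from fun_cong[OF frechet_derivative_at[OF this], of u] show ?thesis by simp
qed

lemma g0_bilinear: "g0 y (u - u') v = g0 y u v - g0 y u' v" "g0 y (u + u') v = g0 y u v + g0 y u' v"
  "g0 y (c *\<^sub>R u) v = c * g0 y u v" "g0 y v u = g0 y u v"
  by (simp_all add: g0_eq algebra_simps)

lemma g0_self: "g0 y u u = G y * (cmod (u $ 2))\<^sup>2 + En (bp y) * (cmod (u $ 1))\<^sup>2"
  by (simp only: g0_eq Re_mult_cnj_self)

lemma g0_definite:
  assumes "y \<in> Ns" "g0 y u u = 0" shows "u = 0"
proof -
  have "0 \<le> G y * (cmod (u $ 2))\<^sup>2" "0 \<le> En (bp y) * (cmod (u $ 1))\<^sup>2"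
    using G_pos En_pos Ns_D(2) assms(1) by (simp_all add: less_imp_le)
  then have "G y * (cmod (u $ 2))\<^sup>2 = 0" "En (bp y) * (cmod (u $ 1))\<^sup>2 = 0"
    using assms(2) unfolding g0_self by linarith+
  then show ?thesis using G_pos[OF assms(1)] En_pos[OF Ns_D(2)[OF assms(1)]]
    by (auto simp: vec_eq_iff forall_2)
qed

text \<open>In these coordinates the model is a product: \<open>En\<close> depends on the base point
  only and \<open>G\<close> on \<open>w\<close> only. Each factor is conformal to the flat metric of
  a line, so \<open>conformal_koszul\<close> applies to both; definiteness of \<open>g0\<close>
  gives uniqueness.\<close>

lemma christoffel_g0:
  assumes y: "y \<in> Ns"
  shows "christoffel g0 y u v = Gam y u v"
  unfolding christoffel_def
proof (rule the_equality)
  show *: "\<forall>w. g0 y (Gam y u v) w = (frechet_derivative (\<lambda>y. g0 y v w) (at y) u +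
      frechet_derivative (\<lambda>y. g0 y u w) (at y) v - frechet_derivative (\<lambda>y. g0 y u v) (at y) w) / 2"
  proof
    fix w
    have "(frechet_derivative (\<lambda>y. g0 y v w) (at y) u +
      frechet_derivative (\<lambda>y. g0 y u w) (at y) v - frechet_derivative (\<lambda>y. g0 y u v) (at y) w) / 2 =
      G y * (Re (cG y * u $ 2) * Re (v $ 2 * cnj (w $ 2)) + Re (cG y * v $ 2) * Re (u $ 2 * cnj (w $ 2)) -
         Re (cG y * w $ 2) * Re (u $ 2 * cnj (v $ 2))) +
      En (bp y) * (Re (cE y * u $ 1) * Re (v $ 1 * cnj (w $ 1)) + Re (cE y * v $ 1) * Re (u $ 1 * cnj (w $ 1)) -
         Re (cE y * w $ 1) * Re (u $ 1 * cnj (v $ 1)))"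
      unfolding g0_derivative[OF y] by (simp only: distrib_left right_diff_distrib) (simp add: field_simps)
    also have "\<dots> = g0 y (Gam y u v) w"
      unfolding conformal_koszul g0_eq Gam_def by simp
    finally show "g0 y (Gam y u v) w = (frechet_derivative (\<lambda>y. g0 y v w) (at y) u +
      frechet_derivative (\<lambda>y. g0 y u w) (at y) v - frechet_derivative (\<lambda>y. g0 y u v) (at y) w) / 2" ..
  qed
  fix z assume "\<forall>w. g0 y z w = (frechet_derivative (\<lambda>y. g0 y v w) (at y) u +
      frechet_derivative (\<lambda>y. g0 y u w) (at y) v - frechet_derivative (\<lambda>y. g0 y u v) (at y) w) / 2"
  with * have "g0 y z w = g0 y (Gam y u v) w" for w by metis
  then have "g0 y (z - Gam y u v) (z - Gam y u v) = 0" by (simp add: g0_bilinear(1))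
  from g0_definite[OF y this] show "z = Gam y u v" by simp
qed

text \<open>Connection coefficients of the frame: the covariant derivative of the \<open>b\<close>-th covector is
  \<open>\<Sum> om b c d * fr c * fr d\<close>.\<close>

definition om :: "nat \<Rightarrow> nat \<Rightarrow> nat \<Rightarrow> complex^2 \<Rightarrow> real" where
  "om b c d y =
   (if b = 0 then (if c = 0 \<and> d = 0 then - Re (cE y) else if c = 1 \<and> d = 1 then Re (cE y)
      else if c = 0 \<and> d = 1 \<or> c = 1 \<and> d = 0 then Im (cE y) else 0)
    else if b = 1 then (if c = 0 \<and> d = 0 then - Im (cE y) else if c = 1 \<and> d = 1 then Im (cE y)
      else if c = 0 \<and> d = 1 \<or> c = 1 \<and> d = 0 then - Re (cE y) else 0)
    else if b = 2 then (if c = 3 \<and> d = 3 then -1 else 0)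
    else (if c = 3 \<and> d = 2 then 1 else 0))"

lemma bnd_if: "bnd f \<Longrightarrow> bnd g \<Longrightarrow> bnd (\<lambda>y. if R then f y else g y)"
  by (cases R) simp_all

lemma bnd_om: "bnd (om b c d)"
proof -
  have sm: "smooth_on O1 (kz lE)"
    unfolding kz_def by (intro smooth_on_d_z open_O1 smooth_on_of_real smooth_lE)
  have 1: "bnd (\<lambda>y. Re (cE y))" "bnd (\<lambda>y. Im (cE y))" unfolding cE_def
    by (rule bnd_base[OF smooth_on_Re[OF sm]], rule bnd_base[OF smooth_on_Im[OF sm]])
  have 2: "bnd (\<lambda>y. - Re (cE y))" "bnd (\<lambda>y. - Im (cE y))"
    using bnd_mult[OF bnd_const[of "-1"] 1(1)] bnd_mult[OF bnd_const[of "-1"] 1(2)] by simp_all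
  show ?thesis unfolding om_def[abs_def] by (intro bnd_if bnd_const 1 2)
qed

text \<open>The unbounded part of the derivative of \<open>cz\<close> is exactly the one produced by
  the Christoffel map. What is left is \<open>\<i> * Im (cz u) * cz v\<close>, with constant
  coefficients in the frame.\<close>

lemma fr_derivative:
  assumes y: "y \<in> Ns" and b: "b < 4"
  shows "((\<lambda>y. fr y b v) has_derivative (\<lambda>u. fr y b (Gam y u v) + (\<Sum>c<4. \<Sum>d<4. om b c d y * fr y c u * fr y d v))) (at y)"
proof -
  have b4: "b = 0 \<or> b = 1 \<or> b = 2 \<or> b = 3" using b by auto
  let ?w = "\<lambda>x::complex^2. x $ 2"
  have dw: "(?w has_derivative (\<lambda>u. u $ 2)) (at y)"
    by (rule bounded_linear_imp_has_derivative[OF bounded_linear_vec_nth])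
  have nz: "y $ 2 * of_real (L y) \<noteq> 0" using Ns_D(1,4)[OF y] by simp
  have cz: "((\<lambda>x. cz x v) has_derivative (\<lambda>u. cz y (Gam y u v) + \<i> * of_real (Im (cz y u)) * cz y v)) (at y)"
  proof -
    note d = has_derivative_mult_right[OF Deriv.has_derivative_inverse[OF nz
          has_derivative_mult[OF dw has_derivative_of_real_comp[OF L_derivative[OF y]]]], of "v $ 2"]
    show ?thesis unfolding cz_def[of _ v] divide_inverse
    proof (rule has_derivative_eq_rhs[OF d], rule ext)
      fix u
      let ?c = "cz y u" and ?L = "complex_of_real (L y)" and ?w = "y $ 2"
      have L: "?L \<noteq> 0" "?w \<noteq> 0" using nz by auto
      have u: "u $ 2 = ?w * ?L * ?c" using L by (simp add: cz_def)
      have g: "Gam y u v $ 2 = - (1 + 1 / ?L) / ?w * (?w * ?L * ?c) * v $ 2"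
        unfolding Gam_def cG_def by (simp add: u)
      \<comment> \<open>Replaces the imaginary part so that its real part cancels the derivative of
        \<open>L\<close>; the rest is a rational identity in \<open>w\<close>, \<open>L\<close> and
        \<open>cz\<close>.\<close>
      have im: "\<i> * of_real (Im ?c) = ?c - of_real (Re ?c)"
        by (simp add: complex_eq_iff)
      show "v $ 2 * - (inverse (?w * ?L) * (?w * of_real (L y * Re ?c) + u $ 2 * ?L) * inverse (?w * ?L)) =
        cz y (Gam y u v) + \<i> * of_real (Im ?c) * (v $ 2 * inverse (?w * ?L))"
        unfolding im cz_def[of y "Gam y u v"] g unfolding u
        using L by (simp add: field_simps)
    qed
  qed
  have ReIm: "Re (\<i> * of_real (Im (cz y u)) * cz y v) = - Im (cz y u) * Im (cz y v)"
    "Im (\<i> * of_real (Im (cz y u)) * cz y v) = Im (cz y u) * Re (cz y v)" for u by simp_all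
  have c2: "((\<lambda>x. Re (cz x v)) has_derivative (\<lambda>u. Re (cz y (Gam y u v)) - Im (cz y u) * Im (cz y v))) (at y)"
    by (rule has_derivative_eq_rhs[OF bounded_linear.has_derivative[OF bounded_linear_Re cz]])
      (simp add: ReIm fun_eq_iff)
  have c3: "((\<lambda>x. Im (cz x v)) has_derivative (\<lambda>u. Im (cz y (Gam y u v)) + Im (cz y u) * Re (cz y v))) (at y)"
    by (rule has_derivative_eq_rhs[OF bounded_linear.has_derivative[OF bounded_linear_Im cz]])
      (simp add: ReIm fun_eq_iff)
  from b4 show ?thesis
  proof (elim disjE)
    assume b: "b = 0"
    show ?thesis unfolding b sum4 fr_simps
      by (rule has_derivative_eq_rhs[OF has_derivative_const]) (simp add: fun_eq_iff om_def Gam_def algebra_simps)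
  next
    assume b: "b = 1"
    show ?thesis unfolding b sum4 
      by (rule has_derivative_eq_rhs, simp, rule has_derivative_const) (simp add: fun_eq_iff om_def Gam_def algebra_simps)
  next
    assume b: "b = 2"
    show ?thesis unfolding b sum4 fr_simps
      by (rule has_derivative_eq_rhs[OF c2]) (simp add: fun_eq_iff om_def)
  next
    assume b: "b = 3"
    show ?thesis unfolding b sum4 fr_simps
      by (rule has_derivative_eq_rhs[OF c3]) (simp add: fun_eq_iff om_def)
  qed
qed

text \<open>Tensors whose frame coefficients vanish at the divisor together with all their derivatives.\<close>

primrec tz :: "nat \<Rightarrow> (complex^2 \<Rightarrow> (complex^2) list \<Rightarrow> real) \<Rightarrow> bool" where
  "tz 0 S \<longleftrightarrow> (\<exists>c. van c \<and> (\<forall>y\<in>Ns. S y [] = c y))"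
| "tz (Suc n) S \<longleftrightarrow> (\<exists>S'. (\<forall>b<4. tz n (S' b)) \<and>
     (\<forall>y\<in>Ns. \<forall>v vs. length vs = n \<longrightarrow> S y (v # vs) = (\<Sum>b<4. fr y b v * S' b y vs)))"

lemma tz_add: "tz n S \<Longrightarrow> tz n S' \<Longrightarrow> tz n (\<lambda>y vs. S y vs + S' y vs)"
proof (induction n arbitrary: S S')
  case 0
  then obtain c c' where "van c" "van c'" "\<forall>y\<in>Ns. S y [] = c y" "\<forall>y\<in>Ns. S' y [] = c' y" by auto
  then show ?case by (auto intro!: exI[of _ "\<lambda>y. c y + c' y"] van_add)
next
  case (Suc n)
  then obtain R R' where R: "\<forall>b<4. tz n (R b)" "\<forall>y\<in>Ns. \<forall>v vs. length vs = n \<longrightarrow> S y (v # vs) = (\<Sum>b<4. fr y b v * R b y vs)"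
    "\<forall>b<4. tz n (R' b)" "\<forall>y\<in>Ns. \<forall>v vs. length vs = n \<longrightarrow> S' y (v # vs) = (\<Sum>b<4. fr y b v * R' b y vs)"
    by auto
  show ?case unfolding tz.simps
    by (rule exI[of _ "\<lambda>b y vs. R b y vs + R' b y vs"]) (use R Suc.IH in \<open>auto simp: sum.distrib distrib_left\<close>)
qed

lemma tz_scale: "bnd f \<Longrightarrow> tz n S \<Longrightarrow> tz n (\<lambda>y vs. f y * S y vs)"
proof (induction n arbitrary: S)
  case 0
  then obtain c where "van c" "\<forall>y\<in>Ns. S y [] = c y" by auto
  with 0 show ?case by (auto intro!: exI[of _ "\<lambda>y. f y * c y"] van_mult)
next
  case (Suc n)
  then obtain R where R: "\<forall>b<4. tz n (R b)" "\<forall>y\<in>Ns. \<forall>v vs. length vs = n \<longrightarrow> S y (v # vs) = (\<Sum>b<4. fr y b v * R b y vs)"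
    by auto
  show ?case unfolding tz.simps
    by (rule exI[of _ "\<lambda>b y vs. f y * R b y vs"]) (use R Suc in \<open>auto simp: sum_distrib_left mult.left_commute\<close>)
qed

lemma tz_sum4: "(\<And>b::nat. b < 4 \<Longrightarrow> tz n (S b)) \<Longrightarrow> tz n (\<lambda>y vs. \<Sum>b<4. S b y vs)"
  unfolding sum4 by (intro tz_add) auto

lemma tz_derivative:
  "tz n S \<Longrightarrow> length vs = n \<Longrightarrow> y \<in> Ns \<Longrightarrow> (\<lambda>y. S y vs) differentiable (at y)"
proof (induction n arbitrary: S vs)
  case 0
  then obtain c where c: "van c" "\<forall>y\<in>Ns. S y [] = c y" by auto
  from frame_derivatives(2)[OF c(1)] obtain d where "fd c d" by blast
  with fd_cong[of c d "\<lambda>y. S y []"] c(2) 0 show ?case unfolding fd_def differentiable_def by auto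
next
  case (Suc n)
  then obtain v ws where vs: "vs = v # ws" "length ws = n" by (cases vs) auto
  from Suc.prems obtain R where R: "\<forall>b<4. tz n (R b)"
    "\<forall>y\<in>Ns. \<forall>v vs. length vs = n \<longrightarrow> S y (v # vs) = (\<Sum>b<4. fr y b v * R b y vs)" by auto
  have 1: "(\<lambda>y. fr y b v) differentiable (at y)" if "b < 4" for b
    using fr_derivative[OF Suc.prems(3) that] differentiableI by blast
  have 2: "(\<lambda>y. R b y ws) differentiable (at y)" if "b < 4" for b
    using Suc.IH[OF _ vs(2) Suc.prems(3)] R(1) that by blast
  have "(\<lambda>y. \<Sum>b<4. fr y b v * R b y ws) differentiable (at y)"
    by (intro differentiable_sum differentiable_mult 1 2 ballI) auto
  then obtain D where "((\<lambda>y. \<Sum>b<4. fr y b v * R b y ws) has_derivative D) (at y)"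
    unfolding differentiable_def by blast
  then have "((\<lambda>y. S y vs) has_derivative D) (at y)"
    by (rule has_derivative_transform_within_open[OF _ open_Ns Suc.prems(3)]) (use R(2) vs in simp)
  then show ?case by (rule differentiableI)
qed

text \<open>Expand the first slot in the frame and use the Leibniz rule. The Christoffel correction
  of that slot cancels the \<open>Gam\<close> term of \<open>fr_derivative\<close>, leaving
  derivatives of the coefficient tensors, treated by induction, and the bounded coefficients
  \<open>om\<close>.\<close>

lemma tz_nabla: "tz n S \<Longrightarrow> tz (Suc n) (nabla g0 S)"
proof (induction n arbitrary: S)
  case 0
  then obtain c where c: "van c" "\<forall>y\<in>Ns. S y [] = c y" by auto
  from frame_derivatives(2)[OF c(1)] obtain d where d: "fd c d" "\<forall>b<4. van (d b)" by blast
  have "nabla g0 S y [u] = (\<Sum>b<4. fr y b u * d b y)" if y: "y \<in> Ns" for y u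
  proof -
    have "((\<lambda>y. S y []) has_derivative (\<lambda>u. \<Sum>b<4. d b y * fr y b u)) (at y)"
      using fd_cong[OF d(1), of "\<lambda>y. S y []"] c(2) y unfolding fd_def by auto
    from fun_cong[OF frechet_derivative_at[OF this], of u] show ?thesis
      by (simp add: nabla_def mult.commute)
  qed
  with d(2) show ?case unfolding tz.simps
    by (intro exI[of _ "\<lambda>b y vs. d b y"]) auto
next
  case (Suc n)
  from Suc.prems obtain R where R: "\<forall>b<4. tz n (R b)"
    "\<forall>y\<in>Ns. \<forall>v vs. length vs = n \<longrightarrow> S y (v # vs) = (\<Sum>b<4. fr y b v * R b y vs)" by auto
  define W where "W b R' \<longleftrightarrow> (\<forall>c<4. tz n (R' c)) \<and> (\<forall>y\<in>Ns. \<forall>u ws. length ws = n \<longrightarrow>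
     nabla g0 (R b) y (u # ws) = (\<Sum>c<4. fr y c u * R' c y ws))" for b R'
  have "\<exists>R'. W b R'" if "b < 4" for b
    using Suc.IH[of "R b"] R(1) that by (simp add: W_def)
  then have WS': "W b (SOME R'. W b R')" if "b < 4" for b using someI_ex[of "W b"] that by blast
  \<comment> \<open>A simultaneous choice, for each frame index, of the coefficient tensors given by
    the induction hypothesis.\<close>
  define R' where "R' b = (SOME R'. W b R')" for b
  have WS: "W b (R' b)" if "b < 4" for b unfolding R'_def by (rule WS'[OF that])
  have R': "tz n (R' b c)" if "b < 4" "c < 4" for b c
    using WS[OF that(1)] that unfolding W_def by blast
  have R'2: "nabla g0 (R b) y (u # ws) = (\<Sum>c<4. fr y c u * R' b c y ws)"
    if "b < 4" "y \<in> Ns" "length ws = n" for b y u ws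
    using WS[OF that(1)] that unfolding W_def by blast
  \<comment> \<open>The coefficient belonging to \<open>fr c\<close> in the slot of differentiation
    and \<open>fr d\<close> in the first slot of \<open>S\<close>.\<close>
  define Q where "Q c d y ws = R' d c y ws + (\<Sum>b<4. om b c d y * R b y ws)" for c d y ws
  have Q: "tz n (Q c d)" if "c < 4" "d < 4" for c d
    unfolding Q_def[abs_def] by (intro tz_add tz_sum4 tz_scale bnd_om) (use R R' that in auto)
  have main: "nabla g0 S y (u # v # ws) = (\<Sum>c<4. fr y c u * (\<Sum>d<4. fr y d v * Q c d y ws))"
    if y: "y \<in> Ns" and ws: "length ws = n" for y u v ws
  proof -
    have Rd: "((\<lambda>y. R b y ws) has_derivative frechet_derivative (\<lambda>y. R b y ws) (at y)) (at y)" if "b < 4" for b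
      using tz_derivative[OF _ ws y] R(1) that frechet_derivative_works by blast
    let ?fd = "\<lambda>b u. fr y b (Gam y u v) + (\<Sum>c<4. \<Sum>d<4. om b c d y * fr y c u * fr y d v)"
    have "((\<lambda>y. \<Sum>b<4. fr y b v * R b y ws) has_derivative
      (\<lambda>u. \<Sum>b<4. fr y b v * frechet_derivative (\<lambda>y. R b y ws) (at y) u + ?fd b u * R b y ws)) (at y)"
      by (intro has_derivative_sum has_derivative_mult fr_derivative[OF y] Rd) auto
    then have "((\<lambda>y. S y (v # ws)) has_derivative
      (\<lambda>u. \<Sum>b<4. fr y b v * frechet_derivative (\<lambda>y. R b y ws) (at y) u + ?fd b u * R b y ws)) (at y)"
      by (rule has_derivative_transform_within_open[OF _ open_Ns y]) (use R(2) ws in simp)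
    from fun_cong[OF frechet_derivative_at[OF this], of u]
    have d: "frechet_derivative (\<lambda>y. S y (v # ws)) (at y) u =
      (\<Sum>b<4. fr y b v * frechet_derivative (\<lambda>y. R b y ws) (at y) u + ?fd b u * R b y ws)" by simp
    have sh: "(\<Sum>i<length (v # ws). S y ((v # ws)[i := christoffel g0 y u ((v # ws) ! i)])) =
       S y (Gam y u v # ws) + (\<Sum>i<length ws. S y (v # ws[i := christoffel g0 y u (ws ! i)]))"
      by (simp only: length_Cons sum.lessThan_Suc_shift) (simp add: christoffel_g0[OF y])
    have s1: "S y (Gam y u v # ws) = (\<Sum>b<4. fr y b (Gam y u v) * R b y ws)"
      using R(2) y ws by blast
    have s2: "(\<Sum>i<length ws. S y (v # ws[i := christoffel g0 y u (ws ! i)])) =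
       (\<Sum>b<4. fr y b v * (\<Sum>i<length ws. R b y (ws[i := christoffel g0 y u (ws ! i)])))"
    proof -
      have "(\<Sum>i<length ws. S y (v # ws[i := christoffel g0 y u (ws ! i)])) =
         (\<Sum>i<length ws. \<Sum>b<4. fr y b v * R b y (ws[i := christoffel g0 y u (ws ! i)]))"
        by (intro sum.cong refl) (use R(2) y ws in simp)
      then show ?thesis by (simp only: sum_distrib_left sum.swap[of _ "{..<4}"])
    qed
    have "nabla g0 S y (u # v # ws) = (\<Sum>b<4. fr y b v * frechet_derivative (\<lambda>y. R b y ws) (at y) u + ?fd b u * R b y ws)
       - ((\<Sum>b<4. fr y b (Gam y u v) * R b y ws) +
          (\<Sum>b<4. fr y b v * (\<Sum>i<length ws. R b y (ws[i := christoffel g0 y u (ws ! i)]))))"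
      unfolding nabla_def list.case d sh s1 s2 ..
    also have "\<dots> = (\<Sum>b<4. fr y b v * nabla g0 (R b) y (u # ws) + (\<Sum>c<4. \<Sum>d<4. om b c d y * fr y c u * fr y d v) * R b y ws)"
      unfolding nabla_def list.case sum.distrib[symmetric] sum_subtractf[symmetric]
      by (intro sum.cong refl) (simp add: algebra_simps)
    also have "\<dots> = (\<Sum>b<4. fr y b v * (\<Sum>c<4. fr y c u * R' b c y ws) + (\<Sum>c<4. \<Sum>d<4. om b c d y * fr y c u * fr y d v) * R b y ws)"
      by (intro sum.cong refl) (use R'2[OF _ y ws] in simp)
    also have "\<dots> = (\<Sum>c<4. fr y c u * (\<Sum>d<4. fr y d v * Q c d y ws))"
      unfolding Q_def sum4 by (simp add: algebra_simps)
    finally show ?thesis .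
  qed
  show ?case unfolding tz.simps(2)[of "Suc n"]
  \<comment> \<open>\<open>tz\<close> peels off one vector at a time, so the vector of the second
    slot is recovered as the head of the remaining list.\<close>
  proof (rule exI[of _ "\<lambda>c y vs. \<Sum>d<4. fr y d (hd vs) * Q c d y (tl vs)"], intro conjI allI impI ballI)
    show "tz (Suc n) (\<lambda>y vs. \<Sum>d<4. fr y d (hd vs) * Q c d y (tl vs))" if "c < 4" for c
      unfolding tz.simps by (rule exI[of _ "Q c"]) (use Q that in auto)
    show "nabla g0 S y (v # vs) = (\<Sum>c<4. fr y c v * (\<Sum>d<4. fr y d (hd vs) * Q c d y (tl vs)))"
      if "y \<in> Ns" "length vs = Suc n" for y v vs
      using main[OF that(1)] that(2) by (cases vs) auto
  qed
qed

text \<open>The model metric is \<open>En * \<bar>dz\<bar>\<^sup>2 + kap / C *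
  \<bar>cz\<bar>\<^sup>2\<close>, so for unit vectors the components are bounded once
  \<open>En\<close> is bounded below on the neighbourhood.\<close>

lemma frame_bounded:
  obtains B where "0 \<le> B" "\<And>y v b. y \<in> Ns \<Longrightarrow> g0 y v v = 1 \<Longrightarrow> \<bar>fr y b v\<bar> \<le> B"
proof -
  have "smooth_on O1 (\<lambda>x. inverse (En x))"
    by (rule smooth_on_inverse[OF _ smooth_En]) (use En_pos in force)
  from base_bounded[OF this] obtain B1 where B1: "\<And>y. y \<in> Ns \<Longrightarrow> \<bar>inverse (En (bp y))\<bar> \<le> B1" by blast
  define B where "B = sqrt \<bar>B1\<bar> + sqrt (C / kap)"
  have nn: "0 \<le> sqrt \<bar>B1\<bar>" "0 \<le> sqrt (C / kap)" using C_pos kap by simp_all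
  have bound: "\<bar>fr y b v\<bar> \<le> B" if y: "y \<in> Ns" and v: "g0 y v v = 1" for y v b
  proof -
    have E: "0 < En (bp y)" and G: "0 < G y" using En_pos Ns_D(2) G_pos y by auto
    have nonneg: "0 \<le> G y * (cmod (v $ 2))\<^sup>2" "0 \<le> En (bp y) * (cmod (v $ 1))\<^sup>2"
      using E G by simp_all
    have 1: "En (bp y) * (cmod (v $ 1))\<^sup>2 \<le> 1" and 2: "G y * (cmod (v $ 2))\<^sup>2 \<le> 1"
      using nonneg v unfolding g0_self by linarith+
    have "(cmod (v $ 1))\<^sup>2 \<le> inverse (En (bp y))" using 1 E by (simp add: field_simps)
    also have "\<dots> \<le> \<bar>B1\<bar>" using B1[OF y] by linarith
    finally have c1: "cmod (v $ 1) \<le> sqrt \<bar>B1\<bar>" by (rule real_le_rsqrt)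
    have "G y * (cmod (v $ 2))\<^sup>2 = kap / C * (cmod (cz y v))\<^sup>2"
      unfolding G_def cz_def L_def[symmetric]
      by (simp add: norm_divide norm_mult power_divide power_mult_distrib)
    with 2 have "(cmod (cz y v))\<^sup>2 \<le> C / kap" using kap C_pos by (simp add: field_simps)
    then have c2: "cmod (cz y v) \<le> sqrt (C / kap)" by (rule real_le_rsqrt)
    have "\<bar>fr y b v\<bar> \<le> cmod (v $ 1) \<or> \<bar>fr y b v\<bar> \<le> cmod (cz y v)"
      unfolding fr_def using abs_Re_le_cmod abs_Im_le_cmod by auto
    then show ?thesis unfolding B_def using c1 c2 nn by linarith
  qed
  show thesis by (rule that[OF _ bound]) (unfold B_def, rule add_nonneg_nonneg[OF nn])
qed

lemma tz_bound:
  "tz n S \<Longrightarrow> \<exists>c. (c \<longlongrightarrow> 0) Fl \<and> (\<forall>y\<in>Ns. \<forall>vs. length vs = n \<and> (\<forall>v\<in>set vs. g0 y v v = 1) \<longrightarrow> \<bar>S y vs\<bar> \<le> c y)"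
proof (induction n arbitrary: S)
  case 0
  then obtain c where c: "van c" "\<forall>y\<in>Ns. S y [] = c y" by auto
  show ?case
    by (rule exI[of _ "\<lambda>y. \<bar>c y\<bar>"]) (use c tendsto_rabs_zero[OF bnd_limits(2)[OF c(1)]] in auto)
next
  case (Suc n)
  from Suc.prems obtain R where R: "\<forall>b<4. tz n (R b)"
    "\<forall>y\<in>Ns. \<forall>v vs. length vs = n \<longrightarrow> S y (v # vs) = (\<Sum>b<4. fr y b v * R b y vs)" by auto
  define W where "W b c \<longleftrightarrow> (c \<longlongrightarrow> 0) Fl \<and> (\<forall>y\<in>Ns. \<forall>vs. length vs = n \<and> (\<forall>v\<in>set vs. g0 y v v = 1) \<longrightarrow> \<bar>R b y vs\<bar> \<le> c y)" for b c
  have "\<exists>c. W b c" if "b < 4" for b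
    using Suc.IH[of "R b"] R(1) that by (simp add: W_def)
  then have WS': "W b (SOME c. W b c)" if "b < 4" for b using someI_ex[of "W b"] that by blast
  define c where "c b = (SOME c. W b c)" for b
  have WS: "W b (c b)" if "b < 4" for b unfolding c_def by (rule WS'[OF that])
  have c: "(c b \<longlongrightarrow> 0) Fl" if "b < 4" for b
    using WS[OF that] unfolding W_def by blast
  have c2: "\<bar>R b y vs\<bar> \<le> c b y" if "b < 4" "y \<in> Ns" "length vs = n" "\<forall>v\<in>set vs. g0 y v v = 1" for b y vs
    using WS[OF that(1)] that(2-4) unfolding W_def by blast
  obtain B where B: "0 \<le> B" "\<And>y v b. y \<in> Ns \<Longrightarrow> g0 y v v = 1 \<Longrightarrow> \<bar>fr y b v\<bar> \<le> B"
    using frame_bounded by blast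
  have lim: "((\<lambda>y. \<Sum>b<4. B * c b y) \<longlongrightarrow> 0) Fl"
    by (intro tendsto_null_sum tendsto_mult_right_zero c) auto
  have "\<bar>S y vs\<bar> \<le> (\<Sum>b<4. B * c b y)" if y: "y \<in> Ns" and vs: "length vs = Suc n" "\<forall>v\<in>set vs. g0 y v v = 1" for y vs
  proof -
    obtain v ws where vw: "vs = v # ws" using vs(1) by (cases vs) auto
    have ws: "length ws = n" "\<forall>v\<in>set ws. g0 y v v = 1" and v: "g0 y v v = 1" using vs vw by auto
    have "\<bar>S y vs\<bar> \<le> (\<Sum>b<4. \<bar>fr y b v * R b y ws\<bar>)"
      using R(2) y ws(1) unfolding vw by (simp add: sum_abs)
    also have "\<dots> \<le> (\<Sum>b<4. B * c b y)"
      unfolding abs_mult by (intro sum_mono mult_mono B c2 y ws v) auto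
    finally show ?thesis .
  qed
  with lim show ?case by blast
qed

lemma exists_orthonormal_basis:
  assumes y: "y \<in> Ns"
  shows "\<exists>B. orthonormal_basis (g0 y) B"
proof -
  define e f where "e = 1 / sqrt (En (bp y))" and "f = 1 / sqrt (G y)"
  have E: "0 < En (bp y)" and G: "0 < G y" using En_pos Ns_D(2) G_pos y by auto
  have ef: "0 < e" "0 < f" "En (bp y) * (e * e) = 1" "G y * (f * f) = 1"
    using E G by (simp_all add: e_def f_def)
  define b1 b2 b3 b4 :: "complex^2" where "b1 = e *\<^sub>R axis 1 1" and "b2 = e *\<^sub>R axis 1 \<i>"
    and "b3 = f *\<^sub>R axis 2 1" and "b4 = f *\<^sub>R axis 2 \<i>"
  note b_defs = b1_def b2_def b3_def b4_def
  let ?B = "{b1, b2, b3, b4}"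
  have "v \<in> span ?B" for v :: "complex^2"
  proof -
    have "v = (Re (v $ 1) / e) *\<^sub>R b1 + (Im (v $ 1) / e) *\<^sub>R b2 + (Re (v $ 2) / f) *\<^sub>R b3 + (Im (v $ 2) / f) *\<^sub>R b4"
      using ef unfolding b_defs by (simp add: vec_eq_iff forall_2 axis_def complex_eq_iff)
    also have "\<dots> \<in> span ?B"
      by (intro span_add span_scale span_base) simp_all
    finally show ?thesis .
  qed
  then have sp: "span ?B = UNIV" by blast
  have g: "g0 y b1 b1 = 1" "g0 y b2 b2 = 1" "g0 y b3 b3 = 1" "g0 y b4 b4 = 1"
    "g0 y b1 b2 = 0" "g0 y b1 b3 = 0" "g0 y b1 b4 = 0" "g0 y b2 b3 = 0" "g0 y b2 b4 = 0" "g0 y b3 b4 = 0"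
    "g0 y b2 b1 = 0" "g0 y b3 b1 = 0" "g0 y b4 b1 = 0" "g0 y b3 b2 = 0" "g0 y b4 b2 = 0" "g0 y b4 b3 = 0"
    using ef unfolding b_defs by (simp_all add: g0_eq axis_def)
  have ne: "b1 \<noteq> b2" "b1 \<noteq> b3" "b1 \<noteq> b4" "b2 \<noteq> b3" "b2 \<noteq> b4" "b3 \<noteq> b4"
    using g by auto
  have "\<forall>u\<in>?B. \<forall>v\<in>?B. g0 y u v = (if u = v then 1 else 0)"
    by (simp only: ball_simps insert_iff empty_iff g ne ne[symmetric] if_True if_False simp_thms)
  with sp have "orthonormal_basis (g0 y) ?B" unfolding orthonormal_basis_def by (intro conjI) simp_all
  then show ?thesis by (rule exI)
qed

text \<open>Whatever basis is selected, at most \<open>DIM(complex^2) ^ n\<close> components are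
  summed, and \<open>tz_bound\<close> dominates each of them by the same decaying function.\<close>

lemma tensor_norm_lim:
  assumes "tz n S"
  shows "((\<lambda>y. tensor_norm g0 n S y) \<longlongrightarrow> 0) Fl"
proof -
  obtain c where c: "(c \<longlongrightarrow> 0) Fl"
    "\<And>y vs. y \<in> Ns \<Longrightarrow> length vs = n \<Longrightarrow> (\<forall>v\<in>set vs. g0 y v v = 1) \<Longrightarrow> \<bar>S y vs\<bar> \<le> c y"
    using tz_bound[OF assms] by blast
  let ?K = "real (DIM(complex^2) ^ n)"
  have "norm (tensor_norm g0 n S y) \<le> sqrt ?K * \<bar>c y\<bar>" if y: "y \<in> Ns" for y
  proof -
    define B where "B = (SOME B. orthonormal_basis (g0 y) B)"
    have B: "orthonormal_basis (g0 y) B"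
      unfolding B_def using someI_ex[OF exists_orthonormal_basis[OF y]] .
    have "linear (\<lambda>u. g0 y u v)" for v by (rule linearI) (simp_all only: g0_bilinear(2,3) real_scaleR_def)
    from orthonormal_card[OF B this] have fin: "finite B" and card: "card B \<le> DIM(complex^2)" by auto
    have "(S y vs)\<^sup>2 \<le> (c y)\<^sup>2" if "vs \<in> {vs. set vs \<subseteq> B \<and> length vs = n}" for vs
    proof -
      have "\<forall>v\<in>set vs. g0 y v v = 1" using that B by (auto simp: orthonormal_basis_def subset_iff)
      with c(2)[OF y, of vs] that have "\<bar>S y vs\<bar> \<le> \<bar>c y\<bar>" by simp
      then show ?thesis by (simp add: abs_le_square_iff)
    qed
    then have "(\<Sum>vs | set vs \<subseteq> B \<and> length vs = n. (S y vs)\<^sup>2) \<le> (\<Sum>vs | set vs \<subseteq> B \<and> length vs = n. (c y)\<^sup>2)"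
      by (rule sum_mono)
    also have "\<dots> = real (card B ^ n) * (c y)\<^sup>2"
      by (simp add: card_lists_length_eq[OF fin])
    also have "\<dots> \<le> ?K * (c y)\<^sup>2"
      by (rule mult_right_mono[OF of_nat_mono[OF power_mono[OF card]]]) simp_all
    finally have "sqrt (\<Sum>vs | set vs \<subseteq> B \<and> length vs = n. (S y vs)\<^sup>2) \<le> sqrt (?K * (c y)\<^sup>2)"
      by (rule real_sqrt_le_mono)
    also have "sqrt (?K * (c y)\<^sup>2) = sqrt ?K * \<bar>c y\<bar>"
      by (simp only: real_sqrt_mult real_sqrt_abs)
    finally have "sqrt (\<Sum>vs | set vs \<subseteq> B \<and> length vs = n. (S y vs)\<^sup>2) \<le> sqrt ?K * \<bar>c y\<bar>" .
    moreover have "0 \<le> sqrt (\<Sum>vs | set vs \<subseteq> B \<and> length vs = n. (S y vs)\<^sup>2)"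
      by (simp add: sum_nonneg)
    ultimately show ?thesis unfolding tensor_norm_def Let_def B_def[symmetric] by simp
  qed
  then have "\<forall>\<^sub>F y in Fl. norm (tensor_norm g0 n S y) \<le> sqrt ?K * \<bar>c y\<bar>"
    using eventually_Ns by (rule eventually_mono[rotated])
  moreover have "((\<lambda>y. sqrt ?K * \<bar>c y\<bar>) \<longlongrightarrow> 0) Fl"
    by (rule tendsto_mult_right_zero[OF tendsto_rabs_zero[OF c(1)]])
  ultimately show ?thesis by (rule Lim_null_comparison)
qed

abbreviation Hc where "Hc \<equiv> lform cusp.lam cusp.mu a k"

text \<open>The metric in the hyperbolic coframe. By the equation the vertical factor, including
  \<open>\<bar>w\<bar>\<^sup>2\<close>, is \<open>kap * q\<^sup>2 * ell\<close>; against
  \<open>L\<^sup>2\<close> it has the finite limit \<open>kap / C\<close> of the model.\<close>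

lemma riem_Hc:
  assumes y: "y \<in> Ns"
  shows "riem Hc y u v = 2 * kap * D (T (inverse (rad k y))) * a (bp y) * Re (u $ 1 * cnj (v $ 1)) +
    kap * (q y * q y * ell y) * Re ((kz k (bp y) * u $ 1 + of_real (L y) * cz y u) * cnj (kz k (bp y) * v $ 1 + of_real (L y) * cz y v))"
proof -
  let ?r = "rad k y" and ?f = "\<lambda>u. kz k (bp y) * u $ 1 + of_real (L y) * cz y u"
  have r: "?r \<in> {0<..}" using Ns_D(5)[OF y] by simp
  have vc: "vcov k y u = y $ 2 * ?f u" for u
    unfolding vcov_def w_cz[OF y, symmetric] using Ns_D(1)[OF y] by (simp add: field_simps)
  have "vcov k y u * cnj (vcov k y v) = of_real ((cmod (y $ 2))\<^sup>2) * (?f u * cnj (?f v))"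
    unfolding vc complex_norm_square by (simp add: mult_ac)
  then have 1: "Re (vcov k y u * cnj (vcov k y v)) = (cmod (y $ 2))\<^sup>2 * Re (?f u * cnj (?f v))"
    by (simp only: Re_of_real_mult)
  have 2: "- (2 * ?r * deriv (\<lambda>r. T (inverse r)) ?r) = q y * q y * ell y"
    using cusp.ode[OF r] cusp.DX[OF r] unfolding q_def ell_def Q_def P_def
    by (simp add: field_simps power2_eq_square)
  have 3: "2 * (cusp.mu ?r * exp (k (bp y)) * ((cmod (y $ 2))\<^sup>2 * z)) = kap * (q y * q y * ell y) * z" for z
  proof -
    have "2 * (cusp.mu ?r * exp (k (bp y)) * ((cmod (y $ 2))\<^sup>2 * z)) = kap * (- (2 * ?r * deriv (\<lambda>r. T (inverse r)) ?r)) * z"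
      unfolding cusp.mu_def rad_def by simp
    then show ?thesis unfolding 2 .
  qed
  have "riem Hc y u v = 2 * cusp.lam ?r * a (bp y) * Re (u $ 1 * cnj (v $ 1)) +
     2 * (cusp.mu ?r * exp (k (bp y)) * Re (vcov k y u * cnj (vcov k y v)))"
    unfolding riem_def herm_lform by (simp add: algebra_simps)
  then show ?thesis unfolding 1 3 by (simp add: cusp.lam_def mult.assoc)
qed

text \<open>All frame coefficients of the difference are seen to vanish: \<open>\<alpha>\<close> is
  the horizontal one, \<open>h\<close> times the parts of \<open>kz\<close> gives the mixed ones,
  and \<open>\<beta>\<close> is the vertical one.\<close>

lemma tz_difference: "tz 2 (\<lambda>z vs. riem Hc z (vs ! 0) (vs ! 1) - g0 z (vs ! 0) (vs ! 1))"
proof -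
  define f where "f y = kap * (q y * q y * ell y)" for y
  define \<alpha> where "\<alpha> y = - 2 * kap * eps * a (bp y) * q y + f y * (Re_k y * Re_k y + Im_k y * Im_k y)" for y
  define h where "h y = kap * (q y * (dl y - 1 / C) * ell y)" for y
  \<comment> \<open>This is \<open>kap * (q * L)\<^sup>2 * ell - kap / C\<close> after
    \<open>q * L = dl - 1 / C\<close> has been expanded and the terms without \<open>dl\<close> have
    been grouped into \<open>1 - ell / C\<close>.\<close>
  define \<beta> where "\<beta> y = kap * ((dl y * (dl y - 2 / C)) * ell y - (1 - ell y / C) / C)" for y
  have bnd_a: "bnd (\<lambda>y. a (bp y))" by (rule bnd_base[OF sma])
  have f: "van f" unfolding f_def[abs_def]
    by (intro van_mult[OF bnd_const] van_mult2 bnd_ell van_q bnd_van[OF van_q])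
  have \<alpha>: "van \<alpha>"
    unfolding \<alpha>_def[abs_def] by (intro van_add van_mult[OF _ van_q] van_mult2 f bnd_mult bnd_add bnd_const bnd_a bnd_k)
  have h: "van h" unfolding h_def[abs_def]
    by (intro van_mult[OF bnd_const] van_mult2 bnd_ell van_q bnd_minus bnd_const bnd_van[OF van_dl])
  have \<beta>: "van \<beta>"
  proof -
    have "van (\<lambda>y. kap * ((dl y * (dl y - 2 / C)) * ell y + (- 1 / C) * (1 - ell y / C)))"
      by (intro van_mult[OF bnd_const] van_add van_mult2 bnd_ell van_dl bnd_minus bnd_const bnd_van[OF van_dl] van_ell)
    then show ?thesis by (simp add: \<beta>_def[abs_def])
  qed
  define s where "s b c = (if b = c then (if b \<le> 1 then \<alpha> else \<beta>)
    else if {b, c} = {0, 2} \<or> {b, c} = {1, 3} then (\<lambda>y. h y * Re_k y)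
    else if {b, c} = {1, 2} then (\<lambda>y. - (h y * Im_k y))
    else if {b, c} = {0, 3} then (\<lambda>y. h y * Im_k y) else (\<lambda>y. 0))" for b c :: nat
  have s: "van (s b c)" for b c
    unfolding s_def using \<alpha> \<beta> van_mult2[OF h bnd_k(1)] van_neg[OF van_mult2[OF h bnd_k(2)]]
      van_mult2[OF h bnd_k(2)] van_zero by simp
  have sx: "\<exists>c'. van c' \<and> (\<forall>y\<in>Ns. s b c y = c' y)" for b c
    by (rule exI[of _ "s b c"]) (simp add: s)
  have "riem Hc y u v - g0 y u v = (\<Sum>b<4. fr y b u * (\<Sum>c<4. fr y c v * s b c y))" if y: "y \<in> Ns" for y u v
  proof -
    have D: "D (T (inverse (rad k y))) = D M - eps * q y" by (simp add: D_def q_def algebra_simps)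
    have w: "y $ 2 \<noteq> 0" "L y \<noteq> 0" using Ns_D(1,4)[OF y] by auto
    have wu: "u $ 2 = y $ 2 * of_real (L y) * cz y u" for u using w by (simp add: cz_def)
    have G: "G y * Re (u $ 2 * cnj (v $ 2)) = kap / C * Re (cz y u * cnj (cz y v))" for u v
    proof -
      have "u $ 2 * cnj (v $ 2) = of_real ((cmod (y $ 2))\<^sup>2 * (L y)\<^sup>2) * (cz y u * cnj (cz y v))"
        unfolding wu[of u] wu[of v] of_real_mult complex_norm_square by (simp add: power2_eq_square mult_ac)
      then have "Re (u $ 2 * cnj (v $ 2)) = (cmod (y $ 2))\<^sup>2 * (L y)\<^sup>2 * Re (cz y u * cnj (cz y v))"
        by (simp only: Re_of_real_mult)
      moreover have "G y = kap / C / ((cmod (y $ 2))\<^sup>2 * (L y)\<^sup>2)"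
        by (simp add: G_def L_def power_mult_distrib)
      ultimately show ?thesis using w by simp
    qed
    have fL: "f y * L y = h y" unfolding f_def h_def by (simp add: qL[symmetric] mult_ac)
    have fL2: "f y * (L y * L y) = \<beta> y + kap / C"
    proof -
      have "f y * (L y * L y) = kap * ((q y * L y) * (q y * L y) * ell y)" by (simp add: f_def mult_ac)
      also have "\<dots> = \<beta> y + kap / C" unfolding qL \<beta>_def using C_pos by (simp add: field_simps)
      finally show ?thesis .
    qed
    define x1 x2 x3 x4 where "x1 = Re (u $ 1)" and "x2 = Im (u $ 1)" and "x3 = Re (cz y u)" and "x4 = Im (cz y u)"
    define y1 y2 y3 y4 where "y1 = Re (v $ 1)" and "y2 = Im (v $ 1)" and "y3 = Re (cz y v)" and "y4 = Im (cz y v)"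
    note defs = x1_def[symmetric] x2_def[symmetric] x3_def[symmetric] x4_def[symmetric]
      y1_def[symmetric] y2_def[symmetric] y3_def[symmetric] y4_def[symmetric]
    have e1: "Re (u $ 1 * cnj (v $ 1)) = x1 * y1 + x2 * y2" "Re (cz y u * cnj (cz y v)) = x3 * y3 + x4 * y4"
      by (simp_all add: defs)
    have "f y * Re ((kz k (bp y) * u $ 1 + of_real (L y) * cz y u) * cnj (kz k (bp y) * v $ 1 + of_real (L y) * cz y v)) =
      f y * (Re_k y * Re_k y + Im_k y * Im_k y) * (x1 * y1 + x2 * y2) +
      (f y * L y) * (Re_k y * (x1 * y3 + x2 * y4) - Im_k y * (x2 * y3 - x1 * y4) + Re_k y * (x3 * y1 + x4 * y2) + Im_k y * (x4 * y1 - x3 * y2)) +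
      f y * (L y * L y) * (x3 * y3 + x4 * y4)"
      by (simp add: Re_k_def[symmetric] Im_k_def[symmetric] defs algebra_simps)
    then have "riem Hc y u v - g0 y u v = - 2 * kap * eps * q y * a (bp y) * (x1 * y1 + x2 * y2) +
      f y * (Re_k y * Re_k y + Im_k y * Im_k y) * (x1 * y1 + x2 * y2) +
      h y * (Re_k y * (x1 * y3 + x2 * y4) - Im_k y * (x2 * y3 - x1 * y4) + Re_k y * (x3 * y1 + x4 * y2) + Im_k y * (x4 * y1 - x3 * y2)) +
      \<beta> y * (x3 * y3 + x4 * y4)"
      unfolding riem_Hc[OF y] f_def[of y, symmetric] fL fL2 g0_eq G e1 D En_def by (simp add: algebra_simps)
    also have "\<dots> = (\<Sum>b<4. fr y b u * (\<Sum>c<4. fr y c v * s b c y))"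
      unfolding sum4 s_def by (simp add: defs \<alpha>_def doubleton_eq_iff algebra_simps)
    finally show ?thesis .
  qed
  then show ?thesis unfolding numeral_2_eq_2 tz.simps
    by (intro exI[of _ "\<lambda>b y vs. \<Sum>c<4. fr y c (hd vs) * s b c y"])
      (auto simp: length_Suc_conv sx intro!: exI[of _ "\<lambda>c y vs. s _ c y"])
qed

lemma tz_iterated: "tz (i + 2) ((nabla g0 ^^ i) (\<lambda>z vs. riem Hc z (vs ! 0) (vs ! 1) - g0 z (vs ! 0) (vs ! 1)))"
proof (induction i)
  case 0 show ?case unfolding funpow_0 add_0 by (rule tz_difference)
next
  case (Suc i)
  from tz_nabla[OF Suc] show ?case by (simp only: funpow.simps o_apply add_Suc)
qed

theorem asymptotically_hyperbolic_local:
  "((\<lambda>z. tensor_norm g0 (i + 2) ((nabla g0 ^^ i) (\<lambda>z vs. riem Hc z (vs ! 0) (vs ! 1) - g0 z (vs ! 0) (vs ! 1))) z)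
    \<longlongrightarrow> 0) (inf (filtercomap (\<lambda>y::complex^2. y $ 2) (at 0)) (principal N))"
  using tensor_norm_lim[OF tz_iterated] unfolding Fl_def .

end

section \<open>Charts of the ruled surface\<close>

lemma hol_fun_on_derivative:
  fixes f :: "complex^1 \<Rightarrow> complex"
  assumes "hol_fun_on f S" "z \<in> S"
  obtains l where "(f has_derivative (\<lambda>v. l * v $ 1)) (at z)"
proof -
  obtain f' where f': "(f has_derivative f') (at z)" "\<And>c v. f' (c *s v) = c * f' v"
    using assms unfolding hol_fun_on_def by blast
  have "v = v $ 1 *s axis 1 1" for v :: "complex^1" by (simp add: vec_eq_iff axis_def forall_1)
  then have "f' v = f' (axis 1 1) * v $ 1" for v
    using f'(2)[of "v $ 1" "axis 1 1"] by (simp only: mult.commute) 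
  then have "f' = (\<lambda>v. f' (axis 1 1) * v $ 1)" by (rule ext)
  from has_derivative_eq_rhs[OF f'(1) this] show thesis by (rule that)
qed

lemma ddbar_minus:
  assumes "open U" "smooth_on U f" "y \<in> U"
  shows "ddbar i j (\<lambda>y. - f y) y = - ddbar i j f y"
proof -
  have "ddbar i j (\<lambda>y. f y + - f y) y = ddbar i j f y + ddbar i j (\<lambda>y. - f y) y"
    by (rule ddbar_add[OF assms(1,2) smooth_on_minus[OF assms(2)] assms(3)])
  moreover have "ddbar i j (\<lambda>y. f y + - f y) y = 0"
  proof -
    have "d_zbar j (\<lambda>y. complex_of_real (f y + - f y)) = (\<lambda>y. 0)" by (rule ext) simp
    then show ?thesis by (simp add: ddbar_def)
  qed
  ultimately show ?thesis by (simp add: eq_neg_iff_add_eq_0 add.commute)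
qed

lemma bp_vector [simp]: "bp (vector [z $ 1, \<zeta>]) = z"
  by (simp add: bp_def)

lemma vector_bp [simp]: "vector [bp y $ 1, y $ 2] = y"
  by (simp add: vec_eq_iff forall_2)

locale ruled =
  fixes A :: "('m, 1) chart set" and p :: "'l \<Rightarrow> 'm" and T :: "('l, 'm) triv set"
    and nrm :: "'l \<Rightarrow> real" and \<omega>M :: "('m, 1) form11"
  assumes at: "complex_atlas A" and lb: "holomorphic_line_bundle A p T" and hn: "hermitian_norm A p T nrm"
    and km: "kaehler_metric A (atlas_space A) \<omega>M"
    and sc: "mfd_scalar_curvature A (atlas_space A) \<omega>M (\<lambda>_. - 2)"
    and cf: "is_curvature_form A p T nrm (\<lambda>c z. - \<omega>M c z)"
begin

lemma atlasD:
  assumes "c \<in> A"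
  shows "inj_on (snd c) (fst c)" "open (snd c ` fst c)" "fst c \<subseteq> atlas_space A"
  using at assms unfolding complex_atlas_def atlas_space_def by (auto simp: case_prod_beta)

lemma atlasD2:
  assumes "c \<in> A" "d \<in> A"
  shows "open (snd c ` (fst c \<inter> fst d))"
    "hol_map_on (snd d \<circ> inv_into (fst c) (snd c)) (snd c ` (fst c \<inter> fst d))"
  using at assms unfolding complex_atlas_def by (auto simp: case_prod_beta)

text \<open>Needed before \<open>openin\<close> can be unfolded for \<open>atlas_topology\<close>.
  Injectivity of the charts is what makes images commute with intersections.\<close>

lemma istopology_atlas: "istopology (\<lambda>W. W \<subseteq> atlas_space A \<and> (\<forall>(U, \<psi>)\<in>A. open (\<psi> ` (W \<inter> U))))"
  unfolding istopology_def
proof (intro conjI allI impI)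
  fix S S' assume S: "S \<subseteq> atlas_space A \<and> (\<forall>(U, \<psi>)\<in>A. open (\<psi> ` (S \<inter> U)))"
    and S': "S' \<subseteq> atlas_space A \<and> (\<forall>(U, \<psi>)\<in>A. open (\<psi> ` (S' \<inter> U)))"
  show "S \<inter> S' \<subseteq> atlas_space A" using S by blast
  show "\<forall>(U, \<psi>)\<in>A. open (\<psi> ` (S \<inter> S' \<inter> U))"
  proof (intro ballI, clarify)
    fix U \<psi> assume c: "(U, \<psi>) \<in> A"
    have "\<psi> ` (S \<inter> S' \<inter> U) = \<psi> ` (S \<inter> U) \<inter> \<psi> ` (S' \<inter> U)"
      using atlasD(1)[OF c] by (auto simp: inj_on_def)
    moreover have "open (\<psi> ` (S \<inter> U) \<inter> \<psi> ` (S' \<inter> U))"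
      using S S' c by (intro open_Int) auto
    ultimately show "open (\<psi> ` (S \<inter> S' \<inter> U))" by simp
  qed
next
  fix K assume K: "\<forall>S\<in>K. S \<subseteq> atlas_space A \<and> (\<forall>(U, \<psi>)\<in>A. open (\<psi> ` (S \<inter> U)))"
  show "\<Union> K \<subseteq> atlas_space A" using K by blast
  show "\<forall>(U, \<psi>)\<in>A. open (\<psi> ` (\<Union> K \<inter> U))"
  proof (intro ballI, clarify)
    fix U \<psi> assume c: "(U, \<psi>) \<in> A"
    have "\<psi> ` (\<Union> K \<inter> U) = (\<Union>S\<in>K. \<psi> ` (S \<inter> U))" by auto
    moreover have "open (\<Union>S\<in>K. \<psi> ` (S \<inter> U))" using K c by (intro open_UN) auto
    ultimately show "open (\<psi> ` (\<Union> K \<inter> U))" by simp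
  qed
qed

lemma openin_atlas: "openin (atlas_topology A) S \<longleftrightarrow> S \<subseteq> atlas_space A \<and> (\<forall>c\<in>A. open (snd c ` (S \<inter> fst c)))"
  unfolding atlas_topology_def topology_inverse'[OF istopology_atlas] by (auto simp: case_prod_beta)

lemma trivD:
  assumes "w \<in> T"
  shows "openin (atlas_topology A) (fst w)" "bij_betw (\<lambda>v. (p v, snd w v)) (p -` fst w) (fst w \<times> UNIV)"
  using lb assms unfolding holomorphic_line_bundle_def by (auto simp: case_prod_beta)

lemma triv_cover: "\<Union> (fst ` T) = atlas_space A"
  using lb unfolding holomorphic_line_bundle_def by blast

definition tg where "tg w w' = (SOME g. mfd_holomorphic_on A (fst w \<inter> fst w') g \<and>
       (\<forall>x\<in>fst w \<inter> fst w'. g x \<noteq> 0) \<and> (\<forall>v. p v \<in> fst w \<inter> fst w' \<longrightarrow> snd w' v = g (p v) * snd w v))"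

lemma tg:
  assumes "w \<in> T" "w' \<in> T"
  shows "mfd_holomorphic_on A (fst w \<inter> fst w') (tg w w')"
    "\<And>x. x \<in> fst w \<Longrightarrow> x \<in> fst w' \<Longrightarrow> tg w w' x \<noteq> 0"
    "\<And>v. p v \<in> fst w \<Longrightarrow> p v \<in> fst w' \<Longrightarrow> snd w' v = tg w w' (p v) * snd w v"
proof -
  have "\<exists>g. mfd_holomorphic_on A (fst w \<inter> fst w') g \<and>
       (\<forall>x\<in>fst w \<inter> fst w'. g x \<noteq> 0) \<and> (\<forall>v. p v \<in> fst w \<inter> fst w' \<longrightarrow> snd w' v = g (p v) * snd w v)"
    using lb assms unfolding holomorphic_line_bundle_def by (auto simp: case_prod_beta)
  from someI_ex[OF this] show "mfd_holomorphic_on A (fst w \<inter> fst w') (tg w w')"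
    "\<And>x. x \<in> fst w \<Longrightarrow> x \<in> fst w' \<Longrightarrow> tg w w' x \<noteq> 0"
    "\<And>v. p v \<in> fst w \<Longrightarrow> p v \<in> fst w' \<Longrightarrow> snd w' v = tg w w' (p v) * snd w v"
    unfolding tg_def[symmetric] by auto
qed

definition vt where "vt w x \<zeta> = (SOME v. p v = x \<and> snd w v = (\<zeta>::complex))"

lemma vt:
  assumes "w \<in> T" "x \<in> fst w"
  shows "p (vt w x \<zeta>) = x" "snd w (vt w x \<zeta>) = \<zeta>"
proof -
  have "(x, \<zeta>) \<in> (\<lambda>v. (p v, snd w v)) ` (p -` fst w)"
    using trivD(2)[OF assms(1)] assms(2) unfolding bij_betw_def by auto
  then have "\<exists>v. p v = x \<and> snd w v = \<zeta>" by auto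
  from someI_ex[OF this] show "p (vt w x \<zeta>) = x" "snd w (vt w x \<zeta>) = \<zeta>" unfolding vt_def by auto
qed

lemma triv_inj: "w \<in> T \<Longrightarrow> p v \<in> fst w \<Longrightarrow> p v' = p v \<Longrightarrow> snd w v' = snd w v \<Longrightarrow> v' = v"
  using trivD(2)[of w] unfolding bij_betw_def inj_on_def by auto

section \<open>Points and charts of the projective bundle\<close>

lemma mem_line: "(u, r) \<in> line p T v s \<longleftrightarrow>
    p u = p v \<and> (\<exists>c. c \<noteq> 0 \<and> r = c * s \<and> (\<forall>w\<in>T. p v \<in> fst w \<longrightarrow> snd w u = c * snd w v))"
  by (simp add: line_def case_prod_beta)

lemma line_eqI:
  assumes "p v = p v'" "c \<noteq> 0" "s' = c * s" "\<And>w. w \<in> T \<Longrightarrow> p v \<in> fst w \<Longrightarrow> snd w v' = c * snd w v"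
  shows "line p T v s = line p T v' s'"
proof -
  have "(u, r) \<in> line p T v s \<longleftrightarrow> (u, r) \<in> line p T v' s'" for u r
  proof
    assume "(u, r) \<in> line p T v s"
    then obtain d where d: "p u = p v" "d \<noteq> 0" "r = d * s" "\<forall>w\<in>T. p v \<in> fst w \<longrightarrow> snd w u = d * snd w v"
      unfolding mem_line by blast
    have "d / c \<noteq> 0 \<and> r = d / c * s' \<and> (\<forall>w\<in>T. p v' \<in> fst w \<longrightarrow> snd w u = d / c * snd w v')"
      using d assms by simp
    then show "(u, r) \<in> line p T v' s'" unfolding mem_line using d(1) assms(1)
      by (intro conjI exI[of _ "d / c"]) simp_all
  next
    assume "(u, r) \<in> line p T v' s'"
    then obtain d where d: "p u = p v'" "d \<noteq> 0" "r = d * s'" "\<forall>w\<in>T. p v' \<in> fst w \<longrightarrow> snd w u = d * snd w v'"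
      unfolding mem_line by blast
    have "d * c \<noteq> 0 \<and> r = d * c * s \<and> (\<forall>w\<in>T. p v \<in> fst w \<longrightarrow> snd w u = d * c * snd w v)"
      using d assms by simp
    then show "(u, r) \<in> line p T v s" unfolding mem_line using d(1) assms(1)
      by (intro conjI exI[of _ "d * c"]) simp_all
  qed
  then show ?thesis by auto
qed

lemma line_eqD:
  assumes "line p T v s = line p T v' s'"
  obtains c where "p v = p v'" "c \<noteq> 0" "s' = c * s" "\<And>w. w \<in> T \<Longrightarrow> p v \<in> fst w \<Longrightarrow> snd w v' = c * snd w v"
proof -
  have "(v', s') \<in> line p T v' s'" unfolding mem_line by (intro conjI exI[of _ 1]) simp_all
  then have "(v', s') \<in> line p T v s" using assms by simp
  then obtain c where "p v' = p v" "c \<noteq> 0" "s' = c * s" "\<forall>w\<in>T. p v \<in> fst w \<longrightarrow> snd w v' = c * snd w v"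
    unfolding mem_line by blast
  then show thesis using that by auto
qed

text \<open>One trivialisation decides equality of lines, because the others differ from it by a
  factor depending only on the base point.\<close>

lemma line_eq_iff:
  assumes "w \<in> T" "p v \<in> fst w"
  shows "line p T v s = line p T v' s' \<longleftrightarrow> p v = p v' \<and> (\<exists>c. c \<noteq> 0 \<and> s' = c * s \<and> snd w v' = c * snd w v)"
proof
  assume "line p T v s = line p T v' s'"
  from line_eqD[OF this] show "p v = p v' \<and> (\<exists>c. c \<noteq> 0 \<and> s' = c * s \<and> snd w v' = c * snd w v)"
    using assms by metis
next
  assume "p v = p v' \<and> (\<exists>c. c \<noteq> 0 \<and> s' = c * s \<and> snd w v' = c * snd w v)"
  then obtain c where c: "p v = p v'" "c \<noteq> 0" "s' = c * s" "snd w v' = c * snd w v" by blast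
  show "line p T v s = line p T v' s'"
  proof (rule line_eqI[OF c(1-3)])
    fix w' assume w': "w' \<in> T" "p v \<in> fst w'"
    have "snd w' v = tg w w' (p v) * snd w v" "snd w' v' = tg w w' (p v) * snd w v'"
      using tg(3)[OF assms(1) w'(1)] assms(2) w'(2) c(1) by auto
    then show "snd w' v' = c * snd w' v" using c(4) by simp
  qed
qed

text \<open>\<open>pt b w x \<zeta>\<close> is the point over \<open>x\<close> with fibre coordinate \<open>\<zeta>\<close>, where \<open>b\<close> selects the chart off the
  infinity section (\<open>True\<close>) or off the zero section (\<open>False\<close>).\<close>

definition pt where "pt b w x \<zeta> = (if b then line p T (vt w x \<zeta>) 1 else line p T (vt w x 1) \<zeta>)"

definition ch where "ch b c w = (if b then chart_off_infinity p T c w else chart_off_zero p T c w)"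

text \<open>The section on which the fibre coordinate of charts of type \<open>b\<close>
  vanishes.\<close>

definition nsec where "nsec b = (if b then zero_section p T else infinity_section p T)"

lemma vt_line_eqD:
  assumes w: "w \<in> T" "x \<in> fst w" and eq: "line p T (vt w x \<zeta>) s = line p T v' s'"
  obtains c where "p v' = x" "c \<noteq> 0" "s' = c * s" "snd w v' = c * \<zeta>"
proof -
  note vv = vt[OF w]
  have "p (vt w x \<zeta>) \<in> fst w" using w(2) by (simp only: vv)
  from line_eq_iff[OF w(1) this, THEN iffD1, OF eq] obtain c where
    "x = p v'" "c \<noteq> 0" "s' = c * s" "snd w v' = c * \<zeta>" unfolding vv by blast
  then show thesis using that by blast
qed

lemma line_pt:
  assumes w: "w \<in> T" "p v \<in> fst w"
  shows "s \<noteq> 0 \<Longrightarrow> line p T v s = pt True w (p v) (snd w v / s)"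
    "snd w v \<noteq> 0 \<Longrightarrow> line p T v s = pt False w (p v) (s / snd w v)"
proof -
  note vv = vt[OF w(1) w(2)]
  show "line p T v s = pt True w (p v) (snd w v / s)" if "s \<noteq> 0"
    unfolding pt_def if_True
    by (rule line_eq_iff[OF w, THEN iffD2], intro conjI exI[of _ "1 / s"]) (use that vv in simp_all)
  show "line p T v s = pt False w (p v) (s / snd w v)" if "snd w v \<noteq> 0"
    unfolding pt_def if_False
    by (rule line_eq_iff[OF w, THEN iffD2], intro conjI exI[of _ "1 / snd w v"]) (use that vv in simp_all)
qed

lemma pt_flip:
  assumes "w \<in> T" "x \<in> fst w" "\<zeta> \<noteq> 0"
  shows "pt b w x \<zeta> = pt (\<not> b) w x (1 / \<zeta>)"
proof -
  note vv = vt[OF assms(1,2)]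
  have "line p T (vt w x \<zeta>) 1 = pt False w x (1 / \<zeta>)"
    using line_pt(2)[OF assms(1), of "vt w x \<zeta>" 1] assms(2,3) by (simp only: vv) simp
  moreover have "line p T (vt w x 1) \<zeta> = pt True w x (1 / \<zeta>)"
    using line_pt(1)[OF assms(1), of "vt w x 1" \<zeta>] assms(2,3) by (simp only: vv) simp
  ultimately show ?thesis unfolding pt_def[of b] by (cases b) simp_all
qed

lemma ch_domain:
  assumes "w \<in> T"
  shows "fst (ch b c w) = {pt b w x \<zeta> | x \<zeta>. x \<in> fst c \<inter> fst w}"
proof -
  have "{line p T v s | v s. p v \<in> fst c \<inter> fst w \<and> s \<noteq> 0} = {pt True w x \<zeta> | x \<zeta>. x \<in> fst c \<inter> fst w}"
  proof (intro equalityI subsetI)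
    fix X assume "X \<in> {line p T v s | v s. p v \<in> fst c \<inter> fst w \<and> s \<noteq> 0}"
    then obtain v s where v: "X = line p T v s" "p v \<in> fst c \<inter> fst w" "s \<noteq> 0" by blast
    with line_pt(1)[OF assms, of v s] show "X \<in> {pt True w x \<zeta> | x \<zeta>. x \<in> fst c \<inter> fst w}" by blast
  next
    fix X assume "X \<in> {pt True w x \<zeta> | x \<zeta>. x \<in> fst c \<inter> fst w}"
    then obtain x \<zeta> where x: "X = line p T (vt w x \<zeta>) 1" "x \<in> fst c \<inter> fst w" unfolding pt_def by auto
    then have "p (vt w x \<zeta>) \<in> fst c \<inter> fst w" using vt(1)[OF assms] by simp
    with x(1) show "X \<in> {line p T v s | v s. p v \<in> fst c \<inter> fst w \<and> s \<noteq> 0}"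
      unfolding mem_Collect_eq by (intro exI[of _ "vt w x \<zeta>"] exI[of _ 1] conjI) simp_all
  qed
  note 1 = this
  have 2: "{line p T v s | v s. p v \<in> fst c \<inter> fst w \<and> snd w v \<noteq> 0} = {pt False w x \<zeta> | x \<zeta>. x \<in> fst c \<inter> fst w}"
  proof (intro equalityI subsetI)
    fix X assume "X \<in> {line p T v s | v s. p v \<in> fst c \<inter> fst w \<and> snd w v \<noteq> 0}"
    then obtain v s where v: "X = line p T v s" "p v \<in> fst c \<inter> fst w" "snd w v \<noteq> 0" by blast
    with line_pt(2)[OF assms, of v s] show "X \<in> {pt False w x \<zeta> | x \<zeta>. x \<in> fst c \<inter> fst w}" by blast
  next
    fix X assume "X \<in> {pt False w x \<zeta> | x \<zeta>. x \<in> fst c \<inter> fst w}"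
    then obtain x \<zeta> where x: "X = line p T (vt w x 1) \<zeta>" "x \<in> fst c \<inter> fst w" unfolding pt_def by auto
    then have "p (vt w x 1) \<in> fst c \<inter> fst w" "snd w (vt w x 1) \<noteq> 0" using vt[OF assms] by simp_all
    with x(1) show "X \<in> {line p T v s | v s. p v \<in> fst c \<inter> fst w \<and> snd w v \<noteq> 0}"
      unfolding mem_Collect_eq by (intro exI[of _ "vt w x 1"] exI[of _ \<zeta>] conjI) simp_all
  qed
  show ?thesis unfolding ch_def chart_off_infinity_def chart_off_zero_def
    by (cases b) (simp_all only: 1 2 if_True if_False fst_conv)
qed

lemma ch_coord:
  assumes "w \<in> T" "x \<in> fst c \<inter> fst w"
  shows "snd (ch b c w) (pt b w x \<zeta>) = vector [snd c x $ 1, \<zeta>]"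
proof -
  have xw: "x \<in> fst w" using assms by simp
  note vv = vt[OF assms(1) xw]
  have "snd (chart_off_infinity p T c w) (pt True w x \<zeta>) = vector [snd c x $ 1, \<zeta>]"
    unfolding chart_off_infinity_def snd_conv
  proof (rule the_equality)
    show "\<exists>v s. pt True w x \<zeta> = line p T v s \<and> s \<noteq> 0 \<and> vector [snd c x $ 1, \<zeta>] = (vector [snd c (p v) $ 1, snd w v / s] :: complex^2)"
      by (intro exI[of _ "vt w x \<zeta>"] exI[of _ 1] conjI) (simp_all only: vv pt_def if_True div_by_1 one_neq_zero not_False_eq_True)
    fix z :: "complex^2" assume "\<exists>v s. pt True w x \<zeta> = line p T v s \<and> s \<noteq> 0 \<and> z = vector [snd c (p v) $ 1, snd w v / s]"
    then obtain v s where vs: "pt True w x \<zeta> = line p T v s" "s \<noteq> 0" "z = vector [snd c (p v) $ 1, snd w v / s]" by blast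
    from vs(1) have "line p T (vt w x \<zeta>) 1 = line p T v s" by (simp only: pt_def if_True)
    from vt_line_eqD[OF assms(1) xw this] have "p v = x" "snd w v = s * \<zeta>" by auto
    with vs(2,3) show "z = vector [snd c x $ 1, \<zeta>]" by simp
  qed
  moreover have "snd (chart_off_zero p T c w) (pt False w x \<zeta>) = vector [snd c x $ 1, \<zeta>]"
    unfolding chart_off_zero_def snd_conv
  proof (rule the_equality)
    show "\<exists>v s. pt False w x \<zeta> = line p T v s \<and> snd w v \<noteq> 0 \<and> vector [snd c x $ 1, \<zeta>] = (vector [snd c (p v) $ 1, s / snd w v] :: complex^2)"
      by (intro exI[of _ "vt w x 1"] exI[of _ \<zeta>] conjI) (simp_all only: vv pt_def if_False div_by_1 one_neq_zero not_False_eq_True)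
    fix z :: "complex^2" assume "\<exists>v s. pt False w x \<zeta> = line p T v s \<and> snd w v \<noteq> 0 \<and> z = vector [snd c (p v) $ 1, s / snd w v]"
    then obtain v s where vs: "pt False w x \<zeta> = line p T v s" "snd w v \<noteq> 0" "z = vector [snd c (p v) $ 1, s / snd w v]" by blast
    from vs(1) have "line p T (vt w x 1) \<zeta> = line p T v s" by (simp only: pt_def if_False)
    from vt_line_eqD[OF assms(1) xw this] have "p v = x" "s = snd w v * \<zeta>" by auto
    with vs(2,3) show "z = vector [snd c x $ 1, \<zeta>]" by simp
  qed
  ultimately show ?thesis unfolding ch_def by (cases b) simp_all
qed

lemma pt_change:
  assumes "w \<in> T" "w' \<in> T" "x \<in> fst w" "x \<in> fst w'"
  shows "pt b w x \<zeta> = pt b w' x ((if b then tg w w' x else inverse (tg w w' x)) * \<zeta>)"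
proof -
  note vv = vt[OF assms(1,3)]
  have g: "snd w' (vt w x z) = tg w w' x * z" for z
    using tg(3)[OF assms(1,2), of "vt w x z"] assms(3,4) by (simp only: vv)
  have "line p T (vt w x \<zeta>) 1 = pt True w' x (tg w w' x * \<zeta>)"
    using line_pt(1)[OF assms(2), of "vt w x \<zeta>" 1] assms(4) by (simp only: vv g) simp
  moreover have "line p T (vt w x 1) \<zeta> = pt False w' x (inverse (tg w w' x) * \<zeta>)"
    using line_pt(2)[OF assms(2), of "vt w x 1" \<zeta>] assms(4) tg(2)[OF assms(1,2,3,4)]
    by (simp only: vv g) (simp add: divide_inverse mult.commute)
  ultimately show ?thesis unfolding pt_def[of b w] by (cases b) simp_all
qed

lemma zero_vector_iff:
  assumes "w \<in> T" "p v \<in> fst w"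
  shows "zero_vector p T v \<longleftrightarrow> snd w v = 0"
proof
  assume "zero_vector p T v" then show "snd w v = 0"
    using assms unfolding zero_vector_def by (auto simp: case_prod_beta)
next
  assume z: "snd w v = 0"
  have "snd w' v = 0" if "w' \<in> T" "p v \<in> fst w'" for w'
    using tg(3)[OF assms(1) that(1) assms(2) that(2)] z by simp
  then show "zero_vector p T v" unfolding zero_vector_def by (auto simp: case_prod_beta)
qed

lemma zero_section_iff:
  assumes "w \<in> T" "x \<in> fst w"
  shows "pt b w x \<zeta> \<in> zero_section p T \<longleftrightarrow> b \<and> \<zeta> = 0"
proof
  assume "pt b w x \<zeta> \<in> zero_section p T"
  then obtain v where v: "pt b w x \<zeta> = line p T v 1" "zero_vector p T v" unfolding zero_section_def by blast
  note vv = vt[OF assms]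
  show "b \<and> \<zeta> = 0"
  proof (cases b)
    case True
    with v have "line p T (vt w x \<zeta>) 1 = line p T v 1" by (simp add: pt_def)
    from vt_line_eqD[OF assms this] have "p v = x" "snd w v = \<zeta>" by auto
    with v(2) zero_vector_iff[OF assms(1), of v] assms(2) True show ?thesis by simp
  next
    case False
    with v have "line p T (vt w x 1) \<zeta> = line p T v 1" by (simp add: pt_def)
    from vt_line_eqD[OF assms this] have "p v = x" "snd w v \<noteq> 0" by auto
    with v(2) zero_vector_iff[OF assms(1), of v] assms(2) show ?thesis by simp
  qed
next
  assume "b \<and> \<zeta> = 0"
  then show "pt b w x \<zeta> \<in> zero_section p T"
  proof -
    have "pt b w x \<zeta> = line p T (vt w x 0) 1" using \<open>b \<and> \<zeta> = 0\<close> by (simp add: pt_def)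
    moreover have "p (vt w x 0) \<in> \<Union> (fst ` T) \<and> zero_vector p T (vt w x 0)"
      using zero_vector_iff[OF assms(1), of "vt w x 0"] vt[OF assms, of 0] assms by auto
    ultimately show ?thesis unfolding zero_section_def by blast
  qed
qed

lemma infinity_section_iff:
  assumes "w \<in> T" "x \<in> fst w"
  shows "pt b w x \<zeta> \<in> infinity_section p T \<longleftrightarrow> \<not> b \<and> \<zeta> = 0"
proof
  assume "pt b w x \<zeta> \<in> infinity_section p T"
  then obtain v where v: "pt b w x \<zeta> = line p T v 0" "\<not> zero_vector p T v" unfolding infinity_section_def by blast
  note vv = vt[OF assms]
  show "\<not> b \<and> \<zeta> = 0"
  proof (cases b)
    case True
    with v have "line p T (vt w x \<zeta>) 1 = line p T v 0" by (simp add: pt_def)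
    from vt_line_eqD[OF assms this] show ?thesis by auto
  next
    case False
    with v have "line p T (vt w x 1) \<zeta> = line p T v 0" by (simp add: pt_def)
    from vt_line_eqD[OF assms this] False show ?thesis by auto
  qed
next
  assume "\<not> b \<and> \<zeta> = 0"
  then show "pt b w x \<zeta> \<in> infinity_section p T"
  proof -
    have "pt b w x \<zeta> = line p T (vt w x 1) 0" using \<open>\<not> b \<and> \<zeta> = 0\<close> by (simp add: pt_def)
    moreover have "p (vt w x 1) \<in> \<Union> (fst ` T) \<and> \<not> zero_vector p T (vt w x 1)"
      using zero_vector_iff[OF assms(1), of "vt w x 1"] vt[OF assms, of 1] assms by auto
    ultimately show ?thesis unfolding infinity_section_def by blast
  qed
qed

lemma pt_in_bundle:
  assumes "w \<in> T" "x \<in> fst w"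
  shows "pt b w x \<zeta> \<in> proj_bundle p T"
proof -
  have 1: "p (vt w x \<zeta>) \<in> \<Union> (fst ` T)" "p (vt w x 1) \<in> \<Union> (fst ` T)"
    using vt(1)[OF assms] assms by auto
  have 2: "\<not> zero_vector p T (vt w x 1)"
    using zero_vector_iff[OF assms(1), of "vt w x 1"] vt[OF assms, of 1] assms by simp
  show ?thesis
  proof (cases b)
    case True
    then have "pt b w x \<zeta> = line p T (vt w x \<zeta>) 1" by (simp add: pt_def)
    then show ?thesis unfolding proj_bundle_def mem_Collect_eq
      by (intro exI[of _ "vt w x \<zeta>"] exI[of _ 1] conjI) (use 1(1) in simp_all)
  next
    case False
    then have "pt b w x \<zeta> = line p T (vt w x 1) \<zeta>" by (simp add: pt_def)
    then show ?thesis unfolding proj_bundle_def mem_Collect_eq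
      by (intro exI[of _ "vt w x 1"] exI[of _ \<zeta>] conjI) (use 1(2) 2 in simp_all)
  qed
qed

lemma bundle_cases:
  assumes "X \<in> proj_bundle p T"
  obtains w x \<zeta> where "w \<in> T" "x \<in> fst w" "X = pt b w x \<zeta>" | w x where "w \<in> T" "x \<in> fst w" "X = pt (\<not> b) w x 0"
proof -
  obtain v s where X: "X = line p T v s" "p v \<in> \<Union> (fst ` T)" "\<not> zero_vector p T v \<or> s \<noteq> 0"
    using assms unfolding proj_bundle_def by blast
  then obtain w where w: "w \<in> T" "p v \<in> fst w" by auto
  have "\<exists>b' \<zeta>. X = pt b' w (p v) \<zeta>"
    using X line_pt[OF w, of s] zero_vector_iff[OF w] by blast
  then obtain b' \<zeta> where b': "X = pt b' w (p v) \<zeta>" by blast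
  show thesis
  proof (cases "b' = b")
    case True with that(1) w b' show thesis by blast
  next
    case False
    then have bb: "b' = (\<not> b)" by auto
    show thesis
    proof (cases "\<zeta> = 0")
      case True with that(2) w b' bb show thesis by blast
    next
      case False
      with pt_flip[OF w False, of b'] b' bb that(1)[OF w, of "1 / \<zeta>"] show thesis by simp
    qed
  qed
qed

text \<open>The union of the charts of type \<open>b\<close>: the only section they miss is the zero
  locus of the other fibre coordinate.\<close>

definition Yb where "Yb b = proj_bundle p T - nsec (\<not> b)"

lemma Yb_iff:
  assumes "w \<in> T" "x \<in> fst w"
  shows "pt b w x \<zeta> \<in> Yb b'  \<longleftrightarrow> b = b' \<or> \<zeta> \<noteq> 0"
  using zero_section_iff[OF assms] infinity_section_iff[OF assms] pt_in_bundle[OF assms]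
  by (auto simp: Yb_def nsec_def)

lemma Yb_cases:
  assumes "X \<in> Yb b"
  obtains w x \<zeta> where "w \<in> T" "x \<in> fst w" "X = pt b w x \<zeta>"
proof (rule bundle_cases[of X b])
  show "X \<in> proj_bundle p T" using assms by (simp add: Yb_def)
  fix w x assume "w \<in> T" "x \<in> fst w" "X = pt (\<not> b) w x 0"
  with Yb_iff[of w x "\<not> b" 0 b] assms show thesis by simp
qed

lemma ruled_atlas_eq: "ruled_atlas A p T = {ch b c w | b c w. c \<in> A \<and> w \<in> T}"
proof (intro equalityI subsetI)
  fix d assume "d \<in> ruled_atlas A p T"
  then consider c w where "d = chart_off_infinity p T c w" "c \<in> A" "w \<in> T"
    | c w where "d = chart_off_zero p T c w" "c \<in> A" "w \<in> T" unfolding ruled_atlas_def by blast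
  then show "d \<in> {ch b c w | b c w. c \<in> A \<and> w \<in> T}"
  proof cases
    case 1
    then have "d = ch True c w" by (simp add: ch_def)
    with 1 show ?thesis by blast
  next
    case 2
    then have "d = ch False c w" by (simp add: ch_def)
    with 2 show ?thesis by blast
  qed
next
  fix d assume "d \<in> {ch b c w | b c w. c \<in> A \<and> w \<in> T}"
  then obtain b c w where d: "d = ch b c w" "c \<in> A" "w \<in> T" by blast
  show "d \<in> ruled_atlas A p T"
  proof (cases b)
    case True
    with d have "d = chart_off_infinity p T c w" by (simp add: ch_def)
    with d(2,3) show ?thesis unfolding ruled_atlas_def by (intro UnI1 CollectI exI conjI)
  next
    case False
    with d have "d = chart_off_zero p T c w" by (simp add: ch_def)
    with d(2,3) show ?thesis unfolding ruled_atlas_def by (intro UnI2 CollectI exI conjI)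
  qed
qed

definition base_dom where "base_dom c w = snd c ` (fst c \<inter> fst w)"

lemma open_base_dom: "c \<in> A \<Longrightarrow> w \<in> T \<Longrightarrow> open (base_dom c w)"
  using trivD(1)[of w] unfolding openin_atlas base_dom_def by (simp add: Int_commute)

lemma ch_image:
  assumes "c \<in> A" "w \<in> T"
  shows "snd (ch b c w) ` (fst (ch b c w) \<inter> Yb b') = {y. bp y \<in> base_dom c w \<and> (b = b' \<or> y $ 2 \<noteq> 0)}"
proof (intro equalityI subsetI)
  fix y assume "y \<in> snd (ch b c w) ` (fst (ch b c w) \<inter> Yb b')"
  then obtain x \<zeta> where x: "x \<in> fst c \<inter> fst w" "pt b w x \<zeta> \<in> Yb b'" "y = snd (ch b c w) (pt b w x \<zeta>)"
    unfolding ch_domain[OF assms(2)] by auto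
  have "y = vector [snd c x $ 1, \<zeta>]" unfolding x(3) by (rule ch_coord[OF assms(2) x(1)])
  then have "bp y = snd c x" "y $ 2 = \<zeta>" by simp_all
  with x(1,2) Yb_iff[OF assms(2), of x b \<zeta> b'] show "y \<in> {y. bp y \<in> base_dom c w \<and> (b = b' \<or> y $ 2 \<noteq> 0)}"
    by (auto simp: base_dom_def)
next
  fix y assume y: "y \<in> {y. bp y \<in> base_dom c w \<and> (b = b' \<or> y $ 2 \<noteq> 0)}"
  then obtain x where x: "x \<in> fst c \<inter> fst w" "bp y = snd c x" by (auto simp: base_dom_def)
  have "snd (ch b c w) (pt b w x (y $ 2)) = y"
    using ch_coord[OF assms(2) x(1), of b "y $ 2"] x(2) by (metis vector_bp)
  moreover have "pt b w x (y $ 2) \<in> fst (ch b c w) \<inter> Yb b'"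
    using x y Yb_iff[OF assms(2), of x b "y $ 2" b'] unfolding ch_domain[OF assms(2)] by auto
  ultimately show "y \<in> snd (ch b c w) ` (fst (ch b c w) \<inter> Yb b')" by (metis image_eqI)
qed

lemma ch_image_full:
  assumes "c \<in> A" "w \<in> T"
  shows "snd (ch b c w) ` fst (ch b c w) = {y. bp y \<in> base_dom c w}"
proof -
  have "fst (ch b c w) \<inter> Yb b = fst (ch b c w)"
    unfolding ch_domain[OF assms(2)] using Yb_iff[OF assms(2)] by auto
  with ch_image[OF assms, of b b] show ?thesis by simp
qed

lemma ch_inv:
  assumes "c \<in> A" "w \<in> T" "bp y \<in> base_dom c w"
  shows "inv_into (fst (ch b c w)) (snd (ch b c w)) y = pt b w (inv_into (fst c) (snd c) (bp y)) (y $ 2)"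
    "inv_into (fst c) (snd c) (bp y) \<in> fst c \<inter> fst w" "snd c (inv_into (fst c) (snd c) (bp y)) = bp y"
proof -
  obtain x where x: "x \<in> fst c \<inter> fst w" "bp y = snd c x" using assms(3) by (auto simp: base_dom_def)
  have inv: "inv_into (fst c) (snd c) (bp y) = x"
    using x inv_into_f_f[OF atlasD(1)[OF assms(1)]] by simp
  show 1: "inv_into (fst c) (snd c) (bp y) \<in> fst c \<inter> fst w" "snd c (inv_into (fst c) (snd c) (bp y)) = bp y"
    using inv x by auto
  have "snd (ch b c w) (pt b w x (y $ 2)) = y"
    using ch_coord[OF assms(2) x(1), of b "y $ 2"] x(2) by (metis vector_bp)
  moreover have "inj_on (snd (ch b c w)) (fst (ch b c w))"
  proof (rule inj_onI)
    fix X X' assume "X \<in> fst (ch b c w)" "X' \<in> fst (ch b c w)" and eq: "snd (ch b c w) X = snd (ch b c w) X'"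
    then obtain x \<zeta> x' \<zeta>' where X: "x \<in> fst c \<inter> fst w" "X = pt b w x \<zeta>" "x' \<in> fst c \<inter> fst w" "X' = pt b w x' \<zeta>'"
      unfolding ch_domain[OF assms(2)] by auto
    with eq have e: "vector [snd c x $ 1, \<zeta>] = (vector [snd c x' $ 1, \<zeta>'] :: complex^2)" by (simp add: ch_coord[OF assms(2)])
    then have "\<zeta> = \<zeta>'" by (metis vector_2(2))
    moreover have "snd c x = snd c x'" using arg_cong[OF e, of bp] by simp
    ultimately show "X = X'" using X atlasD(1)[OF assms(1)] by (auto simp: inj_on_def)
  qed
  moreover have "pt b w x (y $ 2) \<in> fst (ch b c w)" using x unfolding ch_domain[OF assms(2)] by auto
  ultimately show "inv_into (fst (ch b c w)) (snd (ch b c w)) y = pt b w (inv_into (fst c) (snd c) (bp y)) (y $ 2)"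
    unfolding inv by (metis inv_into_f_f)
qed

section \<open>The Hermitian weight and the base metric in coordinates\<close>

definition lw where "lw w = local_weight p nrm (snd w)"

lemma lw:
  assumes "w \<in> T"
  shows "mfd_smooth_on A (fst w) (lw w)" "\<And>x. x \<in> fst w \<Longrightarrow> 0 < lw w x"
    "\<And>v. p v \<in> fst w \<Longrightarrow> nrm v = sqrt (lw w (p v)) * cmod (snd w v)"
proof -
  obtain h where h: "mfd_smooth_on A (fst w) h" "\<forall>x\<in>fst w. 0 < h x"
    "\<forall>v. p v \<in> fst w \<longrightarrow> nrm v = sqrt (h (p v)) * cmod (snd w v)"
    using hn assms unfolding hermitian_norm_def by (auto simp: case_prod_beta)
  \<comment> \<open>The metric comes with some unnamed weight; evaluating the norm on the vector
    with fibre coordinate 1 identifies it with \<open>local_weight\<close>.\<close>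
  have eq: "lw w x = h x" if x: "x \<in> fst w" for x
  proof -
    have "(THE v. p v = x \<and> snd w v = 1) = vt w x 1"
      by (rule the_equality) (use vt[OF assms x] triv_inj[OF assms, of "vt w x 1"] x in auto)
    then show ?thesis unfolding lw_def local_weight_def using h vt[OF assms x, of 1] x
      by (simp add: less_imp_le)
  qed
  show "0 < lw w x" if "x \<in> fst w" for x using eq h that by simp
  show "nrm v = sqrt (lw w (p v)) * cmod (snd w v)" if "p v \<in> fst w" for v using eq h that by simp
  show "mfd_smooth_on A (fst w) (lw w)"
    unfolding mfd_smooth_on_def
  proof clarify
    fix U \<psi> assume c: "(U, \<psi>) \<in> A"
    have s: "smooth_on (\<psi> ` (U \<inter> fst w)) (h \<circ> inv_into U \<psi>)"
      using h(1) c unfolding mfd_smooth_on_def by auto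
    show "smooth_on (\<psi> ` (U \<inter> fst w)) (lw w \<circ> inv_into U \<psi>)"
    proof (rule smooth_on_cong[OF _ _ s])
      show "open (\<psi> ` (U \<inter> fst w))" using open_base_dom[OF c assms] by (simp add: base_dom_def)
      show "(h \<circ> inv_into U \<psi>) x = (lw w \<circ> inv_into U \<psi>) x" if x: "x \<in> \<psi> ` (U \<inter> fst w)" for x
      proof -
        obtain q where "q \<in> U \<inter> fst w" "x = \<psi> q" using x by blast
        then show ?thesis using eq inv_into_f_f[OF atlasD(1)[OF c]] by simp
      qed
    qed
  qed
qed

definition kf :: "('m, 1) chart \<Rightarrow> ('l, 'm) triv \<Rightarrow> complex^1 \<Rightarrow> real"
  where "kf c w z = ln (lw w (inv_into (fst c) (snd c) z))"
text \<open>Charts off the zero section use the coordinate \<open>s / \<theta> v\<close>, which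
  belongs to the dual bundle, so the logarithmic weight changes sign.\<close>

definition kb :: "bool \<Rightarrow> ('m, 1) chart \<Rightarrow> ('l, 'm) triv \<Rightarrow> complex^1 \<Rightarrow> real"
  where "kb b c w z = (if b then kf c w z else - kf c w z)"
definition af :: "('m, 1) chart \<Rightarrow> complex^1 \<Rightarrow> real"
  where "af c z = Re (\<omega>M c z $ 1 $ 1)"
definition sb :: "bool \<Rightarrow> real" where "sb b = (if b then 1 else -1)"

lemma base_domD:
  assumes "z \<in> base_dom c w" "c \<in> A"
  obtains x where "x \<in> fst c" "x \<in> fst w" "z = snd c x" "inv_into (fst c) (snd c) z = x"
  using assms inv_into_f_f[OF atlasD(1)[OF assms(2)]] unfolding base_dom_def by auto

lemma smooth_kf:
  assumes "c \<in> A" "w \<in> T"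
  shows "smooth_on (base_dom c w) (kf c w)"
proof -
  have s: "smooth_on (base_dom c w) (\<lambda>z. lw w (inv_into (fst c) (snd c) z))"
    using lw(1)[OF assms(2)] assms(1) unfolding mfd_smooth_on_def base_dom_def
    by (auto simp: case_prod_beta o_def)
  show ?thesis unfolding kf_def[abs_def]
    by (rule smooth_on_comp_real[OF _ smooth_on_ln[OF order.refl] s])
      (use lw(2)[OF assms(2)] in \<open>auto elim: base_domD[OF _ assms(1)]\<close>)
qed

lemma smooth_kb: "c \<in> A \<Longrightarrow> w \<in> T \<Longrightarrow> smooth_on (base_dom c w) (kb b c w)"
  unfolding kb_def[abs_def] using smooth_kf[of c w] smooth_on_minus[OF smooth_kf[of c w]] by (cases b) simp_all

lemma exp_kb:
  assumes "w \<in> T" "c \<in> A" "x \<in> fst c" "x \<in> fst w"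
  shows "kb b c w (snd c x) = sb b * ln (lw w x)"
  unfolding kb_def kf_def sb_def using inv_into_f_f[OF atlasD(1)[OF assms(2)] assms(3)] by simp

lemma omega_properties:
  assumes "c \<in> A"
  shows "smooth_on (snd c ` fst c) (af c)" "\<And>x. x \<in> fst c \<Longrightarrow> 0 < af c (snd c x)"
    "\<And>x. x \<in> fst c \<Longrightarrow> \<omega>M c (snd c x) $ 1 $ 1 = of_real (af c (snd c x))"
    "\<And>x. x \<in> fst c \<Longrightarrow> Re (ddbar 1 1 (\<lambda>z. ln (af c z)) (snd c x)) = 2 * af c (snd c x)"
proof -
  have int: "fst c \<inter> atlas_space A = fst c" using atlasD(3)[OF assms] by blast
  have "\<forall>c\<in>A. \<forall>j k. smooth_on (snd c ` (fst c \<inter> atlas_space A)) (\<lambda>z. \<omega>M c z $ j $ k)"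
    using km unfolding kaehler_metric_def case_prod_beta prod.collapse by (elim conjE) assumption
  from bspec[OF this assms] have "smooth_on (snd c ` fst c) (\<lambda>z. \<omega>M c z $ 1 $ 1)"
    unfolding int by blast
  then show "smooth_on (snd c ` fst c) (af c)" unfolding af_def[abs_def] by (rule smooth_on_Re)
  have k2: "(\<forall>j k. \<omega>M c (snd c x) $ j $ k = cnj (\<omega>M c (snd c x) $ k $ j)) \<and>
       (\<forall>u. u \<noteq> 0 \<longrightarrow> 0 < Re (herm (\<omega>M c (snd c x)) u u))" if "x \<in> fst c" for x
  proof -
    have x: "snd c x \<in> snd c ` (fst c \<inter> atlas_space A)" using that int by simp
    have "\<forall>c\<in>A. \<forall>z\<in>snd c ` (fst c \<inter> atlas_space A).
       (\<forall>j k. \<omega>M c z $ j $ k = cnj (\<omega>M c z $ k $ j)) \<and>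
       (\<forall>u. u \<noteq> 0 \<longrightarrow> 0 < Re (herm (\<omega>M c z) u u))"
      using km unfolding kaehler_metric_def case_prod_beta prod.collapse by (elim conjE) assumption
    from bspec[OF bspec[OF this assms] x] show ?thesis .
  qed
  show r: "\<omega>M c (snd c x) $ 1 $ 1 = of_real (af c (snd c x))" if "x \<in> fst c" for x
  proof -
    have "\<omega>M c (snd c x) $ 1 $ 1 = cnj (\<omega>M c (snd c x) $ 1 $ 1)" using k2[OF that] by blast
    from arg_cong[OF this, of Im] have "Im (\<omega>M c (snd c x) $ 1 $ 1) = 0" by simp
    then show ?thesis by (simp add: af_def complex_eq_iff)
  qed
  show pos: "0 < af c (snd c x)" if "x \<in> fst c" for x
  proof -
    have "0 < Re (herm (\<omega>M c (snd c x)) (axis 1 1) (axis 1 1))"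
      using k2[OF that] by (simp add: axis_eq_0_iff)
    then show ?thesis by (simp add: herm_def UNIV_1 axis_def af_def)
  qed
  show "Re (ddbar 1 1 (\<lambda>z. ln (af c z)) (snd c x)) = 2 * af c (snd c x)" if "x \<in> fst c" for x
  proof -
    let ?P = "\<omega>M c (snd c x)"
    have s: "scalar_curvature (\<omega>M c) (snd c x) = -2"
      using sc assms int that unfolding mfd_scalar_curvature_def by (auto simp: case_prod_beta)
    have det: "det Q = Q $ 1 $ 1" for Q :: "complex^1^1" by (simp add: det_1)
    have inv: "matrix_inv ?P $ 1 $ 1 = of_real (1 / af c (snd c x))"
    proof -
      have "matrix_inv ?P = (\<chi> i j. 1 / ?P $ 1 $ 1)"
        by (rule matrix_inv_eqI) (use r[OF that] pos[OF that] in
          \<open>auto simp: vec_eq_iff matrix_matrix_mult_def mat_def forall_1 UNIV_1\<close>)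
      then show ?thesis using r[OF that] by simp
    qed
    have "Re (of_real (1 / af c (snd c x)) * ddbar 1 1 (\<lambda>z. ln (af c z)) (snd c x)) = 2"
      using s unfolding scalar_curvature_def UNIV_1 det af_def[symmetric] by (simp add: inv)
    then have "1 / af c (snd c x) * Re (ddbar 1 1 (\<lambda>z. ln (af c z)) (snd c x)) = 2"
      by (simp only: Re_of_real_mult)
    then show ?thesis using pos[OF that] by (simp add: field_simps)
  qed
qed

text \<open>The curvature of \<open>h\<close> is \<open>- \<omega>\<^sub>M\<close>, so
  \<open>\<partial>\<close> \<open>\<partial>\<close>-bar of the logarithmic weight is
  \<open>\<omega>\<^sub>M\<close> itself; the sign \<open>sb b\<close> accounts for the dual
  coordinate.\<close>

lemma ddbar_kb:
  assumes "c \<in> A" "w \<in> T" "z \<in> base_dom c w"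
  shows "ddbar 1 1 (kb b c w) z = of_real (sb b * af c z)"
proof -
  obtain x where x: "x \<in> fst c" "x \<in> fst w" "z = snd c x" using base_domD[OF assms(3,1)] by blast
  have "- (\<omega>M c (snd c x)) $ 1 $ 1 = - ddbar 1 1 (kf c w) (snd c x)"
    using cf assms(1,2) x(1,2) unfolding is_curvature_form_def kf_def[abs_def] lw_def by (auto simp: case_prod_beta)
  then have "ddbar 1 1 (kf c w) z = of_real (af c z)"
    using omega_properties(3)[OF assms(1) x(1)] x(3) by simp
  moreover have "ddbar 1 1 (\<lambda>z. - kf c w z) z = - ddbar 1 1 (kf c w) z"
    by (rule ddbar_minus[OF open_base_dom[OF assms(1,2)] smooth_kf[OF assms(1,2)] assms(3)])
  ultimately show ?thesis unfolding kb_def[abs_def] sb_def by (cases b) simp_all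
qed

lemma log_norm_pt:
  assumes "w \<in> T" "c \<in> A" "x \<in> fst c" "x \<in> fst w" "\<zeta> \<noteq> 0"
  shows "log_norm p T nrm (pt b w x \<zeta>) = sb b / 2 * ln (rad (kb b c w) (vector [snd c x $ 1, \<zeta>]))"
proof -
  note vv = vt[OF assms(1,4)]
  have l: "log_norm p T nrm (line p T v s) = ln (nrm v / cmod s)" if v: "p v = x" and s: "s \<noteq> 0" for v s
    unfolding log_norm_def
  proof (rule the_equality)
    show "\<exists>v' s'. line p T v s = line p T v' s' \<and> s' \<noteq> 0 \<and> ln (nrm v / cmod s) = ln (nrm v' / cmod s')" using s by blast
    fix t assume "\<exists>v' s'. line p T v s = line p T v' s' \<and> s' \<noteq> 0 \<and> t = ln (nrm v' / cmod s')"
    then obtain v' s' where v': "line p T v s = line p T v' s'" "s' \<noteq> 0" "t = ln (nrm v' / cmod s')" by blast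
    have "p v \<in> fst w" using v assms(4) by simp
    from line_eq_iff[OF assms(1) this, THEN iffD1, OF v'(1)]
    obtain d where d: "p v = p v'" "d \<noteq> 0" "s' = d * s" "snd w v' = d * snd w v" by blast
    have "nrm v' = cmod d * nrm v" using lw(3)[OF assms(1)] d v assms(4) by (simp add: norm_mult)
    with v' d show "t = ln (nrm v / cmod s)" by (simp add: norm_mult)
  qed
  have pos: "0 < lw w x" using lw(2)[OF assms(1,4)] .
  have rd: "ln (rad (kb b c w) (vector [snd c x $ 1, \<zeta>])) = sb b * ln (lw w x) + 2 * ln (cmod \<zeta>)"
    unfolding rad_def using assms(5) exp_kb[OF assms(1-4)] by (simp add: ln_mult ln_realpow)
  show ?thesis
  proof (cases b)
    case True
    then have "log_norm p T nrm (pt b w x \<zeta>) = ln (sqrt (lw w x) * cmod \<zeta>)"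
      using l[of "vt w x \<zeta>" 1] vv lw(3)[OF assms(1), of "vt w x \<zeta>"] assms(4) by (simp add: pt_def)
    also have "\<dots> = ln (lw w x) / 2 + ln (cmod \<zeta>)" using pos assms(5) by (simp add: ln_mult ln_sqrt)
    finally show ?thesis unfolding rd using True by (simp add: sb_def)
  next
    case False
    then have "log_norm p T nrm (pt b w x \<zeta>) = ln (sqrt (lw w x) / cmod \<zeta>)"
      using l[of "vt w x 1" \<zeta>] vv lw(3)[OF assms(1), of "vt w x 1"] assms(4,5) by (simp add: pt_def)
    also have "\<dots> = ln (lw w x) / 2 - ln (cmod \<zeta>)" using pos assms(5) by (simp add: ln_div ln_sqrt)
    finally show ?thesis unfolding rd using False by (simp add: sb_def diff_divide_distrib)
  qed
qed

end

section \<open>Compatibility under coordinate changes\<close>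

lemma bounded_linear_axis: "bounded_linear (axis i :: complex \<Rightarrow> complex^'n::finite)"
proof -
  have "linear (axis i :: complex \<Rightarrow> complex^'n)"
    by (rule linearI) (auto simp: vec_eq_iff axis_def)
  then show ?thesis by (simp add: linear_conv_bounded_linear)
qed

lemma vector_2_axis: "vector [x, y] = (axis 1 x + axis 2 y :: complex^2)"
  by (simp add: vec_eq_iff forall_2 axis_def)

lemma has_derivative_vector_2:
  assumes "(f has_derivative f') F" "(g has_derivative g') F"
  shows "((\<lambda>y. vector [f y, g y] :: complex^2) has_derivative (\<lambda>u. vector [f' u, g' u])) F"
  unfolding vector_2_axis
  by (intro has_derivative_add bounded_linear.has_derivative[OF bounded_linear_axis] assms)

lemma has_derivative_ln_norm_sq:
  fixes G :: "'a::real_normed_vector \<Rightarrow> complex"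
  assumes "(G has_derivative G') (at z)" "G z \<noteq> 0"
  shows "((\<lambda>x. ln ((cmod (G x))\<^sup>2)) has_derivative (\<lambda>v. 2 * Re (G' v / G z))) (at z)"
proof -
  have "((\<lambda>x. G x \<bullet> G x) has_derivative (\<lambda>v. G z \<bullet> G' v + G' v \<bullet> G z)) (at z)"
    by (rule has_derivative_inner[OF assms(1) assms(1)])
  then have "((\<lambda>x. (cmod (G x))\<^sup>2) has_derivative (\<lambda>v. 2 * (G z \<bullet> G' v))) (at z)"
    by (simp add: dot_square_norm inner_commute)
  from has_derivative_ln[OF _ this] assms(2)
  have "((\<lambda>x. ln ((cmod (G x))\<^sup>2)) has_derivative (\<lambda>v. 2 * (G z \<bullet> G' v) * inverse ((cmod (G z))\<^sup>2))) (at z)" by simp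
  then show ?thesis
  proof (rule has_derivative_eq_rhs, intro ext)
    fix v
    have "Re (G' v / G z) = Re (G' v * cnj (G z)) / (cmod (G z))\<^sup>2"
      by (subst complex_div_cnj) (simp only: Re_divide_of_real flip: of_real_power)
    then show "2 * (G z \<bullet> G' v) * inverse ((cmod (G z))\<^sup>2) = 2 * Re (G' v / G z)"
      by (simp add: inner_complex_def divide_inverse mult.commute)
  qed
qed

lemma Re_mult_cancel:
  assumes "\<And>v. Re (\<alpha> * v) = Re (\<beta> * v)" shows "\<alpha> = \<beta>"
  using assms[of 1] assms[of \<i>] by (simp add: complex_eq_iff)

lemma kz_derivative:
  assumes "weight O1 k" "z \<in> O1"
  shows "(k has_derivative (\<lambda>v. 2 * Re (kz k z * v $ 1))) (at z)"
proof -
  note d = smooth_on_imp_has_derivative[OF weight.smooth_k[OF assms(1)] assms(2)]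
  show ?thesis
    by (rule has_derivative_eq_rhs[OF d]) (simp add: fun_eq_iff real_derivative_d_z[OF d] kz_def UNIV_1)
qed

lemma vcov_transition:
  fixes g w u1 u2 m K :: complex
  assumes "g \<noteq> 0"
  shows "g * u2 + m * u1 * w + g * w * (of_real 1 * (K - m / g)) * u1 = g * (u2 + w * K * u1)"
    "w \<noteq> 0 \<Longrightarrow> - (inverse (g * w) * (g * u2 + m * u1 * w) * inverse (g * w)) +
       inverse (g * w) * (of_real (-1) * (K - m / g)) * u1 = - (inverse (g * w) / w) * (u2 + w * K * u1)"
  using assms by (simp_all add: divide_simps) (simp_all add: algebra_simps)

text \<open>A change of bundle charts near one point. \<open>chi\<close> changes the base
  coordinate, \<open>G\<close> multiplies the fibre coordinate, \<open>l\<close> and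
  \<open>m\<close> are their derivatives, and \<open>s = -1\<close> when the fibre coordinate is
  also inverted.\<close>

locale transition =
  fixes O1 O1' :: "(complex^1) set" and k k' :: "complex^1 \<Rightarrow> real"
    and chi :: "complex^1 \<Rightarrow> complex^1" and G :: "complex^1 \<Rightarrow> complex"
    and s :: real and l m :: complex and y :: "complex^2" and S :: "(complex^1) set"
  assumes w: "weight O1 k" "weight O1' k'"
    and S: "open S" "bp y \<in> S" "S \<subseteq> O1" "chi (bp y) \<in> O1'"
    and chi: "(chi has_derivative (\<lambda>v. axis 1 (l * v $ 1))) (at (bp y))"
    and G: "(G has_derivative (\<lambda>v. m * v $ 1)) (at (bp y))" "\<And>z. z \<in> S \<Longrightarrow> G z \<noteq> 0"
    and rel: "\<And>z. z \<in> S \<Longrightarrow> k' (chi z) = s * (k z - ln ((cmod (G z))\<^sup>2))"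
begin

text \<open>Differentiate \<open>rel\<close>: as \<open>G\<close> is holomorphic,
  \<open>\<partial>\<close> of \<open>ln (\<bar>G\<bar>\<^sup>2)\<close> is \<open>m / G\<close>,
  the usual gauge term of a connection form. Two complex numbers agree if their products with every
  \<open>v\<close> have equal real parts.\<close>

lemma kz_relation: "l * kz k' (chi (bp y)) = of_real s * (kz k (bp y) - m / G (bp y))"
proof (rule Re_mult_cancel)
  fix v
  let ?z = "bp y"
  have d1: "((\<lambda>z. k' (chi z)) has_derivative (\<lambda>v. 2 * Re (kz k' (chi ?z) * (axis 1 (l * v $ 1) :: complex^1) $ 1))) (at ?z)"
    by (rule has_derivative_compose[where g = k', OF chi kz_derivative[OF w(2) S(4)]])
  have d2: "((\<lambda>z. k' (chi z)) has_derivative (\<lambda>v. s * (2 * Re (kz k ?z * v $ 1) - 2 * Re (m * v $ 1 / G ?z)))) (at ?z)"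
  proof (rule has_derivative_transform_within_open[OF _ S(1,2)])
    show "((\<lambda>z. s * (k z - ln ((cmod (G z))\<^sup>2))) has_derivative (\<lambda>v. s * (2 * Re (kz k ?z * v $ 1) - 2 * Re (m * v $ 1 / G ?z)))) (at ?z)"
      by (intro has_derivative_mult_right has_derivative_diff kz_derivative[OF w(1)] has_derivative_ln_norm_sq G S)
        (use S in auto)
  qed (simp add: rel)
  define R Q Q' where "R = Re (kz k' (chi ?z) * (l * v))" and "Q = Re (kz k ?z * v)" and "Q' = Re (m * v / G ?z)"
  from fun_cong[OF has_derivative_unique[OF d1 d2], of "vec v"]
  have "2 * R = s * (2 * Q - 2 * Q')" unfolding R_def Q_def Q'_def by (simp add: axis_def)
  then have "R = s * (Q - Q')" by (simp add: algebra_simps)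
  moreover have "Re (of_real s * (kz k ?z - m / G ?z) * v) = s * (Q - Q')"
    unfolding Q_def Q'_def by (simp only: mult.assoc Re_of_real_mult) (simp add: left_diff_distrib)
  moreover have "l * kz k' (chi ?z) * v = kz k' (chi ?z) * (l * v)" by (simp only: mult_ac)
  ultimately show "Re (l * kz k' (chi ?z) * v) = Re (of_real s * (kz k ?z - m / G ?z) * v)" 
    unfolding R_def by (simp only:)
qed

lemma chi_bp: "((\<lambda>y. chi (bp y) $ 1) has_derivative (\<lambda>u. l * u $ 1)) (at y)"
proof -
  from bounded_linear.has_derivative[OF bounded_linear_vec_nth[of 1] has_derivative_bp[OF chi]]
  show ?thesis by (simp add: axis_def)
qed

lemma exp_rel:
  "s = 1 \<Longrightarrow> exp (k' (chi (bp y))) = exp (k (bp y)) / (cmod (G (bp y)))\<^sup>2"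
  "s = -1 \<Longrightarrow> exp (k' (chi (bp y))) = (cmod (G (bp y)))\<^sup>2 / exp (k (bp y))"
  unfolding rel[OF S(2)] using G(2)[OF S(2)] by (simp_all add: exp_diff)

text \<open>The gauge term of \<open>kz_relation\<close> makes \<open>vcov\<close> scale by
  \<open>G\<close>, while \<open>exp k\<close> scales by the inverse of
  \<open>\<bar>G\<bar>\<^sup>2\<close>. Hence \<open>rad\<close> and the vertical term of the metric
  are invariant.\<close>

lemma same_type:
  fixes \<Phi> :: "complex^2 \<Rightarrow> complex^2"
  assumes s: "s = 1" and \<Phi>: "\<Phi> = (\<lambda>y. vector [chi (bp y) $ 1, G (bp y) * y $ 2])"
  defines "\<Phi>' \<equiv> frechet_derivative \<Phi> (at y)"
  shows "(\<Phi>' u) $ 1 = l * u $ 1" "vcov k' (\<Phi> y) (\<Phi>' u) = G (bp y) * vcov k y u"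
    "rad k' (\<Phi> y) = rad k y" "exp (k' (bp (\<Phi> y))) * (cmod (G (bp y)))\<^sup>2 = exp (k (bp y))"
proof -
  let ?G = "G (bp y)"
  have nz: "?G \<noteq> 0" using G(2) S(2) by blast
  have "(\<Phi> has_derivative (\<lambda>u. vector [l * u $ 1, ?G * u $ 2 + m * bp u $ 1 * y $ 2])) (at y)"
    unfolding \<Phi>
    by (intro has_derivative_vector_2 chi_bp has_derivative_mult has_derivative_bp[OF G(1)]
        bounded_linear_imp_has_derivative bounded_linear_vec_nth)
  from fun_cong[OF frechet_derivative_at[OF this], of u]
  have d: "\<Phi>' u = vector [l * u $ 1, ?G * u $ 2 + m * u $ 1 * y $ 2]" by (simp add: \<Phi>'_def)
  then show "(\<Phi>' u) $ 1 = l * u $ 1" by simp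
  have b: "bp (\<Phi> y) = chi (bp y)" unfolding \<Phi> by simp
  have "vcov k' (\<Phi> y) (\<Phi>' u) = ?G * u $ 2 + m * u $ 1 * y $ 2 + ?G * y $ 2 * (l * kz k' (chi (bp y))) * u $ 1"
    unfolding vcov_def d vector_2 \<Phi> bp_vector by (simp only: mult_ac)
  also have "\<dots> = ?G * vcov k y u"
    unfolding kz_relation s vcov_def by (rule vcov_transition(1)[OF nz])
  finally show "vcov k' (\<Phi> y) (\<Phi>' u) = ?G * vcov k y u" .
  show e: "exp (k' (bp (\<Phi> y))) * (cmod ?G)\<^sup>2 = exp (k (bp y))"
    unfolding b exp_rel(1)[OF s] using nz by simp
  have "rad k' (\<Phi> y) = exp (k' (bp (\<Phi> y))) * (cmod ?G)\<^sup>2 * (cmod (y $ 2))\<^sup>2"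
    unfolding rad_def by (simp add: \<Phi> norm_mult power_mult_distrib)
  then show "rad k' (\<Phi> y) = rad k y" unfolding e rad_def .
qed

text \<open>The derivative of \<open>1 / (G * w)\<close> supplies the factor \<open>c\<close>, and
  the negated logarithmic weight inverts \<open>rad\<close>. The metrics agree only if the radial
  coefficients are exchanged accordingly, see \<open>LM_flip\<close>.\<close>

lemma opposite_type:
  fixes \<Phi> :: "complex^2 \<Rightarrow> complex^2"
  assumes s: "s = -1" and \<Phi>: "\<Phi> = (\<lambda>y. vector [chi (bp y) $ 1, inverse (G (bp y) * y $ 2)])" and y2: "y $ 2 \<noteq> 0"
  defines "\<Phi>' \<equiv> frechet_derivative \<Phi> (at y)"
  defines "c \<equiv> - (inverse (G (bp y) * y $ 2) / y $ 2)"
  shows "(\<Phi>' u) $ 1 = l * u $ 1" "vcov k' (\<Phi> y) (\<Phi>' u) = c * vcov k y u"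
    "rad k' (\<Phi> y) = inverse (rad k y)"
    "exp (k' (bp (\<Phi> y))) * (cmod c)\<^sup>2 = inverse (rad k y) / (cmod (y $ 2))\<^sup>2"
proof -
  let ?G = "G (bp y)"
  have nz: "?G \<noteq> 0" using G(2) S(2) by blast
  have nz2: "?G * y $ 2 \<noteq> 0" using nz y2 by simp
  let ?i = "inverse (?G * y $ 2)"
  have "((\<lambda>y. G (bp y) * y $ 2) has_derivative (\<lambda>u. ?G * u $ 2 + m * bp u $ 1 * y $ 2)) (at y)"
    by (intro has_derivative_mult has_derivative_bp[OF G(1)]
        bounded_linear_imp_has_derivative bounded_linear_vec_nth)
  from Deriv.has_derivative_inverse[OF nz2 this]
  have "(\<Phi> has_derivative (\<lambda>u. vector [l * u $ 1, - (?i * (?G * u $ 2 + m * bp u $ 1 * y $ 2) * ?i)])) (at y)"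
    unfolding \<Phi> by (intro has_derivative_vector_2 chi_bp)
  from fun_cong[OF frechet_derivative_at[OF this], of u]
  have d: "\<Phi>' u = vector [l * u $ 1, - (?i * (?G * u $ 2 + m * u $ 1 * y $ 2) * ?i)]" by (simp add: \<Phi>'_def)
  then show "(\<Phi>' u) $ 1 = l * u $ 1" by simp
  have b: "bp (\<Phi> y) = chi (bp y)" unfolding \<Phi> by simp
  have "vcov k' (\<Phi> y) (\<Phi>' u) = - (?i * (?G * u $ 2 + m * u $ 1 * y $ 2) * ?i) + ?i * (l * kz k' (chi (bp y))) * u $ 1"
    unfolding vcov_def d vector_2 \<Phi> bp_vector by (simp only: mult_ac)
  also have "\<dots> = c * vcov k y u"
    unfolding kz_relation s vcov_def c_def by (rule vcov_transition(2)[OF nz y2])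
  finally show "vcov k' (\<Phi> y) (\<Phi>' u) = c * vcov k y u" .
  have e: "exp (k' (bp (\<Phi> y))) = (cmod ?G)\<^sup>2 / exp (k (bp y))"
    unfolding b by (rule exp_rel(2)[OF s])
  have i: "(cmod ?i)\<^sup>2 = inverse ((cmod ?G)\<^sup>2) * inverse ((cmod (y $ 2))\<^sup>2)"
    by (simp add: norm_inverse norm_mult power_mult_distrib power_inverse)
  have r: "exp (k' (bp (\<Phi> y))) * (cmod ?i)\<^sup>2 = inverse (rad k y)"
    unfolding e i rad_def using nz y2 by (simp add: divide_simps)
  have P2: "\<Phi> y $ 2 = ?i" unfolding \<Phi> by (simp only: vector_2)
  show "rad k' (\<Phi> y) = inverse (rad k y)"
    unfolding rad_def[of k' "\<Phi> y"] P2 by (rule r)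
  have "(cmod c)\<^sup>2 = (cmod ?i)\<^sup>2 / (cmod (y $ 2))\<^sup>2"
    by (simp only: c_def norm_minus_cancel norm_divide power_divide)
  then show "exp (k' (bp (\<Phi> y))) * (cmod c)\<^sup>2 = inverse (rad k y) / (cmod (y $ 2))\<^sup>2"
    by (simp only: r[symmetric] times_divide_eq_right)
qed

end

section \<open>Transition maps of the ruled atlas\<close>

context ruled
begin

definition gg where "gg b w w' x = (if b then tg w w' x else inverse (tg w w' x))"

lemma trans_lw:
  assumes "w \<in> T" "w' \<in> T" "x \<in> fst w" "x \<in> fst w'"
  shows "ln (lw w' x) = ln (lw w x) - ln ((cmod (tg w w' x))\<^sup>2)"
proof -
  note vv = vt[OF assms(1,3), of 1]
  have "nrm (vt w x 1) = sqrt (lw w x)" using lw(3)[OF assms(1), of "vt w x 1"] assms(3) by (simp add: vv)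
  moreover have "nrm (vt w x 1) = sqrt (lw w' x) * cmod (tg w w' x)"
    using lw(3)[OF assms(2), of "vt w x 1"] tg(3)[OF assms(1,2), of "vt w x 1"] assms(3,4) by (simp add: vv)
  ultimately have "(sqrt (lw w x))\<^sup>2 = (sqrt (lw w' x) * cmod (tg w w' x))\<^sup>2" by simp
  then have "lw w x = lw w' x * (cmod (tg w w' x))\<^sup>2"
    using lw(2)[OF assms(1,3)] lw(2)[OF assms(2,4)] by (simp add: power_mult_distrib)
  then show ?thesis using lw(2)[OF assms(2,4)] tg(2)[OF assms] by (simp add: ln_mult)
qed

lemma weight_kb: "c \<in> A \<Longrightarrow> w \<in> T \<Longrightarrow> weight (base_dom c w) (kb b c w)"
  by unfold_locales (rule open_base_dom smooth_kb; assumption)+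

definition chi where "chi c c' = snd c' \<circ> inv_into (fst c) (snd c)"

text \<open>The same number \<open>l\<close> describes the derivative of the base change and, by
  compatibility of \<open>\<omega>\<^sub>M\<close>, the change of its coefficient; the horizontal
  part of the metric needs both together.\<close>

lemma chi_derivative:
  assumes "c \<in> A" "c' \<in> A" "x \<in> fst c" "x \<in> fst c'"
  obtains l where "(chi c c' has_derivative (\<lambda>v. axis 1 (l * v $ 1))) (at (snd c x))"
    "af c (snd c x) = af c' (snd c' x) * (cmod l)\<^sup>2"
proof -
  have "hol_fun_on (\<lambda>z. chi c c' z $ 1) (snd c ` (fst c \<inter> fst c'))"
    using atlasD2(2)[OF assms(1,2)] unfolding hol_map_on_def chi_def by blast
  moreover have "snd c x \<in> snd c ` (fst c \<inter> fst c')" using assms by blast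
  ultimately obtain l where l: "((\<lambda>z. chi c c' z $ 1) has_derivative (\<lambda>v. l * v $ 1)) (at (snd c x))"
    by (rule hol_fun_on_derivative)
  from bounded_linear.has_derivative[OF bounded_linear_axis[where 'n = 1] l, of 1]
  have "((\<lambda>z. axis (1::1) (chi c c' z $ 1)) has_derivative (\<lambda>v. axis 1 (l * v $ 1))) (at (snd c x))" .
  moreover have "(\<lambda>z. axis (1::1) (chi c c' z $ 1)) = chi c c'"
    by (rule ext) (simp add: vec_eq_iff forall_1 axis_def)
  ultimately have d: "(chi c c' has_derivative (\<lambda>v. axis 1 (l * v $ 1))) (at (snd c x))" by simp
  have td: "transition_deriv c c' x = (\<lambda>v. axis 1 (l * v $ 1))"
    unfolding transition_deriv_def using frechet_derivative_at[OF d] by (simp add: chi_def)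
  have K: "\<forall>c\<in>A. \<forall>d\<in>A. \<forall>x\<in>fst c \<inter> fst d \<inter> atlas_space A. \<forall>u v.
       herm (\<omega>M c (snd c x)) u v =
       herm (\<omega>M d (snd d x)) (transition_deriv c d x u) (transition_deriv c d x v)"
    using km unfolding kaehler_metric_def case_prod_beta prod.collapse by (elim conjE) assumption
  have x: "x \<in> fst c \<inter> fst c' \<inter> atlas_space A" using assms atlasD(3) by blast
  have "herm (\<omega>M c (snd c x)) (axis 1 1) (axis 1 1) =
       herm (\<omega>M c' (snd c' x)) (axis 1 l) (axis 1 l)"
    using bspec[OF bspec[OF bspec[OF K assms(1)] assms(2)] x] unfolding td by (simp add: axis_def)
  then have "complex_of_real (af c (snd c x)) = of_real (af c' (snd c' x)) * (l * cnj l)"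
    by (simp add: herm_def UNIV_1 axis_def omega_properties(3) assms mult.assoc)
  also have "\<dots> = of_real (af c' (snd c' x) * (cmod l)\<^sup>2)"
    by (simp only: of_real_mult complex_norm_square)
  finally have "af c (snd c x) = af c' (snd c' x) * (cmod l)\<^sup>2" by (simp only: of_real_eq_iff)
  with d show thesis by (rule that)
qed

lemma gg_derivative:
  assumes "c \<in> A" "w \<in> T" "w' \<in> T" "x \<in> fst c" "x \<in> fst w" "x \<in> fst w'"
  obtains m where "((\<lambda>z. gg b w w' (inv_into (fst c) (snd c) z)) has_derivative (\<lambda>v. m * v $ 1)) (at (snd c x))"
proof -
  have "hol_fun_on (tg w w' \<circ> inv_into (fst c) (snd c)) (snd c ` (fst c \<inter> (fst w \<inter> fst w')))"
    using tg(1)[OF assms(2,3)] assms(1) unfolding mfd_holomorphic_on_def by (auto simp: case_prod_beta)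
  moreover have "snd c x \<in> snd c ` (fst c \<inter> (fst w \<inter> fst w'))" using assms by blast
  ultimately obtain m where "((tg w w' \<circ> inv_into (fst c) (snd c)) has_derivative (\<lambda>v. m * v $ 1)) (at (snd c x))"
    by (rule hol_fun_on_derivative)
  then have m: "((\<lambda>z. tg w w' (inv_into (fst c) (snd c) z)) has_derivative (\<lambda>v. m * v $ 1)) (at (snd c x))"
    by (simp add: o_def)
  have inv: "inv_into (fst c) (snd c) (snd c x) = x" by (rule inv_into_f_f[OF atlasD(1)[OF assms(1)] assms(4)])
  have nz: "tg w w' (inv_into (fst c) (snd c) (snd c x)) \<noteq> 0" unfolding inv by (rule tg(2)[OF assms(2,3,5,6)])
  show thesis
  proof (cases b)
    case True with m that show thesis by (simp add: gg_def)
  next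
    case False
    let ?i = "inverse (tg w w' (inv_into (fst c) (snd c) (snd c x)))"
    from Deriv.has_derivative_inverse[OF nz m]
    have "((\<lambda>z. gg b w w' (inv_into (fst c) (snd c) z)) has_derivative (\<lambda>v. - (?i * (m * v $ 1) * ?i))) (at (snd c x))"
      using False by (simp add: gg_def)
    from has_derivative_eq_rhs[OF this, of "\<lambda>v. (- (?i * m * ?i)) * v $ 1"] show thesis
      by (intro that[of "- (?i * m * ?i)"]) (simp add: fun_eq_iff mult_ac)
  qed
qed

lemma transition_locale:
  assumes "c \<in> A" "c' \<in> A" "w \<in> T" "w' \<in> T" "x \<in> fst c" "x \<in> fst c'" "x \<in> fst w" "x \<in> fst w'" "bp y = snd c x"
  obtains l m where "af c (bp y) = af c' (snd c' x) * (cmod l)\<^sup>2"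
    "transition (base_dom c w) (base_dom c' w') (kb b c w) (kb b' c' w') (chi c c')
      (\<lambda>z. gg b w w' (inv_into (fst c) (snd c) z)) (if b = b' then 1 else -1) l m y
      (base_dom c w \<inter> base_dom c w' \<inter> snd c ` (fst c \<inter> fst c'))"
proof -
  obtain l where l: "(chi c c' has_derivative (\<lambda>v. axis 1 (l * v $ 1))) (at (snd c x))"
    "af c (snd c x) = af c' (snd c' x) * (cmod l)\<^sup>2" using chi_derivative[OF assms(1,2,5,6)] by blast
  obtain m where m: "((\<lambda>z. gg b w w' (inv_into (fst c) (snd c) z)) has_derivative (\<lambda>v. m * v $ 1)) (at (snd c x))"
    using gg_derivative[OF assms(1,3,4,5,7,8)] by blast
  have inv: "inv_into (fst c) (snd c) (snd c q) = q" if "q \<in> fst c" for q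
    by (rule inv_into_f_f[OF atlasD(1)[OF assms(1)] that])
  show thesis
  proof (rule that[of l m])
    show "af c (bp y) = af c' (snd c' x) * (cmod l)\<^sup>2" using l(2) assms(9) by simp
    show "transition (base_dom c w) (base_dom c' w') (kb b c w) (kb b' c' w') (chi c c')
      (\<lambda>z. gg b w w' (inv_into (fst c) (snd c) z)) (if b = b' then 1 else -1) l m y
      (base_dom c w \<inter> base_dom c w' \<inter> snd c ` (fst c \<inter> fst c'))"
    proof (rule transition.intro)
      show "weight (base_dom c w) (kb b c w)" "weight (base_dom c' w') (kb b' c' w')"
        using weight_kb assms(1-4) by blast+
      show "open (base_dom c w \<inter> base_dom c w' \<inter> snd c ` (fst c \<inter> fst c'))"
        using open_base_dom assms atlasD2(1) by (intro open_Int) blast+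
      show "bp y \<in> base_dom c w \<inter> base_dom c w' \<inter> snd c ` (fst c \<inter> fst c')"
        using assms by (auto simp: base_dom_def)
      show "chi c c' (bp y) \<in> base_dom c' w'"
        using assms inv[OF assms(5)] by (auto simp: base_dom_def chi_def)
      show "(chi c c' has_derivative (\<lambda>v. axis 1 (l * v $ 1))) (at (bp y))"
        "((\<lambda>z. gg b w w' (inv_into (fst c) (snd c) z)) has_derivative (\<lambda>v. m * v $ 1)) (at (bp y))"
        using l(1) m assms(9) by simp_all
      fix z assume z: "z \<in> base_dom c w \<inter> base_dom c w' \<inter> snd c ` (fst c \<inter> fst c')"
      then obtain q where q: "q \<in> fst c" "q \<in> fst w" "z = snd c q" unfolding base_dom_def by blast
      moreover from z obtain q' where q': "q' \<in> fst c" "q' \<in> fst w'" "z = snd c q'" unfolding base_dom_def by blast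
      moreover from z obtain q'' where q'': "q'' \<in> fst c" "q'' \<in> fst c'" "z = snd c q''" by blast
      ultimately have qq: "q \<in> fst c" "q \<in> fst w" "q \<in> fst w'" "q \<in> fst c'" "z = snd c q"
        using inv by metis+
      show "gg b w w' (inv_into (fst c) (snd c) z) \<noteq> 0"
        unfolding qq(5) inv[OF qq(1)] gg_def using tg(2)[OF assms(3,4) qq(2,3)] by simp
      have "kb b' c' w' (chi c c' z) = sb b' * ln (lw w' q)"
        unfolding chi_def qq(5) o_apply inv[OF qq(1)] by (rule exp_kb[OF assms(4,2) qq(4,3)])
      moreover have "kb b c w z = sb b * ln (lw w q)"
        unfolding qq(5) by (rule exp_kb[OF assms(3,1) qq(1,2)])
      moreover have "ln ((cmod (gg b w w' (inv_into (fst c) (snd c) z)))\<^sup>2) = sb b * ln ((cmod (tg w w' q))\<^sup>2)"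
        unfolding qq(5) inv[OF qq(1)] gg_def sb_def using tg(2)[OF assms(3,4) qq(2,3)]
        by (simp add: norm_inverse power_inverse ln_inverse)
      ultimately show "kb b' c' w' (chi c c' z) = (if b = b' then 1 else -1) *
          (kb b c w z - ln ((cmod (gg b w w' (inv_into (fst c) (snd c) z)))\<^sup>2))"
        unfolding trans_lw[OF assms(3,4) qq(2,3)] sb_def by (cases b; cases b') simp_all
    qed auto
  qed
qed

lemma transition_map:
  assumes "c \<in> A" "c' \<in> A" "w \<in> T" "w' \<in> T"
    and y: "bp y \<in> base_dom c w \<inter> base_dom c w' \<inter> snd c ` (fst c \<inter> fst c')" "b = b' \<or> y $ 2 \<noteq> 0"
  shows "(snd (ch b' c' w') \<circ> inv_into (fst (ch b c w)) (snd (ch b c w))) y =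
    vector [chi c c' (bp y) $ 1, (if b = b' then gg b w w' (inv_into (fst c) (snd c) (bp y)) * y $ 2
       else inverse (gg b w w' (inv_into (fst c) (snd c) (bp y)) * y $ 2))]"
proof -
  let ?q = "inv_into (fst c) (snd c) (bp y)"
  have bw: "bp y \<in> base_dom c w" using y by blast
  note i = ch_inv[OF assms(1,3) bw]
  have inv: "inv_into (fst c) (snd c) (snd c q) = q" if "q \<in> fst c" for q
    by (rule inv_into_f_f[OF atlasD(1)[OF assms(1)] that])
  have q: "?q \<in> fst w'" "?q \<in> fst c'" "?q \<in> fst w"
  proof -
    obtain q where "q \<in> fst c" "q \<in> fst w'" "bp y = snd c q" using y(1) unfolding base_dom_def by blast
    then show "?q \<in> fst w'" by (simp add: inv)
    obtain q where "q \<in> fst c" "q \<in> fst c'" "bp y = snd c q" using y(1) by blast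
    then show "?q \<in> fst c'" by (simp add: inv)
    show "?q \<in> fst w" using i(2) by blast
  qed
  have "inv_into (fst (ch b c w)) (snd (ch b c w)) y = pt b w' ?q (gg b w w' ?q * y $ 2)"
    unfolding i(1) gg_def by (rule pt_change[OF assms(3,4) q(3,1)])
  also have "\<dots> = pt b' w' ?q (if b = b' then gg b w w' ?q * y $ 2 else inverse (gg b w w' ?q * y $ 2))"
  proof (cases "b = b'")
    case False
    then have "b' = (\<not> b)" by blast
    moreover have "gg b w w' ?q * y $ 2 \<noteq> 0"
      using False y(2) tg(2)[OF assms(3,4) q(3,1)] by (simp add: gg_def)
    ultimately show ?thesis using pt_flip[OF assms(4) q(1), of _ b] False by (simp add: divide_inverse)
  qed simp
  finally show ?thesis
    using ch_coord[OF assms(4), of ?q c' b'] q by (simp add: chi_def)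
qed

text \<open>Lines record the base point of their vectors, so it can be read off in any chart of
  either type.\<close>

lemma pt_base:
  assumes "w \<in> T" "x \<in> fst w" "w' \<in> T" "x' \<in> fst w'" "pt b w x \<zeta> = pt b' w' x' \<zeta>'"
  shows "x' = x"
proof -
  have *: "\<exists>v s. pt b w x \<zeta> = line p T v s \<and> p v = x" if "w \<in> T" "x \<in> fst w" for b w x \<zeta>
  proof (cases b)
    case True
    then show ?thesis
      by (intro exI[of _ "vt w x \<zeta>"] exI[of _ 1]) (simp add: pt_def vt(1)[OF that])
  next
    case False
    then show ?thesis
      by (intro exI[of _ "vt w x 1"] exI[of _ \<zeta>]) (simp add: pt_def vt(1)[OF that])
  qed
  obtain v s where v: "pt b w x \<zeta> = line p T v s" "p v = x" using *[OF assms(1,2)] by blast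
  obtain v' s' where v': "pt b' w' x' \<zeta>' = line p T v' s'" "p v' = x'" using *[OF assms(3,4)] by blast
  have "line p T v s = line p T v' s'" using assms(5) v(1) v'(1) by simp
  then have "p v = p v'" by (rule line_eqD)
  then show ?thesis using v(2) v'(2) by simp
qed

end

section \<open>The metric on the ruled surface\<close>

text \<open>\<open>b0 = True\<close> means closing along the zero section, where the moment map is
  smallest, and forces \<open>eps = 1\<close>; \<open>b0 = False\<close> closes along the infinity
  section.\<close>

locale ruled_profile = ruled A p Tv nrm \<omega>M + profile_solution eps kap M d0 p0 p1 A0 A1 T rh J
  for A :: "('m, 1) chart set" and p :: "'l \<Rightarrow> 'm" and Tv :: "('l, 'm) triv set"
    and nrm :: "'l \<Rightarrow> real" and \<omega>M :: "('m, 1) form11"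
    and eps kap M d0 p0 p1 A0 A1 :: real and T rh :: "real \<Rightarrow> real" and J :: "real set" +
  fixes b0 :: bool
  assumes eps_b0: "eps = sb b0"
begin

text \<open>The metric closes up along the section in the charts of type \<open>b0\<close> and has its complete end in
  the charts of the other type.\<close>

definition JJ where "JJ b = (if b = b0 then J else {0<..})"
definition XX where "XX b r = (if b = b0 then T r else T (inverse r))"
definition LL where "LL b = (if b = b0 then closing.lam else cusp.lam)"
definition MM where "MM b = (if b = b0 then closing.mu else cusp.mu)"
definition loc where "loc b c w = lform (LL b) (MM b) (af c) (kb b c w)"
text \<open>A form is indexed by charts, and a chart of the ruled surface need not determine the
  data it was built from, so one triple is chosen. \<open>herm_loc_compat\<close> and
  \<open>chart_independence\<close> show that the choice does no harm.\<close>

definition rep where "rep d = (SOME t. case t of (b, c, w) \<Rightarrow> c \<in> A \<and> w \<in> Tv \<and> d = ch b c w)"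
definition HH :: "('l line, 2) form11"
  where "HH d = (case rep d of (b, c, w) \<Rightarrow> loc b c w)"
text \<open>The limiting horizontal part of the metric, extended independently of the fibre
  coordinate.\<close>

definition eta :: "('l line, 2) chart \<Rightarrow> complex^2 \<Rightarrow> complex^2 \<Rightarrow> complex^2 \<Rightarrow> real"
  where "eta d z u v = 2 * kap * D M * af (fst (snd (rep d))) (bp z) * Re (u $ 1 * cnj (v $ 1))"

lemma rep_cases:
  assumes "d \<in> ruled_atlas A p Tv"
  obtains b c w where "c \<in> A" "w \<in> Tv" "d = ch b c w" "HH d = loc b c w"
    "eta d = (\<lambda>z u v. 2 * kap * D M * af c (bp z) * Re (u $ 1 * cnj (v $ 1)))"
proof -
  obtain b1 c1 w1 where "c1 \<in> A" "w1 \<in> Tv" "d = ch b1 c1 w1" using assms unfolding ruled_atlas_eq by blast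
  then have "\<exists>t. case t of (b, c, w) \<Rightarrow> c \<in> A \<and> w \<in> Tv \<and> d = ch b c w"
    by (intro exI[of _ "(b1, c1, w1)"]) simp
  from someI_ex[OF this] have r: "case rep d of (b, c, w) \<Rightarrow> c \<in> A \<and> w \<in> Tv \<and> d = ch b c w"
    unfolding rep_def .
  obtain b c w where bcw: "rep d = (b, c, w)" by (cases "rep d") auto
  show thesis
    by (rule that[of c w b]) (use r bcw in \<open>simp_all add: HH_def eta_def[abs_def]\<close>)
qed

lemma HH_cases:
  assumes "d \<in> ruled_atlas A p Tv"
  obtains b c w where "c \<in> A" "w \<in> Tv" "d = ch b c w" "HH d = loc b c w"
  using rep_cases[OF assms] that by metis

lemma radial_ch:
  assumes "c \<in> A" "w \<in> Tv"
  shows "radial (base_dom c w) (kb b c w) (af c) (JJ b) (LL b) (MM b) (sb b)"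
proof (rule radial.intro[OF weight_kb[OF assms]], rule radial_axioms.intro)
  have sub: "base_dom c w \<subseteq> snd c ` fst c" by (auto simp: base_dom_def)
  show "smooth_on (base_dom c w) (af c)" by (rule smooth_on_subset[OF omega_properties(1)[OF assms(1)] sub])
  fix x assume x: "x \<in> base_dom c w"
  then obtain q where q: "q \<in> fst c" "x = snd c q" by (auto simp: base_dom_def)
  show "0 < af c x" unfolding q(2) by (rule omega_properties(2)[OF assms(1) q(1)])
  show "Re (ddbar 1 1 (\<lambda>x. ln (af c x)) x) = 2 * af c x"
    unfolding q(2) by (rule omega_properties(4)[OF assms(1) q(1)])
  show "ddbar 1 1 (kb b c w) x = of_real (sb b * af c x)" by (rule ddbar_kb[OF assms x])
next
  have e: "sb b = (if b = b0 then 1 * eps else -1 * eps)" unfolding eps_b0 sb_def by auto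
  show "open (JJ b)" unfolding JJ_def using closing.oJ by auto
  show "smooth_on (JJ b) (LL b)" unfolding JJ_def LL_def using closing.lam_smooth cusp.lam_smooth by simp
  show "smooth_on (JJ b) (MM b)" unfolding JJ_def MM_def using closing.mu_smooth cusp.mu_smooth by simp
  fix r assume r: "r \<in> JJ b"
  show "0 < LL b r" "0 < MM b r" using r closing.lam_gt_0 cusp.lam_gt_0 closing.mu_gt_0 cusp.mu_gt_0
    unfolding JJ_def LL_def MM_def by (cases "b = b0"; simp)+
  show "(LL b has_real_derivative sb b * MM b r) (at r)"
    using r closing.lam_has_derivative cusp.lam_has_derivative
    unfolding JJ_def LL_def MM_def e by (cases "b = b0"; simp)
qed

lemma LL_eq: "LL b r = kap * D (XX b r)"
  unfolding LL_def XX_def closing.lam_def cusp.lam_def by simp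

lemma Om_eq:
  assumes "c \<in> A" "w \<in> Tv"
  shows "radial.Om (base_dom c w) (kb b c w) (JJ b) = {y. bp y \<in> base_dom c w \<and> (b = b0 \<or> y $ 2 \<noteq> 0)}"
proof -
  interpret R: radial "base_dom c w" "kb b c w" "af c" "JJ b" "LL b" "MM b" "sb b" by (rule radial_ch[OF assms])
  have "rad (kb b c w) y \<in> JJ b \<longleftrightarrow> b = b0 \<or> y $ 2 \<noteq> 0" for y
  proof (cases "b = b0")
    case True
    then show ?thesis using rad_ge_0[of "kb b c w" y] sol(2) unfolding JJ_def by (auto simp: subset_iff)
  next
    case False
    then show ?thesis unfolding JJ_def by (simp add: rad_def zero_less_mult_iff)
  qed
  then show ?thesis unfolding R.Om_def R.Ov_def by auto
qed

lemma image_Om: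
  assumes "c \<in> A" "w \<in> Tv"
  shows "snd (ch b c w) ` (fst (ch b c w) \<inter> Yb b0) = radial.Om (base_dom c w) (kb b c w) (JJ b)"
  unfolding ch_image[OF assms] Om_eq[OF assms] ..

lemma scalar_curvature_loc:
  assumes "c \<in> A" "w \<in> Tv" "y \<in> radial.Om (base_dom c w) (kb b c w) (JJ b)"
  shows "scalar_curvature (loc b c w) y = A0 + A1 * XX b (rad (kb b c w) y)"
proof -
  interpret R: radial "base_dom c w" "kb b c w" "af c" "JJ b" "LL b" "MM b" "sb b"
    by (rule radial_ch[OF assms(1,2)])
  let ?r = "rad (kb b c w) y"
  have r: "?r \<in> JJ b" using R.Om_D(3)[OF assms(3)] .
  show ?thesis
  proof (cases "b = b0")
    case True
    then have e: "sb b = 1 * eps" by (simp add: eps_b0)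
    have r': "?r \<in> J" using r True by (simp add: JJ_def)
    have LM: "LL b = closing.lam" "MM b = closing.mu" "JJ b = J" using True by (simp_all add: LL_def MM_def JJ_def)
    have XX: "XX b r = T r" for r using True by (simp add: XX_def)
    show ?thesis
      unfolding loc_def LM XX
      by (rule trans[OF R.scalar_curvature_H[OF assms(3), unfolded LM e, OF closing.V_eq closing.V_deriv[OF r']]
          closing.scalar_eq[OF r']])
  next
    case False
    then have e: "sb b = -1 * eps" unfolding eps_b0 sb_def by auto
    have r': "?r \<in> {0<..}" using r False by (simp add: JJ_def)
    have LM: "LL b = cusp.lam" "MM b = cusp.mu" "JJ b = {0<..}"
      using False by (simp_all add: LL_def MM_def JJ_def)
    have XX: "XX b r = T (inverse r)" for r using False by (simp add: XX_def)
    show ?thesis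
      unfolding loc_def LM XX
      by (rule trans[OF R.scalar_curvature_H[OF assms(3), unfolded LM e, OF cusp.V_eq cusp.V_deriv[OF r']]
          cusp.scalar_eq[OF r']])
  qed
qed

text \<open>The curvature is affine in \<open>XX\<close>, so proportionality of its derivative to
  \<open>MM\<close> is precisely what makes the gradient in \<open>gradient_H\<close>
  holomorphic.\<close>

lemma XX_derivative:
  assumes "r \<in> JJ b"
  obtains d where "(XX b has_real_derivative d) (at r)" "d = (if b = b0 then 1 else -1) * MM b r / kap"
proof (cases "b = b0")
  case True
  have X: "XX b = T" using True by (intro ext) (simp add: XX_def)
  have Mb: "MM b r = 1 * kap * deriv T r" using True by (simp add: MM_def closing.mu_def)
  have "r \<in> J" using True assms by (simp add: JJ_def)
  show thesis
  proof (rule that)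
    show "(XX b has_real_derivative deriv T r) (at r)" unfolding X by (rule closing.dX[OF \<open>r \<in> J\<close>])
    show "deriv T r = (if b = b0 then 1 else -1) * MM b r / kap" unfolding Mb using kap True by simp
  qed
next
  case False
  have X: "XX b = (\<lambda>r. T (inverse r))" using False by (intro ext) (simp add: XX_def)
  have Mb: "MM b r = -1 * kap * deriv (\<lambda>r. T (inverse r)) r" using False by (simp add: MM_def cusp.mu_def)
  have r: "r \<in> {0<..}" using False assms by (simp add: JJ_def)
  show thesis
  proof (rule that)
    show "(XX b has_real_derivative deriv (\<lambda>r. T (inverse r)) r) (at r)" unfolding X by (rule cusp.dX[OF r])
    show "deriv (\<lambda>r. T (inverse r)) r = (if b = b0 then 1 else -1) * MM b r / kap" unfolding Mb using kap False by simp
  qed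
qed

lemma extremal_HH: "extremal_metric (ruled_atlas A p Tv) (Yb b0) HH"
  unfolding extremal_metric_def
proof (intro ballI, unfold case_prod_beta prod.collapse)
  fix d assume "d \<in> ruled_atlas A p Tv"
  then obtain b c w where d: "c \<in> A" "w \<in> Tv" "d = ch b c w" "HH d = loc b c w" by (rule HH_cases)
  interpret R: radial "base_dom c w" "kb b c w" "af c" "JJ b" "LL b" "MM b" "sb b" by (rule radial_ch[OF d(1,2)])
  have im: "snd d ` (fst d \<inter> Yb b0) = R.Om" unfolding d(3) by (rule image_Om[OF d(1,2)])
  define s where "s = A1 * ((if b = b0 then 1 else -1) / kap)"
  have g: "gradient (loc b c w) (scalar_curvature (loc b c w)) y = vector [0, of_real s * y $ 2]" if y: "y \<in> R.Om" for y
  proof -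
    let ?r = "rad (kb b c w) y"
    have r: "?r \<in> JJ b" using R.Om_D(3)[OF y] .
    obtain e where e: "(XX b has_real_derivative e) (at ?r)" "e = (if b = b0 then 1 else -1) * MM b ?r / kap"
      using XX_derivative[OF r] by blast
    have S: "((\<lambda>r. A0 + A1 * XX b r) has_real_derivative A1 * e) (at ?r)"
      by (rule DERIV_cong[OF DERIV_add[OF DERIV_const DERIV_cmult[OF e(1)]]]) simp
    have "A1 * e / MM b ?r = s" unfolding e(2) s_def using R.mu_pos[OF r] by simp
    moreover have "gradient (loc b c w) (scalar_curvature (loc b c w)) y = vector [0, of_real (A1 * e / MM b ?r) * y $ 2]"
      unfolding loc_def
      by (rule R.gradient_H[OF y S R.open_Om y]) (rule scalar_curvature_loc[OF d(1,2), unfolded loc_def])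
    ultimately show ?thesis by simp
  qed
  have "hol_fun_on (\<lambda>y. gradient (loc b c w) (scalar_curvature (loc b c w)) y $ i) R.Om" for i
    unfolding hol_fun_on_def
  proof
    fix y assume y: "y \<in> R.Om"
    define F :: "complex^2 \<Rightarrow> complex" where "F = (\<lambda>y. if i = 1 then 0 else of_real s * y $ 2)"
    have "bounded_linear F" unfolding F_def
      by (cases "i = 1") (simp_all add: bounded_linear_const_mult[OF bounded_linear_vec_nth])
    then have "(F has_derivative F) (at y)" by (rule bounded_linear_imp_has_derivative)
    then have "((\<lambda>y. gradient (loc b c w) (scalar_curvature (loc b c w)) y $ i) has_derivative F) (at y)"
      by (rule has_derivative_transform_within_open[OF _ R.open_Om y]) (use exhaust_2[of i] in \<open>auto simp: g F_def\<close>)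
    moreover have "\<forall>c v. F (c *s v) = c * F v" by (simp add: F_def)
    ultimately show "\<exists>f'. ((\<lambda>y. gradient (loc b c w) (scalar_curvature (loc b c w)) y $ i) has_derivative f') (at y) \<and>
       (\<forall>c v. f' (c *s v) = c * f' v)" by blast
  qed
  then show "hol_map_on (gradient (HH d) (scalar_curvature (HH d))) (snd d ` (fst d \<inter> Yb b0))"
    unfolding im d(4) hol_map_on_def by blast
qed

text \<open>\<open>lam\<close> depends only on the moment coordinate, and \<open>r * mu\<close> is,
  up to sign, its derivative in \<open>ln r\<close>; inversion of \<open>r\<close> reverses
  \<open>ln r\<close>, which the sign in \<open>mu\<close> undoes.\<close>

lemma LM_flip:
  assumes "0 < r"
  shows "LL (\<not> b) (inverse r) = LL b r" "inverse r * MM (\<not> b) (inverse r) = r * MM b r"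
proof -
  show "LL (\<not> b) (inverse r) = LL b r" unfolding LL_eq XX_def by (cases b; cases b0) simp_all
  have 1: "inverse s * cusp.mu (inverse s) = s * closing.mu s" if "0 < s" for s
  proof -
    have d: "deriv (\<lambda>r. T (inverse r)) (inverse s) = - (deriv T (inverse (inverse s)) / (inverse s)\<^sup>2)"
      by (rule DERIV_imp_deriv[OF inverse_deriv]) (use that in simp)
    show ?thesis unfolding cusp.mu_def closing.mu_def d using that
      by (simp add: power2_eq_square divide_inverse)
  qed
  show "inverse r * MM (\<not> b) (inverse r) = r * MM b r"
  proof (cases "b = b0")
    case True
    then have "MM b = closing.mu" "MM (\<not> b) = cusp.mu" unfolding MM_def by (cases b; cases b0; simp)+
    then show ?thesis using 1[OF assms] by (simp only:)
  next
    case False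
    then have "MM b = cusp.mu" "MM (\<not> b) = closing.mu" unfolding MM_def by (cases b; cases b0; simp)+
    moreover have "0 < inverse r" using assms by simp
    ultimately show ?thesis using 1[of "inverse r"] by (simp only: inverse_inverse_eq)
  qed
qed

text \<open>Every change of charts multiplies \<open>dz\<close> by \<open>l\<close> and
  \<open>vcov\<close> by \<open>C\<close>, with the coefficients changing inversely to the squared
  moduli. Compatibility of the metric and of \<open>eta\<close> are both read off from this.\<close>

lemma transition_data:
  assumes c: "c \<in> A" "c' \<in> A" and w: "w \<in> Tv" "w' \<in> Tv"
    and X: "X \<in> fst (ch b c w)" "X \<in> fst (ch b' c' w')" "b \<noteq> b' \<Longrightarrow> snd (ch b c w) X $ 2 \<noteq> 0"
  defines "y \<equiv> snd (ch b c w) X" and "y' \<equiv> snd (ch b' c' w') X"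
    and "td \<equiv> transition_deriv (ch b c w) (ch b' c' w') X"
  obtains l C where "af c (bp y) = af c' (bp y') * (cmod l)\<^sup>2" "\<And>u. td u $ 1 = l * u $ 1"
    "\<And>u. vcov (kb b' c' w') y' (td u) = C * vcov (kb b c w) y u"
    "LL b' (rad (kb b' c' w') y') = LL b (rad (kb b c w) y)"
    "MM b' (rad (kb b' c' w') y') * exp (kb b' c' w' (bp y')) * (cmod C)\<^sup>2 =
      MM b (rad (kb b c w) y) * exp (kb b c w (bp y))"
proof -
  obtain x \<zeta> where x: "X = pt b w x \<zeta>" "x \<in> fst c" "x \<in> fst w" using X(1) unfolding ch_domain[OF w(1)] by blast
  obtain x' \<zeta>' where x': "X = pt b' w' x' \<zeta>'" "x' \<in> fst c'" "x' \<in> fst w'" using X(2) unfolding ch_domain[OF w(2)] by blast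
  have y: "y = vector [snd c x $ 1, \<zeta>]" unfolding y_def x(1) by (rule ch_coord[OF w(1)]) (use x in simp)
  have ybp: "bp y = snd c x" and y2: "y $ 2 = \<zeta>" unfolding y by simp_all
  have xx: "x' = x"
    by (rule pt_base[OF w(1) x(3) w(2) x'(3) trans[OF x(1)[symmetric] x'(1)]])
  have xc: "x \<in> fst c'" "x \<in> fst w'" using x' xx by auto
  obtain l m where a: "af c (bp y) = af c' (snd c' x) * (cmod l)\<^sup>2" and
    tr: "transition (base_dom c w) (base_dom c' w') (kb b c w) (kb b' c' w') (chi c c')
      (\<lambda>z. gg b w w' (inv_into (fst c) (snd c) z)) (if b = b' then 1 else -1) l m y
      (base_dom c w \<inter> base_dom c w' \<inter> snd c ` (fst c \<inter> fst c'))"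
    using transition_locale[OF c w x(2) xc(1) x(3) xc(2) ybp] by blast
  let ?S = "base_dom c w \<inter> base_dom c w' \<inter> snd c ` (fst c \<inter> fst c')"
  let ?G = "\<lambda>z. gg b w w' (inv_into (fst c) (snd c) z)"
  let ?\<Phi> = "\<lambda>y. vector [chi c c' (bp y) $ 1, (if b = b' then ?G (bp y) * y $ 2 else inverse (?G (bp y) * y $ 2))] :: complex^2"
  let ?tm = "snd (ch b' c' w') \<circ> inv_into (fst (ch b c w)) (snd (ch b c w))"
  have oS: "open ?S" using transition.S(1)[OF tr] .
  have yS: "bp y \<in> ?S" using transition.S(2)[OF tr] .
  have o2: "open {y::complex^2. y $ 2 \<noteq> 0}" by (intro open_Collect_neq continuous_intros)
  \<comment> \<open>For charts of opposite type the transition formula needs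
    \<open>w \<noteq> 0\<close>; the derivative is computed on this open set.\<close>
  have oU: "open (bp -` ?S \<inter> {y. b = b' \<or> y $ 2 \<noteq> 0})"
    using open_Int[OF open_vimage[OF oS continuous_on_bp] o2] open_vimage[OF oS continuous_on_bp] by (cases "b = b'") auto
  have yU: "y \<in> bp -` ?S \<inter> {y. b = b' \<or> y $ 2 \<noteq> 0}" using yS X(3) by (cases "b = b'") (simp_all add: y_def)
  have eq: "?tm z = ?\<Phi> z" if "z \<in> bp -` ?S \<inter> {y. b = b' \<or> y $ 2 \<noteq> 0}" for z
    by (rule transition_map[OF c w]) (use that in auto)
  have td: "td = frechet_derivative ?\<Phi> (at y)"
    unfolding td_def transition_deriv_def y_def[symmetric] by (rule frechet_derivative_cong_open[OF oU yU eq])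
  have "bp y \<in> base_dom c w" using yS by blast
  have invX: "inv_into (fst (ch b c w)) (snd (ch b c w)) y = X"
    unfolding ch_inv(1)[OF c(1) w(1) \<open>bp y \<in> base_dom c w\<close>] ybp inv_into_f_f[OF atlasD(1)[OF c(1)] x(2)] y2 x(1) ..
  have y': "y' = ?\<Phi> y" using eq[OF yU] invX unfolding y'_def by simp
  have bpy': "bp (?\<Phi> y) = snd c' x"
    using inv_into_f_f[OF atlasD(1)[OF c(1)] x(2)] by (simp add: chi_def ybp)
  let ?k = "kb b c w" and ?k' = "kb b' c' w'"
  have "\<exists>C. (\<forall>u. vcov ?k' (?\<Phi> y) (frechet_derivative ?\<Phi> (at y) u) = C * vcov ?k y u) \<and>
      (\<forall>u. frechet_derivative ?\<Phi> (at y) u $ 1 = l * u $ 1) \<and>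
      LL b' (rad ?k' (?\<Phi> y)) = LL b (rad ?k y) \<and>
      MM b' (rad ?k' (?\<Phi> y)) * exp (?k' (bp (?\<Phi> y))) * (cmod C)\<^sup>2 = MM b (rad ?k y) * exp (?k (bp y))"
  proof (cases "b = b'")
    case True
    have s: "(if b = b' then 1 else -1 :: real) = 1" using True by simp
    have \<Phi>: "?\<Phi> = (\<lambda>y. vector [chi c c' (bp y) $ 1, ?G (bp y) * y $ 2])" using True by simp
    note T = transition.same_type[OF tr s \<Phi>]
    show ?thesis
      by (rule exI[of _ "?G (bp y)"], intro conjI allI T(1,2), unfold T(3))
        (use T(4) True in \<open>simp_all add: mult.assoc\<close>)
  next
    case False
    have s: "(if b = b' then 1 else -1 :: real) = -1" using False by simp
    have \<Phi>: "?\<Phi> = (\<lambda>y. vector [chi c c' (bp y) $ 1, inverse (?G (bp y) * y $ 2)])" using False by simp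
    have nz: "y $ 2 \<noteq> 0" using X(3)[OF False] by (simp add: y_def)
    note T = transition.opposite_type[OF tr s \<Phi> nz]
    have b': "b' = (\<not> b)" using False by blast
    have r: "0 < rad ?k y" by (rule rad_pos[OF nz])
    have "MM b' (inverse (rad ?k y)) * (inverse (rad ?k y) / (cmod (y $ 2))\<^sup>2) = MM b (rad ?k y) * exp (?k (bp y))"
    proof -
      have "MM b' (inverse (rad ?k y)) * (inverse (rad ?k y) / (cmod (y $ 2))\<^sup>2) = rad ?k y * MM b (rad ?k y) / (cmod (y $ 2))\<^sup>2"
        using LM_flip(2)[OF r, of b] unfolding b' by (simp add: mult.commute)
      also have "\<dots> = MM b (rad ?k y) * exp (?k (bp y))" unfolding rad_def[of ?k y] using nz by simp
      finally show ?thesis .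
    qed
    then have "MM b' (rad ?k' (?\<Phi> y)) * exp (?k' (bp (?\<Phi> y))) * (cmod (- (inverse (?G (bp y) * y $ 2) / y $ 2)))\<^sup>2 =
        MM b (rad ?k y) * exp (?k (bp y))"
      unfolding mult.assoc T(3) T(4) .
    moreover have "LL b' (rad ?k' (?\<Phi> y)) = LL b (rad ?k y)"
      unfolding T(3) unfolding b' by (rule LM_flip(1)[OF r])
    ultimately show ?thesis using T(1,2)
      by (intro exI[of _ "- (inverse (?G (bp y) * y $ 2) / y $ 2)"] conjI allI)
  qed
  then obtain C where C: "\<And>u. vcov ?k' (?\<Phi> y) (frechet_derivative ?\<Phi> (at y) u) = C * vcov ?k y u"
      "\<And>u. frechet_derivative ?\<Phi> (at y) u $ 1 = l * u $ 1"
      "LL b' (rad ?k' (?\<Phi> y)) = LL b (rad ?k y)"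
      "MM b' (rad ?k' (?\<Phi> y)) * exp (?k' (bp (?\<Phi> y))) * (cmod C)\<^sup>2 = MM b (rad ?k y) * exp (?k (bp y))" by blast
  show thesis
    by (rule that[of l C]; unfold td y' bpy') (rule a C(1-3) C(4)[unfolded bpy'])+
qed

lemma herm_loc_compat:
  assumes "c \<in> A" "c' \<in> A" "w \<in> Tv" "w' \<in> Tv"
    "X \<in> fst (ch b c w)" "X \<in> fst (ch b' c' w')" "b \<noteq> b' \<Longrightarrow> snd (ch b c w) X $ 2 \<noteq> 0"
  shows "herm (loc b c w (snd (ch b c w) X)) u v =
    herm (loc b' c' w' (snd (ch b' c' w') X)) (transition_deriv (ch b c w) (ch b' c' w') X u) (transition_deriv (ch b c w) (ch b' c' w') X v)"
proof -
  define y y' td where "y = snd (ch b c w) X" and "y' = snd (ch b' c' w') X"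
    and "td = transition_deriv (ch b c w) (ch b' c' w') X"
  obtain l C where a: "af c (bp y) = af c' (bp y') * (cmod l)\<^sup>2" and td: "\<And>u. td u $ 1 = l * u $ 1"
    "\<And>u. vcov (kb b' c' w') y' (td u) = C * vcov (kb b c w) y u"
    and C: "LL b' (rad (kb b' c' w') y') = LL b (rad (kb b c w) y)"
    "MM b' (rad (kb b' c' w') y') * exp (kb b' c' w' (bp y')) * (cmod C)\<^sup>2 =
      MM b (rad (kb b c w) y) * exp (kb b c w (bp y))"
    unfolding y_def y'_def td_def using transition_data[OF assms] by blast
  have A: "complex_of_real (LL b (rad (kb b c w) y) * af c (bp y)) = of_real (LL b (rad (kb b c w) y) * af c' (bp y')) * (l * cnj l)"
    unfolding a by (simp only: of_real_mult complex_norm_square mult.assoc)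
  have B: "complex_of_real (MM b (rad (kb b c w) y) * exp (kb b c w (bp y))) =
      of_real (MM b' (rad (kb b' c' w') y') * exp (kb b' c' w' (bp y'))) * (C * cnj C)"
    unfolding C(2)[symmetric] by (simp only: of_real_mult complex_norm_square mult.assoc)
  show ?thesis
    unfolding y_def[symmetric] y'_def[symmetric] td_def[symmetric] loc_def herm_lform C(1) td complex_cnj_mult A B
    by (simp only: mult_ac)
qed

text \<open>Where the fibre coordinate vanishes the point lies on a section that charts of the other
  type do not contain.\<close>

lemma chart_types_agree:
  assumes "w \<in> Tv" "w' \<in> Tv" "X \<in> fst (ch b c w)" "X \<in> fst (ch b' c' w')" "b \<noteq> b'"
  shows "snd (ch b c w) X $ 2 \<noteq> 0"
proof
  assume z: "snd (ch b c w) X $ 2 = 0"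
  obtain x \<zeta> where x: "X = pt b w x \<zeta>" "x \<in> fst c \<inter> fst w" using assms(3) unfolding ch_domain[OF assms(1)] by blast
  then have z0: "\<zeta> = 0" using z ch_coord[OF assms(1), of x c b \<zeta>] by simp
  obtain x' \<zeta>' where x': "X = pt b' w' x' \<zeta>'" "x' \<in> fst c' \<inter> fst w'" using assms(4) unfolding ch_domain[OF assms(2)] by blast
  have "X \<in> zero_section p Tv \<longleftrightarrow> b" "X \<in> infinity_section p Tv \<longleftrightarrow> \<not> b"
    unfolding x(1) z0 using zero_section_iff[OF assms(1)] infinity_section_iff[OF assms(1)] x(2) by auto
  moreover have "X \<in> zero_section p Tv \<longleftrightarrow> b' \<and> \<zeta>' = 0" "X \<in> infinity_section p Tv \<longleftrightarrow> \<not> b' \<and> \<zeta>' = 0"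
    unfolding x'(1) using zero_section_iff[OF assms(2)] infinity_section_iff[OF assms(2)] x'(2) by auto
  ultimately show False using assms(5) by blast
qed

lemma kaehler_HH: "kaehler_metric (ruled_atlas A p Tv) (Yb b0) HH"
  unfolding kaehler_metric_def case_prod_beta prod.collapse
proof (intro conjI)
  have main: "(\<forall>j k. smooth_on (snd d ` (fst d \<inter> Yb b0)) (\<lambda>z. HH d z $ j $ k)) \<and>
     (\<forall>z\<in>snd d ` (fst d \<inter> Yb b0). (\<forall>j k. HH d z $ j $ k = cnj (HH d z $ k $ j)) \<and>
       (\<forall>u. u \<noteq> 0 \<longrightarrow> 0 < Re (herm (HH d z) u u))) \<and>
     (\<forall>z\<in>snd d ` (fst d \<inter> Yb b0). \<forall>j k l. d_z l (\<lambda>y. HH d y $ j $ k) z = d_z j (\<lambda>y. HH d y $ l $ k) z)"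
    if dd: "d \<in> ruled_atlas A p Tv" for d
  proof -
    obtain b c w where d: "c \<in> A" "w \<in> Tv" "d = ch b c w" "HH d = loc b c w" using HH_cases[OF dd] by blast
    interpret R: radial "base_dom c w" "kb b c w" "af c" "JJ b" "LL b" "MM b" "sb b" by (rule radial_ch[OF d(1,2)])
    have im: "snd d ` (fst d \<inter> Yb b0) = R.Om" unfolding d(3) by (rule image_Om[OF d(1,2)])
    show ?thesis unfolding im d(4) loc_def
    proof (intro conjI allI ballI impI)
      show "smooth_on R.Om (\<lambda>z. R.H z $ j $ k)" for j k by (rule R.smooth_H)
      fix z assume z: "z \<in> R.Om"
      show "R.H z $ j $ k = cnj (R.H z $ k $ j)" for j k by (rule R.hermitian_H)
      show "0 < Re (herm (R.H z) u u)" if "u \<noteq> 0" for u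
        using R.positive_H[OF z that] by (simp add: riem_def)
      show "d_z l (\<lambda>y. R.H y $ j $ k) z = d_z j (\<lambda>y. R.H y $ l $ k) z" for l j k
        by (rule R.closed_H[OF z])
    qed
  qed
  show "\<forall>d\<in>ruled_atlas A p Tv. \<forall>j k. smooth_on (snd d ` (fst d \<inter> Yb b0)) (\<lambda>z. HH d z $ j $ k)"
    using main by blast
  show "\<forall>d\<in>ruled_atlas A p Tv. \<forall>z\<in>snd d ` (fst d \<inter> Yb b0). (\<forall>j k. HH d z $ j $ k = cnj (HH d z $ k $ j)) \<and>
       (\<forall>u. u \<noteq> 0 \<longrightarrow> 0 < Re (herm (HH d z) u u))" using main by blast
  show "\<forall>d\<in>ruled_atlas A p Tv. \<forall>z\<in>snd d ` (fst d \<inter> Yb b0). \<forall>j k l. d_z l (\<lambda>y. HH d y $ j $ k) z = d_z j (\<lambda>y. HH d y $ l $ k) z"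
    using main by blast
  show "\<forall>d\<in>ruled_atlas A p Tv. \<forall>d'\<in>ruled_atlas A p Tv. \<forall>x\<in>fst d \<inter> fst d' \<inter> Yb b0. \<forall>u v.
     herm (HH d (snd d x)) u v = herm (HH d' (snd d' x)) (transition_deriv d d' x u) (transition_deriv d d' x v)"
  proof (intro ballI allI)
    fix d d' X u v assume dd: "d \<in> ruled_atlas A p Tv" "d' \<in> ruled_atlas A p Tv" and X: "X \<in> fst d \<inter> fst d' \<inter> Yb b0"
    obtain b c w where d: "c \<in> A" "w \<in> Tv" "d = ch b c w" "HH d = loc b c w" using HH_cases[OF dd(1)] by blast
    obtain b' c' w' where d': "c' \<in> A" "w' \<in> Tv" "d' = ch b' c' w'" "HH d' = loc b' c' w'" using HH_cases[OF dd(2)] by blast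
    have nz: "snd (ch b c w) X $ 2 \<noteq> 0" if "b \<noteq> b'"
      by (rule chart_types_agree[OF d(2) d'(2) _ _ that]) (use X d(3) d'(3) in auto)
    show "herm (HH d (snd d X)) u v = herm (HH d' (snd d' X)) (transition_deriv d d' X u) (transition_deriv d d' X v)"
      unfolding d(4) d'(4) unfolding d(3) d'(3)
      by (rule herm_loc_compat[OF d(1) d'(1) d(2) d'(2)]) (use X d(3) d'(3) nz in auto)
  qed
qed

lemma scalar_HH:
  assumes mm: "\<And>b c w x \<zeta>. c \<in> A \<Longrightarrow> w \<in> Tv \<Longrightarrow> x \<in> fst c \<Longrightarrow> x \<in> fst w \<Longrightarrow> b = b0 \<or> \<zeta> \<noteq> 0 \<Longrightarrow>
     s (pt b w x \<zeta>) = A0 + A1 * XX b (rad (kb b c w) (vector [snd c x $ 1, \<zeta>]))"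
  shows "mfd_scalar_curvature (ruled_atlas A p Tv) (Yb b0) HH s"
  unfolding mfd_scalar_curvature_def case_prod_beta prod.collapse
proof (intro ballI)
  fix d X assume dd: "d \<in> ruled_atlas A p Tv" and X: "X \<in> fst d \<inter> Yb b0"
  obtain b c w where d: "c \<in> A" "w \<in> Tv" "d = ch b c w" "HH d = loc b c w" using HH_cases[OF dd] by blast
  obtain x \<zeta> where x: "X = pt b w x \<zeta>" "x \<in> fst c \<inter> fst w" using X unfolding d(3) ch_domain[OF d(2)] by blast
  have b: "b = b0 \<or> \<zeta> \<noteq> 0" using X Yb_iff[OF d(2), of x b \<zeta> b0] x by auto
  have "snd d X \<in> radial.Om (base_dom c w) (kb b c w) (JJ b)"
    unfolding image_Om[OF d(1,2), symmetric] using X d(3) by blast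
  from scalar_curvature_loc[OF d(1,2) this]
  show "scalar_curvature (HH d) (snd d X) = s X"
    unfolding d(4) unfolding d(3) x(1) ch_coord[OF d(2) x(2)] using mm[OF d(1,2)] x(2) b by simp
qed

text \<open>On the closing section the moment map is an endpoint by definition, which matches
  \<open>T 0 = 0\<close>; elsewhere it is the derivative of \<open>f\<close> at the logarithmic
  norm, and the exponential in \<open>f\<close> turns that norm back into \<open>rad\<close> or its
  inverse.\<close>

lemma moment_map_pt:
  assumes f: "\<And>t. (f has_real_derivative kap * D (T (exp (2 * eps * t))) - 1) (at t)"
    and ends: "(if b0 then lo else hi) = kap * d0 - 1"
    and c: "c \<in> A" "w \<in> Tv" "x \<in> fst c" "x \<in> fst w" "b = b0 \<or> \<zeta> \<noteq> 0"
  shows "moment_map p Tv nrm lo hi f (pt b w x \<zeta>) = kap * D (XX b (rad (kb b c w) (vector [snd c x $ 1, \<zeta>]))) - 1"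
proof (cases "\<zeta> = 0")
  case True
  then have b: "b = b0" using c(5) by blast
  have "moment_map p Tv nrm lo hi f (pt b w x \<zeta>) = (if b0 then lo else hi)"
    unfolding moment_map_def zero_section_iff[OF c(2,4)] infinity_section_iff[OF c(2,4)] using True b by simp
  moreover have "rad (kb b c w) (vector [snd c x $ 1, \<zeta>]) = 0" using True by (simp add: rad_def)
  ultimately show ?thesis unfolding ends XX_def using b sol(4) by (simp add: D_def)
next
  case False
  let ?r = "rad (kb b c w) (vector [snd c x $ 1, \<zeta>])"
  have r: "0 < ?r" by (rule rad_pos) (use False in simp)
  have "moment_map p Tv nrm lo hi f (pt b w x \<zeta>) = deriv f (sb b / 2 * ln ?r)"
    unfolding moment_map_def zero_section_iff[OF c(2,4)] infinity_section_iff[OF c(2,4)]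
      log_norm_pt[OF c(2,1,3,4) False] using False by simp
  also have "\<dots> = kap * D (T (exp (2 * eps * (sb b / 2 * ln ?r)))) - 1" by (rule DERIV_imp_deriv[OF f])
  also have "exp (2 * eps * (sb b / 2 * ln ?r)) = (if b = b0 then ?r else inverse ?r)"
    unfolding eps_b0 sb_def using r by (cases b; cases b0) (simp_all add: exp_minus)
  finally show ?thesis unfolding XX_def by (simp split: if_splits)
qed

text \<open>\<open>momentum_form\<close> speaks of every base chart producing a given chart of the
  ruled surface, whereas \<open>HH\<close> uses the chosen one. Equal charts above have base
  coordinates that agree over the common domain, so the transition derivative there is the
  identity.\<close>

lemma chart_independence:
  assumes "c \<in> A" "c' \<in> A" "w \<in> Tv" "w' \<in> Tv" and eq: "ch b c w = ch b' c' w'" and X: "x \<in> fst c" "x \<in> fst w"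
  shows "\<omega>M c (snd c x) $ 1 $ 1 = \<omega>M c' (snd c x) $ 1 $ 1"
proof -
  have sub: "q \<in> fst c'" "snd c' q = snd c q" if q: "q \<in> fst c" "q \<in> fst w" for q
  proof -
    have "pt b w q 1 \<in> fst (ch b c w)" using q unfolding ch_domain[OF assms(3)] by blast
    then obtain q' \<zeta>' where q': "pt b w q 1 = pt b' w' q' \<zeta>'" "q' \<in> fst c' \<inter> fst w'"
      unfolding eq ch_domain[OF assms(4)] by blast
    have qq: "q' = q" using q'(2) by (intro pt_base[OF assms(3) q(2) assms(4) _ q'(1)]) blast
    show "q \<in> fst c'" using q'(2) qq by simp
    have "vector [snd c q $ 1, 1] = (vector [snd c' q $ 1, \<zeta>'] :: complex^2)"
      using ch_coord[OF assms(3), of q c b 1] ch_coord[OF assms(4), of q' c' b' \<zeta>'] q q' qq eq by simp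
    from arg_cong[OF this, of bp] show "snd c' q = snd c q" by simp
  qed
  have id: "chi c c' z = z" if zb: "z \<in> base_dom c w" for z
  proof -
    obtain q where "q \<in> fst c" "q \<in> fst w" "z = snd c q" "inv_into (fst c) (snd c) z = q"
      using base_domD[OF zb assms(1)] by blast
    then show ?thesis using sub(2)[of q] by (simp add: chi_def)
  qed
  have xb: "snd c x \<in> base_dom c w" using X by (auto simp: base_dom_def)
  have "transition_deriv c c' x = frechet_derivative (\<lambda>z. z) (at (snd c x))"
    unfolding transition_deriv_def chi_def[symmetric]
    by (rule frechet_derivative_cong_open[OF open_base_dom[OF assms(1,3)] xb id])
  then have td: "transition_deriv c c' x v = v" for v by (simp add: frechet_derivative_id[unfolded id_def])
  have K: "\<forall>c\<in>A. \<forall>d\<in>A. \<forall>x\<in>fst c \<inter> fst d \<inter> atlas_space A. \<forall>u v.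
       herm (\<omega>M c (snd c x)) u v =
       herm (\<omega>M d (snd d x)) (transition_deriv c d x u) (transition_deriv c d x v)"
    using km unfolding kaehler_metric_def case_prod_beta prod.collapse by (elim conjE) assumption
  have x: "x \<in> fst c \<inter> fst c' \<inter> atlas_space A" using X sub(1)[OF X] atlasD(3)[OF assms(1)] by blast
  have "herm (\<omega>M c (snd c x)) (axis 1 1) (axis 1 1) = herm (\<omega>M c' (snd c' x)) (axis 1 1) (axis 1 1)"
    using bspec[OF bspec[OF bspec[OF K assms(1)] assms(2)] x] unfolding td by blast
  then show ?thesis unfolding sub(2)[OF X] by (simp add: herm_def UNIV_1 axis_def)
qed

text \<open>As a function of \<open>r\<close> the potential is \<open>f (sb b / 2 * ln r)\<close>.
  Its derivative is \<open>sb b * \<tau> / (2 * r)\<close> with \<open>\<tau> = lam - 1\<close>, the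
  hypothesis of \<open>potential_H\<close>.\<close>

lemma momentum_HH:
  assumes f: "\<And>t. (f has_real_derivative kap * D (T (exp (2 * eps * t))) - 1) (at t)"
  shows "momentum_form A p Tv nrm \<omega>M f HH"
  unfolding momentum_form_def
proof (intro ballI allI)
  fix c1 w1 d X i j
  assume cw: "c1 \<in> A" "w1 \<in> Tv" and d1: "d \<in> {chart_off_infinity p Tv c1 w1, chart_off_zero p Tv c1 w1}"
    and X: "X \<in> fst d - zero_section p Tv - infinity_section p Tv"
  have "d = ch True c1 w1 \<or> d = ch False c1 w1" using d1 by (simp add: ch_def)
  then obtain b1 where b1: "d = ch b1 c1 w1" by blast
  then have dd: "d \<in> ruled_atlas A p Tv" unfolding ruled_atlas_eq using cw by blast
  obtain b c w where d: "c \<in> A" "w \<in> Tv" "d = ch b c w" "HH d = loc b c w" using HH_cases[OF dd] by blast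
  interpret R: radial "base_dom c w" "kb b c w" "af c" "JJ b" "LL b" "MM b" "sb b" by (rule radial_ch[OF d(1,2)])
  obtain x \<zeta> where x: "X = pt b w x \<zeta>" "x \<in> fst c" "x \<in> fst w" using X unfolding d(3) ch_domain[OF d(2)] by blast
  have z: "\<zeta> \<noteq> 0" using X zero_section_iff[OF d(2) x(3), of b \<zeta>] infinity_section_iff[OF d(2) x(3), of b \<zeta>] x(1) by auto
  define y where "y = snd d X"
  have y: "y = vector [snd c x $ 1, \<zeta>]" unfolding y_def d(3) x(1) by (rule ch_coord[OF d(2)]) (use x in simp)
  have ybp: "bp y = snd c x" and y2: "y $ 2 = \<zeta>" unfolding y by simp_all
  have yO: "y \<in> R.Om" unfolding Om_eq[OF d(1,2)] using ybp y2 z x by (auto simp: base_dom_def)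
  have om: "\<omega>M c1 (bp y) $ 1 $ 1 = of_real (af c (bp y))"
    using chart_independence[OF d(1) cw(1) d(2) cw(2) _ x(2,3)] d(3) b1 omega_properties(3)[OF d(1) x(2)] ybp by metis
  define P where "P r = f (sb b / 2 * ln r)" for r
  have P: "(P has_real_derivative sb b * (LL b r - 1) / (2 * r)) (at r)" if "r \<in> JJ b" "0 < r" for r
  proof -
    have e: "exp (2 * eps * (sb b / 2 * ln r)) = (if b = b0 then r else inverse r)"
      unfolding eps_b0 sb_def using that(2) by (cases b; cases b0) (simp_all add: exp_minus)
    have "((\<lambda>r. sb b / 2 * ln r) has_real_derivative sb b / 2 * (1 / r)) (at r)"
      by (rule DERIV_cmult[OF DERIV_ln_divide[OF that(2)]])
    from DERIV_chain2[OF f this]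
    have "(P has_real_derivative (kap * D (T (if b = b0 then r else inverse r)) - 1) * (sb b / 2 * (1 / r))) (at r)"
      unfolding P_def[abs_def] e .
    moreover have "kap * D (T (if b = b0 then r else inverse r)) = LL b r" unfolding LL_eq XX_def by simp
    ultimately show ?thesis by (simp add: mult.commute)
  qed
  have e: "sb b * sb b = 1" by (simp add: sb_def)
  have o2: "open (R.Om \<inter> {y. y $ 2 \<noteq> 0})"
    by (intro open_Int R.open_Om open_Collect_neq continuous_intros)
  have cong: "f (log_norm p Tv nrm (inv_into (fst d) (snd d) v)) = P (rad (kb b c w) v)" if v: "v \<in> R.Om \<inter> {y. y $ 2 \<noteq> 0}" for v
  proof -
    have vb: "bp v \<in> base_dom c w" using v R.Om_D(2) by blast
    note i = ch_inv(1)[OF d(1,2) vb, of b] ch_inv(2,3)[OF d(1,2) vb]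
    have "v $ 2 \<noteq> 0" using v by blast
    have "log_norm p Tv nrm (pt b w (inv_into (fst c) (snd c) (bp v)) (v $ 2)) = sb b / 2 * ln (rad (kb b c w) v)"
      using log_norm_pt[OF d(2,1) _ _ \<open>v $ 2 \<noteq> 0\<close>, of "inv_into (fst c) (snd c) (bp v)" b] i(2)
      unfolding i(3) vector_bp by blast
    then show ?thesis unfolding d(3) i(1) P_def by (simp only:)
  qed
  have "HH d y $ i $ j = (if i = 1 \<and> j = 1 then of_real (af c (bp y)) else 0) + 2 * ddbar i j (\<lambda>v. P (rad (kb b c w) v)) y"
    unfolding d(4) loc_def by (rule R.potential_H[OF yO _ e P]) (use y2 z in auto)
  also have "ddbar i j (\<lambda>v. P (rad (kb b c w) v)) y = ddbar i j (\<lambda>v. f (log_norm p Tv nrm (inv_into (fst d) (snd d) v))) y"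
    by (rule ddbar_cong_open[OF o2]) (use yO y2 z cong in auto)
  finally show "HH d (snd d X) $ i $ j =
          (if i = 1 \<and> j = 1 then \<omega>M c1 (vec (snd d X $ 1)) $ 1 $ 1 else 0) +
          2 * ddbar i j (\<lambda>z. f (log_norm p Tv nrm (inv_into (fst d) (snd d) z))) (snd d X)"
    using om unfolding y_def bp_def by simp
qed

section \<open>The limit tensor on the divisor and the hyperbolic asymptotics\<close>

lemma eta_tensor: "smooth_symmetric_tensor (ruled_atlas A p Tv) eta"
  unfolding smooth_symmetric_tensor_def case_prod_beta prod.collapse
proof (intro conjI ballI allI)
  fix d assume dd: "d \<in> ruled_atlas A p Tv"
  obtain b c w where d: "c \<in> A" "w \<in> Tv" "d = ch b c w"
    "eta d = (\<lambda>z u v. 2 * kap * D M * af c (bp z) * Re (u $ 1 * cnj (v $ 1)))"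
    using rep_cases[OF dd] by blast
  show "smooth_on (snd d ` fst d) (\<lambda>z. eta d z u v)" for u v
  proof -
    have sub: "bp ` {y. bp y \<in> base_dom c w} \<subseteq> snd c ` fst c" by (auto simp: base_dom_def)
    have "smooth_on {y. bp y \<in> base_dom c w} (\<lambda>y. af c (bp y))"
      by (rule smooth_on_comp_linear[OF bounded_linear_bp sub omega_properties(1)[OF d(1)]])
    then show ?thesis unfolding d(4) unfolding d(3) ch_image_full[OF d(1,2)]
      by (intro smooth_on_mult smooth_on_const)
  qed
  show "bilinear (eta d z)" for z
    unfolding bilinear_def d(4)
    by (intro conjI allI linearI) (simp_all add: algebra_simps)
  show "eta d z u v = eta d z v u" for z u v
    unfolding d(4) by (simp add: mult.commute)
next
  fix d d' X and u v :: "complex^2" assume dd: "d \<in> ruled_atlas A p Tv" "d' \<in> ruled_atlas A p Tv" and X: "X \<in> fst d \<inter> fst d'"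
  obtain b c w where d: "c \<in> A" "w \<in> Tv" "d = ch b c w"
    "eta d = (\<lambda>z u v. 2 * kap * D M * af c (bp z) * Re (u $ 1 * cnj (v $ 1)))"
    using rep_cases[OF dd(1)] by blast
  obtain b' c' w' where d': "c' \<in> A" "w' \<in> Tv" "d' = ch b' c' w'"
    "eta d' = (\<lambda>z u v. 2 * kap * D M * af c' (bp z) * Re (u $ 1 * cnj (v $ 1)))"
    using rep_cases[OF dd(2)] by blast
  have X': "X \<in> fst (ch b c w)" "X \<in> fst (ch b' c' w')" using X d(3) d'(3) by auto
  let ?y = "snd (ch b c w) X" and ?y' = "snd (ch b' c' w') X" and ?td = "transition_deriv (ch b c w) (ch b' c' w') X"
  obtain l where a: "af c (bp ?y) = af c' (bp ?y') * (cmod l)\<^sup>2" and td: "\<And>u. ?td u $ 1 = l * u $ 1"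
    by (rule transition_data[OF d(1) d'(1) d(2) d'(2) X' chart_types_agree[OF d(2) d'(2) X']], assumption, rule that)
  have e: "Re (l * u $ 1 * cnj (l * v $ 1)) = (cmod l)\<^sup>2 * Re (u $ 1 * cnj (v $ 1))"
  proof -
    have "l * u $ 1 * cnj (l * v $ 1) = of_real ((cmod l)\<^sup>2) * (u $ 1 * cnj (v $ 1))"
      unfolding complex_norm_square by (simp add: mult_ac)
    then show ?thesis by (simp only: Re_of_real_mult)
  qed
  show "eta d (snd d X) u v = eta d' (snd d' X) (transition_deriv d d' X u) (transition_deriv d d' X v)"
  proof -
    have "eta d (snd d X) u v = 2 * kap * D M * af c (bp ?y) * Re (u $ 1 * cnj (v $ 1))"
      unfolding d(4) unfolding d(3) ..
    also have "\<dots> = 2 * kap * D M * af c' (bp ?y') * ((cmod l)\<^sup>2 * Re (u $ 1 * cnj (v $ 1)))"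
      by (simp only: a mult.assoc)
    also have "\<dots> = 2 * kap * D M * af c' (bp ?y') * Re (?td u $ 1 * cnj (?td v $ 1))"
      by (subst td, subst td, subst e) (rule refl)
    also have "\<dots> = eta d' (snd d' X) (transition_deriv d d' X u) (transition_deriv d d' X v)"
      unfolding d'(4) unfolding d(3) d'(3) ..
    finally show ?thesis .
  qed
qed

lemma asymptotically_hyperbolic_HH:
  assumes strict: "0 < p0 + p1 * M"
  shows "asymptotically_hyperbolic (ruled_atlas A p Tv) (nsec (\<not> b0)) HH"
  unfolding asymptotically_hyperbolic_def
proof (rule exI[of _ "\<lambda>_. kap / C"], rule exI[of _ eta], intro conjI ballI)
  have C: "0 < kap / C" unfolding C_def using M kap strict D_pos[of M] by simp
  show "mfd_smooth_on (ruled_atlas A p Tv) (atlas_space (ruled_atlas A p Tv)) (\<lambda>_. kap / C)"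
    unfolding mfd_smooth_on_def by (auto simp: o_def smooth_on_const)
  show "0 < kap / C" by (rule C)
  show "smooth_symmetric_tensor (ruled_atlas A p Tv) eta" by (rule eta_tensor)
  fix X assume "X \<in> nsec (\<not> b0)"
  then obtain w0 x where x: "w0 \<in> Tv" "x \<in> fst w0" "X = pt (\<not> b0) w0 x 0"
  proof -
    have "zero_section p Tv \<subseteq> proj_bundle p Tv"
    proof
      fix X assume "X \<in> zero_section p Tv"
      then obtain v where "X = line p Tv v 1" "p v \<in> \<Union> (fst ` Tv)" unfolding zero_section_def by blast
      then show "X \<in> proj_bundle p Tv" unfolding proj_bundle_def
        by (intro CollectI exI[of _ v] exI[of _ "1::complex"] conjI disjI2) simp_all
    qed
    moreover have "infinity_section p Tv \<subseteq> proj_bundle p Tv"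
      unfolding infinity_section_def proj_bundle_def by blast
    ultimately have "nsec (\<not> b0) \<subseteq> proj_bundle p Tv" by (simp add: nsec_def)
    with \<open>X \<in> nsec (\<not> b0)\<close> have "X \<in> proj_bundle p Tv" by blast
    then show thesis
    proof (cases rule: bundle_cases[of X "\<not> b0"])
      case (1 w x \<zeta>)
      have "\<zeta> = 0" using \<open>X \<in> nsec (\<not> b0)\<close>
        unfolding nsec_def 1(3) using zero_section_iff[OF 1(1,2)] infinity_section_iff[OF 1(1,2)] by (cases b0) simp_all
      then show thesis using 1 by (intro that[of w x]) simp_all
    next
      case (2 w x)
      have False using \<open>X \<in> nsec (\<not> b0)\<close>
        unfolding nsec_def 2(3) using zero_section_iff[OF 2(1,2)] infinity_section_iff[OF 2(1,2)] by (cases b0) simp_all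
      then show thesis ..
    qed
  qed
  have "x \<in> atlas_space A" using x(1,2) triv_cover by blast
  then obtain c0 where c0: "c0 \<in> A" "x \<in> fst c0" unfolding atlas_space_def by blast
  define d where "d = ch (\<not> b0) c0 w0"
  have dd: "d \<in> ruled_atlas A p Tv" unfolding ruled_atlas_eq d_def using c0(1) x(1) by blast
  have Xd: "X \<in> fst d" unfolding d_def ch_domain[OF x(1)] x(3) using x(2) c0(2) by blast
  obtain b c w where d: "c \<in> A" "w \<in> Tv" "d = ch b c w" "HH d = loc b c w"
    "eta d = (\<lambda>z u v. 2 * kap * D M * af c (bp z) * Re (u $ 1 * cnj (v $ 1)))"
    using rep_cases[OF dd] by blast
  obtain x1 \<zeta>1 where x1: "X = pt b w x1 \<zeta>1" "x1 \<in> fst c" "x1 \<in> fst w"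
    using Xd unfolding d(3) ch_domain[OF d(2)] by blast
  \<comment> \<open>The triple chosen by \<open>rep\<close> is again of type
    \<open>\<not> b0\<close>, because charts of the other type miss this section.\<close>
  have b: "b = (\<not> b0)" "\<zeta>1 = 0"
    using \<open>X \<in> nsec (\<not> b0)\<close> unfolding nsec_def x1(1)
    using zero_section_iff[OF d(2) x1(3)] infinity_section_iff[OF d(2) x1(3)] by (cases b0; simp)+
  have Xy: "snd d X = vector [snd c x1 $ 1, 0]"
    unfolding d(3) x1(1) b(2) by (rule ch_coord[OF d(2)]) (use x1 in simp)
  have "snd c x1 \<in> base_dom c w" using x1 by (auto simp: base_dom_def)
  then obtain rd where rd: "0 < rd" "cball (snd c x1) rd \<subseteq> base_dom c w"
    using open_base_dom[OF d(1,2)] open_contains_cball by blast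
  interpret W: weight "base_dom c w" "kb b c w" by (rule weight_kb[OF d(1,2)])
  interpret CC: cusp_chart eps kap M d0 p0 p1 A0 A1 T rh J "base_dom c w" "kb b c w" "af c" "snd c x1" rd
  proof (unfold_locales)
    show "smooth_on (base_dom c w) (af c)"
      by (rule smooth_on_subset[OF omega_properties(1)[OF d(1)]]) (auto simp: base_dom_def)
    show "0 < af c z" if z: "z \<in> base_dom c w" for z
      using base_domD[OF z d(1)] omega_properties(2)[OF d(1)] by metis
  qed (use strict rd in auto)
  let ?\<zeta> = "\<lambda>y::complex^2. y $ 2"
  have fr: "frechet_derivative ?\<zeta> (at z) = (\<lambda>u. u $ 2)" for z
    using frechet_derivative_at[OF bounded_linear_imp_has_derivative[OF bounded_linear_vec_nth]] by metis
  have NO: "bp z \<in> base_dom c w" if "z \<in> CC.N" for z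
    using that rd(2) ball_subset_cball unfolding CC.N_def by blast
  show "\<exists>c\<in>ruled_atlas A p Tv. \<exists>N \<zeta>. X \<in> fst c \<and> snd c X \<in> N \<and> local_defining_function c (nsec (\<not> b0)) N \<zeta> \<and>
        (\<forall>z\<in>N. \<zeta> z = 0 \<longrightarrow>
           (\<forall>u. u \<noteq> 0 \<longrightarrow> frechet_derivative \<zeta> (at z) u = 0 \<longrightarrow> 0 < eta c z u u)) \<and>
        (let g = riem (HH c);
             g0 = hyperbolic_model ((\<lambda>_. kap / C) \<circ> inv_into (fst c) (snd c)) (eta c) \<zeta>;
             S = (\<lambda>z vs. g z (vs ! 0) (vs ! 1) - g0 z (vs ! 0) (vs ! 1))
         in \<forall>i. ((\<lambda>z. tensor_norm g0 (i + 2) ((nabla g0 ^^ i) S) z) \<longlongrightarrow> 0)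
                  (inf (filtercomap \<zeta> (at 0)) (principal N)))"
  proof (rule bexI[OF _ dd], rule exI[of _ CC.N], rule exI[of _ ?\<zeta>], intro conjI)
    show "X \<in> fst d" by (rule Xd)
    show "snd d X \<in> CC.N" unfolding Xy CC.N_def using rd(1) by simp
    show "local_defining_function d (nsec (\<not> b0)) CC.N ?\<zeta>"
      unfolding local_defining_function_def
    proof (intro conjI ballI impI)
      show "open CC.N" by (rule CC.open_N)
      show "CC.N \<subseteq> snd d ` fst d" unfolding d(3) ch_image_full[OF d(1,2)] using NO by blast
      show "hol_fun_on ?\<zeta> CC.N" unfolding hol_fun_on_def
      proof
        fix z assume "z \<in> CC.N"
        show "\<exists>f'. (?\<zeta> has_derivative f') (at z) \<and> (\<forall>c v. f' (c *s v) = c * f' v)"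
          by (rule exI[of _ ?\<zeta>]) (simp add: bounded_linear_imp_has_derivative[OF bounded_linear_vec_nth])
      qed
      fix z assume z: "z \<in> CC.N"
      obtain q where q: "q \<in> fst c" "q \<in> fst w" "inv_into (fst c) (snd c) (bp z) = q"
        using base_domD[OF NO[OF z] d(1)] by metis
      show "(z $ 2 = 0) = (inv_into (fst d) (snd d) z \<in> nsec (\<not> b0))"
        unfolding d(3) ch_inv(1)[OF d(1,2) NO[OF z]] q(3) nsec_def
        using zero_section_iff[OF d(2) q(2)] infinity_section_iff[OF d(2) q(2)] b(1) by auto
      show "\<exists>u. frechet_derivative ?\<zeta> (at z) u \<noteq> 0" unfolding fr by (rule exI[of _ "axis 2 1"]) simp
    qed
    show "\<forall>z\<in>CC.N. z $ 2 = 0 \<longrightarrow> (\<forall>u. u \<noteq> 0 \<longrightarrow> frechet_derivative ?\<zeta> (at z) u = 0 \<longrightarrow> 0 < eta d z u u)"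
    proof (intro ballI impI allI)
      fix z and u :: "complex^2" assume z: "z \<in> CC.N" "u \<noteq> 0" "frechet_derivative ?\<zeta> (at z) u = 0"
      then have "u $ 1 \<noteq> 0" unfolding fr by (auto simp: vec_eq_iff forall_2)
      then have "0 < Re (u $ 1 * cnj (u $ 1))" by (simp only: Re_mult_cnj_self) simp
      moreover have "0 < D M" using D_pos[of M] M by simp
      ultimately show "0 < eta d z u u" unfolding d(5)
        using CC.apos[OF NO[OF z(1)]] kap by simp
    qed
    \<comment> \<open>With the constant \<open>K = kap / C\<close>, the defining function
      \<open>w\<close> and the tensor \<open>eta\<close>, the abstract model is the metric treated
      in \<open>cusp_chart\<close>.\<close>
    have g0: "hyperbolic_model ((\<lambda>_. kap / C) \<circ> inv_into (fst d) (snd d)) (eta d) ?\<zeta> = CC.g0"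
      by (intro ext) (simp add: hyperbolic_model_def fr d(5) CC.g0_def CC.En_def)
    have Hd: "HH d = CC.Hc" unfolding d(4) loc_def LL_def MM_def using b(1) by simp
    show "let g = riem (HH d);
             g0 = hyperbolic_model ((\<lambda>_. kap / C) \<circ> inv_into (fst d) (snd d)) (eta d) ?\<zeta>;
             S = (\<lambda>z vs. g z (vs ! 0) (vs ! 1) - g0 z (vs ! 0) (vs ! 1))
         in \<forall>i. ((\<lambda>z. tensor_norm g0 (i + 2) ((nabla g0 ^^ i) S) z) \<longlongrightarrow> 0)
                  (inf (filtercomap ?\<zeta> (at 0)) (principal CC.N))"
      unfolding Let_def g0 Hd by (intro allI) (rule CC.asymptotically_hyperbolic_local)
  qed
qed

end

section \<open>Completeness\<close>

text \<open>A function that is not integrable has \<open>integral\<close> 0, which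
  \<open>0 \<le> B\<close> covers; so length estimates from above need no regularity of the
  integrand.\<close>

lemma integral_unit_interval_le:
  fixes f :: "real \<Rightarrow> real"
  assumes "\<And>s. s \<in> {0..1} \<Longrightarrow> f s \<le> B" "0 \<le> B"
  shows "integral {0..1} f \<le> B"
proof (cases "f integrable_on {0..1}")
  case True
  have "integral {0..1} f \<le> integral {0..1} (\<lambda>_::real. B)"
    by (rule integral_le[OF True integrable_const_ivl assms(1)])
  then show ?thesis by simp
next
  case False
  then show ?thesis using assms(2) by (simp add: not_integrable_integral)
qed

lemma riem_le:
  fixes u :: "complex^'n::finite"
  assumes "\<And>j k. cmod (P z $ j $ k) \<le> K"
  shows "riem P z u u \<le> 2 * (real CARD('n))\<^sup>2 * K * (norm u)\<^sup>2"
proof -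
  have K: "0 \<le> K" using assms norm_ge_zero order_trans by blast
  have "cmod (P z $ j $ k * u $ j * cnj (u $ k)) \<le> K * norm u * norm u" for j k
    unfolding norm_mult complex_mod_cnj
    by (intro mult_mono assms Finite_Cartesian_Product.norm_nth_le mult_nonneg_nonneg K norm_ge_zero order_refl)
  then have "cmod (herm (P z) u u) \<le> (\<Sum>j\<in>(UNIV::'n set). \<Sum>k\<in>(UNIV::'n set). K * norm u * norm u)"
    unfolding herm_def by (intro sum_norm_le) 
  then have "cmod (herm (P z) u u) \<le> (real CARD('n))\<^sup>2 * K * (norm u)\<^sup>2"
    by (simp add: power2_eq_square mult_ac)
  then show ?thesis unfolding riem_def using complex_Re_le_cmod[of "herm (P z) u u"] by linarith
qed

text \<open>Coordinate segments bound distances from above: near a limit point, convergence of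
  coordinates implies convergence in the length distance.\<close>

lemma curve_of_length_segment:
  fixes H :: "('x, 'n::finite) form11"
  assumes x: "curve_of_length A Y H x y l" and d: "d \<in> A" "y \<in> fst d \<inter> Y" "z \<in> fst d \<inter> Y"
    and seg: "closed_segment (snd d y) (snd d z) \<subseteq> snd d ` (fst d \<inter> Y)"
    and K: "\<And>v j k. v \<in> closed_segment (snd d y) (snd d z) \<Longrightarrow> cmod (H d v $ j $ k) \<le> K"
  obtains l' where "curve_of_length A Y H x z (l + l')"
    "l' \<le> sqrt (2 * (real CARD('n))\<^sup>2 * K) * norm (snd d z - snd d y)"
proof -
  let ?c = "linepath (snd d y) (snd d z)" and ?u = "snd d z - snd d y"
  have cd: "(?c has_vector_derivative ?u) (at s)" for s
    by (rule has_vector_derivative_linepath_within)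
  have C1: "?c C1_differentiable_on {0..1}"
    unfolding C1_differentiable_on_def by (intro exI[of _ "\<lambda>_. ?u"] conjI ballI cd continuous_on_const)
  have vd: "vector_derivative ?c (at s) = ?u" for s by (rule vector_derivative_at[OF cd])
  have im: "?c ` {0..1} = closed_segment (snd d y) (snd d z)" by (rule linepath_image_01)
  obtain U \<psi> where d': "d = (U, \<psi>)" by (cases d)
  let ?l = "integral {0..1} (\<lambda>s. sqrt (riem (H (U, \<psi>)) (?c s) (vector_derivative ?c (at s)) (vector_derivative ?c (at s))))"
  have cv: "curve_of_length A Y H x z (l + ?l)"
    by (rule join[OF x]) (use d seg C1 im in \<open>auto simp: d' linepath_def\<close>)
  have K0: "0 \<le> K" using K[of "snd d y"] norm_ge_zero order_trans by (metis ends_in_segment(1))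
  have "?l \<le> sqrt (2 * (real CARD('n))\<^sup>2 * K) * norm ?u"
  proof (rule integral_unit_interval_le)
    show "0 \<le> sqrt (2 * (real CARD('n))\<^sup>2 * K) * norm ?u" using K0 by simp
    fix s :: real assume "s \<in> {0..1}"
    then have "?c s \<in> closed_segment (snd d y) (snd d z)" using im by blast
    from riem_le[of "H d" "?c s" K ?u, OF K[OF this]]
    have "sqrt (riem (H d) (?c s) ?u ?u) \<le> sqrt (2 * (real CARD('n))\<^sup>2 * K * (norm ?u)\<^sup>2)"
      by (rule real_sqrt_le_mono)
    then show "sqrt (riem (H (U, \<psi>)) (?c s) (vector_derivative ?c (at s)) (vector_derivative ?c (at s)))
        \<le> sqrt (2 * (real CARD('n))\<^sup>2 * K) * norm ?u"
      unfolding vd d'[symmetric] real_sqrt_mult[of _ "(norm ?u)\<^sup>2"] by simp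
  qed
  then show thesis by (rule that[OF cv])
qed

text \<open>On each piece the increment of \<open>B\<close> is the integral of its derivative along
  the curve, and this is at most \<open>C\<close> times the speed. Induction adds up the
  pieces.\<close>

lemma curve_of_length_lipschitz:
  fixes H :: "('x, 'n::finite) form11"
  assumes "curve_of_length A Y H x y l"
    and loc: "\<And>d. d \<in> A \<Longrightarrow> \<exists>\<beta>. (\<forall>X\<in>fst d \<inter> Y. B X = \<beta> (snd d X)) \<and>
      (\<forall>z\<in>snd d ` (fst d \<inter> Y). \<exists>\<beta>'. (\<beta> has_derivative \<beta>') (at z) \<and> (\<forall>u. \<beta>' u \<le> C * sqrt (riem (H d) z u u)))"
    and cont: "\<And>d j k. d \<in> A \<Longrightarrow> continuous_on (snd d ` (fst d \<inter> Y)) (\<lambda>z. H d z $ j $ k)"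
  shows "B y \<le> B x + C * (l :: real)"
  using assms(1)
proof induction
  case (const x)
  show ?case by simp
next
  case (join x y l U \<psi> z c)
  let ?S = "\<psi> ` (U \<inter> Y)"
  from loc[OF join.hyps(2)] obtain \<beta> where \<beta>: "\<And>X. X \<in> U \<inter> Y \<Longrightarrow> B X = \<beta> (\<psi> X)"
    and "\<forall>z\<in>?S. \<exists>\<beta>'. (\<beta> has_derivative \<beta>') (at z) \<and> (\<forall>u. \<beta>' u \<le> C * sqrt (riem (H (U, \<psi>)) z u u))"
    by auto
  from bchoice[OF this(2)] obtain \<beta>' where \<beta>': "\<And>z. z \<in> ?S \<Longrightarrow> (\<beta> has_derivative \<beta>' z) (at z)"
    "\<And>z u. z \<in> ?S \<Longrightarrow> \<beta>' z u \<le> C * sqrt (riem (H (U, \<psi>)) z u u)" by blast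
  from join.hyps(5) obtain D where D: "\<And>s. s \<in> {0..1} \<Longrightarrow> (c has_vector_derivative D s) (at s)"
    "continuous_on {0..1} D" unfolding C1_differentiable_on_def by blast
  have vd: "vector_derivative c (at s) = D s" if "s \<in> {0..1}" for s by (rule vector_derivative_at[OF D(1)[OF that]])
  have cS: "c s \<in> ?S" if "s \<in> {0..1}" for s using join.hyps(6) that by blast
  let ?f = "\<lambda>s. sqrt (riem (H (U, \<psi>)) (c s) (D s) (D s))"
  have cc: "continuous_on {0..1} c"
    using D(1) by (intro continuous_at_imp_continuous_on ballI) (rule has_vector_derivative_continuous)
  have "continuous_on {0..1} (\<lambda>s. H (U, \<psi>) (c s) $ j $ k)" for j k
    using continuous_on_compose2[OF cont[OF join.hyps(2)] cc, of j k] join.hyps(6) by simp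
  from continuous_on_mult[OF continuous_on_mult[OF this continuous_on_component[OF D(2)]]
      continuous_on_cnj[OF continuous_on_component[OF D(2)]]]
  have "continuous_on {0..1} ?f"
    unfolding riem_def herm_def
    by (intro continuous_on_real_sqrt continuous_on_mult_left continuous_on_Re continuous_on_sum)
  then have "(?f has_integral integral {0..1} ?f) {0..1}"
    by (rule integrable_integral[OF integrable_continuous_interval])
  from has_integral_mult_right[OF this, of C]
  have i1: "((\<lambda>s. C * ?f s) has_integral C * integral {0..1} ?f) {0..1}" .
  have "((\<lambda>s. \<beta>' (c s) (D s)) has_integral \<beta> (c 1) - \<beta> (c 0)) {0..1}"
  proof (rule fundamental_theorem_of_calculus)
    fix s :: real assume s: "s \<in> {0..1}"
    have "((\<lambda>s. \<beta> (c s)) has_derivative (\<lambda>h. \<beta>' (c s) (h *\<^sub>R D s))) (at s)"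
      by (rule has_derivative_compose[OF D(1)[OF s, unfolded has_vector_derivative_def] \<beta>'(1)[OF cS[OF s]]])
    moreover have "(\<lambda>h. \<beta>' (c s) (h *\<^sub>R D s)) = (\<lambda>h. h *\<^sub>R \<beta>' (c s) (D s))"
      using linear_scale[OF has_derivative_linear[OF \<beta>'(1)[OF cS[OF s]]]] by (intro ext) 
    ultimately have "((\<lambda>s. \<beta> (c s)) has_vector_derivative \<beta>' (c s) (D s)) (at s)"
      unfolding has_vector_derivative_def by simp
    then show "((\<lambda>s. \<beta> (c s)) has_vector_derivative \<beta>' (c s) (D s)) (at s within {0..1})"
      by (rule has_vector_derivative_at_within)
  qed simp
  from has_integral_le[OF this i1] \<beta>'(2)[OF cS]
  have "\<beta> (c 1) - \<beta> (c 0) \<le> C * integral {0..1} ?f" by blast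
  moreover have "B y = \<beta> (c 0)" "B z = \<beta> (c 1)" using \<beta> join.hyps(3,4,7,8) by auto
  moreover have "integral {0..1} ?f = integral {0..1} (\<lambda>s. sqrt (riem (H (U, \<psi>)) (c s)
             (vector_derivative c (at s)) (vector_derivative c (at s))))"
    by (rule integral_cong) (simp add: vd)
  ultimately show ?case using join.IH by (simp add: algebra_simps)
qed

section \<open>The Lipschitz estimate that puts the complete end at infinity\<close>

context ruled_profile
begin

lemma MM_ode:
  assumes "r \<in> JJ b"
  shows "2 * r * MM b r * D (XX b r) = kap * Q (XX b r)"
proof (cases "b = b0")
  case True
  then have "r \<in> J" "MM b r = kap * deriv T r" "XX b r = T r"
    using assms by (simp_all add: JJ_def MM_def closing.mu_def XX_def)
  then show ?thesis using closing.ode[of r] by (simp add: mult_ac)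
next
  case False
  then have r: "r \<in> {0<..}" and e: "MM b r = - kap * deriv (\<lambda>r. T (inverse r)) r" "XX b r = T (inverse r)"
    using assms by (simp_all add: JJ_def MM_def cusp.mu_def XX_def)
  have "2 * r * MM b r * D (XX b r) = - kap * (2 * r * deriv (\<lambda>r. T (inverse r)) r * D (T (inverse r)))"
    unfolding e by simp
  also have "\<dots> = kap * Q (XX b r)" unfolding cusp.ode[OF r] e(2) by simp
  finally show ?thesis .
qed

lemma XX_bounds:
  assumes "r \<in> JJ b" "0 \<le> r"
  shows "0 \<le> XX b r" "XX b r < M"
proof -
  define s where "s = (if b = b0 then r else inverse r)"
  have "0 \<le> s" "XX b r = T s" using assms(2) by (simp_all add: s_def XX_def)
  moreover from this(1) have "s \<in> J" using sol(2) by auto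
  ultimately show "0 \<le> XX b r" "XX b r < M" using T_nonneg sol(5) by simp_all
qed

lemma slope_bound:
  obtains C0 where "0 \<le> C0" "\<And>x. 0 \<le> x \<Longrightarrow> x \<le> M \<Longrightarrow> x * (p0 + p1 * x) / (kap * D x) \<le> C0\<^sup>2"
proof -
  let ?f = "\<lambda>x. x * (p0 + p1 * x) / (kap * D x)"
  have "continuous_on {0..M} ?f"
    unfolding D_def by (intro continuous_intros) (use kap D_pos in \<open>auto simp: D_def less_imp_neq[symmetric]\<close>)
  then have "bounded (?f ` {0..M})" by (intro compact_imp_bounded compact_continuous_image) simp_all
  then obtain B where B: "\<And>x. x \<in> {0..M} \<Longrightarrow> norm (?f x) \<le> B" unfolding bounded_iff by blast
  show thesis
  proof (rule that[of "sqrt \<bar>B\<bar>"])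
    show "?f x \<le> (sqrt \<bar>B\<bar>)\<^sup>2" if "0 \<le> x" "x \<le> M" for x
      using abs_le_D1[OF B[of x, unfolded real_norm_def]] that by simp
  qed simp
qed

text \<open>The derivative depends on \<open>u\<close> only through \<open>vcov\<close>, so by
  Cauchy-Schwarz its square is controlled by the vertical part of the metric.\<close>

lemma gap_derivative:
  assumes cw: "c \<in> A" "w \<in> Tv" and y: "y \<in> radial.Om (base_dom c w) (kb b c w) (JJ b)"
    and C0: "0 \<le> C0" "\<And>x. 0 \<le> x \<Longrightarrow> x \<le> M \<Longrightarrow> x * (p0 + p1 * x) / (kap * D x) \<le> C0\<^sup>2"
  obtains \<beta>' where "((\<lambda>y. - ln (M - XX b (rad (kb b c w) y))) has_derivative \<beta>') (at y)"
    "\<And>u. \<beta>' u \<le> C0 * sqrt (riem (loc b c w) y u u)"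
proof -
  interpret R: radial "base_dom c w" "kb b c w" "af c" "JJ b" "LL b" "MM b" "sb b" by (rule radial_ch[OF cw])
  define E r m X where "E = exp (kb b c w (bp y))" and "r = rad (kb b c w) y" and "m = MM b r" and "X = XX b r"
  have rJ: "r \<in> JJ b" unfolding r_def by (rule R.Om_D(3)[OF y])
  have r0: "0 \<le> r" unfolding r_def by (rule rad_ge_0)
  note X = XX_bounds[OF rJ r0, folded X_def]
  have DX: "0 < D X" using D_pos[OF X(1)] X(2) by simp
  have m0: "0 < m" unfolding m_def by (rule R.mu_pos[OF rJ])
  obtain d where d: "(XX b has_real_derivative d) (at r)" "d = (if b = b0 then 1 else -1) * m / kap"
    using XX_derivative[OF rJ] unfolding m_def by blast
  define \<beta>' where "\<beta>' u = d / (M - X) * (2 * E * Re (cnj (y $ 2) * vcov (kb b c w) y u))" for u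
  show thesis
  proof (rule that)
    have "((\<lambda>r. - ln (M - XX b r)) has_real_derivative d / (M - X)) (at r)"
      by (rule derivative_eq_intros d(1) refl | use X in \<open>simp add: X_def\<close>)+
    from has_derivative_compose[OF R.derivative_rad[OF R.Om_D(1)[OF y]] this[unfolded has_field_derivative_def r_def]]
    show "((\<lambda>y. - ln (M - XX b (rad (kb b c w) y))) has_derivative \<beta>') (at y)"
      unfolding \<beta>'_def[abs_def] E_def by (simp only: r_def[symmetric])
    fix u
    define v where "v = cmod (vcov (kb b c w) y u)"
    have "\<bar>Re (cnj (y $ 2) * vcov (kb b c w) y u)\<bar> \<le> cmod (y $ 2) * v"
      unfolding v_def using abs_Re_le_cmod[of "cnj (y $ 2) * vcov (kb b c w) y u"] by (simp only: norm_mult complex_mod_cnj)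
    then have 1: "(Re (cnj (y $ 2) * vcov (kb b c w) y u))\<^sup>2 \<le> (cmod (y $ 2) * v)\<^sup>2"
      by (metis power2_abs power_mono abs_ge_zero)
    have dd: "d\<^sup>2 = (m / kap)\<^sup>2" unfolding d(2) by simp
    have "(\<beta>' u)\<^sup>2 = (m / kap / (M - X) * (2 * E))\<^sup>2 * (Re (cnj (y $ 2) * vcov (kb b c w) y u))\<^sup>2"
      unfolding \<beta>'_def power_mult_distrib power_divide dd by simp
    also have "\<dots> \<le> (m / kap / (M - X) * (2 * E))\<^sup>2 * (cmod (y $ 2) * v)\<^sup>2"
      by (rule mult_left_mono[OF 1]) simp
    also have "\<dots> = 2 * (2 * r * m / (M - X)\<^sup>2) / kap\<^sup>2 * (m * E * v\<^sup>2)"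
      unfolding r_def rad_def E_def[symmetric] by (simp add: power2_eq_square mult_ac)
    \<comment> \<open>The double zero of \<open>Q\<close> enters: it cancels the square of the pole
      of the logarithmic derivative, and a function bounded up to \<open>X = M\<close> is
      left.\<close>
    also have "2 * r * m / (M - X)\<^sup>2 = kap * (X * (p0 + p1 * X)) / D X"
    proof -
      have "2 * r * m * D X = kap * (X * ((M - X)\<^sup>2 * (p0 + p1 * X)))"
        using MM_ode[OF rJ] unfolding m_def X_def Q_def P_def .
      then show ?thesis using X DX by (simp add: frac_eq_eq mult_ac)
    qed
    also have "2 * (kap * (X * (p0 + p1 * X)) / D X) / kap\<^sup>2 * (m * E * v\<^sup>2) =
        (X * (p0 + p1 * X) / (kap * D X)) * (2 * (m * E * v\<^sup>2))"
      using kap by (simp add: power2_eq_square) (simp only: mult_ac)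
    also have "\<dots> \<le> C0\<^sup>2 * (2 * (m * E * v\<^sup>2))"
      by (rule mult_right_mono[OF C0(2)[OF X(1) less_imp_le[OF X(2)]]]) (use m0 in \<open>simp add: E_def\<close>)
    also have "\<dots> \<le> C0\<^sup>2 * riem (loc b c w) y u u"
    proof (rule mult_left_mono)
      have "0 \<le> LL b (rad (kb b c w) y) * af c (bp y) * (cmod (u $ 1))\<^sup>2"
        using R.lam_pos[OF R.Om_D(3)[OF y]] R.a_pos[OF R.Om_D(2)[OF y]] by simp
      then show "2 * (m * E * v\<^sup>2) \<le> riem (loc b c w) y u u"
        unfolding loc_def R.riem_self m_def E_def v_def r_def by simp
    qed simp
    finally have "\<bar>\<beta>' u\<bar> \<le> sqrt (C0\<^sup>2 * riem (loc b c w) y u u)" by (rule real_le_rsqrt[of "\<bar>\<beta>' u\<bar>", unfolded power2_abs])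
    then show "\<beta>' u \<le> C0 * sqrt (riem (loc b c w) y u u)" using C0(1) by (simp add: real_sqrt_mult)
  qed
qed

lemma HH_continuous:
  assumes "d \<in> ruled_atlas A p Tv"
  shows "continuous_on (snd d ` (fst d \<inter> Yb b0)) (\<lambda>z. HH d z $ j $ k)"
proof -
  have "\<forall>d\<in>ruled_atlas A p Tv. \<forall>j k. smooth_on (snd d ` (fst d \<inter> Yb b0)) (\<lambda>z. HH d z $ j $ k)"
    using kaehler_HH unfolding kaehler_metric_def case_prod_beta prod.collapse by (elim conjE) assumption
  then show ?thesis using assms by (intro smooth_on_imp_continuous_on) blast
qed

lemma gap_lipschitz:
  assumes mm: "\<And>b c w x \<zeta>. c \<in> A \<Longrightarrow> w \<in> Tv \<Longrightarrow> x \<in> fst c \<Longrightarrow> x \<in> fst w \<Longrightarrow> b = b0 \<or> \<zeta> \<noteq> 0 \<Longrightarrow>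
     xv (pt b w x \<zeta>) = XX b (rad (kb b c w) (vector [snd c x $ 1, \<zeta>]))"
  obtains C0 where "0 \<le> C0" "\<And>x y l. curve_of_length (ruled_atlas A p Tv) (Yb b0) HH x y l \<Longrightarrow>
    - ln (M - xv y) \<le> - ln (M - xv x) + C0 * l"
proof -
  obtain C0 where C0: "0 \<le> C0" "\<And>x. 0 \<le> x \<Longrightarrow> x \<le> M \<Longrightarrow> x * (p0 + p1 * x) / (kap * D x) \<le> C0\<^sup>2"
    using slope_bound by blast
  show thesis
  proof (rule that[OF C0(1)])
    fix x y l assume cv: "curve_of_length (ruled_atlas A p Tv) (Yb b0) HH x y l"
    show "- ln (M - xv y) \<le> - ln (M - xv x) + C0 * l"
    proof (rule curve_of_length_lipschitz[OF cv _ HH_continuous])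
      fix d assume dd: "d \<in> ruled_atlas A p Tv"
      obtain b c w where d: "c \<in> A" "w \<in> Tv" "d = ch b c w" "HH d = loc b c w" using HH_cases[OF dd] by blast
      let ?\<beta> = "\<lambda>y. - ln (M - XX b (rad (kb b c w) y))"
      show "\<exists>\<beta>. (\<forall>X\<in>fst d \<inter> Yb b0. - ln (M - xv X) = \<beta> (snd d X)) \<and>
        (\<forall>z\<in>snd d ` (fst d \<inter> Yb b0). \<exists>\<beta>'. (\<beta> has_derivative \<beta>') (at z) \<and> (\<forall>u. \<beta>' u \<le> C0 * sqrt (riem (HH d) z u u)))"
      proof (rule exI[of _ ?\<beta>], intro conjI ballI)
        fix X assume X: "X \<in> fst d \<inter> Yb b0"
        obtain x \<zeta> where x: "X = pt b w x \<zeta>" "x \<in> fst c \<inter> fst w" using X unfolding d(3) ch_domain[OF d(2)] by blast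
        have b: "b = b0 \<or> \<zeta> \<noteq> 0" using X Yb_iff[OF d(2), of x b \<zeta> b0] x by auto
        show "- ln (M - xv X) = ?\<beta> (snd d X)"
          unfolding d(3) x(1) ch_coord[OF d(2) x(2)] using mm[OF d(1,2) _ _ b] x(2) by simp
      next
        fix z assume "z \<in> snd d ` (fst d \<inter> Yb b0)"
        then have z: "z \<in> radial.Om (base_dom c w) (kb b c w) (JJ b)" unfolding d(3) image_Om[OF d(1,2)] .
        obtain \<beta>' where "(?\<beta> has_derivative \<beta>') (at z)" "\<And>u. \<beta>' u \<le> C0 * sqrt (riem (loc b c w) z u u)"
          using gap_derivative[OF d(1,2) z C0] by blast
        then show "\<exists>\<beta>'. (?\<beta> has_derivative \<beta>') (at z) \<and> (\<forall>u. \<beta>' u \<le> C0 * sqrt (riem (HH d) z u u))"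
          unfolding d(4) by (intro exI[of _ \<beta>'] conjI allI)
      qed
    qed
  qed
qed

end

section \<open>Finite coordinate covers of the compact base\<close>

context ruled
begin

lemma transition_continuous:
  assumes "c \<in> A" "d \<in> A"
  shows "continuous_on (snd d ` (fst d \<inter> fst c)) (\<lambda>v. snd c (inv_into (fst d) (snd d) v))"
proof -
  have "hol_map_on (snd c \<circ> inv_into (fst d) (snd d)) (snd d ` (fst d \<inter> fst c))"
    using at assms unfolding complex_atlas_def by (auto simp: case_prod_beta)
  then have h: "hol_fun_on (\<lambda>v. snd c (inv_into (fst d) (snd d) v) $ 1) (snd d ` (fst d \<inter> fst c))"
    unfolding hol_map_on_def o_def by blast
  have "continuous_on (snd d ` (fst d \<inter> fst c)) (\<lambda>v. snd c (inv_into (fst d) (snd d) v) $ 1)"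
  proof (intro continuous_at_imp_continuous_on ballI)
    fix v assume v: "v \<in> snd d ` (fst d \<inter> fst c)"
    obtain l where "((\<lambda>v. snd c (inv_into (fst d) (snd d) v) $ 1) has_derivative (\<lambda>u. l * u $ 1)) (at v)"
      by (rule hol_fun_on_derivative[OF h v])
    then show "isCont (\<lambda>v. snd c (inv_into (fst d) (snd d) v) $ 1) v" by (rule has_derivative_continuous)
  qed
  then have "continuous_on (snd d ` (fst d \<inter> fst c)) (\<lambda>v. \<chi> i::1. snd c (inv_into (fst d) (snd d) v) $ i)"
    by (intro continuous_on_vec_lambda) (metis num1_eq1)
  then show ?thesis by simp
qed

lemma openin_coordinate_ball:
  assumes "c \<in> A" "w \<in> T"
  shows "openin (atlas_topology A) {x \<in> fst c \<inter> fst w. snd c x \<in> ball z e}"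
  unfolding openin_atlas
proof (intro conjI ballI)
  show "{x \<in> fst c \<inter> fst w. snd c x \<in> ball z e} \<subseteq> atlas_space A" using atlasD(3)[OF assms(1)] by blast
  fix d assume d: "d \<in> A"
  let ?\<chi> = "\<lambda>v. snd c (inv_into (fst d) (snd d) v)" and ?S = "snd d ` (fst d \<inter> fst c)"
  have inv: "inv_into (fst d) (snd d) (snd d x) = x" if "x \<in> fst d" for x
    by (rule inv_into_f_f[OF atlasD(1)[OF d] that])
  have "open (?S \<inter> ?\<chi> -` ball z e)"
    by (rule continuous_open_preimage[OF transition_continuous[OF assms(1) d] atlasD2(1)[OF d assms(1)] open_ball])
  from open_Int[OF this open_base_dom[OF d assms(2)]]
  have "open (?S \<inter> ?\<chi> -` ball z e \<inter> base_dom d w)" .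
  moreover have "?S \<inter> ?\<chi> -` ball z e \<inter> base_dom d w = snd d ` ({x \<in> fst c \<inter> fst w. snd c x \<in> ball z e} \<inter> fst d)"
  proof (intro equalityI subsetI)
    fix v assume v: "v \<in> ?S \<inter> ?\<chi> -` ball z e \<inter> base_dom d w"
    then obtain x x' where x: "v = snd d x" "x \<in> fst d" "x \<in> fst c" and x': "v = snd d x'" "x' \<in> fst d" "x' \<in> fst w"
      unfolding base_dom_def by blast
    have "x' = x" using inv[OF x(2)] inv[OF x'(2)] x(1) x'(1) by simp
    moreover have "snd c x \<in> ball z e" using v inv[OF x(2)] x(1) by simp
    ultimately show "v \<in> snd d ` ({x \<in> fst c \<inter> fst w. snd c x \<in> ball z e} \<inter> fst d)" using x x' by blast
  next
    fix v assume "v \<in> snd d ` ({x \<in> fst c \<inter> fst w. snd c x \<in> ball z e} \<inter> fst d)"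
    then obtain x where "v = snd d x" "x \<in> fst d" "x \<in> fst c" "x \<in> fst w" "snd c x \<in> ball z e" by blast
    then show "v \<in> ?S \<inter> ?\<chi> -` ball z e \<inter> base_dom d w" unfolding base_dom_def using inv by auto
  qed
  ultimately show "open (snd d ` ({x \<in> fst c \<inter> fst w. snd c x \<in> ball z e} \<inter> fst d))" by simp
qed

text \<open>The open coordinate balls provide the cover for compactness; the closed ones are kept so
  that continuous functions of the coordinates are bounded on every piece.\<close>

lemma finite_coordinate_cover:
  assumes "compact_space (atlas_topology A)"
  obtains F where "finite F" "\<And>c w z e. (c, w, z, e) \<in> F \<Longrightarrow> c \<in> A \<and> w \<in> T \<and> cball z e \<subseteq> base_dom c w"
    "\<And>x. x \<in> atlas_space A \<Longrightarrow> \<exists>(c, w, z, e)\<in>F. x \<in> fst c \<inter> fst w \<and> snd c x \<in> cball z e"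
proof -
  define I where "I = {(c, w, z, e). c \<in> A \<and> w \<in> T \<and> cball z e \<subseteq> base_dom c w}"
  define U where "U q = (case q of (c, w, z, e) \<Rightarrow> {x \<in> fst c \<inter> fst w. snd c x \<in> ball z e})"
    for q :: "('m, 1) chart \<times> ('l, 'm) triv \<times> (complex^1) \<times> real"
  have ts: "topspace (atlas_topology A) = atlas_space A"
  proof
    show "topspace (atlas_topology A) \<subseteq> atlas_space A" using openin_topspace openin_atlas by blast
    have "openin (atlas_topology A) (atlas_space A)" unfolding openin_atlas
      using atlasD(2,3) by (simp add: Int_absorb1)
    then show "atlas_space A \<subseteq> topspace (atlas_topology A)" by (rule openin_subset)
  qed
  have op: "\<forall>S\<in>U ` I. openin (atlas_topology A) S"
    unfolding U_def I_def using openin_coordinate_ball by auto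
  have cov: "topspace (atlas_topology A) \<subseteq> \<Union> (U ` I)"
  proof
    fix x assume "x \<in> topspace (atlas_topology A)"
    then have x: "x \<in> atlas_space A" by (simp add: ts)
    then obtain c where c: "c \<in> A" "x \<in> fst c" unfolding atlas_space_def by blast
    obtain w where w: "w \<in> T" "x \<in> fst w" using x triv_cover by blast
    have "snd c x \<in> base_dom c w" using c w by (auto simp: base_dom_def)
    then obtain e where e: "0 < e" "cball (snd c x) e \<subseteq> base_dom c w"
      using open_base_dom[OF c(1) w(1)] open_contains_cball by blast
    have "(c, w, snd c x, e) \<in> I" using c w e by (simp add: I_def)
    moreover have "x \<in> U (c, w, snd c x, e)" using c w e by (simp add: U_def)
    ultimately show "x \<in> \<Union> (U ` I)" by blast
  qed
  obtain G where "finite G" "G \<subseteq> U ` I" "topspace (atlas_topology A) \<subseteq> \<Union> G"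
    using assms[unfolded compact_space_alt, THEN spec, THEN mp, OF conjI[OF op cov]] by blast
  then obtain F where F: "finite F" "F \<subseteq> I" "atlas_space A \<subseteq> \<Union> (U ` F)"
    using finite_subset_image[of G U I] ts by metis
  show thesis
  proof (rule that[OF F(1)])
    show "c \<in> A \<and> w \<in> T \<and> cball z e \<subseteq> base_dom c w" if "(c, w, z, e) \<in> F" for c w z e
      using that F(2) by (auto simp: I_def)
    show "\<exists>(c, w, z, e)\<in>F. x \<in> fst c \<inter> fst w \<and> snd c x \<in> cball z e" if that: "x \<in> atlas_space A" for x
    proof -
      have "x \<in> \<Union> (U ` F)" by (rule subsetD[OF F(3) that])
      then obtain q where q: "q \<in> F" "x \<in> U q" by blast
      obtain c w z e where "q = (c, w, z, e)" by (cases q) auto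
      with q(2) have "case q of (c, w, z, e) \<Rightarrow> x \<in> fst c \<inter> fst w \<and> snd c x \<in> cball z e" by (simp add: U_def)
      with q(1) show ?thesis by (rule bexI[rotated])
    qed
  qed
qed

end

section \<open>Convergence of Cauchy sequences\<close>

context ruled_profile
begin

lemma complete_HH:
  assumes cs: "compact_space (atlas_topology A)"
    and mm: "\<And>b c w x \<zeta>. c \<in> A \<Longrightarrow> w \<in> Tv \<Longrightarrow> x \<in> fst c \<Longrightarrow> x \<in> fst w \<Longrightarrow> b = b0 \<or> \<zeta> \<noteq> 0 \<Longrightarrow>
     xv (pt b w x \<zeta>) = XX b (rad (kb b c w) (vector [snd c x $ 1, \<zeta>]))"
  shows "complete_metric (ruled_atlas A p Tv) (Yb b0) HH"
  unfolding complete_metric_def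
proof (intro allI impI)
  let ?cv = "curve_of_length (ruled_atlas A p Tv) (Yb b0) HH"
  fix s :: "nat \<Rightarrow> 'l line"
  assume sY: "range s \<subseteq> Yb b0" and cauchy: "\<forall>e>0. \<exists>N. \<forall>i\<ge>N. \<forall>j\<ge>N. \<exists>l<e. ?cv (s i) (s j) l"
  obtain C0 where C0: "0 \<le> C0" "\<And>x y l. ?cv x y l \<Longrightarrow> - ln (M - xv y) \<le> - ln (M - xv x) + C0 * l"
    using gap_lipschitz[OF mm] by blast
  obtain F where F: "finite F" "\<And>c w z e. (c, w, z, e) \<in> F \<Longrightarrow> c \<in> A \<and> w \<in> Tv \<and> cball z e \<subseteq> base_dom c w"
    "\<And>x. x \<in> atlas_space A \<Longrightarrow> \<exists>(c, w, z, e)\<in>F. x \<in> fst c \<inter> fst w \<and> snd c x \<in> cball z e"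
    using finite_coordinate_cover[OF cs] by blast
  define Pq where "Pq j q \<longleftrightarrow> (case q of (c, w, z, e) \<Rightarrow>
      \<exists>x \<zeta>. x \<in> fst c \<inter> fst w \<and> snd c x \<in> cball z e \<and> s j = pt b0 w x \<zeta>)"
    for j and q :: "('m, 1) chart \<times> ('l, 'm) triv \<times> (complex^1) \<times> real"
  have Pex: "\<exists>q\<in>F. Pq j q" for j
  proof -
    have "s j \<in> Yb b0" using sY by blast
    then obtain w' x \<zeta>' where x: "w' \<in> Tv" "x \<in> fst w'" "s j = pt b0 w' x \<zeta>'" by (rule Yb_cases)
    have "x \<in> atlas_space A" using x(1,2) triv_cover by blast
    from F(3)[OF this] obtain c w z e where q: "(c, w, z, e) \<in> F" "x \<in> fst c \<inter> fst w" "snd c x \<in> cball z e" by blast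
    have "w \<in> Tv" "x \<in> fst w" using F(2)[OF q(1)] q(2) by auto
    from pt_change[OF x(1) this(1) x(2) this(2), of b0 \<zeta>'] x(3) q(2,3) have "Pq j (c, w, z, e)"
      unfolding Pq_def by auto
    with q(1) show ?thesis by (rule bexI[rotated])
  qed
  obtain N0 where N0: "\<And>i j. i \<ge> N0 \<Longrightarrow> j \<ge> N0 \<Longrightarrow> \<exists>l<1. ?cv (s i) (s j) l"
    using cauchy zero_less_one by meson
  \<comment> \<open>A bound for the moment coordinate from \<open>N0\<close> on: curves shorter than
    1 raise \<open>- ln (M - xv)\<close> by at most \<open>C0\<close>. The maximum with
    \<open>M / 2\<close> keeps it positive.\<close>
  define x2 where "x2 = max (M / 2) (M - exp (ln (M - xv (s N0)) - C0))"
  have x2: "0 < x2" "x2 < M" using M by (auto simp: x2_def)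
  \<comment> \<open>Pigeonhole: infinitely many members of the sequence lie over one of the finitely
    many coordinate balls.\<close>
  have "\<exists>q\<in>F. infinite {j \<in> {N0..}. Pq j q}"
  proof (rule ccontr)
    assume "\<not> (\<exists>q\<in>F. infinite {j \<in> {N0..}. Pq j q})"
    then have "finite (\<Union>q\<in>F. {j \<in> {N0..}. Pq j q})" using F(1) by blast
    moreover have "(\<Union>q\<in>F. {j \<in> {N0..}. Pq j q}) = {N0..}" using Pex by blast
    ultimately show False using infinite_Ici[of N0] by simp
  qed
  then obtain q where q: "q \<in> F" "infinite {j \<in> {N0..}. Pq j q}" by blast
  obtain c w z e where cwze: "q = (c, w, z, e)" by (cases q) auto
  have c: "c \<in> A" "w \<in> Tv" "cball z e \<subseteq> base_dom c w" using F(2) q(1) cwze by auto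
  let ?d = "ch b0 c w" and ?k = "kb b0 c w"
  have dd: "?d \<in> ruled_atlas A p Tv" unfolding ruled_atlas_eq using c by blast
  obtain h :: "nat \<Rightarrow> nat" where h: "strict_mono h" "\<And>n. h n \<in> {j \<in> {N0..}. Pq j q}"
    using infinite_enumerate[OF q(2)] by blast
  have "\<forall>n. \<exists>x \<zeta>. x \<in> fst c \<inter> fst w \<and> snd c x \<in> cball z e \<and> s (h n) = pt b0 w x \<zeta>"
    using h(2) unfolding Pq_def cwze by simp
  then obtain xx \<zeta> where x\<zeta>: "\<And>n. xx n \<in> fst c \<inter> fst w" "\<And>n. snd c (xx n) \<in> cball z e" "\<And>n. s (h n) = pt b0 w (xx n) (\<zeta> n)"
    by metis
  define y :: "nat \<Rightarrow> complex^2" where "y n = vector [snd c (xx n) $ 1, \<zeta> n]" for n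
  have ybp: "bp (y n) = snd c (xx n)" and y2: "y n $ 2 = \<zeta> n" for n by (simp_all add: y_def)
  have sy: "snd ?d (s (h n)) = y n" "s (h n) \<in> fst ?d" for n
  proof -
    show "snd ?d (s (h n)) = y n" unfolding x\<zeta>(3) y_def by (rule ch_coord[OF c(2) x\<zeta>(1)])
    show "s (h n) \<in> fst ?d" unfolding x\<zeta>(3) ch_domain[OF c(2)] using x\<zeta>(1) by blast
  qed
  have rad_le: "rad ?k (y n) \<le> rh x2" for n
  proof -
    have r0: "0 \<le> rad ?k (y n)" by (rule rad_ge_0)
    have xv: "xv (s (h n)) = T (rad ?k (y n))"
      unfolding x\<zeta>(3) y_def using mm[of c w "xx n" b0 "\<zeta> n"] c x\<zeta>(1)[of n] by (simp add: XX_def)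
    have "rad ?k (y n) \<in> J" using sol(2) r0 by auto
    then have gap: "0 < M - xv (s (h n))" unfolding xv using sol(5) by simp
    have "h n \<ge> N0" using h(2) by blast
    then obtain l where l: "l < 1" "?cv (s N0) (s (h n)) l" using N0[of N0 "h n"] by blast
    have "C0 * l \<le> C0" using C0(1) l(1) by (simp add: mult_left_le)
    with C0(2)[OF l(2)] have "ln (M - xv (s N0)) - C0 \<le> ln (M - xv (s (h n)))" by simp
    then have "exp (ln (M - xv (s N0)) - C0) \<le> M - xv (s (h n))" using gap by (simp add: ln_ge_iff)
    then have le: "T (rad ?k (y n)) \<le> x2" unfolding x2_def xv by simp
    show ?thesis
    proof (rule ccontr)
      assume "\<not> rad ?k (y n) \<le> rh x2"
      then have "rh x2 < rad ?k (y n)" by simp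
      moreover have "0 < rh x2" by (rule sol(10)[OF x2])
      ultimately have "T (rh x2) < T (rad ?k (y n))" using sol(2) r0 by (intro strict_mono_onD[OF sol(14)]) auto
      then show False using le sol(11)[OF x2] by simp
    qed
  qed
  have "bounded (?k ` cball z e)"
    by (intro compact_imp_bounded compact_continuous_image continuous_on_subset[OF smooth_on_imp_continuous_on[OF smooth_kb[OF c(1,2)]] c(3)]) simp
  then obtain K where K: "\<And>v. v \<in> cball z e \<Longrightarrow> \<bar>?k v\<bar> \<le> K"
    unfolding bounded_iff ball_simps(9) real_norm_def by blast
  define \<rho> where "\<rho> = sqrt (rh x2 * exp K)"
  \<comment> \<open>The bound on \<open>rad\<close> and the bounded weight confine the fibre
    coordinate, so a subsequence stays in this compact set of coordinates inside a single
    chart.\<close>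
  define Kc where "Kc = {y::complex^2. bp y \<in> cball z e \<and> cmod (y $ 2) \<le> \<rho>}"
  have yK: "y n \<in> Kc" for n
  proof -
    have zb: "bp (y n) \<in> cball z e" using x\<zeta>(2) ybp by simp
    have "exp (- K) * (cmod (y n $ 2))\<^sup>2 \<le> exp (?k (bp (y n))) * (cmod (y n $ 2))\<^sup>2"
      using K[OF zb] by (intro mult_right_mono) auto
    also have "\<dots> \<le> rh x2" using rad_le unfolding rad_def .
    finally have "(cmod (y n $ 2))\<^sup>2 \<le> rh x2 * exp K" by (simp add: exp_minus field_simps)
    then have "cmod (y n $ 2) \<le> \<rho>" unfolding \<rho>_def by (rule real_le_rsqrt)
    with zb show ?thesis by (simp add: Kc_def)
  qed
  have "compact Kc"
  proof -
    have "closed (bp -` cball z e \<inter> {y. cmod (y $ 2) \<le> \<rho>})"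
      by (intro closed_Int closed_vimage closed_cball continuous_on_bp closed_Collect_le continuous_intros)
    moreover have "bounded Kc" unfolding bounded_iff
    proof (intro exI ballI)
      fix v assume v: "v \<in> Kc"
      have "norm v \<le> cmod (v $ 1) + cmod (v $ 2)" using L2_set_le_sum[of UNIV "\<lambda>i. cmod (v $ i)"]
        by (simp add: norm_vec_def sum_2)
      moreover have "cmod (v $ 1) \<le> norm (bp v)" using Finite_Cartesian_Product.norm_nth_le[of "bp v" 1] by simp
      moreover have "norm (bp v) \<le> norm z + e"
        using v norm_triangle_sub[of "bp v" z] unfolding Kc_def by (simp add: dist_norm norm_minus_commute)
      ultimately show "norm v \<le> norm z + e + \<rho>" using v unfolding Kc_def by simp
    qed
    moreover have "bp -` cball z e \<inter> {y. cmod (y $ 2) \<le> \<rho>} = Kc" by (auto simp: Kc_def)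
    ultimately show ?thesis by (simp add: compact_eq_bounded_closed)
  qed
  then obtain yl g where g: "yl \<in> Kc" "strict_mono g" "(y \<circ> g) \<longlonglongrightarrow> yl"
    using yK unfolding compact_def by meson
  have ylb: "bp yl \<in> base_dom c w" using g(1) c(3) unfolding Kc_def by blast
  let ?\<Omega> = "snd ?d ` (fst ?d \<inter> Yb b0)"
  have \<Omega>: "?\<Omega> = {y. bp y \<in> base_dom c w}" unfolding ch_image[OF c(1,2)] by simp
  have "open ?\<Omega>" unfolding \<Omega>
    using open_vimage[OF open_base_dom[OF c(1,2)] continuous_on_bp] by (simp add: vimage_def)
  moreover have yl\<Omega>: "yl \<in> ?\<Omega>" using ylb \<Omega> by blast
  ultimately obtain \<delta> where \<delta>: "0 < \<delta>" "cball yl \<delta> \<subseteq> ?\<Omega>" unfolding open_contains_cball by blast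
  obtain Xl where Xl: "Xl \<in> fst ?d \<inter> Yb b0" "snd ?d Xl = yl" using yl\<Omega> by blast
  have "bounded ((\<lambda>v. \<Sum>j\<in>UNIV. \<Sum>k\<in>UNIV. cmod (HH ?d v $ j $ k)) ` cball yl \<delta>)"
    by (intro compact_imp_bounded compact_continuous_image continuous_on_sum continuous_on_norm
        continuous_on_subset[OF HH_continuous[OF dd] \<delta>(2)]) simp
  then obtain B where B: "\<And>v. v \<in> cball yl \<delta> \<Longrightarrow> \<bar>\<Sum>j\<in>UNIV. \<Sum>k\<in>UNIV. cmod (HH ?d v $ j $ k)\<bar> \<le> B"
    unfolding bounded_iff ball_simps(9) real_norm_def by blast
  have HB: "cmod (HH ?d v $ j $ k) \<le> B" if v: "v \<in> cball yl \<delta>" for v j k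
  proof -
    have "cmod (HH ?d v $ j $ k) \<le> (\<Sum>k\<in>UNIV. cmod (HH ?d v $ j $ k))"
      by (rule member_le_sum) simp_all
    also have "\<dots> \<le> (\<Sum>j\<in>UNIV. \<Sum>k\<in>UNIV. cmod (HH ?d v $ j $ k))"
      by (rule member_le_sum) (simp_all add: sum_nonneg)
    finally show ?thesis using B[OF v] by linarith
  qed
  define L where "L = sqrt (2 * (real CARD(2))\<^sup>2 * B)"
  have L0: "0 \<le> L" unfolding L_def
    using order_trans[OF norm_ge_zero HB[of yl 1 1]] \<delta>(1) by simp
  show "\<exists>x\<in>Yb b0. \<forall>e>0. \<exists>N. \<forall>i\<ge>N. \<exists>l<e. ?cv (s i) x l"
  proof (rule bexI[of _ Xl], intro allI impI)
    fix e :: real assume e: "0 < e"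
    obtain N1 where N1: "\<And>i j. i \<ge> N1 \<Longrightarrow> j \<ge> N1 \<Longrightarrow> \<exists>l<e / 2. ?cv (s i) (s j) l"
      using cauchy half_gt_zero[OF e] by meson
    \<comment> \<open>The segment to the limit stays in the ball where the coefficients are bounded,
      and has length at most \<open>e / 2\<close>; \<open>L + 1\<close> avoids division by zero when
      \<open>L = 0\<close>.\<close>
    define \<epsilon> where "\<epsilon> = min \<delta> (e / (2 * (L + 1)))"
    have \<epsilon>: "0 < \<epsilon>" unfolding \<epsilon>_def using \<delta>(1) e L0 by simp
    obtain n0 where n0: "\<And>n. n \<ge> n0 \<Longrightarrow> dist ((y \<circ> g) n) yl < \<epsilon>"
      using g(3) \<epsilon> unfolding lim_sequentially by blast
    define n where "n = max n0 N1"
    define m where "m = h (g n)"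
    have yn: "dist (y (g n)) yl < \<epsilon>" using n0[of n] by (simp add: n_def)
    have "N1 \<le> m"
      using seq_suble[OF g(2), of n] seq_suble[OF h(1), of "g n"] unfolding m_def n_def by linarith
    have "\<exists>l<e. ?cv (s i) Xl l" if i: "N1 \<le> i" for i
    proof -
      obtain l where l: "l < e / 2" "?cv (s i) (s m) l" using N1[OF i \<open>N1 \<le> m\<close>] by blast
      have sm: "s m \<in> fst ?d \<inter> Yb b0" "snd ?d (s m) = y (g n)" using sy sY unfolding m_def by auto
      have "closed_segment (y (g n)) yl \<subseteq> cball yl \<delta>"
        using yn \<delta>(1) by (intro closed_segment_subset) (auto simp: \<epsilon>_def dist_commute)
      then have seg: "closed_segment (snd ?d (s m)) (snd ?d Xl) \<subseteq> cball yl \<delta>" unfolding sm(2) Xl(2) .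
      obtain l' where l': "?cv (s i) Xl (l + l')" "l' \<le> L * norm (snd ?d Xl - snd ?d (s m))"
        unfolding L_def
        by (rule curve_of_length_segment[OF l(2) dd sm(1) Xl(1) subset_trans[OF seg \<delta>(2)] HB]) (use seg in blast)+
      have "norm (snd ?d Xl - snd ?d (s m)) \<le> e / (2 * (L + 1))"
        using yn unfolding sm(2) Xl(2) \<epsilon>_def by (simp add: dist_norm norm_minus_commute)
      from mult_left_mono[OF this L0] have "l' \<le> L * (e / (2 * (L + 1)))" using l'(2) by linarith
      also have "\<dots> \<le> e / 2" using L0 e by (simp add: field_simps)
      finally have "l + l' < e" using l(1) by simp
      with l'(1) show ?thesis by blast
    qed
    then show "\<exists>N. \<forall>i\<ge>N. \<exists>l<e. ?cv (s i) Xl l" by blast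
  qed (use Xl in blast)
qed

end

section \<open>Existence of the metrics\<close>

text \<open>The curvature is expressed through the moment map by inverting
  \<open>1 + \<tau> = kap * (d0 + eps * x)\<close>, where \<open>eps\<close> is its own
  inverse.\<close>

lemma (in ruled) exists_metric:
  assumes prof: "profile eps kap M d0 p0 p1 A0 A1" and e: "eps = sb b0"
    and cs: "compact_space (atlas_topology A)"
    and ends: "(if b0 then lo else hi) = kap * d0 - 1" "(if b0 then hi else lo) = kap * (d0 + eps * M) - 1"
  shows "\<exists>\<phi> f H. profile_potential lo hi \<phi> f \<and> momentum_form A p T nrm \<omega>M f H \<and>
    kaehler_metric (ruled_atlas A p T) (Yb b0) H \<and> complete_metric (ruled_atlas A p T) (Yb b0) H \<and>
    extremal_metric (ruled_atlas A p T) (Yb b0) H \<and>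
    mfd_scalar_curvature (ruled_atlas A p T) (Yb b0) H
      (\<lambda>x. A0 + A1 * (((moment_map p T nrm lo hi f x + 1) / kap - d0) * eps)) \<and>
    (0 < p0 + p1 * M \<longrightarrow> asymptotically_hyperbolic (ruled_atlas A p T) (nsec (\<not> b0)) H)"
proof -
  interpret P: profile eps kap M d0 p0 p1 A0 A1 by (rule prof)
  obtain X rh J where sol: "profile_solution eps kap M d0 p0 p1 A0 A1 X rh J"
    by (rule P.exists_solution) (rule that, intro profile_solution.intro prof profile_solution_axioms.intro)
  interpret S: ruled_profile A p T nrm \<omega>M eps kap M d0 p0 p1 A0 A1 X rh J b0
    by (intro ruled_profile.intro ruled_profile_axioms.intro sol e ruled_axioms)
  have h: "eps = 1 \<and> lo = kap * d0 - 1 \<and> hi = kap * P.D M - 1 \<or>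
    eps = -1 \<and> lo = kap * P.D M - 1 \<and> hi = kap * d0 - 1"
    using ends e unfolding P.D_def sb_def by (cases b0) simp_all
  obtain \<phi> f where \<phi>: "profile_potential lo hi \<phi> f"
    and f: "\<And>t. (f has_real_derivative kap * P.D (X (exp (2 * eps * t))) - 1) (at t)"
    by (rule S.profile_potential_exists[OF h], rule that)
  let ?xv = "\<lambda>x. ((moment_map p T nrm lo hi f x + 1) / kap - d0) * eps"
  have mm: "?xv (pt b w x \<zeta>) = S.XX b (rad (kb b c w) (vector [snd c x $ 1, \<zeta>]))"
    if "c \<in> A" "w \<in> T" "x \<in> fst c" "x \<in> fst w" "b = b0 \<or> \<zeta> \<noteq> 0" for b c w x \<zeta>
    unfolding S.moment_map_pt[OF f ends(1) that] using P.kap by (simp add: P.D_def mult.commute)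
  show ?thesis
  proof (intro exI conjI impI)
    show "profile_potential lo hi \<phi> f" by (rule \<phi>)
    show "momentum_form A p T nrm \<omega>M f S.HH" by (rule S.momentum_HH[OF f])
    show "kaehler_metric (ruled_atlas A p T) (Yb b0) S.HH" by (rule S.kaehler_HH)
    show "complete_metric (ruled_atlas A p T) (Yb b0) S.HH" by (rule S.complete_HH[OF cs mm])
    show "extremal_metric (ruled_atlas A p T) (Yb b0) S.HH" by (rule S.extremal_HH)
    show "mfd_scalar_curvature (ruled_atlas A p T) (Yb b0) S.HH (\<lambda>x. A0 + A1 * ?xv x)"
      by (rule S.scalar_HH) (rule arg_cong[where f = "\<lambda>v. A0 + A1 * v"], rule mm)
    show "asymptotically_hyperbolic (ruled_atlas A p T) (nsec (\<not> b0)) S.HH" if "0 < p0 + p1 * M"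
      by (rule S.asymptotically_hyperbolic_HH[OF that])
  qed
qed

text \<open>Divided by the cube of the variable the polynomial becomes
  \<open>1 - 3 / x - 9 / x\<^sup>2 - 6 / x ^ 3\<close>, which increases on the positive axis. The
  proof compares the two quotients after cross-multiplication.\<close>

lemma cubic_neg:
  fixes m n :: real
  assumes "0 < m" "m < n" "n ^ 3 - 3 * n\<^sup>2 - 9 * n - 6 \<le> 0"
  shows "m ^ 3 - 3 * m\<^sup>2 - 9 * m - 6 < 0"
proof -
  let ?p = "\<lambda>x::real. x ^ 3 - 3 * x\<^sup>2 - 9 * x - 6"
  have "?p m * n ^ 3 - ?p n * m ^ 3 = - (3 * m\<^sup>2 * n\<^sup>2 * (n - m) + 9 * m * n * (n\<^sup>2 - m\<^sup>2) + 6 * (n ^ 3 - m ^ 3))"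
    by (simp add: algebra_simps power2_eq_square power3_eq_cube)
  moreover have "0 < 3 * m\<^sup>2 * n\<^sup>2 * (n - m)" using assms by simp
  moreover have "0 \<le> 9 * m * n * (n\<^sup>2 - m\<^sup>2)" using assms by (simp add: power_mono)
  moreover have "0 \<le> 6 * (n ^ 3 - m ^ 3)" using assms by (simp add: power_mono)
  moreover have "?p n * m ^ 3 \<le> 0" using assms by (simp add: mult_nonpos_nonneg)
  ultimately have "?p m * n ^ 3 < 0" by linarith
  then show ?thesis using assms(1,2) by (simp add: mult_less_0_iff)
qed

text \<open>The cubic is -1 at 5 and 48 at 6, which gives a root; \<open>cubic_neg\<close> excludes
  a second positive one, so the description in \<open>k2\<close> is meaningful.\<close>

lemma k2: "0 < k2" "k2 ^ 3 - 3 * k2\<^sup>2 - 9 * k2 - 6 = 0"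
proof -
  let ?p = "\<lambda>x::real. x ^ 3 - 3 * x\<^sup>2 - 9 * x - 6"
  have "\<exists>x\<ge>5. x \<le> 6 \<and> ?p x = 0"
  proof (rule IVT')
    show "continuous_on {5..6} ?p" by (intro continuous_intros)
  qed simp_all
  then obtain x where "5 \<le> x" "?p x = 0" by blast
  then have x: "0 < x" "?p x = 0" by simp_all
  have "\<exists>!m. 0 < m \<and> ?p m = 0"
  proof (rule ex1I[of _ x])
    show "0 < x \<and> ?p x = 0" using x by simp
    show "y = x" if y: "0 < y \<and> ?p y = 0" for y
      using cubic_neg[of y x] cubic_neg[of x y] x y by (cases y x rule: linorder_cases) auto
  qed
  from theI'[OF this] show "0 < k2" "?p k2 = 0" unfolding k2_def by auto
qed

lemma le_k2:
  assumes "0 < m"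
  shows "m \<le> k2 \<Longrightarrow> m ^ 3 - 3 * m\<^sup>2 - 9 * m - 6 \<le> 0" "m < k2 \<Longrightarrow> m ^ 3 - 3 * m\<^sup>2 - 9 * m - 6 < 0"
proof -
  show lt: "m ^ 3 - 3 * m\<^sup>2 - 9 * m - 6 < 0" if "m < k2" using cubic_neg[OF assms that] k2 by simp
  show "m ^ 3 - 3 * m\<^sup>2 - 9 * m - 6 \<le> 0" if "m \<le> k2"
    using lt k2(2) that by (cases "m = k2") auto
qed

text \<open>Here \<open>x\<close> is the moment map itself. The closing condition gives
  \<open>p0 = 2 / m\<^sup>2\<close>; eliminating \<open>A0\<close> and \<open>A1\<close> from the
  coefficients of \<open>Q2\<close> leaves a linear equation in which \<open>p1\<close> has the
  coefficient \<open>2 * q\<close>, the origin of this denominator.\<close>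

lemma profile_zero_section:
  assumes m: "0 < m" "m \<le> k2"
  defines "q \<equiv> m\<^sup>2 + 6 * m + 6"
  shows "profile 1 1 m 1 (2 / m\<^sup>2) (- 2 * (m\<^sup>2 - 2 * m - 3) / (m\<^sup>2 * q))
      (- 6 * (2 * m\<^sup>2 - m - 4) / (m * q)) (12 * (m\<^sup>2 - 2 * m - 3) / (m\<^sup>2 * q))"
    and "2 / m\<^sup>2 + - 2 * (m\<^sup>2 - 2 * m - 3) / (m\<^sup>2 * q) * m = - (m ^ 3 - 3 * m\<^sup>2 - 9 * m - 6) * (2 / (m\<^sup>2 * q))"
proof -
  have q: "0 < q" unfolding q_def using m by (simp add: add_pos_pos)
  show end': "2 / m\<^sup>2 + - 2 * (m\<^sup>2 - 2 * m - 3) / (m\<^sup>2 * q) * m = - (m ^ 3 - 3 * m\<^sup>2 - 9 * m - 6) * (2 / (m\<^sup>2 * q))"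
  proof -
    have "2 / m\<^sup>2 = 2 * q / (m\<^sup>2 * q)" using q by simp
    moreover have "2 * q + - 2 * (m\<^sup>2 - 2 * m - 3) * m = - (m ^ 3 - 3 * m\<^sup>2 - 9 * m - 6) * 2"
      by (simp add: q_def algebra_simps power2_eq_square power3_eq_cube)
    from arg_cong[OF this, of "\<lambda>z. z / (m\<^sup>2 * q)"]
    have "2 * q / (m\<^sup>2 * q) + - 2 * (m\<^sup>2 - 2 * m - 3) / (m\<^sup>2 * q) * m = - (m ^ 3 - 3 * m\<^sup>2 - 9 * m - 6) * (2 / (m\<^sup>2 * q))"
      by (simp only: add_divide_distrib times_divide_eq_left times_divide_eq_right)
    ultimately show ?thesis by (simp only:)
  qed
  show "profile 1 1 m 1 (2 / m\<^sup>2) (- 2 * (m\<^sup>2 - 2 * m - 3) / (m\<^sup>2 * q))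
      (- 6 * (2 * m\<^sup>2 - m - 4) / (m * q)) (12 * (m\<^sup>2 - 2 * m - 3) / (m\<^sup>2 * q))"
  proof
    show "0 \<le> 2 / m\<^sup>2 + - 2 * (m\<^sup>2 - 2 * m - 3) / (m\<^sup>2 * q) * m"
      unfolding end' by (rule mult_nonneg_nonneg) (use le_k2(1)[OF m] q in auto)
    fix x
    have "m\<^sup>2 * q * (2 / m\<^sup>2 * (6 * x - 4 * m) + - 2 * (m\<^sup>2 - 2 * m - 3) / (m\<^sup>2 * q) * (12 * x\<^sup>2 - 12 * m * x + 2 * m\<^sup>2)) =
      2 * q * (6 * x - 4 * m) - 2 * (m\<^sup>2 - 2 * m - 3) * (12 * x\<^sup>2 - 12 * m * x + 2 * m\<^sup>2)"
      using m(1) q by (simp add: distrib_left) (simp add: algebra_simps)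
    also have "\<dots> = m\<^sup>2 * q * - 4 - 2 * (1 + x) * (- 6 * (2 * m\<^sup>2 - m - 4) * m + 12 * (m\<^sup>2 - 2 * m - 3) * x)"
      unfolding q_def by (simp add: algebra_simps power2_eq_square)
    also have "\<dots> = m\<^sup>2 * q * (- 4 - 2 * (1 + 1 * x) * (1 * (- 6 * (2 * m\<^sup>2 - m - 4) / (m * q) +
        12 * (m\<^sup>2 - 2 * m - 3) / (m\<^sup>2 * q) * x)))"
    proof -
      have "m\<^sup>2 * q * (- 6 * (2 * m\<^sup>2 - m - 4) / (m * q) + 12 * (m\<^sup>2 - 2 * m - 3) / (m\<^sup>2 * q) * x) =
        - 6 * (2 * m\<^sup>2 - m - 4) * m + 12 * (m\<^sup>2 - 2 * m - 3) * x"
        using m(1) q by (simp add: distrib_left power2_eq_square)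
      from arg_cong[OF this, of "\<lambda>z. m\<^sup>2 * q * - 4 - 2 * (1 + x) * z"] show ?thesis by (simp add: algebra_simps)
    qed
    finally show "2 / m\<^sup>2 * (6 * x - 4 * m) + - 2 * (m\<^sup>2 - 2 * m - 3) / (m\<^sup>2 * q) * (12 * x\<^sup>2 - 12 * m * x + 2 * m\<^sup>2) =
       - 4 - 2 * (1 + 1 * x) * (1 * (- 6 * (2 * m\<^sup>2 - m - 4) / (m * q) + 12 * (m\<^sup>2 - 2 * m - 3) / (m\<^sup>2 * q) * x))"
      using m(1) q by simp
  qed (use m in simp_all)
qed

text \<open>Here \<open>m\<close> is the rescaled length and \<open>x\<close> is measured downwards
  from the upper end, so \<open>d0 = 1 + m\<close>. The same elimination again yields
  \<open>q\<close>. The curvature \<open>(a1 * (m - x) - a0) / kap\<close> is rewritten in powers of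
  \<open>x\<close>, whence the signs of the last two constants.\<close>

lemma profile_infinity_section:
  assumes m: "0 < m" "m \<le> k2" and kap: "0 < kap"
  defines "q \<equiv> m\<^sup>2 + 6 * m + 6"
  defines "a0 \<equiv> 6 * (3 * m\<^sup>2 + 5 * m + 2) / (m * q)" and "a1 \<equiv> 12 * (2 * m\<^sup>2 + 4 * m + 3) / (m\<^sup>2 * q)"
  shows "profile (- 1) kap m (1 + m) (2 * (1 + m) / m\<^sup>2) (- 2 * (2 * m\<^sup>2 + 4 * m + 3) / (m\<^sup>2 * q))
      ((a1 * m - a0) / kap) (- a1 / kap)"
    and "2 * (1 + m) / m\<^sup>2 + - 2 * (2 * m\<^sup>2 + 4 * m + 3) / (m\<^sup>2 * q) * m = - (m ^ 3 - 3 * m\<^sup>2 - 9 * m - 6) * (2 / (m\<^sup>2 * q))"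
proof -
  have q: "0 < q" unfolding q_def using m by (simp add: add_pos_pos)
  show end': "2 * (1 + m) / m\<^sup>2 + - 2 * (2 * m\<^sup>2 + 4 * m + 3) / (m\<^sup>2 * q) * m = - (m ^ 3 - 3 * m\<^sup>2 - 9 * m - 6) * (2 / (m\<^sup>2 * q))"
  proof -
    have "2 * (1 + m) / m\<^sup>2 = 2 * (1 + m) * q / (m\<^sup>2 * q)" using q by simp
    moreover have "2 * (1 + m) * q + - 2 * (2 * m\<^sup>2 + 4 * m + 3) * m = - (m ^ 3 - 3 * m\<^sup>2 - 9 * m - 6) * 2"
      by (simp add: q_def algebra_simps power2_eq_square power3_eq_cube)
    from arg_cong[OF this, of "\<lambda>z. z / (m\<^sup>2 * q)"]
    have "2 * (1 + m) * q / (m\<^sup>2 * q) + - 2 * (2 * m\<^sup>2 + 4 * m + 3) / (m\<^sup>2 * q) * m = - (m ^ 3 - 3 * m\<^sup>2 - 9 * m - 6) * (2 / (m\<^sup>2 * q))"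
      by (simp only: add_divide_distrib times_divide_eq_left times_divide_eq_right)
    ultimately show ?thesis by (simp only:)
  qed
  show "profile (- 1) kap m (1 + m) (2 * (1 + m) / m\<^sup>2) (- 2 * (2 * m\<^sup>2 + 4 * m + 3) / (m\<^sup>2 * q))
      ((a1 * m - a0) / kap) (- a1 / kap)"
  proof
    show "0 \<le> 2 * (1 + m) / m\<^sup>2 + - 2 * (2 * m\<^sup>2 + 4 * m + 3) / (m\<^sup>2 * q) * m"
      unfolding end' by (rule mult_nonneg_nonneg) (use le_k2(1)[OF m] q in auto)
    fix x
    have "m\<^sup>2 * q * (2 * (1 + m) / m\<^sup>2 * (6 * x - 4 * m) + - 2 * (2 * m\<^sup>2 + 4 * m + 3) / (m\<^sup>2 * q) * (12 * x\<^sup>2 - 12 * m * x + 2 * m\<^sup>2)) =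
      2 * (1 + m) * q * (6 * x - 4 * m) - 2 * (2 * m\<^sup>2 + 4 * m + 3) * (12 * x\<^sup>2 - 12 * m * x + 2 * m\<^sup>2)"
      using m(1) q by (simp add: distrib_left) (simp add: algebra_simps)
    also have "\<dots> = m\<^sup>2 * q * - 4 - 2 * (1 + m - x) * (12 * (2 * m\<^sup>2 + 4 * m + 3) * (m - x) - 6 * (3 * m\<^sup>2 + 5 * m + 2) * m)"
      unfolding q_def by (simp add: algebra_simps power2_eq_square)
    also have "12 * (2 * m\<^sup>2 + 4 * m + 3) * (m - x) - 6 * (3 * m\<^sup>2 + 5 * m + 2) * m = m\<^sup>2 * q * (kap * ((a1 * m - a0) / kap + - a1 / kap * x))"
    proof -
      have "kap * ((a1 * m - a0) / kap + - a1 / kap * x) = a1 * (m - x) - a0"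
        using kap by (simp add: field_simps)
      moreover have "m\<^sup>2 * q * (a1 * (m - x) - a0) = 12 * (2 * m\<^sup>2 + 4 * m + 3) * (m - x) - 6 * (3 * m\<^sup>2 + 5 * m + 2) * m"
      proof -
        have "m\<^sup>2 * q * a1 = 12 * (2 * m\<^sup>2 + 4 * m + 3)" "m\<^sup>2 * q * a0 = 6 * (3 * m\<^sup>2 + 5 * m + 2) * m"
          unfolding a0_def a1_def using m(1) q by (simp_all add: power2_eq_square)
        then show ?thesis by (simp only: right_diff_distrib mult.assoc[symmetric])
      qed
      ultimately show ?thesis by simp
    qed
    also have "m\<^sup>2 * q * - 4 - 2 * (1 + m - x) * (m\<^sup>2 * q * (kap * ((a1 * m - a0) / kap + - a1 / kap * x))) =
        m\<^sup>2 * q * (- 4 - 2 * (1 + m + - 1 * x) * (kap * ((a1 * m - a0) / kap + - a1 / kap * x)))"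
    proof -
      have "R * - 4 - 2 * (1 + m - x) * (R * Z) = R * (- 4 - 2 * (1 + m + - 1 * x) * Z)" for R Z
        by (simp add: algebra_simps)
      then show ?thesis .
    qed
    finally show "2 * (1 + m) / m\<^sup>2 * (6 * x - 4 * m) + - 2 * (2 * m\<^sup>2 + 4 * m + 3) / (m\<^sup>2 * q) * (12 * x\<^sup>2 - 12 * m * x + 2 * m\<^sup>2) =
       - 4 - 2 * (1 + m + - 1 * x) * (kap * ((a1 * m - a0) / kap + - a1 / kap * x))"
      using m(1) q by simp
  qed (use m kap in simp_all)
qed

theorem proposition5p3p1:
  fixes A :: "('m, 1) chart set"
    and \<omega>M :: "('m, 1) form11"
    and p :: "'l \<Rightarrow> 'm"
    and T :: "('l, 'm) triv set"
    and nrm :: "'l \<Rightarrow> real"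
  assumes M: "compact_riemann_surface A" "has_genus A 2"
    and \<omega>M: "kaehler_metric A (atlas_space A) \<omega>M"
      "has_surface_integral A \<omega>M (2 * pi)"
      "mfd_scalar_curvature A (atlas_space A) \<omega>M (\<lambda>_. - 2)"
    and L: "holomorphic_line_bundle A p T" "has_degree A p T (- 1)"
    and h: "hermitian_norm A p T nrm" "is_curvature_form A p T nrm (\<lambda>c z. - \<omega>M c z)"
  defines "X \<equiv> ruled_atlas A p T"
    and "S0 \<equiv> zero_section p T"
    and "Sinf \<equiv> infinity_section p T"
    and "Y0 \<equiv> proj_bundle p T - zero_section p T"
    and "Yinf \<equiv> proj_bundle p T - infinity_section p T"
  shows "(\<forall>m::real. 0 < m \<and> m \<le> k2 \<longrightarrow>
      (\<exists>\<phi> f H. profile_potential 0 m \<phi> f \<and>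
        momentum_form A p T nrm \<omega>M f H \<and>
        kaehler_metric X Yinf H \<and> complete_metric X Yinf H \<and> extremal_metric X Yinf H \<and>
        mfd_scalar_curvature X Yinf H
          (\<lambda>x. 12 * (m\<^sup>2 - 2 * m - 3) / (m\<^sup>2 * (m\<^sup>2 + 6 * m + 6)) * moment_map p T nrm 0 m f x
               - 6 * (2 * m\<^sup>2 - m - 4) / (m * (m\<^sup>2 + 6 * m + 6))) \<and>
        (m < k2 \<longrightarrow> asymptotically_hyperbolic X Sinf H))) \<and>
    (\<forall>c m mt::real. 0 < c \<and> c < m \<and> mt = (m - c) / (c + 1) \<and> mt \<le> k2 \<longrightarrow>
      (\<exists>\<phi> f H. profile_potential c m \<phi> f \<and>
        momentum_form A p T nrm \<omega>M f H \<and>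
        kaehler_metric X Y0 H \<and> complete_metric X Y0 H \<and> extremal_metric X Y0 H \<and>
        mfd_scalar_curvature X Y0 H
          (\<lambda>x. 1 / (c + 1) *
             (12 * (2 * mt\<^sup>2 + 4 * mt + 3) / (mt\<^sup>2 * (mt\<^sup>2 + 6 * mt + 6))
                * ((moment_map p T nrm c m f x - c) / (c + 1))
              - 6 * (3 * mt\<^sup>2 + 5 * mt + 2) / (mt * (mt\<^sup>2 + 6 * mt + 6)))) \<and>
        (mt < k2 \<longrightarrow> asymptotically_hyperbolic X S0 H)))"
proof -
  have at: "complex_atlas A" and cs: "compact_space (atlas_topology A)"
    using M(1) unfolding compact_riemann_surface_def by auto
  interpret ruled A p T nrm \<omega>M
    by (rule ruled.intro[OF at L(1) h(1) \<omega>M(1,3) h(2)])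
  have Yinf: "Yinf = Yb True" and Y0: "Y0 = Yb False" and Sinf: "Sinf = nsec False" and S0: "S0 = nsec True"
    unfolding Yinf_def Y0_def Sinf_def S0_def Yb_def nsec_def by simp_all
  show ?thesis
    unfolding X_def Yinf Y0 Sinf S0
  proof (intro conjI allI impI)
    fix m :: real assume m: "0 < m \<and> m \<le> k2"
    let ?q = "m\<^sup>2 + 6 * m + 6"
    let ?A0 = "- 6 * (2 * m\<^sup>2 - m - 4) / (m * ?q)" and ?A1 = "12 * (m\<^sup>2 - 2 * m - 3) / (m\<^sup>2 * ?q)"
    have q: "0 < m\<^sup>2 * ?q" using m by (simp add: add_pos_pos)
    note prof = profile_zero_section[OF conjunct1[OF m] conjunct2[OF m]]
    have s: "?A1 * y - 6 * (2 * m\<^sup>2 - m - 4) / (m * ?q) = ?A0 + ?A1 * (((y + 1) / 1 - 1) * 1)" for y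
    proof -
      have "a * y - 6 * u / v = - 6 * u / v + a * (((y + 1) / 1 - 1) * 1)" for a u v :: real by simp
      then show ?thesis .
    qed
    have st: "0 < 2 / m\<^sup>2 + - 2 * (m\<^sup>2 - 2 * m - 3) / (m\<^sup>2 * ?q) * m" if "m < k2"
      unfolding prof(2) by (rule mult_pos_pos) (use le_k2(2)[OF conjunct1[OF m] that] q in auto)
    obtain \<phi> f H where H: "profile_potential 0 m \<phi> f" "momentum_form A p T nrm \<omega>M f H"
      "kaehler_metric (ruled_atlas A p T) (Yb True) H" "complete_metric (ruled_atlas A p T) (Yb True) H"
      "extremal_metric (ruled_atlas A p T) (Yb True) H"
      "mfd_scalar_curvature (ruled_atlas A p T) (Yb True) H
        (\<lambda>x. ?A0 + ?A1 * (((moment_map p T nrm 0 m f x + 1) / 1 - 1) * 1))"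
      "0 < 2 / m\<^sup>2 + - 2 * (m\<^sup>2 - 2 * m - 3) / (m\<^sup>2 * ?q) * m \<longrightarrow>
        asymptotically_hyperbolic (ruled_atlas A p T) (nsec (\<not> True)) H"
      using exists_metric[OF prof(1) _ cs, of True 0 m] by (auto simp: sb_def)
    show "\<exists>\<phi> f H. profile_potential 0 m \<phi> f \<and> momentum_form A p T nrm \<omega>M f H \<and>
        kaehler_metric (ruled_atlas A p T) (Yb True) H \<and> complete_metric (ruled_atlas A p T) (Yb True) H \<and>
        extremal_metric (ruled_atlas A p T) (Yb True) H \<and>
        mfd_scalar_curvature (ruled_atlas A p T) (Yb True) H
          (\<lambda>x. ?A1 * moment_map p T nrm 0 m f x - 6 * (2 * m\<^sup>2 - m - 4) / (m * ?q)) \<and>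
        (m < k2 \<longrightarrow> asymptotically_hyperbolic (ruled_atlas A p T) (nsec False) H)"
      unfolding s using H st by (intro exI conjI impI) simp_all
  next
    fix c m mt :: real assume h: "0 < c \<and> c < m \<and> mt = (m - c) / (c + 1) \<and> mt \<le> k2"
    have mt: "0 < mt" "mt \<le> k2" using h by simp_all
    have c: "0 < c + 1" using h by simp
    have mc: "m - c = mt * (c + 1)" using h by simp
    let ?q = "mt\<^sup>2 + 6 * mt + 6"
    let ?a0 = "6 * (3 * mt\<^sup>2 + 5 * mt + 2) / (mt * ?q)" and ?a1 = "12 * (2 * mt\<^sup>2 + 4 * mt + 3) / (mt\<^sup>2 * ?q)"
    let ?A0 = "(?a1 * mt - ?a0) / (c + 1)" and ?A1 = "- ?a1 / (c + 1)"
    let ?end = "2 * (1 + mt) / mt\<^sup>2 + - 2 * (2 * mt\<^sup>2 + 4 * mt + 3) / (mt\<^sup>2 * ?q) * mt"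
    have q: "0 < mt\<^sup>2 * ?q" using mt by (simp add: add_pos_pos)
    note prof = profile_infinity_section[OF mt c]
    \<comment> \<open>Translates back from the distance \<open>x\<close> to the upper end:
      \<open>mt - x\<close> is the normalised moment map \<open>(y - c) / (c + 1)\<close>.\<close>
    have s: "1 / (c + 1) * (?a1 * ((y - c) / (c + 1)) - ?a0) = ?A0 + ?A1 * (((y + 1) / (c + 1) - (1 + mt)) * - 1)" for y
    proof -
      have "((y + 1) / (c + 1) - (1 + mt)) * - 1 = mt - (y - c) / (c + 1)" using c by (simp add: field_simps)
      moreover have "1 / k * (a * z - b) = (a * mt - b) / k + - a / k * (mt - z)" for a b k z :: real
        by (simp add: diff_divide_distrib right_diff_distrib)
      ultimately show ?thesis by (simp only:)
    qed
    have st: "0 < ?end" if "mt < k2"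
      unfolding prof(2) by (rule mult_pos_pos) (use le_k2(2)[OF mt(1) that] q in auto)
    \<comment> \<open>The closing end is the upper one: \<open>(c + 1) * (1 + mt) - 1 = m\<close>,
      and subtracting \<open>mt\<close> inside gives \<open>c\<close>.\<close>
    have ends: "(if False then c else m) = (c + 1) * (1 + mt) - 1" "(if False then m else c) = (c + 1) * (1 + mt + - 1 * mt) - 1"
      using mc by (simp_all add: algebra_simps)
    obtain \<phi> f H where H: "profile_potential c m \<phi> f" "momentum_form A p T nrm \<omega>M f H"
      "kaehler_metric (ruled_atlas A p T) (Yb False) H" "complete_metric (ruled_atlas A p T) (Yb False) H"
      "extremal_metric (ruled_atlas A p T) (Yb False) H"
      "mfd_scalar_curvature (ruled_atlas A p T) (Yb False) H
        (\<lambda>x. ?A0 + ?A1 * (((moment_map p T nrm c m f x + 1) / (c + 1) - (1 + mt)) * - 1))"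
      "0 < ?end \<longrightarrow> asymptotically_hyperbolic (ruled_atlas A p T) (nsec (\<not> False)) H"
      using exists_metric[OF prof(1) _ cs ends] sb_def[of False] by (simp only: if_False) blast
    show "\<exists>\<phi> f H. profile_potential c m \<phi> f \<and> momentum_form A p T nrm \<omega>M f H \<and>
        kaehler_metric (ruled_atlas A p T) (Yb False) H \<and> complete_metric (ruled_atlas A p T) (Yb False) H \<and>
        extremal_metric (ruled_atlas A p T) (Yb False) H \<and>
        mfd_scalar_curvature (ruled_atlas A p T) (Yb False) H
          (\<lambda>x. 1 / (c + 1) * (?a1 * ((moment_map p T nrm c m f x - c) / (c + 1)) - ?a0)) \<and>
        (mt < k2 \<longrightarrow> asymptotically_hyperbolic (ruled_atlas A p T) (nsec True) H)"
      unfolding s using H st by (intro exI conjI impI) simp_all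
  qed
qed

end
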